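(* Let $F=\mathbb C$ and $n\ge2$. The operator $M:\mathcal C_+\to\mathcal C_-$, $Mf(\xi)=\int_{\xi\cdot x=1}f(x)\,d\mu_\xi$, is an isomorphism. For all integers $p,q\ge0$ and $\varphi\in\mathcal C_-(\mathbb R_{>0})\otimes H^{p,q}$, the inverse $M^{-1}:\mathcal C_-\to\mathcal C_+$ is given by the formula $$M^{-1}\varphi=\beta_{p,q}*\mathrm{Inv}(\varphi),$$ where $\beta_{p,q}$ is the distribution on $\mathbb R_{>0}$ defined by $$\beta_{p,q}(t)=\frac{1}{2^{n+m-2}\,\pi^{n-1}\,\Gamma(m)}\prod_{j=1}^{n+m-1}\left(-\frac{d}{dt}\cdot t+p+q-2j\right)\left(t^{-p-q-2n+1}(1-t^2)_+^{m-1}\right)dt,\qquad m=\min(p,q).$$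
   Context: Notation. $n\ge2$, $K=U(n)$, all functions are complex valued; $\|\cdot\|$ is the standard Hermitian norm on $\mathbb C^n$, $\xi\cdot x=\sum\xi_ix_i$ (bilinear), $\bar x$ is coordinate-wise conjugation, and $\mathbb C$ and $\mathbb C^n$ carry Lebesgue measure. $\mathcal C$ is the space of $K$-finite $C^\infty$ functions on $\mathbb C^n\setminus\{0\}$, where $g\in GL_n(\mathbb C)$ acts by $(g\cdot f)(x)=f(g^{-1}x)$. $\mathcal C_+\subset\mathcal C$ is the subspace of functions with bounded support in $\mathbb C^n$; $\mathcal C_-\subset\mathcal C$ is the subspace of functions vanishing in a neighborhood of $0$. Similarly $\mathcal C(\mathbb R_{>0})$ is the space of smooth functions on $\mathbb R_{>0}$, $\mathcal C_+(\mathbb R_{>0})$ the subspace of functions vanishing for all large $r$, and $\mathcal C_-(\mathbb R_{>0})$ the subspace of functions vanishing near $0$. For $f\in\mathcal C_+$ and $\xi\in\mathbb C^n\setminus\{0\}$, $Mf(\xi)=\int_{\xi\cdot x=1}f(x)\,d\mu_\xi$, where $d\mu_\xi$ is the measure on the complex hyperplane $\{\xi\cdot x=t\}$ with $d\mu_\xi\,dt=dx$. This gives an operator $M:\mathcal C_+\to\mathcal C_-$. $H^{p,q}$ is the space of homogeneous polynomials $Y$ of degree $p+q$ on $\mathbb R^{2n}=\mathbb C^n$ that are harmonic and satisfy $Y(\lambda z)=\lambda^p\bar\lambda^qY(z)$ for $\lambda\in\mathbb C$, $z\in\mathbb C^n$. For $u\in\mathcal C(\mathbb R_{>0})$ and $Y\in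 H^{p,q}$, $u\otimes Y\in\mathcal C$ denotes the function $(u\otimes Y)(x)=u(\|x\|)\,Y(x/\|x\|)$. One has $\mathcal C=\bigoplus_{p,q\ge0}\mathcal C(\mathbb R_{>0})\otimes H^{p,q}$, and $\mathcal C_\pm(\mathbb R_{>0})\otimes H^{p,q}\subset\mathcal C_\pm$. $\mathrm{Inv}:\mathcal C_-\to\mathcal C_+$ is the isomorphism $(\mathrm{Inv}\,\varphi)(x)=\|x\|^{-2n}\varphi(\bar x/\|x\|^2)$. $A$ is the algebra (under multiplicative convolution) of distributions on $\mathbb R_{>0}$ supported on $(0,1]$. It acts on $\mathcal C_+$ through the action of $\mathbb R_{>0}$ (viewed as scalar matrices): $(\beta*f)(x)=\int_{\mathbb R_{>0}}\beta(t)\,f(t^{-1}x)$, i.e. the distribution $\beta$ applied to $t\mapsto f(t^{-1}x)$. The derivative $\frac d{dt}$ is taken in the sense of generalized functions on $\mathbb R_{>0}$, and $-\frac d{dt}\cdot t$ is the operator $g\mapsto-\frac d{dt}(tg)$. For $\mathrm{Re}(\lambda)>-1$, $(1-t)_+^\lambda$ is the generalized function equal to $(1-t)^\lambda$ on $(0,1)$ and $0$ on $[1,\infty)$, extended to $\lambda\in\mathbb C$ not a negative integer by analytic continuation, and $(1-t^2)_+^\lambda=(1+t)^\lambda(1-t)_+^\lambda$. For $m=0$ the expression $\frac1{\Gamma(m)}(1-t^2)_+^{m-1}$ is understood by analytic continuation in $m$: the regularization of $\frac2{\Gamma(m)}(1-t^2)_+^{m-1}dt$ at $m=0$ is $\delta(1-t)$,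 the delta distribution at $t=1$. *)

theory Defs
  imports
    "HOL-Complex_Analysis.Complex_Analysis"
    "HOL-Library.Function_Algebras"
begin

text \<open>
  A function on an open set \<open>S\<close> (\<open>\<complex>\<^sup>n - {0}\<close> or the positive reals) is represented by the total
  function that is \<open>0\<close> off \<open>S\<close>, so that equality of functions on \<open>S\<close> is HOL equality.
  The dimension is \<open>n = CARD('n)\<close>.
\<close>

global_interpretation cfun: vector_space "\<lambda>(c::complex) (f::'a \<Rightarrow> complex). (\<lambda>x. c * f x)"
  by unfold_locales (auto simp: fun_eq_iff algebra_simps)


section \<open>Smooth functions\<close>

text \<open>Only used for open \<open>S\<close> in a finite-dimensional real space; derivatives are real derivatives.\<close>

fun Ck_on :: "nat \<Rightarrow> 'a::real_normed_vector set \<Rightarrow> ('a \<Rightarrow> 'b::real_normed_vector) \<Rightarrow> bool" where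
  "Ck_on 0 S f = continuous_on S f"
| "Ck_on (Suc k) S f =
     ((\<forall>x\<in>S. f differentiable (at x)) \<and> (\<forall>v. Ck_on k S (\<lambda>x. frechet_derivative f (at x) v)))"

definition smooth_on :: "'a::real_normed_vector set \<Rightarrow> ('a \<Rightarrow> 'b::real_normed_vector) \<Rightarrow> bool" where
  "smooth_on S f \<longleftrightarrow> (\<forall>k. Ck_on k S f)"


section \<open>Function spaces\<close>

definition unitary_group :: "(complex^'n^'n) set" where
  "unitary_group = {A. (\<chi> i j. cnj (A $ j $ i)) ** A = mat 1}"

definition K_finite :: "(complex^'n \<Rightarrow> complex) \<Rightarrow> bool" where
  "K_finite f \<longleftrightarrow>
     (\<exists>B. finite B \<and> {\<lambda>x. f (matrix_inv g *v x) |g. g \<in> unitary_group} \<subseteq> cfun.span B)"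

definition C_all :: "(complex^'n \<Rightarrow> complex) set" where
  "C_all = {f. f 0 = 0 \<and> smooth_on (- {0}) f \<and> K_finite f}"

definition C_plus :: "(complex^'n \<Rightarrow> complex) set" where
  "C_plus = {f \<in> C_all. \<exists>R. \<forall>x. R < norm x \<longrightarrow> f x = 0}"

definition C_minus :: "(complex^'n \<Rightarrow> complex) set" where
  "C_minus = {f \<in> C_all. \<exists>\<epsilon>>0. \<forall>x. norm x < \<epsilon> \<longrightarrow> f x = 0}"

definition C_minus_pos :: "(real \<Rightarrow> complex) set" where
  "C_minus_pos = {u. (\<forall>r\<le>0. u r = 0) \<and> smooth_on {0<..} u \<and> (\<exists>\<epsilon>>0. \<forall>r<\<epsilon>. u r = 0)}"


section \<open>Harmonic polynomials\<close>

definition laplacian :: "('a::euclidean_space \<Rightarrow> complex) \<Rightarrow> 'a \<Rightarrow> complex" where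
  "laplacian f x =
     (\<Sum>b\<in>Basis. frechet_derivative (\<lambda>y. frechet_derivative f (at y) b) (at x) b)"

definition harmonic_polys :: "nat \<Rightarrow> nat \<Rightarrow> (complex^'n \<Rightarrow> complex) set" where
  "harmonic_polys p q =
     {Y. polynomial_function Y \<and>
         (\<forall>(r::real) z. Y (r *\<^sub>R z) = of_real r ^ (p + q) * Y z) \<and>
         (\<forall>z. laplacian Y z = 0) \<and>
         (\<forall>(c::complex) z. Y (c *s z) = c ^ p * cnj c ^ q * Y z)}"

definition tensor :: "(real \<Rightarrow> complex) \<Rightarrow> (complex^'n \<Rightarrow> complex) \<Rightarrow> complex^'n \<Rightarrow> complex" where
  "tensor u Y x = u (norm x) * Y (x /\<^sub>R norm x)"

definition C_minus_tensor :: "nat \<Rightarrow> nat \<Rightarrow> (complex^'n \<Rightarrow> complex) set" where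
  "C_minus_tensor p q = cfun.span {tensor u Y |u Y. u \<in> C_minus_pos \<and> Y \<in> harmonic_polys p q}"


section \<open>The transform over complex hyperplanes\<close>

definition bilin :: "complex^'n \<Rightarrow> complex^'n \<Rightarrow> complex" where
  "bilin \<xi> x = (\<Sum>i\<in>UNIV. \<xi> $ i * x $ i)"

definition cnj_vec :: "complex^'n \<Rightarrow> complex^'n" where
  "cnj_vec x = (\<chi> i. cnj (x $ i))"

text \<open>
  With \<open>v = cnj_vec \<xi> / \<parallel>\<xi>\<parallel>\<^sup>2\<close> one has \<open>bilin \<xi> v = 1\<close>, so the map below projects the slab
  \<open>{x. \<bar>bilin \<xi> x - t\<bar> < 1}\<close> along \<open>v\<close> onto the hyperplane \<open>{x. bilin \<xi> x = t}\<close>; its fibres are discs of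
  area \<open>\<pi>\<close> in the coordinate \<open>bilin \<xi> x\<close>. The lemmas that follow show that this is the family
  \<open>d\<mu>\<^sub>\<xi>\<close> with \<open>d\<mu>\<^sub>\<xi> dt = dx\<close>: \<open>hyperplane_measure_unique\<close> characterizes it by that property together
  with translation covariance.
\<close>

definition hyperplane_measure :: "complex^'n \<Rightarrow> complex \<Rightarrow> (complex^'n) measure" where
  "hyperplane_measure \<xi> t =
     scale_measure (ennreal (1 / pi))
       (distr (restrict_space lborel {x. norm (bilin \<xi> x - t) < 1}) borel
          (\<lambda>x. x + ((t - bilin \<xi> x) / of_real ((norm \<xi>)\<^sup>2)) *s cnj_vec \<xi>))"

definition transform :: "(complex^'n \<Rightarrow> complex) \<Rightarrow> complex^'n \<Rightarrow> complex" where
  "transform f \<xi> = (if \<xi> = 0 then 0 else \<integral>x. f x \<partial>hyperplane_measure \<xi> 1)"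

lemma continuous_on_bilin: "continuous_on UNIV (bilin \<xi>)"
  unfolding bilin_def by (intro continuous_intros)

lemma measurable_bilin [measurable]: "bilin \<xi> \<in> borel_measurable borel"
  by (intro borel_measurable_continuous_onI continuous_on_bilin)

lemma bilin_add: "bilin \<xi> (x + y) = bilin \<xi> x + bilin \<xi> y"
  by (simp add: bilin_def algebra_simps sum.distrib)

lemma bilin_diff: "bilin \<xi> (x - y) = bilin \<xi> x - bilin \<xi> y"
  by (simp add: bilin_def algebra_simps sum_subtractf)

lemma bilin_scale: "bilin \<xi> (c *s x) = c * bilin \<xi> x"
  by (simp add: bilin_def sum_distrib_left algebra_simps)

lemma bilin_cnj: "bilin \<xi> (cnj_vec \<xi>) = of_real ((norm \<xi>)\<^sup>2)"
  by (simp add: bilin_def cnj_vec_def norm_vec_def L2_set_def sum_nonneg complex_norm_square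
      del: of_real_power)

definition normal_vec :: "complex^'n \<Rightarrow> complex^'n" where
  "normal_vec \<xi> = (1 / of_real ((norm \<xi>)\<^sup>2)) *s cnj_vec \<xi>"

lemma bilin_normal_vec: "\<xi> \<noteq> 0 \<Longrightarrow> bilin \<xi> (normal_vec \<xi>) = 1"
  by (simp add: normal_vec_def bilin_scale bilin_cnj)

lemma continuous_on_scale_vec: "continuous_on UNIV (\<lambda>p::complex \<times> (complex^'n). fst p *s (v::complex^'n) + snd p)"
  unfolding vector_scalar_mult_def by (intro continuous_intros)

lemma measurable_scale_vec [measurable]:
  "(\<lambda>c. c *s (v::complex^'n)) \<in> borel_measurable borel"
  unfolding vector_scalar_mult_def
  by (intro borel_measurable_continuous_onI continuous_intros)

lemma hyperplane_measure_alt: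
  "hyperplane_measure \<xi> t =
     scale_measure (ennreal (1 / pi))
       (distr (restrict_space lborel {x. norm (bilin \<xi> x - t) < 1}) borel
          (\<lambda>x. x + (t - bilin \<xi> x) *s normal_vec \<xi>))"
  by (simp add: hyperplane_measure_def normal_vec_def vector_smult_assoc)

lemma sets_hyperplane_measure [measurable_cong, simp]: "sets (hyperplane_measure \<xi> t) = sets borel"
  by (simp add: hyperplane_measure_def)

lemma emeasure_hyperplane_measure:
  assumes [measurable]: "A \<in> sets borel"
  shows "emeasure (hyperplane_measure \<xi> t) A = ennreal (1 / pi) *
    (\<integral>\<^sup>+x. indicator {x. norm (bilin \<xi> x - t) < 1} x *
          indicator A (x + (t - bilin \<xi> x) *s normal_vec \<xi>) \<partial>lborel)"
proof -
  let ?S = "{x. norm (bilin \<xi> x - t) < 1}"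
  let ?g = "\<lambda>x. x + (t - bilin \<xi> x) *s normal_vec \<xi>"
  have S [measurable]: "?S \<in> sets borel" by measurable
  have g [measurable]: "?g \<in> borel_measurable borel" by measurable
  have g': "?g \<in> restrict_space lborel ?S \<rightarrow>\<^sub>M borel"
    by (rule measurable_restrict_space1) simp
  have "emeasure (distr (restrict_space lborel ?S) borel ?g) A =
      emeasure (restrict_space lborel ?S) (?g -` A \<inter> ?S)"
    using assms g' by (subst emeasure_distr) (auto simp: space_restrict_space)
  also have "\<dots> = emeasure lborel (?g -` A \<inter> ?S)"
    by (intro emeasure_restrict_space) auto
  also have "\<dots> = (\<integral>\<^sup>+x. indicator (?g -` A \<inter> ?S) x \<partial>lborel)"
    using measurable_sets[OF g assms] by (intro nn_integral_indicator[symmetric]) auto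
  also have "\<dots> = (\<integral>\<^sup>+x. indicator ?S x * indicator A (?g x) \<partial>lborel)"
    by (intro nn_integral_cong) (auto simp: indicator_def)
  finally show ?thesis by (simp add: hyperplane_measure_alt)
qed

text \<open>\<open>d\<mu>\<^sub>\<xi>\<close> is carried by the hyperplane.\<close>

lemma hyperplane_measure_null:
  assumes "\<xi> \<noteq> 0"
  shows "emeasure (hyperplane_measure \<xi> t) {x. bilin \<xi> x \<noteq> t} = 0"
proof -
  have "{x. bilin \<xi> x \<noteq> t} \<in> sets borel" by measurable
  moreover have "bilin \<xi> (x + (t - bilin \<xi> x) *s normal_vec \<xi>) = t" for x
    using assms by (simp add: bilin_add bilin_diff bilin_scale bilin_normal_vec)
  ultimately show ?thesis by (simp add: emeasure_hyperplane_measure)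
qed

lemma nn_integral_lborel_shift:
  fixes f :: "'a::euclidean_space \<Rightarrow> ennreal"
  assumes [measurable]: "f \<in> borel_measurable borel"
  shows "(\<integral>\<^sup>+x. f (c + x) \<partial>lborel) = (\<integral>\<^sup>+x. f x \<partial>lborel)"
  by (subst (2) lborel_distr_plus[of c, symmetric], subst nn_integral_distr) auto

lemma emeasure_unit_disc: "emeasure lborel {s::complex. norm (s - t) < 1} = ennreal pi"
proof -
  have "{s::complex. norm (s - t) < 1} = ball t 1"
    by (auto simp: dist_norm norm_minus_commute)
  then show ?thesis
    by (simp add: emeasure_ball unit_ball_vol_2)
qed

lemma hyperplane_measure_translate:
  assumes [measurable]: "A \<in> sets borel" and "\<xi> \<noteq> 0"
  shows "emeasure (hyperplane_measure \<xi> (t + bilin \<xi> w)) A =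
         emeasure (hyperplane_measure \<xi> t) {x. w + x \<in> A}"
proof -
  have [measurable]: "{x. w + x \<in> A} \<in> sets borel" by measurable
  have "(\<integral>\<^sup>+x. indicator {x. norm (bilin \<xi> x - (t + bilin \<xi> w)) < 1} x *
          indicator A (x + (t + bilin \<xi> w - bilin \<xi> x) *s normal_vec \<xi>) \<partial>lborel) =
     (\<integral>\<^sup>+x. indicator {x. norm (bilin \<xi> x - (t + bilin \<xi> w)) < 1} (w + x) *
          indicator A ((w + x) + (t + bilin \<xi> w - bilin \<xi> (w + x)) *s normal_vec \<xi>) \<partial>lborel)"
    by (rule nn_integral_lborel_shift[symmetric]) measurable
  also have "\<dots> = (\<integral>\<^sup>+x. indicator {x. norm (bilin \<xi> x - t) < 1} x *
          indicator {x. w + x \<in> A} (x + (t - bilin \<xi> x) *s normal_vec \<xi>) \<partial>lborel)"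
    by (intro nn_integral_cong) (auto simp: bilin_add indicator_def algebra_simps)
  finally show ?thesis by (simp add: emeasure_hyperplane_measure)
qed

text \<open>\<open>d\<mu>\<^sub>\<xi> dt = dx\<close>.\<close>

lemma hyperplane_measure_disintegration:
  fixes \<xi> :: "complex^'n"
  assumes [measurable]: "A \<in> sets borel" and "\<xi> \<noteq> 0"
  shows "(\<integral>\<^sup>+t. emeasure (hyperplane_measure \<xi> t) A \<partial>lborel) = emeasure lborel A"
proof -
  let ?v = "normal_vec \<xi>"
  let ?D = "{s::complex. norm (s - 0) < 1}"
  have D [measurable]: "?D \<in> sets borel" by measurable
  have "(\<lambda>p::complex \<times> (complex^'n). fst p *s ?v + snd p) \<in> borel_measurable borel"
    by (intro borel_measurable_continuous_onI continuous_on_scale_vec)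
  then have sc [measurable]: "(\<lambda>p. fst p *s ?v + snd p) \<in> borel_measurable (borel \<Otimes>\<^sub>M borel)"
    by (simp add: borel_prod)
  have *: "(\<integral>\<^sup>+t. indicator {x. norm (bilin \<xi> x - t) < 1} x *
             indicator A (x + (t - bilin \<xi> x) *s ?v) \<partial>lborel) =
           (\<integral>\<^sup>+s. indicator ?D s * indicator A (s *s ?v + x) \<partial>lborel)" for x
  proof -
    have "(\<integral>\<^sup>+t. indicator {x. norm (bilin \<xi> x - t) < 1} x *
             indicator A (x + (t - bilin \<xi> x) *s ?v) \<partial>lborel) =
          (\<integral>\<^sup>+t. indicator ?D (- bilin \<xi> x + t) * indicator A ((- bilin \<xi> x + t) *s ?v + x) \<partial>lborel)"
      by (intro nn_integral_cong) (auto simp: indicator_def norm_minus_commute algebra_simps)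
    also have "\<dots> = (\<integral>\<^sup>+s. indicator ?D s * indicator A (s *s ?v + x) \<partial>lborel)"
      by (rule nn_integral_lborel_shift) measurable
    finally show ?thesis .
  qed
  have meas1: "(\<lambda>(t, x). indicator {x. norm (bilin \<xi> x - t) < 1} x *
             indicator A (x + (t - bilin \<xi> x) *s ?v) :: ennreal)
        \<in> borel_measurable (lborel \<Otimes>\<^sub>M lborel)"
  proof -
    have h: "(\<lambda>p. fst (fst p - bilin \<xi> (snd p), snd p) *s ?v + snd (fst p - bilin \<xi> (snd p), snd p))
        \<in> borel_measurable (borel \<Otimes>\<^sub>M borel)"
      by (rule measurable_compose[OF _ sc]) measurable
    then have h' [measurable]: "(\<lambda>p. snd p + (fst p - bilin \<xi> (snd p)) *s ?v)
        \<in> borel_measurable (borel \<Otimes>\<^sub>M borel)"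
      by (simp add: add.commute)
    have "(\<lambda>p. indicator {p. norm (bilin \<xi> (snd p) - fst p) < 1} p *
             indicator A (snd p + (fst p - bilin \<xi> (snd p)) *s ?v) :: ennreal)
        \<in> borel_measurable (borel \<Otimes>\<^sub>M borel)"
      by measurable
    then show ?thesis
      by (simp add: case_prod_beta indicator_def cong: measurable_cong_sets)
  qed
  have meas2: "(\<lambda>(s, x). indicator ?D s * indicator A (s *s ?v + x) :: ennreal)
        \<in> borel_measurable (lborel \<Otimes>\<^sub>M lborel)"
    using sc by (simp add: case_prod_beta cong: measurable_cong_sets)
  have "(\<integral>\<^sup>+t. emeasure (hyperplane_measure \<xi> t) A \<partial>lborel) = ennreal (1 / pi) *
     (\<integral>\<^sup>+t. (\<integral>\<^sup>+x. indicator {x. norm (bilin \<xi> x - t) < 1} x *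
             indicator A (x + (t - bilin \<xi> x) *s ?v) \<partial>lborel) \<partial>lborel)"
    using lborel.borel_measurable_nn_integral[OF meas1]
    by (simp add: emeasure_hyperplane_measure nn_integral_cmult)
  also have "(\<integral>\<^sup>+t. (\<integral>\<^sup>+x. indicator {x. norm (bilin \<xi> x - t) < 1} x *
             indicator A (x + (t - bilin \<xi> x) *s ?v) \<partial>lborel) \<partial>lborel) =
     (\<integral>\<^sup>+x. (\<integral>\<^sup>+t. indicator {x. norm (bilin \<xi> x - t) < 1} x *
             indicator A (x + (t - bilin \<xi> x) *s ?v) \<partial>lborel) \<partial>lborel)"
    by (rule lborel_pair.Fubini'[OF meas1, symmetric])
  also have "\<dots> = (\<integral>\<^sup>+x. (\<integral>\<^sup>+s. indicator ?D s * indicator A (s *s ?v + x) \<partial>lborel) \<partial>lborel)"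
    by (simp only: *)
  also have "\<dots> = (\<integral>\<^sup>+s. (\<integral>\<^sup>+x. indicator ?D s * indicator A (s *s ?v + x) \<partial>lborel) \<partial>lborel)"
    by (rule lborel_pair.Fubini'[OF meas2])
  also have "\<dots> = (\<integral>\<^sup>+s. indicator ?D s * emeasure lborel A \<partial>lborel)"
    by (intro nn_integral_cong)
       (auto simp: nn_integral_cmult nn_integral_lborel_shift[of "indicator A"])
  also have "\<dots> = ennreal pi * emeasure lborel A"
    using emeasure_unit_disc[of 0] by (simp add: nn_integral_multc)
  also have "ennreal (1 / pi) * (ennreal pi * emeasure lborel A) = emeasure lborel A"
    by (simp add: mult.assoc[symmetric] flip: ennreal_mult')
  finally show ?thesis .
qed

lemma hyperplane_measure_unique:
  fixes \<nu> :: "complex \<Rightarrow> (complex^'n) measure"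
  assumes "\<xi> \<noteq> 0"
    and sets: "\<And>t. sets (\<nu> t) = sets borel"
    and null: "\<And>t. emeasure (\<nu> t) {x. bilin \<xi> x \<noteq> t} = 0"
    and translate: "\<And>A t w. A \<in> sets borel \<Longrightarrow>
          emeasure (\<nu> (t + bilin \<xi> w)) A = emeasure (\<nu> t) {x. w + x \<in> A}"
    and disintegration: "\<And>A. A \<in> sets borel \<Longrightarrow>
          (\<integral>\<^sup>+t. emeasure (\<nu> t) A \<partial>lborel) = emeasure lborel A"
  shows "\<nu> t = hyperplane_measure \<xi> t"
proof (rule measure_eqI)
  show "sets (\<nu> t) = sets (hyperplane_measure \<xi> t)" by (simp add: sets)
  fix A assume "A \<in> sets (\<nu> t)"
  then have A [measurable]: "A \<in> sets borel" by (simp add: sets)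
  let ?v = "normal_vec \<xi>"
  let ?S = "{x. norm (bilin \<xi> x - t) < 1}"
  let ?B = "{x \<in> ?S. x + (t - bilin \<xi> x) *s ?v \<in> A}"
  have B [measurable]: "?B \<in> sets borel" by measurable
  have "emeasure (\<nu> s) ?B = indicator {s. norm (s - t) < 1} s * emeasure (\<nu> t) A" for s
  proof -
    have sp: "s = t + bilin \<xi> ((s - t) *s ?v)"
      using assms(1) by (simp add: bilin_diff bilin_scale bilin_normal_vec)
    have N: "{x. bilin \<xi> x \<noteq> t} \<in> null_sets (\<nu> t)"
    proof -
      have "{x. bilin \<xi> x \<noteq> t} \<in> sets borel" by measurable
      then show ?thesis using null[of t] by (auto simp: null_sets_def sets)
    qed
    have m: "{x. (s - t) *s ?v + x \<in> ?B} \<in> sets borel" by measurable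
    have "emeasure (\<nu> s) ?B = emeasure (\<nu> t) {x. (s - t) *s ?v + x \<in> ?B}"
      using translate[OF B, of t "(s - t) *s ?v"] sp by simp
    also have "\<dots> = emeasure (\<nu> t) ({x. norm (s - t) < 1} \<inter> A)"
    proof (rule emeasure_eq_AE)
      have "AE x in \<nu> t. bilin \<xi> x = t"
        using AE_not_in[OF N] by simp
      then show "AE x in \<nu> t. (x \<in> {x. (s - t) *s ?v + x \<in> ?B}) \<longleftrightarrow> (x \<in> {x. norm (s - t) < 1} \<inter> A)"
      proof eventually_elim
        case (elim x)
        define y where "y = (s - t) *s ?v + x"
        have b: "bilin \<xi> y = s"
          using elim assms(1) by (simp add: y_def bilin_add bilin_diff bilin_scale bilin_normal_vec)
        have e: "y + (t - s) *s ?v = x"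
          by (simp add: y_def vec_eq_iff algebra_simps)
        have "y \<in> ?B \<longleftrightarrow> norm (s - t) < 1 \<and> x \<in> A"
          unfolding mem_Collect_eq b e ..
        then show ?case by (simp only: y_def mem_Collect_eq Int_iff)
      qed
    qed (use m A in \<open>auto simp: sets\<close>)
    also have "\<dots> = indicator {s. norm (s - t) < 1} s * emeasure (\<nu> t) A"
      by (cases "norm (s - t) < 1") auto
    finally show ?thesis .
  qed
  then have "emeasure lborel ?B = ennreal pi * emeasure (\<nu> t) A"
    using disintegration[OF B] emeasure_unit_disc[of t] by (simp add: nn_integral_multc)
  moreover have "emeasure (hyperplane_measure \<xi> t) A = ennreal (1 / pi) * emeasure lborel ?B"
  proof -
    have "emeasure lborel ?B = (\<integral>\<^sup>+x. indicator ?B x \<partial>lborel)" by simp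
    also have "\<dots> = (\<integral>\<^sup>+x. indicator ?S x * indicator A (x + (t - bilin \<xi> x) *s ?v) \<partial>lborel)"
      by (intro nn_integral_cong) (auto simp: indicator_def)
    finally show ?thesis by (simp add: emeasure_hyperplane_measure)
  qed
  ultimately show "emeasure (\<nu> t) A = emeasure (hyperplane_measure \<xi> t) A"
    by (simp add: mult.assoc[symmetric] flip: ennreal_mult')
qed

definition complex_linear_on ::
  "('a \<Rightarrow> complex) set \<Rightarrow> (('a \<Rightarrow> complex) \<Rightarrow> ('b \<Rightarrow> complex)) \<Rightarrow> bool" where
  "complex_linear_on V L \<longleftrightarrow>
     (\<forall>f\<in>V. \<forall>g\<in>V. L (\<lambda>x. f x + g x) = (\<lambda>y. L f y + L g y)) \<and>
     (\<forall>c. \<forall>f\<in>V. L (\<lambda>x. c * f x) = (\<lambda>y. c * L f y))"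

definition Inv_op :: "(complex^'n \<Rightarrow> complex) \<Rightarrow> complex^'n \<Rightarrow> complex" where
  "Inv_op \<phi> x = \<phi> (cnj_vec x /\<^sub>R (norm x)\<^sup>2) / of_real (norm x ^ (2 * CARD('n)))"


section \<open>Generalized functions on the positive reals\<close>

text \<open>
  A generalized function \<open>T\<close> is identified with the distribution \<open>T dt\<close>, that is, with the functional
  \<open>\<phi> \<mapsto> \<integral> T(t) \<phi>(t) dt\<close> on test functions; only values on \<open>test_functions\<close> matter.
\<close>

type_synonym gen_fun = "(real \<Rightarrow> complex) \<Rightarrow> complex"

definition test_functions :: "(real \<Rightarrow> complex) set" where
  "test_functions =
     {\<phi>. smooth_on {0<..} \<phi> \<and> (\<exists>a b. 0 < a \<and> (\<forall>t. \<phi> t \<noteq> 0 \<longrightarrow> a \<le> t \<and> t \<le> b))}"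

definition gf_mult :: "(real \<Rightarrow> complex) \<Rightarrow> gen_fun \<Rightarrow> gen_fun" where
  "gf_mult a T = (\<lambda>\<phi>. T (\<lambda>t. a t * \<phi> t))"

definition gf_deriv :: "gen_fun \<Rightarrow> gen_fun" where
  "gf_deriv T = (\<lambda>\<phi>. - T (\<lambda>t. vector_derivative \<phi> (at t)))"

text \<open>The operator \<open>- d/dt \<circ> t + c\<close>.\<close>

definition gf_euler :: "complex \<Rightarrow> gen_fun \<Rightarrow> gen_fun" where
  "gf_euler c T = (\<lambda>\<phi>. - gf_deriv (gf_mult of_real T) \<phi> + c * T \<phi>)"

text \<open>
  The generalized function \<open>(1 - t\<^sup>2)\<^sub>+\<^bsup>s-1\<^esup> / \<Gamma>(s)\<close>: for \<open>Re s > 0\<close> it is the locally integrable function,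
  and it is continued analytically in \<open>s\<close>, here to the half-plane \<open>Re s > -1\<close>, which contains
  all integers \<open>s \<ge> 0\<close>. Its value at \<open>s = 0\<close> is half the delta distribution at \<open>t = 1\<close>.
\<close>

definition gf_kernel :: "complex \<Rightarrow> gen_fun" where
  "gf_kernel s = (\<lambda>\<phi>. THE z. \<exists>F. F holomorphic_on {w. - 1 < Re w} \<and>
     (\<forall>w. 0 < Re w \<longrightarrow>
        F w = 1 / Gamma w * (LINT t:{0<..<1}|lborel. of_real (1 - t\<^sup>2) powr (w - 1) * \<phi> t)) \<and>
     z = F s)"

definition beta :: "nat \<Rightarrow> nat \<Rightarrow> nat \<Rightarrow> gen_fun" where
  "beta n p q =
     (let m = min p q in
      gf_mult (\<lambda>t. of_real (1 / (2 ^ (n + m - 2) * pi ^ (n - 1))))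
        (fold (\<lambda>j. gf_euler (of_nat p + of_nat q - 2 * of_nat j)) [1..<n + m]
          (gf_mult (\<lambda>t. of_real (t powi (1 - int p - int q - 2 * int n)))
            (gf_kernel (of_nat m)))))"

text \<open>
  A distribution with support in \<open>(0,1]\<close> is applied to a function \<open>g\<close> that is smooth on the positive
  reals and vanishes near \<open>0\<close> by evaluating it on any test function that coincides with \<open>g\<close> on a
  neighbourhood of \<open>(0,1]\<close>.
\<close>

definition gf_apply :: "gen_fun \<Rightarrow> (real \<Rightarrow> complex) \<Rightarrow> complex" where
  "gf_apply T g =
     (THE z. \<exists>\<phi>\<in>test_functions. (\<exists>\<epsilon>>0. \<forall>t\<in>{0<..<1 + \<epsilon>}. \<phi> t = g t) \<and> z = T \<phi>)"

definition mult_conv :: "gen_fun \<Rightarrow> (complex^'n \<Rightarrow> complex) \<Rightarrow> complex^'n \<Rightarrow> complex" where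
  "mult_conv T f x = gf_apply T (\<lambda>t. f (x /\<^sub>R t))"

end

theory Submission
  imports Defs
begin

text \<open>
  A \<open>K\<close>-finite function generates a finite-dimensional \<open>K\<close>-invariant space. A vector of highest
  weight in it is a radial function times \<open>z\<^sub>s\<^sup>p cnj z\<^sub>e\<^sup>q\<close> with \<open>s \<noteq> e\<close>, and complete reducibility then
  shows that the functions \<open>h(\<parallel>x\<parallel>\<^sup>2) Y(x)\<close> with \<open>Y \<in> H\<^bsup>p,q\<^esup>\<close> span. With \<open>m = min p q\<close>, \<open>M = max p q\<close>, \<open>D = d/dy\<close> and
  \<open>I h(y) = \<integral>\<^sub>y\<^sup>\<infinity> h\<close>, the transform of such a function is \<open>(R h)(1/\<parallel>\<xi>\<parallel>\<^sup>2) Y(cnj \<xi>)\<close>, where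
  \<open>R h = \<pi>\<^bsup>n-1\<^esup> (-1)\<^sup>m y\<^bsup>m+1\<^esup> D\<^sup>m y\<^sup>M I\<^bsup>m+n-1\<^esup> h\<close>; as \<open>D\<close> and \<open>-I\<close> are mutually inverse on
  profiles that vanish for large \<open>y\<close>, \<open>R\<close> is bijective.

  The substitution \<open>s = \<parallel>x\<parallel>\<^sup>2/t\<^sup>2\<close> turns the pairing with \<open>(1 - t\<^sup>2)\<^sub>+\<^bsup>m-1\<^esup>/\<Gamma>(m)\<close> into \<open>I\<^sup>m\<close> and each factor
  \<open>- d/dt t + p + q - 2j\<close> into \<open>-2 (y D + j)\<close>. Since \<open>(y D + 1) \<dots> (y D + N) = D\<^sup>N y\<^sup>N\<close>, the distribution of the
  theorem acts on the profile as \<open>R\<^sup>-\<^sup>1\<close>.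
\<close>

section \<open>Smooth functions\<close>

text \<open>Why \<open>R\<close> has this form: \<open>transform\<close> intertwines unitary maps,
  so \<xi> may be placed on a coordinate axis. There the integral of a radial function times a
  monomial is a product of planar moments, each an iterated antiderivative of the profile. Summed
  over the monomials of Y, it becomes a series in powers of the Laplacian transverse to the axis.
  Harmonicity trades this Laplacian for the one along the axis, where Y is a multiple of
  \<open>c^p cnj c^q\<close>; so the series stops at m, and Leibniz' rule sums it up. In the
  distribution the kernel is paired last, so the Euler factors end up inside the integral
  \<open>I^m\<close>. They can be taken out because both are invariant under dilations of y; only
  outside do they meet the power of y that they need. An invariant inner product has to cope with
  functions that are singular at 0 and do not decay at infinity. An integral over a suitable
  spherical shell is definite on a finite-dimensional space, since such a space is determined by
  values at finitely many points. Injectivity cannot be read off from a spanning set; it follows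
  from a highest weight vector inside the kernel, which is itself an invariant space.\<close>

lemma has_derivative_cong_open:
  assumes "open S" "x \<in> S" "\<And>y. y \<in> S \<Longrightarrow> f y = g y"
  shows "(f has_derivative f') (at x) \<longleftrightarrow> (g has_derivative f') (at x)"
  using assms has_derivative_transform_within_open[of f f' x UNIV S g]
    has_derivative_transform_within_open[of g f' x UNIV S f] by auto

lemma frechet_derivative_cong_open:
  assumes "open S" "x \<in> S" "\<And>y. y \<in> S \<Longrightarrow> f y = g y"
  shows "frechet_derivative f (at x) = frechet_derivative g (at x)"
  unfolding frechet_derivative_def using has_derivative_cong_open[OF assms] by simp

lemma Ck_on_cong:
  assumes "open S" "\<And>x. x \<in> S \<Longrightarrow> f x = g x"
  shows "Ck_on k S f \<longleftrightarrow> Ck_on k S g"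
  using assms(2)
proof (induction k arbitrary: f g)
  case 0
  then show ?case by (simp cong: continuous_on_cong)
next
  case (Suc k)
  have "(\<forall>x\<in>S. f differentiable (at x)) \<longleftrightarrow> (\<forall>x\<in>S. g differentiable (at x))"
    unfolding differentiable_def using has_derivative_cong_open[OF assms(1), of _ f g] Suc.prems by auto
  moreover have "Ck_on k S (\<lambda>x. frechet_derivative f (at x) v) \<longleftrightarrow> Ck_on k S (\<lambda>x. frechet_derivative g (at x) v)" for v
    using frechet_derivative_cong_open[OF assms(1) _ Suc.prems] by (intro Suc.IH) simp
  ultimately show ?case by simp
qed

text \<open>\<open>Ck_on\<close> speaks of \<open>frechet_derivative\<close>, a choice operator.
  Uniqueness of derivatives lets any formula for the derivative, valid on the open set only, take
  its place.\<close>

lemma Ck_on_SucI: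
  assumes "open S" "\<And>x. x \<in> S \<Longrightarrow> (f has_derivative f' x) (at x)" "\<And>v. Ck_on k S (\<lambda>x. f' x v)"
  shows "Ck_on (Suc k) S f"
proof -
  have "Ck_on k S (\<lambda>x. frechet_derivative f (at x) v)" for v
    using assms(3)[of v] frechet_derivative_at[OF assms(2)]
    by (subst Ck_on_cong[OF assms(1), where g = "\<lambda>x. f' x v"]) auto
  then show ?thesis using assms(2) by (auto simp: differentiable_def)
qed

lemma Ck_on_SucD: "Ck_on (Suc k) S f \<Longrightarrow> Ck_on k S f"
proof (induction k arbitrary: f)
  case 0
  then show ?case
    by (auto intro!: differentiable_imp_continuous_on simp: differentiable_on_def differentiable_at_withinI)
next
  case (Suc k)
  then show ?case unfolding Ck_on.simps(2)[of "Suc k"] Ck_on.simps(2)[of k] by blast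
qed

lemma Ck_on_has_derivative:
  assumes "Ck_on (Suc k) S f" "x \<in> S"
  shows "(f has_derivative frechet_derivative f (at x)) (at x)"
  using assms by (simp add: frechet_derivative_works[symmetric])

lemma Ck_on_const: "open S \<Longrightarrow> Ck_on k S (\<lambda>x. c)"
proof (induction k arbitrary: c)
  case (Suc k)
  show ?case by (rule Ck_on_SucI[where f' = "\<lambda>_ _. 0"]) (use Suc in \<open>auto intro!: derivative_eq_intros\<close>)
qed simp

lemma Ck_on_linear: "open S \<Longrightarrow> bounded_linear f \<Longrightarrow> Ck_on k S f"
proof (cases k)
  case 0
  assume "bounded_linear f"
  then show ?thesis using 0 by (simp add: linear_continuous_on)
next
  case (Suc j)
  assume "open S" "bounded_linear f"
  then show ?thesis unfolding Suc
    by (intro Ck_on_SucI[where f' = "\<lambda>_. f"]) (auto intro: bounded_linear_imp_has_derivative Ck_on_const)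
qed

lemma Ck_on_add: "open S \<Longrightarrow> Ck_on k S f \<Longrightarrow> Ck_on k S g \<Longrightarrow> Ck_on k S (\<lambda>x. f x + g x)"
proof (induction k arbitrary: f g)
  case (Suc k)
  show ?case
  proof (rule Ck_on_SucI[OF Suc.prems(1)])
    fix x assume "x \<in> S"
    then show "((\<lambda>x. f x + g x) has_derivative
        (\<lambda>v. frechet_derivative f (at x) v + frechet_derivative g (at x) v)) (at x)"
      by (intro has_derivative_add Ck_on_has_derivative[of k S] Suc.prems)
  qed (use Suc in auto)
qed (auto intro: continuous_on_add)

text \<open>The product rule expresses the derivative through the same bilinear map, applied to a
  function and a derivative, so the induction on the order closes when it runs over all pairs at
  once.\<close>

lemma Ck_on_bilinear:
  assumes "open S" "bounded_bilinear prd"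
  shows "Ck_on k S f \<Longrightarrow> Ck_on k S g \<Longrightarrow> Ck_on k S (\<lambda>x. prd (f x) (g x))"
proof (induction k arbitrary: f g)
  case 0
  then show ?case using bounded_bilinear.continuous_on[OF assms(2)] by simp
next
  case (Suc k)
  show ?case
  proof (rule Ck_on_SucI[OF assms(1)])
    fix x assume "x \<in> S"
    then show "((\<lambda>x. prd (f x) (g x)) has_derivative
        (\<lambda>v. prd (f x) (frechet_derivative g (at x) v) + prd (frechet_derivative f (at x) v) (g x))) (at x)"
      by (intro bounded_bilinear.FDERIV[OF assms(2)] Ck_on_has_derivative[of k S] Suc.prems)
  next
    fix v
    show "Ck_on k S (\<lambda>x. prd (f x) (frechet_derivative g (at x) v) + prd (frechet_derivative f (at x) v) (g x))"
      using Suc.prems Ck_on_SucD[OF Suc.prems(1)] Ck_on_SucD[OF Suc.prems(2)]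
      by (intro Ck_on_add assms(1) Suc.IH) auto
  qed
qed

lemma Ck_on_compose_linear:
  assumes "open S" "open T" "bounded_linear A" "\<And>x. x \<in> S \<Longrightarrow> A x \<in> T"
  shows "Ck_on k T f \<Longrightarrow> Ck_on k S (\<lambda>x. f (A x))"
proof (induction k arbitrary: f)
  case 0
  then show ?case
    using continuous_on_compose2[of T f S A] linear_continuous_on[OF assms(3)] assms(4) by auto
next
  case (Suc k)
  show ?case
  proof (rule Ck_on_SucI[OF assms(1)])
    fix x assume "x \<in> S"
    then show "((\<lambda>x. f (A x)) has_derivative (\<lambda>v. frechet_derivative f (at (A x)) (A v))) (at x)"
      using Ck_on_has_derivative[OF Suc.prems] assms(4)
      by (intro has_derivative_compose[OF bounded_linear_imp_has_derivative[OF assms(3)]]) auto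
  next
    fix v
    show "Ck_on k S (\<lambda>x. frechet_derivative f (at (A x)) (A v))"
      using Suc by (intro Suc.IH) auto
  qed
qed

text \<open>With an outer function of one real variable the chain rule gives a product of a
  directional derivative of \<open>g\<close> and the vector \<open>u' (g x)\<close>. The second
  factor is again a composition covered by the induction hypothesis; this is why \<open>u\<close>
  lives on the real line.\<close>

lemma Ck_on_compose_real:
  fixes u :: "real \<Rightarrow> 'b::real_normed_vector"
  assumes "open S" "open T" "\<And>x. x \<in> S \<Longrightarrow> g x \<in> T"
  shows "Ck_on k T u \<Longrightarrow> Ck_on k S g \<Longrightarrow> Ck_on k S (\<lambda>x. u (g x))"
proof (induction k arbitrary: u)
  case 0
  then show ?case
    using continuous_on_compose2[of T u S g] assms(3) by auto
next
  case (Suc k)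
  show ?case
  proof (rule Ck_on_SucI[OF assms(1)])
    fix x assume x: "x \<in> S"
    have u: "(u has_derivative frechet_derivative u (at (g x))) (at (g x))"
      using Ck_on_has_derivative[OF Suc.prems(1)] assms(3) x by auto
    have "frechet_derivative u (at (g x)) s = s *\<^sub>R frechet_derivative u (at (g x)) 1" for s
      using linear_scale[OF has_derivative_linear[OF u], of s 1] by simp
    then have eq: "frechet_derivative u (at (g x)) = (\<lambda>s. s *\<^sub>R frechet_derivative u (at (g x)) 1)"
      by (rule ext)
    show "((\<lambda>x. u (g x)) has_derivative
        (\<lambda>v. frechet_derivative g (at x) v *\<^sub>R frechet_derivative u (at (g x)) 1)) (at x)"
      using has_derivative_compose[OF Ck_on_has_derivative[OF Suc.prems(2) x] u] by (subst (asm) eq)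
  next
    fix v
    have "Ck_on k S (\<lambda>x. frechet_derivative u (at (g x)) 1)"
      using Suc.prems(1) Ck_on_SucD[OF Suc.prems(2)] Suc.IH[of "\<lambda>y. frechet_derivative u (at y) 1"] by simp
    moreover have "Ck_on k S (\<lambda>x. frechet_derivative g (at x) v)"
      using Suc.prems by simp
    ultimately show "Ck_on k S (\<lambda>x. frechet_derivative g (at x) v *\<^sub>R frechet_derivative u (at (g x)) 1)"
      by (intro Ck_on_bilinear[OF assms(1) bounded_bilinear_scaleR])
  qed
qed

lemma smooth_on_cong: "open S \<Longrightarrow> (\<And>x. x \<in> S \<Longrightarrow> f x = g x) \<Longrightarrow> smooth_on S f \<longleftrightarrow> smooth_on S g"
  unfolding smooth_on_def using Ck_on_cong[of S f g] by simp

lemma smooth_on_subset: "open S \<Longrightarrow> open T \<Longrightarrow> S \<subseteq> T \<Longrightarrow> smooth_on T f \<Longrightarrow> smooth_on S f"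
  unfolding smooth_on_def using Ck_on_compose_linear[of S T "\<lambda>x. x" _ f] by (auto intro: bounded_linear_ident)

lemma smooth_on_const: "open S \<Longrightarrow> smooth_on S (\<lambda>x. c)"
  by (simp add: smooth_on_def Ck_on_const)

lemma smooth_on_linear: "open S \<Longrightarrow> bounded_linear f \<Longrightarrow> smooth_on S f"
  by (simp add: smooth_on_def Ck_on_linear)

lemma smooth_on_add: "open S \<Longrightarrow> smooth_on S f \<Longrightarrow> smooth_on S g \<Longrightarrow> smooth_on S (\<lambda>x. f x + g x)"
  by (simp add: smooth_on_def Ck_on_add)

lemma smooth_on_bilinear:
  "open S \<Longrightarrow> bounded_bilinear prd \<Longrightarrow> smooth_on S f \<Longrightarrow> smooth_on S g \<Longrightarrow> smooth_on S (\<lambda>x. prd (f x) (g x))"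
  by (simp add: smooth_on_def Ck_on_bilinear)

lemma smooth_on_mult:
  fixes f g :: "_ \<Rightarrow> 'b::real_normed_algebra"
  shows "open S \<Longrightarrow> smooth_on S f \<Longrightarrow> smooth_on S g \<Longrightarrow> smooth_on S (\<lambda>x. f x * g x)"
  by (rule smooth_on_bilinear[OF _ bounded_bilinear_mult])

lemma smooth_on_power:
  fixes f :: "_ \<Rightarrow> 'b::real_normed_algebra_1"
  shows "open S \<Longrightarrow> smooth_on S f \<Longrightarrow> smooth_on S (\<lambda>x. f x ^ j)"
  by (induction j) (auto intro: smooth_on_const smooth_on_mult)

lemma smooth_on_prod:
  fixes f :: "_ \<Rightarrow> _ \<Rightarrow> 'b::{real_normed_algebra_1,comm_monoid_mult}"
  shows "open S \<Longrightarrow> (\<And>i. i \<in> I \<Longrightarrow> smooth_on S (f i)) \<Longrightarrow> smooth_on S (\<lambda>x. \<Prod>i\<in>I. f i x)"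
  by (induction I rule: infinite_finite_induct) (auto intro: smooth_on_const smooth_on_mult)

lemma smooth_on_compose_linear:
  "open S \<Longrightarrow> open T \<Longrightarrow> bounded_linear A \<Longrightarrow> (\<And>x. x \<in> S \<Longrightarrow> A x \<in> T) \<Longrightarrow> smooth_on T f \<Longrightarrow>
    smooth_on S (\<lambda>x. f (A x))"
  by (simp add: smooth_on_def Ck_on_compose_linear)

lemma smooth_on_compose_real:
  fixes u :: "real \<Rightarrow> 'b::real_normed_vector"
  shows "open S \<Longrightarrow> open T \<Longrightarrow> (\<And>x. x \<in> S \<Longrightarrow> g x \<in> T) \<Longrightarrow> smooth_on T u \<Longrightarrow> smooth_on S g \<Longrightarrow>
    smooth_on S (\<lambda>x. u (g x))"
  by (simp add: smooth_on_def Ck_on_compose_real)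

lemma smooth_on_of_real:
  fixes g :: "'a::real_normed_vector \<Rightarrow> real"
  shows "open S \<Longrightarrow> smooth_on S g \<Longrightarrow> smooth_on S (\<lambda>x. of_real (g x) :: 'b::real_normed_algebra_1)"
  by (rule smooth_on_compose_real[of S UNIV g of_real]) (auto intro: smooth_on_linear bounded_linear_of_real)

lemma smooth_on_continuous: "smooth_on S f \<Longrightarrow> continuous_on S f"
  unfolding smooth_on_def by (erule allE[of _ 0]) simp

lemma smooth_on_differentiable: "smooth_on S f \<Longrightarrow> x \<in> S \<Longrightarrow> f differentiable (at x)"
  unfolding smooth_on_def by (erule allE[of _ "Suc 0"]) simp

lemma smooth_on_has_derivative:
  "smooth_on S f \<Longrightarrow> x \<in> S \<Longrightarrow> (f has_derivative frechet_derivative f (at x)) (at x)"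
  by (simp add: frechet_derivative_works[symmetric] smooth_on_differentiable)

lemma smooth_on_frechet_derivative: "smooth_on S f \<Longrightarrow> smooth_on S (\<lambda>x. frechet_derivative f (at x) v)"
  unfolding smooth_on_def by (rule allI, erule_tac x = "Suc k" in allE) simp

lemma smooth_on_has_vector_derivative:
  "smooth_on S u \<Longrightarrow> t \<in> S \<Longrightarrow> (u has_vector_derivative vector_derivative u (at t)) (at t)"
  using smooth_on_differentiable vector_derivative_works by blast

lemma smooth_on_vector_derivative:
  assumes "open S" "smooth_on S u"
  shows "smooth_on S (\<lambda>t. vector_derivative u (at t))"
proof -
  have "vector_derivative u (at t) = frechet_derivative u (at t) 1" if "t \<in> S" for t
  proof -
    have "frechet_derivative u (at t) = (\<lambda>s. s *\<^sub>R vector_derivative u (at t))"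
      using smooth_on_has_vector_derivative[OF assms(2) that]
      by (intro frechet_derivative_at[symmetric]) (simp add: has_vector_derivative_def)
    then show ?thesis by simp
  qed
  then show ?thesis
    using smooth_on_frechet_derivative[OF assms(2), of 1]
    by (subst smooth_on_cong[OF assms(1), where g = "\<lambda>t. frechet_derivative u (at t) 1"]) auto
qed

lemma smooth_on_realI:
  fixes u :: "real \<Rightarrow> 'b::real_normed_vector"
  assumes "open S" "\<And>t. t \<in> S \<Longrightarrow> (u has_vector_derivative u' t) (at t)" "smooth_on S u'"
  shows "smooth_on S u"
  unfolding smooth_on_def
proof
  fix k
  have "Ck_on (Suc k) S u"
    by (rule Ck_on_SucI[where f' = "\<lambda>t v. v *\<^sub>R u' t"])
      (use assms in \<open>auto simp: has_vector_derivative_def smooth_on_def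
        intro!: Ck_on_bilinear[OF _ bounded_bilinear_scaleR] Ck_on_const\<close>)
  then show "Ck_on k S u" by (rule Ck_on_SucD)
qed

lemma smooth_on_inverse: "smooth_on {0<..} (inverse :: real \<Rightarrow> real)"
  unfolding smooth_on_def
proof
  fix k
  show "Ck_on k {0<..} (inverse :: real \<Rightarrow> real)"
  proof (induction k)
    case 0
    then show ?case by (auto intro!: continuous_intros)
  next
    case (Suc k)
    \<comment> \<open>The derivative is a polynomial in the function itself, so the induction feeds
      on its own hypothesis.\<close>
    show ?case
    proof (rule Ck_on_SucI[where f' = "\<lambda>t v. (- v) * (inverse t * inverse t)"])
      show "(inverse has_derivative (\<lambda>v. - v * (inverse x * inverse x))) (at x)" if "x \<in> {0<..}" for x :: real
        using that by (auto intro!: derivative_eq_intros)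
      show "Ck_on k {0<..} (\<lambda>x. - v * (inverse x * inverse x))" for v :: real
        by (intro Ck_on_bilinear[OF _ bounded_bilinear_mult] Ck_on_const Suc open_greaterThan)
    qed simp
  qed
qed

lemma smooth_on_sqrt: "smooth_on {0<..} sqrt"
  unfolding smooth_on_def
proof
  fix k
  show "Ck_on k {0<..} sqrt"
  proof (induction k)
    case 0
    then show ?case by (auto intro!: continuous_intros)
  next
    case (Suc k)
    \<comment> \<open>The derivative is written as \<open>sqrt t / (2 t)\<close>, so that only
      \<open>sqrt\<close> and the already smooth \<open>inverse\<close> occur.\<close>
    show ?case
    proof (rule Ck_on_SucI[where f' = "\<lambda>t v. (v / 2) * (sqrt t * inverse t)"])
      show "(sqrt has_derivative (\<lambda>v. v / 2 * (sqrt x * inverse x))) (at x)" if "x \<in> {0<..}" for x :: real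
        using that by (auto intro!: derivative_eq_intros simp: field_simps)
      show "Ck_on k {0<..} (\<lambda>x. v / 2 * (sqrt x * inverse x))" for v :: real
        using smooth_on_inverse
        by (intro Ck_on_bilinear[OF _ bounded_bilinear_mult] Ck_on_const Suc open_greaterThan)
          (auto simp: smooth_on_def)
    qed simp
  qed
qed

lemma smooth_on_id: "open S \<Longrightarrow> smooth_on S (\<lambda>x. x)"
  by (rule smooth_on_linear[OF _ bounded_linear_ident])

lemma smooth_on_powi: "smooth_on {0<..} (\<lambda>t::real. t powi k)"
proof (cases "k \<ge> 0")
  case True
  then show ?thesis by (simp add: power_int_def smooth_on_power smooth_on_id)
next
  case False
  then show ?thesis by (simp add: power_int_def smooth_on_power smooth_on_inverse)
qed

lemma smooth_on_norm: "smooth_on (- {0}) (norm :: 'a::euclidean_space \<Rightarrow> real)"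
  unfolding norm_eq_sqrt_inner
  by (rule smooth_on_compose_real[of _ "{0<..}"])
    (auto intro!: smooth_on_sqrt smooth_on_bilinear[OF _ bounded_bilinear_inner] smooth_on_id)

section \<open>Radial profiles\<close>

text \<open>Profiles are functions of y = ||x||^2: in this variable planar moments become iterated
  antiderivatives. The support is bounded above and unrestricted at 0, so the integral from y to
  infinity inverts differentiation up to sign.\<close>

definition Cp :: "(real \<Rightarrow> complex) set" where
  "Cp = {h. smooth_on {0<..} h \<and> (\<forall>y\<le>0. h y = 0) \<and> (\<exists>R. \<forall>y>R. h y = 0)}"

definition dop :: "(real \<Rightarrow> complex) \<Rightarrow> real \<Rightarrow> complex" where
  "dop h y = (if 0 < y then vector_derivative h (at y) else 0)"

definition iop :: "(real \<Rightarrow> complex) \<Rightarrow> real \<Rightarrow> complex" where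
  "iop h y = (if 0 < y then LINT s:{y..}|lborel. h s else 0)"

definition mulp :: "int \<Rightarrow> (real \<Rightarrow> complex) \<Rightarrow> real \<Rightarrow> complex" where
  "mulp k h y = of_real (y powi k) * h y"

lemma CpI:
  "smooth_on {0<..} h \<Longrightarrow> (\<And>y. y \<le> 0 \<Longrightarrow> h y = 0) \<Longrightarrow> (\<And>y. y > R \<Longrightarrow> h y = 0) \<Longrightarrow> h \<in> Cp"
  by (auto simp: Cp_def)

lemma Cp_smooth: "h \<in> Cp \<Longrightarrow> smooth_on {0<..} h"
  by (simp add: Cp_def)

lemma Cp_nonpos: "h \<in> Cp \<Longrightarrow> y \<le> 0 \<Longrightarrow> h y = 0"
  by (simp add: Cp_def)

lemma Cp_bound: assumes "h \<in> Cp" obtains R where "R > 0" "\<And>y. y > R \<Longrightarrow> h y = 0"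
proof -
  from assms obtain R where "\<forall>y>R. h y = 0" by (auto simp: Cp_def)
  then show thesis by (intro that[of "max R 1"]) auto
qed

lemma Cp_eqI: "f \<in> Cp \<Longrightarrow> g \<in> Cp \<Longrightarrow> (\<And>y. 0 < y \<Longrightarrow> f y = g y) \<Longrightarrow> f = g"
  by (rule ext) (metis Cp_nonpos linorder_not_le)

lemma Cp_deriv: "h \<in> Cp \<Longrightarrow> 0 < y \<Longrightarrow> (h has_vector_derivative dop h y) (at y)"
  unfolding dop_def by (auto intro: smooth_on_has_vector_derivative[OF Cp_smooth])

lemma dop_eqI: "0 < y \<Longrightarrow> (h has_vector_derivative d) (at y) \<Longrightarrow> dop h y = d"
  by (simp add: dop_def vector_derivative_at)

lemma Cp_continuous: "h \<in> Cp \<Longrightarrow> continuous_on {0<..} h"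
  by (intro smooth_on_continuous Cp_smooth)

lemma Cp_zero: "(\<lambda>_. 0) \<in> Cp"
  by (simp add: Cp_def smooth_on_const)

lemma Cp_add: assumes "f \<in> Cp" "g \<in> Cp" shows "(\<lambda>y. f y + g y) \<in> Cp"
proof -
  obtain R where "\<And>y. y > R \<Longrightarrow> f y = 0" using Cp_bound[OF assms(1)] by metis
  moreover obtain Q where "\<And>y. y > Q \<Longrightarrow> g y = 0" using Cp_bound[OF assms(2)] by metis
  ultimately have "f y + g y = 0" if "y > max R Q" for y using that by simp
  then show ?thesis
    using assms by (intro CpI[where R = "max R Q"] smooth_on_add) (auto intro: Cp_smooth simp: Cp_nonpos)
qed

lemma Cp_mult:
  assumes "f \<in> Cp" "smooth_on {0<..} a" shows "(\<lambda>y. a y * f y) \<in> Cp"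
proof -
  obtain R where "\<And>y. y > R \<Longrightarrow> f y = 0" using Cp_bound[OF assms(1)] by metis
  then have "\<forall>y>R. a y * f y = 0" by simp
  then show ?thesis
    using assms unfolding Cp_def by (auto intro!: smooth_on_mult)
qed

lemma Cp_cmult: "f \<in> Cp \<Longrightarrow> (\<lambda>y. c * f y) \<in> Cp"
  by (rule Cp_mult) (simp_all add: smooth_on_const)

lemma mulp_Cp: "f \<in> Cp \<Longrightarrow> mulp k f \<in> Cp"
  unfolding mulp_def
  by (intro Cp_mult smooth_on_of_real smooth_on_powi) auto

lemma mulp_mulp: "f \<in> Cp \<Longrightarrow> mulp j (mulp k f) = mulp (j + k) f"
  by (intro Cp_eqI mulp_Cp) (auto simp: mulp_def power_int_add)

lemma mulp_0: "mulp 0 f = f"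
  by (simp add: mulp_def fun_eq_iff)

lemma mulp_cmult: "mulp k (\<lambda>y. c * f y) = (\<lambda>y. c * mulp k f y)"
  by (simp add: mulp_def fun_eq_iff)

lemma mulp_add: "mulp k (\<lambda>y. f y + g y) = (\<lambda>y. mulp k f y + mulp k g y)"
  by (simp add: mulp_def fun_eq_iff algebra_simps)

lemma dop_Cp: assumes "h \<in> Cp" shows "dop h \<in> Cp"
proof -
  have sm: "smooth_on {0<..} (dop h)"
    using smooth_on_vector_derivative[OF open_greaterThan Cp_smooth[OF assms]]
    by (subst smooth_on_cong[OF open_greaterThan, where g = "\<lambda>t. vector_derivative h (at t)"])
      (auto simp: dop_def)
  obtain R where R: "R > 0" "\<And>y. y > R \<Longrightarrow> h y = 0" using Cp_bound[OF assms] by metis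
  have "dop h y = 0" if "y > R" for y
  proof (rule dop_eqI)
    show "(h has_vector_derivative 0) (at y)"
      by (rule has_vector_derivative_transform_within_open[of "\<lambda>_. 0" _ _ "{R<..}"]) (use that R in auto)
  qed (use that R in auto)
  then show ?thesis using sm by (intro CpI[of _ R]) (auto simp: dop_def)
qed

lemma dop_add: "f \<in> Cp \<Longrightarrow> g \<in> Cp \<Longrightarrow> dop (\<lambda>y. f y + g y) = (\<lambda>y. dop f y + dop g y)"
  by (intro Cp_eqI dop_Cp Cp_add dop_eqI)
    (auto intro!: has_vector_derivative_add Cp_deriv)

lemma dop_cmult: "f \<in> Cp \<Longrightarrow> dop (\<lambda>y. c * f y) = (\<lambda>y. c * dop f y)"
  by (intro Cp_eqI dop_Cp Cp_cmult dop_eqI has_vector_derivative_mult_right Cp_deriv)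

lemma dop_mulp:
  assumes "h \<in> Cp"
  shows "dop (mulp k h) = (\<lambda>y. of_int k * mulp (k - 1) h y + mulp k (dop h) y)"
proof (rule Cp_eqI)
  fix y :: real assume y: "0 < y"
  have "((\<lambda>y. of_real (y powi k) :: complex) has_vector_derivative of_real (of_int k * y powi (k - 1))) (at y)"
    using y by (intro has_vector_derivative_of_real)
      (auto intro!: derivative_eq_intros simp flip: has_real_derivative_iff_has_vector_derivative)
  from has_vector_derivative_mult[OF this Cp_deriv[OF assms y]]
  show "dop (mulp k h) y = of_int k * mulp (k - 1) h y + mulp k (dop h) y"
    unfolding mulp_def using y by (intro dop_eqI) (auto simp: algebra_simps)
qed (intro assms dop_Cp mulp_Cp Cp_add Cp_cmult)+

lemma Cp_integrable:
  assumes "h \<in> Cp" "0 < y" shows "h integrable_on {y..R}" "set_integrable lborel {y..R} h"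
proof -
  have "continuous_on {y..R} h"
    using assms by (intro continuous_on_subset[OF Cp_continuous]) auto
  then show "h integrable_on {y..R}" "set_integrable lborel {y..R} h"
    by (auto intro: integrable_continuous_real borel_integrable_atLeastAtMost')
qed

lemma iop_eq:
  assumes "h \<in> Cp" "0 < y" "\<And>s. s > R \<Longrightarrow> h s = 0"
  shows "iop h y = integral {y..R} h"
proof -
  have "(LINT s:{y..}|lborel. h s) = (LINT s:{y..R}|lborel. h s)"
    unfolding set_lebesgue_integral_def
    by (intro Bochner_Integration.integral_cong) (auto simp: indicator_def assms(3) not_le)
  also have "\<dots> = integral {y..R} h"
    by (rule set_borel_integral_eq_integral(2)[OF Cp_integrable(2)[OF assms(1,2)]])
  finally show ?thesis using assms by (simp add: iop_def)
qed

lemma iop_deriv: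
  assumes "h \<in> Cp" "0 < y"
  shows "(iop h has_vector_derivative - h y) (at y)"
proof -
  obtain R' where R': "R' > 0" "\<And>y. y > R' \<Longrightarrow> h y = 0" using Cp_bound[OF assms(1)] by metis
  define R where "R = max R' (y + 1)"
  have R: "\<And>y. y > R \<Longrightarrow> h y = 0" "y < R" using R' by (auto simp: R_def)
  \<comment> \<open>A positive base point is taken because h may be unbounded near 0.\<close>
  define c where "c = y / 2"
  have c: "0 < c" "c < y" using assms by (auto simp: c_def)
  have cont: "continuous_on {c..R} h"
    using c by (intro continuous_on_subset[OF Cp_continuous[OF assms(1)]]) auto
  have "((\<lambda>x. integral {c..x} h) has_vector_derivative h y) (at y within {c..R})"
    by (rule integral_has_vector_derivative[OF cont]) (use c R in auto)
  then have "((\<lambda>x. integral {c..x} h) has_vector_derivative h y) (at y)"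
    using c R by (simp add: at_within_Icc_at)
  then have "((\<lambda>x. integral {c..R} h - integral {c..x} h) has_vector_derivative - h y) (at y)"
    by (auto intro!: derivative_eq_intros)
  moreover have "integral {c..R} h - integral {c..x} h = iop h x" if "x \<in> {c<..<R}" for x
  proof -
    have "integral {c..x} h + integral {x..R} h = integral {c..R} h"
      using that Cp_integrable(1)[OF assms(1) c(1)]
      by (intro Henstock_Kurzweil_Integration.integral_combine) auto
    moreover have "iop h x = integral {x..R} h"
      by (rule iop_eq) (use that c R assms in auto)
    ultimately show ?thesis by (simp add: algebra_simps)
  qed
  ultimately show ?thesis
    by (auto intro: has_vector_derivative_transform_within_open[where S = "{c<..<R}"] simp: c R)
qed

lemma iop_Cp: assumes "h \<in> Cp" shows "iop h \<in> Cp"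
proof -
  have "smooth_on {0<..} (\<lambda>y. - 1 * h y)"
    using Cp_smooth[OF assms] by (intro smooth_on_mult smooth_on_const) auto
  then have sm: "smooth_on {0<..} (iop h)"
    using iop_deriv[OF assms] by (intro smooth_on_realI[where u = "iop h" and u' = "\<lambda>y. - 1 * h y"]) auto
  obtain R where R: "R > 0" "\<And>y. y > R \<Longrightarrow> h y = 0" using Cp_bound[OF assms] by metis
  have "iop h y = 0" if "y > R" for y
    using iop_eq[OF assms, of y R] that R by simp
  then show ?thesis using sm by (intro CpI[of _ R]) (auto simp: iop_def)
qed

lemma dop_iop: "h \<in> Cp \<Longrightarrow> dop (iop h) = (\<lambda>y. - 1 * h y)"
  by (intro Cp_eqI dop_Cp iop_Cp Cp_cmult dop_eqI) (auto intro!: iop_deriv)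

text \<open>The constant of integration is zero because profiles vanish for large y. Identities
  about \<open>iop\<close> are proved below by applying \<open>dop\<close> to both sides and
  invoking this uniqueness.\<close>

lemma dop_0_imp:
  assumes "h \<in> Cp" "\<And>y. 0 < y \<Longrightarrow> dop h y = 0" shows "h = (\<lambda>_. 0)"
proof (rule Cp_eqI[OF assms(1) Cp_zero])
  fix y :: real assume y: "0 < y"
  obtain R where R: "R > 0" "\<And>y. y > R \<Longrightarrow> h y = 0" using Cp_bound[OF assms(1)] by metis
  have "\<exists>c. \<forall>x\<in>{0<..}. h x = c"
  proof (rule has_vector_derivative_zero_constant)
    show "(h has_vector_derivative 0) (at x within {0<..})" if "x \<in> {0<..}" for x
      using Cp_deriv[OF assms(1), of x] assms(2)[of x] that
      by (auto intro: has_vector_derivative_at_within)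
  qed auto
  then have "h y = h (max y R + 1)" using y by auto
  then show "h y = 0" using R by simp
qed

lemma Cp_diff: "f \<in> Cp \<Longrightarrow> g \<in> Cp \<Longrightarrow> (\<lambda>y. f y - g y) \<in> Cp"
  using Cp_add[of f "\<lambda>y. - 1 * g y"] Cp_cmult[of g "- 1"] by simp

lemma dop_diff: "f \<in> Cp \<Longrightarrow> g \<in> Cp \<Longrightarrow> dop (\<lambda>y. f y - g y) = (\<lambda>y. dop f y - dop g y)"
  by (intro Cp_eqI dop_Cp Cp_diff dop_eqI)
    (auto intro!: has_vector_derivative_diff Cp_deriv)

lemma iop_add: "f \<in> Cp \<Longrightarrow> g \<in> Cp \<Longrightarrow> iop (\<lambda>y. f y + g y) = (\<lambda>y. iop f y + iop g y)"
proof -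
  assume fg: "f \<in> Cp" "g \<in> Cp"
  have "(\<lambda>y. iop (\<lambda>y. f y + g y) y - (iop f y + iop g y)) = (\<lambda>_. 0)"
    by (rule dop_0_imp) (auto simp: fg dop_diff dop_add dop_iop Cp_add Cp_diff iop_Cp)
  then show ?thesis by (simp add: fun_eq_iff)
qed

lemma iop_cmult: "f \<in> Cp \<Longrightarrow> iop (\<lambda>y. c * f y) = (\<lambda>y. c * iop f y)"
proof -
  assume f: "f \<in> Cp"
  have "(\<lambda>y. iop (\<lambda>y. c * f y) y - c * iop f y) = (\<lambda>_. 0)"
    by (rule dop_0_imp) (auto simp: f dop_diff dop_cmult dop_iop Cp_cmult Cp_diff iop_Cp)
  then show ?thesis by (simp add: fun_eq_iff)
qed

lemma iop_dop: assumes "h \<in> Cp" shows "iop (dop h) = (\<lambda>y. - 1 * h y)"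
proof -
  have "(\<lambda>y. iop (dop h) y + h y) = (\<lambda>_. 0)"
    by (rule dop_0_imp) (simp_all add: assms dop_add dop_iop dop_Cp iop_Cp Cp_add)
  then show ?thesis by (simp add: fun_eq_iff eq_neg_iff_add_eq_0)
qed

lemma funpow_Cp: "(\<And>h. h \<in> Cp \<Longrightarrow> T h \<in> Cp) \<Longrightarrow> h \<in> Cp \<Longrightarrow> (T ^^ k) h \<in> Cp"
  by (induction k) auto

lemma funpow_cmult:
  assumes "\<And>h c. h \<in> Cp \<Longrightarrow> T (\<lambda>y. c * h y) = (\<lambda>y. c * T h y)" "\<And>h. h \<in> Cp \<Longrightarrow> T h \<in> Cp" "h \<in> Cp"
  shows "(T ^^ k) (\<lambda>y. c * h y) = (\<lambda>y. c * (T ^^ k) h y)"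
  using assms(1)[OF funpow_Cp[OF assms(2,3)]] by (induction k) auto

lemma funpow_additive:
  assumes "\<And>g h. g \<in> Cp \<Longrightarrow> h \<in> Cp \<Longrightarrow> T (\<lambda>y. g y + h y) = (\<lambda>y. T g y + T h y)"
    "\<And>h. h \<in> Cp \<Longrightarrow> T h \<in> Cp" "g \<in> Cp" "h \<in> Cp"
  shows "(T ^^ k) (\<lambda>y. g y + h y) = (\<lambda>y. (T ^^ k) g y + (T ^^ k) h y)"
  using assms(1)[OF funpow_Cp[OF assms(2,3)] funpow_Cp[OF assms(2,4)]] by (induction k) auto

lemma iop_pow_Cp: "h \<in> Cp \<Longrightarrow> (iop ^^ k) h \<in> Cp"
  by (rule funpow_Cp) (auto intro: iop_Cp)

lemma iop_pow_cmult: "h \<in> Cp \<Longrightarrow> (iop ^^ k) (\<lambda>y. c * h y) = (\<lambda>y. c * (iop ^^ k) h y)"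
  by (rule funpow_cmult) (auto intro: iop_Cp iop_cmult)

lemma iop_pow_add:
  "g \<in> Cp \<Longrightarrow> h \<in> Cp \<Longrightarrow> (iop ^^ k) (\<lambda>y. g y + h y) = (\<lambda>y. (iop ^^ k) g y + (iop ^^ k) h y)"
  by (rule funpow_additive) (auto intro: iop_Cp iop_add)

lemma dop_pow_Cp: "h \<in> Cp \<Longrightarrow> (dop ^^ k) h \<in> Cp"
  by (rule funpow_Cp) (auto intro: dop_Cp)

lemma dop_pow_cmult: "h \<in> Cp \<Longrightarrow> (dop ^^ k) (\<lambda>y. c * h y) = (\<lambda>y. c * (dop ^^ k) h y)"
  by (rule funpow_cmult) (auto intro: dop_Cp dop_cmult)

lemma dop_pow_add:
  "g \<in> Cp \<Longrightarrow> h \<in> Cp \<Longrightarrow> (dop ^^ k) (\<lambda>y. g y + h y) = (\<lambda>y. (dop ^^ k) g y + (dop ^^ k) h y)"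
  by (rule funpow_additive) (auto intro: dop_Cp dop_add)

lemma dop_iop_pow: "h \<in> Cp \<Longrightarrow> (dop ^^ k) ((iop ^^ k) h) = (\<lambda>y. (- 1) ^ k * h y)"
proof (induction k arbitrary: h)
  case (Suc k)
  have "(dop ^^ Suc k) ((iop ^^ Suc k) h) = (dop ^^ k) (dop (iop ((iop ^^ k) h)))"
    by (simp add: funpow_swap1)
  also have "\<dots> = (dop ^^ k) (\<lambda>y. - 1 * (iop ^^ k) h y)"
    by (simp only: dop_iop[OF iop_pow_Cp[OF Suc.prems]])
  also have "\<dots> = (\<lambda>y. (- 1) ^ Suc k * h y)"
    using Suc by (simp only: dop_pow_cmult iop_pow_Cp) (simp add: fun_eq_iff)
  finally show ?case .
qed simp

lemma iop_dop_pow: "h \<in> Cp \<Longrightarrow> (iop ^^ k) ((dop ^^ k) h) = (\<lambda>y. (- 1) ^ k * h y)"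
proof (induction k arbitrary: h)
  case (Suc k)
  have "(iop ^^ Suc k) ((dop ^^ Suc k) h) = (iop ^^ k) (iop (dop ((dop ^^ k) h)))"
    by (simp add: funpow_swap1)
  also have "\<dots> = (iop ^^ k) (\<lambda>y. - 1 * (dop ^^ k) h y)"
    by (simp only: iop_dop[OF dop_pow_Cp[OF Suc.prems]])
  also have "\<dots> = (\<lambda>y. (- 1) ^ Suc k * h y)"
    using Suc by (simp only: iop_pow_cmult dop_pow_Cp) (simp add: fun_eq_iff)
  finally show ?case .
qed simp

text \<open>Integration by parts: since -h is the derivative of \<open>iop h\<close>, each step
  lowers the power of s by one, yields the exponent as a factor and replaces h by
  \<open>iop h\<close>. After a steps a! times one last antiderivative remains.\<close>

lemma moment_eq:
  assumes h: "h \<in> Cp" and y: "0 < y"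
  shows "set_integrable lborel {0..} (\<lambda>s. of_real s ^ a * h (y + s))"
    and "(LINT s:{0..}|lborel. of_real s ^ a * h (y + s)) = fact a * (iop ^^ Suc a) h y"
proof -
  have *: "set_integrable lborel {0..} (\<lambda>s. of_real s ^ a * h (y + s)) \<and>
      (LINT s:{0..}|lborel. of_real s ^ a * h (y + s)) = integral {0..R} (\<lambda>s. of_real s ^ a * h (y + s))"
    if h: "h \<in> Cp" and R: "\<And>y. y > R \<Longrightarrow> h y = 0" for h a R
  proof -
    have eq: "(\<lambda>s. indicat_real {0..} s *\<^sub>R (of_real s ^ a * h (y + s))) =
        (\<lambda>s. indicat_real {0..R} s *\<^sub>R (of_real s ^ a * h (y + s)))"
      using R y by (auto simp: fun_eq_iff indicator_def)
    have "continuous_on {0..R} (\<lambda>s. of_real s ^ a * h (y + s))"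
      by (intro continuous_intros continuous_on_compose2[OF Cp_continuous[OF h]]) (use y in auto)
    then have i: "set_integrable lborel {0..R} (\<lambda>s. of_real s ^ a * h (y + s))"
      by (rule borel_integrable_atLeastAtMost')
    then have "set_integrable lborel {0..} (\<lambda>s. of_real s ^ a * h (y + s))"
      unfolding set_integrable_def eq .
    moreover have "(LINT s:{0..}|lborel. of_real s ^ a * h (y + s)) = (LINT s:{0..R}|lborel. of_real s ^ a * h (y + s))"
      unfolding set_lebesgue_integral_def eq ..
    ultimately show ?thesis using set_borel_integral_eq_integral(2)[OF i] by simp
  qed
  obtain R0 where "\<And>y. y > R0 \<Longrightarrow> h y = 0" using Cp_bound[OF h] by metis
  then show "set_integrable lborel {0..} (\<lambda>s. of_real s ^ a * h (y + s))"
    using *[OF h] by blast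
  have step: "(LINT s:{0..}|lborel. of_real s ^ a * h (y + s)) =
      (if a = 0 then iop h y else of_nat a * (LINT s:{0..}|lborel. of_real s ^ (a - 1) * iop h (y + s)))"
    if h: "h \<in> Cp" for a h
  proof -
    obtain R where R: "R > 0" "\<And>y. y > R \<Longrightarrow> h y = 0" using Cp_bound[OF h] by metis
    have R': "iop h t = 0" if "t > R" for t
      using iop_eq[OF h, of t R] R that by simp
    \<comment> \<open>The derivative of \<open>s^a * iop h (y + s)\<close>. For a = 0 the truncated
      exponent \<open>a - 1\<close> comes with the factor 0, and the lower boundary value
      \<open>iop h y\<close> is what survives.\<close>
    have "((\<lambda>s. of_nat a * of_real s ^ (a - 1) * iop h (y + s) - of_real s ^ a * h (y + s)) has_integral
        (of_real R ^ a * iop h (y + R) - of_real 0 ^ a * iop h (y + 0))) {0..R}"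
    proof (rule fundamental_theorem_of_calculus)
      fix s assume s: "s \<in> {0..R}"
      have "((\<lambda>s. of_real (s ^ a) :: complex) has_vector_derivative of_real (of_nat a * s ^ (a - 1))) (at s)"
        by (intro has_vector_derivative_of_real)
          (auto intro!: derivative_eq_intros simp flip: has_real_derivative_iff_has_vector_derivative)
      moreover have "((\<lambda>s. iop h (y + s)) has_vector_derivative - h (y + s)) (at s)"
        using vector_diff_chain_at[of "\<lambda>s. y + s" 1 s "iop h" "- h (y + s)"] iop_deriv[OF h, of "y + s"] s y
          has_vector_derivative_add[OF has_vector_derivative_const[of y] has_vector_derivative_id[of "at s"]]
        by (auto simp: o_def id_def)
      ultimately have "((\<lambda>s. of_real (s ^ a) * iop h (y + s)) has_vector_derivative
          (of_real (s ^ a) * (- h (y + s)) + of_real (of_nat a * s ^ (a - 1)) * iop h (y + s))) (at s)"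
        by (rule has_vector_derivative_mult)
      also have "of_real (s ^ a) * (- h (y + s)) + of_real (of_nat a * s ^ (a - 1)) * iop h (y + s) =
          of_nat a * of_real s ^ (a - 1) * iop h (y + s) - of_real s ^ a * h (y + s)"
        by simp
      finally show "((\<lambda>s. of_real s ^ a * iop h (y + s)) has_vector_derivative
          (of_nat a * of_real s ^ (a - 1) * iop h (y + s) - of_real s ^ a * h (y + s))) (at s within {0..R})"
        unfolding of_real_power by (rule has_vector_derivative_at_within)
    qed (use R in auto)
    moreover have i1: "(\<lambda>s. of_real s ^ b * k (y + s)) integrable_on {0..R}" if "k \<in> Cp" for b k
      by (intro integrable_continuous_real continuous_intros continuous_on_compose2[OF Cp_continuous[OF that]])
        (use y in auto)
    ultimately have "- (0 ^ a * iop h y) =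
        of_nat a * integral {0..R} (\<lambda>s. of_real s ^ (a - 1) * iop h (y + s)) - integral {0..R} (\<lambda>s. of_real s ^ a * h (y + s))"
      using R' y
      by (subst (asm) has_integral_iff)
        (auto simp: mult.assoc integral_diff[OF integrable_on_mult_right[OF i1[OF iop_Cp[OF h]]] i1[OF h]])
    then show ?thesis
      using *[OF h R(2), of R a] *[OF iop_Cp[OF h] R', of R "a - 1"] by (cases a) auto
  qed
  show "(LINT s:{0..}|lborel. of_real s ^ a * h (y + s)) = fact a * (iop ^^ Suc a) h y"
    using h
  proof (induction a arbitrary: h)
    case 0
    then show ?case using step[of h 0] by simp
  next
    case (Suc a)
    then show ?case using step[of h "Suc a"] Suc.IH[OF iop_Cp[OF Suc.prems]]
      by (simp add: funpow_swap1 algebra_simps)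
  qed
qed

section \<open>Leibniz formula and Euler operators on profiles\<close>

definition ffall :: "complex \<Rightarrow> nat \<Rightarrow> complex" where
  "ffall x k = (\<Prod>i<k. x - of_nat i)"

lemma ffall_0: "ffall x 0 = 1" by (simp add: ffall_def)

lemma ffall_Suc: "ffall x (Suc k) = ffall x k * (x - of_nat k)"
  by (simp add: ffall_def)

lemma ffall_Suc': "ffall x (Suc k) = x * ffall (x - 1) k"
  unfolding ffall_def by (subst prod.lessThan_Suc_shift) (simp add: algebra_simps)

lemma ffall_of_nat: "ffall (of_nat m) k = fact k * of_nat (m choose k)"
proof -
  have "ffall (of_nat m) k = fact k * (of_nat m gchoose k)"
    by (simp add: ffall_def gbinomial_prod_rev lessThan_atLeast0)
  then show ?thesis by (simp add: binomial_gbinomial)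
qed

text \<open>Leibniz' rule: m - k derivatives turn \<open>iop ^^ m\<close> into (-1)^(m-k) times
  \<open>iop ^^ k\<close>, and the other k derivatives hit the power of y and produce the falling
  factorial.\<close>

lemma rodrigues:
  assumes "h \<in> Cp"
  shows "(- 1) ^ m * (dop ^^ m) (mulp M ((iop ^^ m) h)) y =
    (\<Sum>k\<le>m. (- 1) ^ k * of_nat (m choose k) * ffall (of_int M) k * mulp (M - int k) ((iop ^^ k) h) y)"
  using assms
proof (induction m arbitrary: M h)
  case 0
  then show ?case by (simp add: ffall_0)
next
  case (Suc m)
  let ?t = "\<lambda>M h k. (- 1) ^ k * ffall (of_int M) k * mulp (M - int k) ((iop ^^ k) h) y"
  have sw: "(iop ^^ m) (iop h) = iop ((iop ^^ m) h)"
    by (simp add: funpow_swap1)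
  \<comment> \<open>One derivative reduces m + 1 to m for the two pairs (M - 1, iop h) and (M, h);
    Pascal's rule merges the resulting sums.\<close>
  have "dop (mulp M ((iop ^^ Suc m) h)) =
      (\<lambda>y. of_int M * mulp (M - 1) ((iop ^^ m) (iop h)) y + - 1 * mulp M ((iop ^^ m) h) y)"
    unfolding sw using iop_pow_Cp[OF Suc.prems, of m]
    by (simp add: dop_mulp iop_Cp dop_iop mulp_cmult[of _ "-1", simplified])
  then have "(- 1) ^ Suc m * (dop ^^ Suc m) (mulp M ((iop ^^ Suc m) h)) y =
     - of_int M * ((- 1) ^ m * (dop ^^ m) (mulp (M - 1) ((iop ^^ m) (iop h))) y)
     + (- 1) ^ m * (dop ^^ m) (mulp M ((iop ^^ m) h)) y"
    using Suc.prems
    by (simp only: funpow_Suc_right o_apply dop_pow_add dop_pow_cmult mulp_Cp Cp_cmult iop_pow_Cp iop_Cp)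
      (simp add: algebra_simps)
  also have "\<dots> = - of_int M * (\<Sum>k\<le>m. of_nat (m choose k) * ?t (M - 1) (iop h) k)
      + (\<Sum>k\<le>m. of_nat (m choose k) * ?t M h k)"
    using Suc.IH[OF Suc.prems, of M] Suc.IH[OF iop_Cp[OF Suc.prems], of "M - 1"]
    by (simp add: mult_ac)
  also have "- of_int M * (\<Sum>k\<le>m. of_nat (m choose k) * ?t (M - 1) (iop h) k) =
      (\<Sum>k\<le>m. of_nat (m choose k) * ?t M h (Suc k))"
    by (simp add: sum_distrib_left ffall_Suc' funpow_swap1 algebra_simps flip: sum_negf)
  also have "(\<Sum>k\<le>m. of_nat (m choose k) * ?t M h (Suc k)) + (\<Sum>k\<le>m. of_nat (m choose k) * ?t M h k) =
      (\<Sum>k\<le>Suc m. of_nat (Suc m choose k) * ?t M h k)"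
  proof -
    have "(\<Sum>k\<le>Suc m. of_nat (Suc m choose k) * ?t M h k) =
        ?t M h 0 + (\<Sum>k\<le>m. of_nat (Suc m choose Suc k) * ?t M h (Suc k))"
      by (subst sum.atMost_Suc_shift) simp
    also have "\<dots> = (\<Sum>k\<le>m. of_nat (m choose k) * ?t M h (Suc k)) +
       (?t M h 0 + (\<Sum>k\<le>m. of_nat (m choose Suc k) * ?t M h (Suc k)))"
      by (simp only: binomial_Suc_Suc of_nat_add distrib_right sum.distrib add.left_commute add.commute)
    also have "?t M h 0 + (\<Sum>k\<le>m. of_nat (m choose Suc k) * ?t M h (Suc k)) =
       (\<Sum>k\<le>Suc m. of_nat (m choose k) * ?t M h k)"
      by (subst sum.atMost_Suc_shift) simp
    also have "\<dots> = (\<Sum>k\<le>m. of_nat (m choose k) * ?t M h k)" by simp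
    finally show ?thesis by (rule sym)
  qed
  finally show ?case by (simp add: mult_ac)
qed

definition yd :: "(real \<Rightarrow> complex) \<Rightarrow> real \<Rightarrow> complex" where
  "yd g y = of_real y * dop g y"

lemma yd_Cp: "g \<in> Cp \<Longrightarrow> yd g \<in> Cp"
  using mulp_Cp[OF dop_Cp, of g 1] by (simp add: yd_def[abs_def] mulp_def[abs_def])

lemma yd_mulp: "g \<in> Cp \<Longrightarrow> yd (mulp k g) = (\<lambda>y. of_int k * mulp k g y + mulp k (yd g) y)"
  by (intro Cp_eqI yd_Cp mulp_Cp Cp_add Cp_cmult)
    (auto simp: yd_def dop_mulp mulp_def algebra_simps power_int_diff)

text \<open>The conjugated operator is the integral of u^(b-1) g(u y) over u > 1. It commutes with
  dilations, hence with their generator y d/dy. The proof is one integration by parts: y^b g' = (y^b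
  g)' - b y^(b-1) g.\<close>

lemma yd_conv1:
  assumes g: "g \<in> Cp"
  shows "yd (mulp (- b) (iop (mulp (b - 1) g))) = mulp (- b) (iop (mulp (b - 1) (yd g)))"
proof -
  have 1: "mulp (b - 1) (yd g) = mulp b (dop g)"
    using g by (intro Cp_eqI mulp_Cp yd_Cp dop_Cp) (auto simp: mulp_def yd_def power_int_diff)
  have 2: "mulp b (dop g) = (\<lambda>y. dop (mulp b g) y + - of_int b * mulp (b - 1) g y)"
    using g by (simp add: dop_mulp)
  have 3: "iop (mulp b (dop g)) = (\<lambda>y. - 1 * mulp b g y + - of_int b * iop (mulp (b - 1) g) y)"
    unfolding 2 iop_add[OF dop_Cp[OF mulp_Cp[OF g]] Cp_cmult[OF mulp_Cp[OF g]]]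
      iop_dop[OF mulp_Cp[OF g]] iop_cmult[OF mulp_Cp[OF g]] ..
  have 4: "yd (iop (mulp (b - 1) g)) = (\<lambda>y. - 1 * mulp b g y)"
    using g by (intro Cp_eqI yd_Cp iop_Cp mulp_Cp Cp_cmult)
      (auto simp: yd_def dop_iop mulp_Cp mulp_def power_int_diff)
  show ?thesis
    unfolding 1 3 using g
    by (simp add: yd_mulp iop_Cp mulp_Cp 4) (simp add: mulp_def fun_eq_iff algebra_simps)
qed

text \<open>An operator of Erdelyi-Kober type. It factors into m one-step operators with parameters
  b, b - 1, ..., b - m + 1, because the powers between them cancel.\<close>

lemma yd_conv:
  assumes g: "g \<in> Cp"
  shows "yd (mulp (- b) ((iop ^^ m) (mulp (b - int m) g))) = mulp (- b) ((iop ^^ m) (mulp (b - int m) (yd g)))"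
  using g
proof (induction m arbitrary: b)
  case 0
  then show ?case by (simp add: mulp_mulp mulp_0 yd_Cp)
next
  case (Suc m)
  have C: "mulp (- b) ((iop ^^ Suc m) (mulp (b - int (Suc m)) g)) =
      mulp (- b) (iop (mulp (b - 1) (mulp (- (b - 1)) ((iop ^^ m) (mulp ((b - 1) - int m) g)))))" if "g \<in> Cp" for g
    using that by (simp add: mulp_mulp[OF iop_pow_Cp] mulp_Cp mulp_0 algebra_simps)
  show ?case
    unfolding C[OF Suc.prems] C[OF yd_Cp[OF Suc.prems]] Suc.IH[OF Suc.prems, symmetric]
    by (rule yd_conv1) (intro Suc.prems mulp_Cp iop_pow_Cp)
qed

text \<open>The product (y D + 1) ... (y D + N), in which the factor with constant N acts first; in
  this order the transposed Euler factors reach a test function.\<close>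

fun eprod :: "nat \<Rightarrow> (real \<Rightarrow> complex) \<Rightarrow> real \<Rightarrow> complex" where
  "eprod 0 g = g"
| "eprod (Suc N) g = eprod N (\<lambda>y. yd g y + of_nat (Suc N) * g y)"

lemma eprod_eq: "g \<in> Cp \<Longrightarrow> eprod N g = (dop ^^ N) (mulp (int N) g)"
proof (induction N arbitrary: g)
  case 0
  then show ?case by (simp add: mulp_0)
next
  case (Suc N)
  \<comment> \<open>As operators, y^N (y D + N + 1) = D y^(N+1): each factor contributes one
    derivative and raises the exponent by one.\<close>
  have "mulp (int N) (\<lambda>y. yd g y + of_nat (Suc N) * g y) = dop (mulp (int (Suc N)) g)"
    using Suc.prems
    by (intro Cp_eqI mulp_Cp Cp_add Cp_cmult dop_Cp yd_Cp)
      (auto simp: dop_mulp mulp_def yd_def power_int_add algebra_simps)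
  then show ?case
    using Suc.prems Suc.IH[of "\<lambda>y. yd g y + of_nat (Suc N) * g y"]
    by (simp add: Cp_add Cp_cmult yd_Cp funpow_swap1 del: of_nat_Suc)
qed

lemma eprod_Cp: "g \<in> Cp \<Longrightarrow> eprod N g \<in> Cp"
  by (simp add: eprod_eq dop_pow_Cp mulp_Cp)

lemma eprod_conv:
  assumes g: "g \<in> Cp"
  shows "eprod N (mulp (- b) ((iop ^^ m) (mulp (b - int m) g))) = mulp (- b) ((iop ^^ m) (mulp (b - int m) (eprod N g)))"
  using g
proof (induction N arbitrary: g)
  case (Suc N)
  have "mulp (- b) ((iop ^^ m) (mulp (b - int m) (\<lambda>y. yd g y + of_nat (Suc N) * g y))) =
      (\<lambda>y. yd (mulp (- b) ((iop ^^ m) (mulp (b - int m) g))) y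
        + of_nat (Suc N) * mulp (- b) ((iop ^^ m) (mulp (b - int m) g)) y)"
    using Suc.prems
    by (simp only: yd_conv mulp_add mulp_cmult iop_pow_add iop_pow_cmult mulp_Cp yd_Cp Cp_cmult)
  then show ?case
    using Suc.IH[of "\<lambda>y. yd g y + of_nat (Suc N) * g y"] Suc.prems
    by (simp only: eprod.simps Cp_add Cp_cmult yd_Cp)
qed simp

section \<open>Lebesgue measure on complex space\<close>

lemma nn_integral_lborel_reflect:
  fixes f :: "'a::euclidean_space \<Rightarrow> ennreal"
  assumes [measurable]: "f \<in> borel_measurable borel"
  shows "(\<integral>\<^sup>+x. f (c - x) \<partial>lborel) = (\<integral>\<^sup>+x. f x \<partial>lborel)"
proof -
  have "lborel = distr lborel borel (\<lambda>x::'a. c - x)"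
    using lborel_affine[of "- 1" c] by (simp add: density_1)
  then have "(\<integral>\<^sup>+x. f x \<partial>lborel) = (\<integral>\<^sup>+x. f x \<partial>distr lborel borel (\<lambda>x::'a. c - x))" by simp
  also have "\<dots> = (\<integral>\<^sup>+x. f (c - x) \<partial>lborel)" by (subst nn_integral_distr) auto
  finally show ?thesis by simp
qed

text \<open>
  Integrating \<open>1\<^sub>A(T x) 1\<^sub>B(T x + y)\<close> in both orders gives \<open>\<mu> A \<cdot> \<lambda> B = \<mu> B \<cdot> \<lambda> A\<close> for the image measure \<open>\<mu>\<close>;
  with \<open>B\<close> the unit ball the constant is \<open>1\<close>.
\<close>

lemma lborel_distr_isometry:
  fixes T :: "'a::euclidean_space \<Rightarrow> 'a"
  assumes lin: "linear T" and norm: "\<And>x. norm (T x) = norm x"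
  shows "distr lborel borel T = lborel"
proof (rule measure_eqI)
  have inj: "inj T"
    using lin norm by (metis linear_injective_0 norm_eq_zero)
  then have surj: "surj T" using lin linear_injective_imp_surjective by blast
  have T [measurable]: "T \<in> borel_measurable borel"
    using lin by (intro borel_measurable_continuous_onI linear_continuous_on) (simp add: linear_conv_bounded_linear)
  fix A assume "A \<in> sets (distr lborel borel T)"
  then have A [measurable]: "A \<in> sets borel" by simp
  define B where "B = ball (0::'a) 1"
  have B [measurable]: "B \<in> sets borel" by (simp add: B_def)
  have I: "(\<integral>\<^sup>+x. indicator X (T x) \<partial>lborel) = emeasure (distr lborel borel T) X"
    if [measurable]: "X \<in> sets borel" for X
    using nn_integral_distr[of T lborel borel "indicator X"] by simp
  have m1: "(\<lambda>(x, y). indicator A (T x) * indicator B (T x + y) :: ennreal) \<in> borel_measurable (lborel \<Otimes>\<^sub>M lborel)"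
    by measurable
  have m2: "(\<lambda>(x, y). indicator A (T x - y) * indicator B (T x) :: ennreal) \<in> borel_measurable (lborel \<Otimes>\<^sub>M lborel)"
    by measurable
  have "emeasure (distr lborel borel T) A * emeasure lborel B =
      (\<integral>\<^sup>+x. indicator A (T x) * emeasure lborel B \<partial>lborel)"
    by (simp add: nn_integral_multc I)
  also have "\<dots> = (\<integral>\<^sup>+x. (\<integral>\<^sup>+y. indicator A (T x) * indicator B (T x + y) \<partial>lborel) \<partial>lborel)"
    by (simp add: nn_integral_cmult nn_integral_lborel_shift[of "indicator B"])
  also have "\<dots> = (\<integral>\<^sup>+y. (\<integral>\<^sup>+x. indicator A (T x) * indicator B (T x + y) \<partial>lborel) \<partial>lborel)"
    by (rule lborel_pair.Fubini'[OF m1, symmetric])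
  also have "\<dots> = (\<integral>\<^sup>+y. (\<integral>\<^sup>+x. indicator A (T x - y) * indicator B (T x) \<partial>lborel) \<partial>lborel)"
  proof (rule nn_integral_cong)
    fix y
    \<comment> \<open>Translating x by a preimage z of y shifts \<open>T x\<close> by y, which moves
      y from one indicator to the other.\<close>
    obtain z where z: "T z = y" using surj by (metis surjD)
    have [simp]: "T (z + x) = y + T x" for x using lin z by (simp add: linear_add)
    have "(\<integral>\<^sup>+x. indicator A (T x - y) * indicator B (T x) \<partial>lborel) =
        (\<integral>\<^sup>+x. indicator A (T (z + x) - y) * indicator B (T (z + x)) \<partial>lborel)"
      by (rule nn_integral_lborel_shift[symmetric]) measurable
    also have "\<dots> = (\<integral>\<^sup>+x. indicator A (T x) * indicator B (T x + y) \<partial>lborel)"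
      by (simp add: add.commute[of "T _" y])
    finally show "(\<integral>\<^sup>+x. indicator A (T x) * indicator B (T x + y) \<partial>lborel) =
        (\<integral>\<^sup>+x. indicator A (T x - y) * indicator B (T x) \<partial>lborel)" ..
  qed
  also have "\<dots> = (\<integral>\<^sup>+x. (\<integral>\<^sup>+y. indicator A (T x - y) * indicator B (T x) \<partial>lborel) \<partial>lborel)"
    by (rule lborel_pair.Fubini'[OF m2])
  also have "\<dots> = (\<integral>\<^sup>+x. emeasure lborel A * indicator B (T x) \<partial>lborel)"
    by (simp add: nn_integral_multc nn_integral_lborel_reflect[of "indicator A"])
  also have "\<dots> = emeasure lborel A * emeasure (distr lborel borel T) B"
    by (simp add: nn_integral_cmult I)
  also have "emeasure (distr lborel borel T) B = emeasure lborel B"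
  proof -
    have "T -` B = B" using norm by (auto simp: B_def)
    then show ?thesis by (subst emeasure_distr) auto
  qed
  finally have eq: "emeasure lborel B * emeasure (distr lborel borel T) A = emeasure lborel B * emeasure lborel A"
    by (simp add: mult.commute)
  have "emeasure lborel B \<noteq> 0" "emeasure lborel B \<noteq> \<infinity>"
    using unit_ball_vol_pos[of "real DIM('a)", THEN less_imp_neq] by (auto simp: emeasure_ball B_def)
  with eq show "emeasure (distr lborel borel T) A = emeasure lborel A"
    by (simp add: ennreal_mult_cancel_left)
qed simp

lemma integral_lborel_isometry:
  fixes T :: "'a::euclidean_space \<Rightarrow> 'a" and f :: "'a \<Rightarrow> 'b::{banach, second_countable_topology}"
  assumes lin: "linear T" and norm: "\<And>x. norm (T x) = norm x" and [measurable]: "f \<in> borel_measurable borel"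
  shows "(\<integral>x. f (T x) \<partial>lborel) = (\<integral>x. f x \<partial>lborel)"
proof -
  have [measurable]: "T \<in> borel_measurable borel"
    using lin by (intro borel_measurable_continuous_onI linear_continuous_on) (simp add: linear_conv_bounded_linear)
  show ?thesis
    by (subst (2) lborel_distr_isometry[OF lin norm, symmetric], subst integral_distr) auto
qed

lemma Basis_vec_image: "(Basis :: ('a::euclidean_space^'n) set) = (\<lambda>(i, u). axis i u) ` (UNIV \<times> Basis)"
  by (auto simp: Basis_vec_def)

text \<open>\<open>lborel\<close> on vectors refers to the real basis as a whole. Measuring boxes
  identifies it with the product of the coordinate measures, so that Fubini can be used one complex
  coordinate at a time.\<close>

lemma lborel_vec:
  "lborel = distr (Pi\<^sub>M (UNIV::'n::finite set) (\<lambda>_. lborel::'a::euclidean_space measure)) borel (\<lambda>f. \<chi> i. f i)"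
    (is "_ = distr ?P _ ?g")
proof (rule lborel_eqI)
  interpret P: product_sigma_finite "\<lambda>_::'n. lborel::'a measure" ..
  fix l u :: "'a^'n" assume le: "\<And>b. b \<in> Basis \<Longrightarrow> l \<bullet> b \<le> u \<bullet> b"
  have le': "\<forall>i. \<forall>b\<in>Basis. l $ i \<bullet> b \<le> u $ i \<bullet> b"
    using le by (force simp: Basis_vec_def inner_axis)
  have g [measurable]: "?g \<in> measurable ?P borel"
    by (rule borel_measurable_euclidean_space[THEN iffD2])
      (auto simp: Basis_vec_def inner_axis)
  have "emeasure (distr ?P borel ?g) (box l u) = emeasure ?P (?g -` box l u \<inter> space ?P)"
    by (subst emeasure_distr) auto
  also have "?g -` box l u \<inter> space ?P = Pi\<^sub>E UNIV (\<lambda>i. box (l $ i) (u $ i))"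
    by (auto simp: box_def Basis_vec_def inner_axis space_PiM)
  also have "emeasure ?P \<dots> = (\<Prod>i\<in>UNIV. emeasure lborel (box (l $ i) (u $ i)))"
    by (rule P.emeasure_PiM) auto
  also have "\<dots> = (\<Prod>i\<in>UNIV. ennreal (\<Prod>b\<in>Basis. (u $ i - l $ i) \<bullet> b))"
    using le' by (intro prod.cong refl) (simp add: inner_diff_left)
  also have "\<dots> = ennreal (\<Prod>i\<in>UNIV. \<Prod>b\<in>Basis. (u $ i - l $ i) \<bullet> b)"
    using le' by (intro prod_ennreal prod_nonneg) (auto simp: inner_diff_left)
  also have "(\<Prod>i\<in>UNIV. \<Prod>b\<in>Basis. (u $ i - l $ i) \<bullet> b) = (\<Prod>b\<in>Basis. (u - l) \<bullet> b)"
    unfolding Basis_vec_image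
    by (subst prod.reindex) (auto simp: inj_on_def axis_eq_axis inner_axis prod.cartesian_product split_def)
  finally show "emeasure (distr ?P borel ?g) (box l u) = (\<Prod>b\<in>Basis. (u - l) \<bullet> b)" .
qed simp

lemma measurable_vec_lambda [measurable]:
  "(\<lambda>f. \<chi> i. f i) \<in> measurable (Pi\<^sub>M (UNIV::'n::finite set) (\<lambda>_. lborel::'a::euclidean_space measure)) borel"
  by (rule borel_measurable_euclidean_space[THEN iffD2]) (auto simp: Basis_vec_def inner_axis)

text \<open>Polar coordinates in the plane: the disc of radius sqrt b has area \<pi> b, and the
  half-lines \<open>{..b}\<close> generate the Borel sets.\<close>

lemma distr_norm_square:
  "distr lborel borel (\<lambda>z::complex. (norm z)\<^sup>2) = density lborel (\<lambda>s. ennreal (pi * indicator {0..} s))"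
proof (rule measure_eqI_generator_eq[where E = "range (\<lambda>a. {..a})" and \<Omega> = UNIV and A = "\<lambda>i. {..real i}"])
  show "Int_stable (range (\<lambda>a::real. {..a}))"
    by (auto simp: Int_stable_def)
  have *: "emeasure (distr lborel borel (\<lambda>z::complex. (norm z)\<^sup>2)) {..b} = ennreal (pi * max b 0)" for b
  proof (cases "b \<ge> 0")
    case True
    have "(\<lambda>z::complex. (norm z)\<^sup>2) -` {..b} = cball 0 (sqrt b)"
      using True by (auto simp: real_le_rsqrt intro: sqrt_le_D dest: real_sqrt_le_mono)
        (metis norm_ge_zero power_mono real_sqrt_pow2)
    then show ?thesis using True by (simp add: emeasure_distr emeasure_cball unit_ball_vol_2 max_def)
  next
    case False
    then have "(\<lambda>z::complex. (norm z)\<^sup>2) -` {..b} = {}"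
      by auto (meson not_le order_trans zero_le_power2)
    then show ?thesis using False by (simp add: emeasure_distr max_def)
  qed
  have **: "emeasure (density lborel (\<lambda>s. ennreal (pi * indicator {0..} s))) {..b} = ennreal (pi * max b 0)" for b
  proof -
    have "emeasure (density lborel (\<lambda>s. ennreal (pi * indicator {0..} s))) {..b} =
       (\<integral>\<^sup>+s. ennreal pi * indicator {0..b} s \<partial>lborel)"
      by (subst emeasure_density) (auto intro!: nn_integral_cong simp: indicator_def)
    then show ?thesis
      by (cases "b \<ge> 0") (auto simp: nn_integral_cmult ennreal_mult' max_def)
  qed
  show "emeasure (distr lborel borel (\<lambda>z::complex. (norm z)\<^sup>2)) X = emeasure (density lborel (\<lambda>s. ennreal (pi * indicator {0..} s))) X"
    if "X \<in> range (\<lambda>a. {..a})" for X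
    using that * ** by auto
  show "(\<Union>i. {..real i}) = UNIV"
    using real_arch_simple by auto
  show "emeasure (distr lborel borel (\<lambda>z::complex. (norm z)\<^sup>2)) {..real i} \<noteq> \<infinity>" for i
    using * by simp
qed (auto simp: borel_eq_atMost)

lemma integral_radial:
  fixes G :: "real \<Rightarrow> complex"
  assumes [measurable]: "G \<in> borel_measurable borel"
  shows "(\<integral>z. G ((norm (z::complex))\<^sup>2) \<partial>lborel) = of_real pi * (LINT s:{0..}|lborel. G s)"
proof -
  have "(\<integral>z. G ((norm (z::complex))\<^sup>2) \<partial>lborel) = (\<integral>s. G s \<partial>distr lborel borel (\<lambda>z::complex. (norm z)\<^sup>2))"
    by (subst integral_distr) auto
  also have "\<dots> = (\<integral>s. (pi * indicator {0..} s) *\<^sub>R G s \<partial>lborel)"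
    unfolding distr_norm_square by (rule integral_density) auto
  also have "\<dots> = of_real pi * (LINT s:{0..}|lborel. G s)"
    unfolding set_lebesgue_integral_def
    by (simp add: scaleR_conv_of_real mult.assoc flip: scaleR_scaleR)
  finally show ?thesis .
qed

lemma Cp_measurable [measurable]: assumes "h \<in> Cp" shows "h \<in> borel_measurable borel"
proof -
  have "(\<lambda>y. if y \<in> {0<..} then h y else 0) \<in> borel_measurable borel"
    by (intro borel_measurable_continuous_on_if Cp_continuous assms continuous_on_const) auto
  also have "(\<lambda>y. if y \<in> {0<..} then h y else 0) = h"
    using Cp_nonpos[OF assms] by (auto simp: fun_eq_iff)
  finally show ?thesis .
qed

lemma Cp_bounded: assumes "h \<in> Cp" "0 < y" obtains B where "\<And>s. y \<le> s \<Longrightarrow> norm (h s) \<le> B"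
proof -
  obtain R where R: "R > 0" "\<And>y. y > R \<Longrightarrow> h y = 0" using Cp_bound[OF assms(1)] by metis
  have "compact (h ` {y..R})"
    using assms by (intro compact_continuous_image continuous_on_subset[OF Cp_continuous]) auto
  then have "bounded (h ` {y..R})" by (rule compact_imp_bounded)
  then obtain B where B: "\<forall>x\<in>h ` {y..R}. norm x \<le> B" unfolding bounded_iff ..
  have "norm (h s) \<le> max B 0" if "y \<le> s" for s
    using B R(2)[of s] that by (cases "s \<le> R") (auto simp: le_max_iff_disj)
  then show thesis by (rule that)
qed

lemma measurable_cnj [measurable]: "cnj \<in> borel_measurable borel"
  by (intro borel_measurable_continuous_onI continuous_intros)

text \<open>For a = b the integrand depends on the modulus of z alone and the integral is a moment
  of h; otherwise a rotation of the plane reverses its sign.\<close>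

lemma complex_moment:
  assumes h: "h \<in> Cp" and y: "0 < y"
  shows "(\<integral>z. h (y + (norm (z::complex))\<^sup>2) * (z ^ a * cnj z ^ b) \<partial>lborel) =
    (if a = b then of_real pi * fact a * (iop ^^ Suc a) h y else 0)"
proof (cases "a = b")
  case True
  note [measurable] = Cp_measurable[OF h]
  have "(\<integral>z. h (y + (norm (z::complex))\<^sup>2) * (z ^ a * cnj z ^ b) \<partial>lborel) =
    (\<integral>z. (\<lambda>s. of_real s ^ a * h (y + s)) ((norm (z::complex))\<^sup>2) \<partial>lborel)"
  proof (rule Bochner_Integration.integral_cong[OF refl])
    fix z :: complex
    have "z ^ a * cnj z ^ b = of_real ((norm z)\<^sup>2) ^ a"
      unfolding complex_norm_square True power_mult_distrib ..
    then show "h (y + (norm z)\<^sup>2) * (z ^ a * cnj z ^ b) = of_real ((norm z)\<^sup>2) ^ a * h (y + (norm z)\<^sup>2)"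
      by (simp only: mult.commute)
  qed
  also have "\<dots> = of_real pi * (LINT s:{0..}|lborel. of_real s ^ a * h (y + s))"
    by (rule integral_radial) measurable
  finally show ?thesis using moment_eq(2)[OF h y] True by simp
next
  case False
  note [measurable] = Cp_measurable[OF h]
  let ?f = "\<lambda>z::complex. h (y + (norm z)\<^sup>2) * (z ^ a * cnj z ^ b)"
  \<comment> \<open>Chosen so that rotation by c multiplies \<open>z ^ a * cnj z ^ b\<close> by cis
    \<pi> = -1.\<close>
  define c where "c = cis (pi / (real a - real b))"
  have c: "c ^ a * cnj c ^ b = - 1"
  proof -
    have "c ^ a * cnj c ^ b = cis (real a * (pi / (real a - real b)) - real b * (pi / (real a - real b)))"
      unfolding c_def cis_cnj Complex.DeMoivre cis_mult by simp
    also have "real a * (pi / (real a - real b)) - real b * (pi / (real a - real b)) = pi"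
      unfolding left_diff_distrib[symmetric] using False by simp
    finally show ?thesis by simp
  qed
  have nc: "norm c = 1" by (simp add: c_def)
  have "(\<integral>z. ?f z \<partial>lborel) = (\<integral>z. ?f (c * z) \<partial>lborel)"
    by (rule integral_lborel_isometry[symmetric])
      (auto simp: nc norm_mult intro!: bounded_linear.linear bounded_linear_mult_right)
  also have "\<dots> = (\<integral>z. - ?f z \<partial>lborel)"
  proof (rule Bochner_Integration.integral_cong[OF refl])
    fix z
    have "?f (c * z) = h (y + (norm z)\<^sup>2) * ((c ^ a * cnj c ^ b) * (z ^ a * cnj z ^ b))"
      by (simp add: nc norm_mult power_mult_distrib mult_ac)
    then show "?f (c * z) = - ?f z" using c by simp
  qed
  also have "\<dots> = - (\<integral>z. ?f z \<partial>lborel)" by simp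
  finally show ?thesis using False by simp
qed

text \<open>Fubini, one coordinate at a time: the squares of the remaining coordinates only shift
  the base point y, and integrating out coordinate i replaces h by
  \<open>(iop ^^ Suc (\<alpha> i)) h\<close>. The induction therefore runs over all
  profiles.\<close>

lemma product_moment:
  assumes "finite J" "h \<in> Cp" "0 < y"
  shows "(\<integral>x. h (y + (\<Sum>j\<in>J. (norm (x j :: complex))\<^sup>2)) * (\<Prod>j\<in>J. x j ^ \<alpha> j * cnj (x j) ^ \<beta> j) \<partial>Pi\<^sub>M J (\<lambda>_. lborel)) =
    (if \<forall>j\<in>J. \<alpha> j = \<beta> j
     then of_real pi ^ card J * (\<Prod>j\<in>J. fact (\<alpha> j)) * (iop ^^ (card J + sum \<alpha> J)) h y else 0)"
  using assms
proof (induction J arbitrary: h rule: finite_induct)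
  case empty
  interpret P: product_sigma_finite "\<lambda>_::'a. lborel::complex measure" ..
  show ?case by (simp add: PiM_empty lebesgue_integral_count_space_finite)
next
  case (insert i J)
  interpret P: product_sigma_finite "\<lambda>_::'a. lborel::complex measure" ..
  note [measurable] = Cp_measurable[OF \<open>h \<in> Cp\<close>]
  let ?J = "insert i J"
  let ?f = "\<lambda>x. h (y + (\<Sum>j\<in>?J. (norm (x j :: complex))\<^sup>2)) * (\<Prod>j\<in>?J. x j ^ \<alpha> j * cnj (x j) ^ \<beta> j)"
  have int: "integrable (Pi\<^sub>M ?J (\<lambda>_. lborel)) ?f"
  proof -
    obtain R where R: "R > 0" "\<And>y. y > R \<Longrightarrow> h y = 0" using Cp_bound[OF \<open>h \<in> Cp\<close>] by metis
    obtain B where B: "\<And>s. y \<le> s \<Longrightarrow> norm (h s) \<le> B"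
      using Cp_bounded[OF \<open>h \<in> Cp\<close> \<open>0 < y\<close>] by metis
    \<comment> \<open>Since h vanishes beyond R, the integrand lives on the polydisc of this radius;
      it is bounded there because the argument of h is at least y > 0.\<close>
    define r where "r = sqrt R"
    have r: "norm (x j) \<le> r" if "h (y + (\<Sum>j\<in>?J. (norm (x j :: complex))\<^sup>2)) \<noteq> 0" "j \<in> ?J" for x j
    proof -
      have "y + (\<Sum>j\<in>?J. (norm (x j))\<^sup>2) \<le> R" using that R(2) by (meson not_le)
      moreover have "(norm (x j))\<^sup>2 \<le> (\<Sum>j\<in>?J. (norm (x j))\<^sup>2)"
        by (rule member_le_sum) (use that insert in auto)
      ultimately have "(norm (x j))\<^sup>2 \<le> R" using \<open>0 < y\<close> by linarith
      then show ?thesis unfolding r_def by (rule real_le_rsqrt)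
    qed
    have r0: "0 \<le> r" using R by (simp add: r_def)
    have fin: "emeasure lborel (cball (0::complex) r) < top"
      using emeasure_bounded_finite[of "cball (0::complex) r"] by simp
    show ?thesis
    proof (rule integrableI_bounded_set[where A = "Pi\<^sub>E ?J (\<lambda>_. cball 0 r)" and B = "B * (\<Prod>j\<in>?J. r ^ \<alpha> j * r ^ \<beta> j)"])
      show "Pi\<^sub>E ?J (\<lambda>_. cball 0 r) \<in> sets (Pi\<^sub>M ?J (\<lambda>_. lborel))"
        by (rule sets_PiM_I_finite) (use insert in auto)
      show "?f \<in> borel_measurable (Pi\<^sub>M ?J (\<lambda>_. lborel))"
        using insert by measurable
      show "emeasure (Pi\<^sub>M ?J (\<lambda>_. lborel)) (Pi\<^sub>E ?J (\<lambda>_. cball (0::complex) r)) < \<infinity>"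
        using insert(1,2) fin by (subst P.emeasure_PiM)
          (auto simp: ennreal_mult_less_top power_less_top_ennreal)
      show "AE x in Pi\<^sub>M ?J (\<lambda>_. lborel). x \<in> Pi\<^sub>E ?J (\<lambda>_. cball 0 r) \<longrightarrow>
          norm (?f x) \<le> B * (\<Prod>j\<in>?J. r ^ \<alpha> j * r ^ \<beta> j)"
      proof (intro AE_I2 impI)
        fix x assume x: "x \<in> Pi\<^sub>E ?J (\<lambda>_. cball (0::complex) r)"
        have "norm (\<Prod>j\<in>?J. x j ^ \<alpha> j * cnj (x j) ^ \<beta> j) \<le> (\<Prod>j\<in>?J. r ^ \<alpha> j * r ^ \<beta> j)"
          unfolding prod_norm[symmetric] norm_mult norm_power complex_mod_cnj
          using x r0 by (intro prod_mono conjI mult_mono power_mono) (auto simp: PiE_iff)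
        moreover have "0 \<le> (\<Sum>j\<in>?J. (norm (x j))\<^sup>2)" by (intro sum_nonneg) auto
        ultimately show "norm (?f x) \<le> B * (\<Prod>j\<in>?J. r ^ \<alpha> j * r ^ \<beta> j)"
          unfolding norm_mult[of "h _"]
          by (intro mult_mono B) (use order_trans[OF norm_ge_zero B, of y] in auto)
      qed
      show "AE x in Pi\<^sub>M ?J (\<lambda>_. lborel). x \<notin> Pi\<^sub>E ?J (\<lambda>_. cball 0 r) \<longrightarrow> ?f x = 0"
        using r by (intro AE_I2) (auto simp: space_PiM PiE_iff)
    qed
  qed
  have pos: "0 < y + (\<Sum>j\<in>J. (norm (x j :: complex))\<^sup>2)" for x
    using \<open>0 < y\<close> by (intro add_pos_nonneg sum_nonneg) auto
  have "(\<integral>x. ?f x \<partial>Pi\<^sub>M ?J (\<lambda>_. lborel)) =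
     (\<integral>x. (\<integral>z. ?f (x(i := z)) \<partial>lborel) \<partial>Pi\<^sub>M J (\<lambda>_. lborel))"
    by (rule P.product_integral_insert[OF insert(1,2) int])
  also have "\<dots> = (\<integral>x. (\<integral>z. h ((y + (\<Sum>j\<in>J. (norm (x j))\<^sup>2)) + (norm z)\<^sup>2) * (z ^ \<alpha> i * cnj z ^ \<beta> i) \<partial>lborel)
       * (\<Prod>j\<in>J. x j ^ \<alpha> j * cnj (x j) ^ \<beta> j) \<partial>Pi\<^sub>M J (\<lambda>_. lborel))"
  proof (rule Bochner_Integration.integral_cong[OF refl])
    fix x
    have "?f (x(i := z)) = (h ((y + (\<Sum>j\<in>J. (norm (x j))\<^sup>2)) + (norm z)\<^sup>2) * (z ^ \<alpha> i * cnj z ^ \<beta> i))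
       * (\<Prod>j\<in>J. x j ^ \<alpha> j * cnj (x j) ^ \<beta> j)" for z
    proof -
      have "(\<Sum>j\<in>J. (norm ((x(i := z)) j))\<^sup>2) = (\<Sum>j\<in>J. (norm (x j))\<^sup>2)"
        using insert(2) by (intro sum.cong) auto
      moreover have "(\<Prod>j\<in>J. (x(i := z)) j ^ \<alpha> j * cnj ((x(i := z)) j) ^ \<beta> j) = (\<Prod>j\<in>J. x j ^ \<alpha> j * cnj (x j) ^ \<beta> j)"
        using insert(2) by (intro prod.cong) auto
      ultimately show ?thesis
        unfolding sum.insert[OF insert(1,2)] prod.insert[OF insert(1,2)] by (simp add: ac_simps)
    qed
    then show "(\<integral>z. ?f (x(i := z)) \<partial>lborel) =
       (\<integral>z. h ((y + (\<Sum>j\<in>J. (norm (x j))\<^sup>2)) + (norm z)\<^sup>2) * (z ^ \<alpha> i * cnj z ^ \<beta> i) \<partial>lborel)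
       * (\<Prod>j\<in>J. x j ^ \<alpha> j * cnj (x j) ^ \<beta> j)"
      by (simp only:) (rule integral_mult_left_zero)
  qed
  also have "\<dots> = (\<integral>x. (if \<alpha> i = \<beta> i then of_real pi * fact (\<alpha> i) else 0) *
       ((iop ^^ Suc (\<alpha> i)) h (y + (\<Sum>j\<in>J. (norm (x j))\<^sup>2)) * (\<Prod>j\<in>J. x j ^ \<alpha> j * cnj (x j) ^ \<beta> j)) \<partial>Pi\<^sub>M J (\<lambda>_. lborel))"
    by (intro Bochner_Integration.integral_cong refl)
      (subst complex_moment[OF insert.prems(1) pos], simp)
  also have "\<dots> = (if \<alpha> i = \<beta> i then of_real pi * fact (\<alpha> i) else 0) *
     (if \<forall>j\<in>J. \<alpha> j = \<beta> j
     then of_real pi ^ card J * (\<Prod>j\<in>J. fact (\<alpha> j)) * (iop ^^ (card J + sum \<alpha> J)) ((iop ^^ Suc (\<alpha> i)) h) y else 0)"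
    unfolding integral_mult_right_zero insert.IH[OF iop_pow_Cp[OF insert.prems(1)] insert.prems(2)] ..
  also have "(iop ^^ (card J + sum \<alpha> J)) ((iop ^^ Suc (\<alpha> i)) h) = (iop ^^ (card ?J + sum \<alpha> ?J)) h"
  proof -
    have "card ?J + sum \<alpha> ?J = (card J + sum \<alpha> J) + Suc (\<alpha> i)" using insert(1,2) by simp
    then show ?thesis by (simp only: funpow_add o_apply)
  qed
  finally show ?case using insert(1,2) by (auto simp: ac_simps)
qed

no_notation fps_nth (infixl \<open>$\<close> 75)

section \<open>Polynomials in \<open>z\<close> and its conjugate\<close>

lemma cfun_zero: "(\<lambda>x. 0) \<in> cfun.span B"
  using cfun.span_zero[of B] by (simp add: zero_fun_def)

lemma cfun_add: "f \<in> cfun.span B \<Longrightarrow> g \<in> cfun.span B \<Longrightarrow> (\<lambda>x. f x + g x) \<in> cfun.span B"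
  using cfun.span_add[of f B g] by (simp add: plus_fun_def)

lemma cfun_scale: "f \<in> cfun.span B \<Longrightarrow> (\<lambda>x. c * f x) \<in> cfun.span B"
  by (rule cfun.span_scale)

lemma cfun_sum: "(\<And>i. i \<in> I \<Longrightarrow> f i \<in> cfun.span B) \<Longrightarrow> (\<lambda>x. \<Sum>i\<in>I. f i x) \<in> cfun.span B"
  by (induction I rule: infinite_finite_induct) (auto intro: cfun_zero cfun_add)

lemma cfun_span_induct [consumes 1, case_names base zero add scale]:
  assumes "f \<in> cfun.span B" "\<And>b. b \<in> B \<Longrightarrow> P b" "P (\<lambda>_. 0)"
    "\<And>f g. f \<in> cfun.span B \<Longrightarrow> g \<in> cfun.span B \<Longrightarrow> P f \<Longrightarrow> P g \<Longrightarrow> P (\<lambda>x. f x + g x)"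
    "\<And>c f. f \<in> cfun.span B \<Longrightarrow> P f \<Longrightarrow> P (\<lambda>x. c * f x)"
  shows "P f"
proof -
  have "f \<in> cfun.span B \<and> P f"
    using assms(1)
  proof (induction rule: cfun.span_induct_alt)
    case base
    then show ?case using assms(3) cfun_zero by (simp add: zero_fun_def)
  next
    case (step c x y)
    have "x \<in> cfun.span B" using step by (simp add: cfun.span_base)
    moreover have y: "y \<in> cfun.span B" "P y" using step by auto
    moreover have "P (\<lambda>z. c * x z)" by (rule assms(5)[OF \<open>x \<in> cfun.span B\<close> assms(2)[OF step(1)]])
    ultimately have "(\<lambda>z. c * x z + y z) \<in> cfun.span B \<and> P (\<lambda>z. c * x z + y z)"
      using assms(4)[OF cfun_scale y(1)] cfun_add[OF cfun_scale y(1)] by simp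
    then show ?case by (simp add: plus_fun_def)
  qed
  then show ?thesis ..
qed

definition cmono :: "('n::finite \<Rightarrow> nat) \<Rightarrow> ('n \<Rightarrow> nat) \<Rightarrow> complex^'n \<Rightarrow> complex" where
  "cmono \<alpha> \<beta> x = (\<Prod>i\<in>UNIV. x $ i ^ \<alpha> i * cnj (x $ i) ^ \<beta> i)"

definition polys :: "(complex^'n \<Rightarrow> complex) set" where
  "polys = cfun.span (range (\<lambda>(\<alpha>, \<beta>). cmono \<alpha> \<beta>))"

lemma cmono_polys: "cmono \<alpha> \<beta> \<in> polys"
  unfolding polys_def by (intro cfun.span_base) auto

lemmas polys_zero = cfun_zero[of "range (\<lambda>(\<alpha>, \<beta>). cmono \<alpha> \<beta>)", folded polys_def]
  and polys_add = cfun_add[of _ "range (\<lambda>(\<alpha>, \<beta>). cmono \<alpha> \<beta>)", folded polys_def]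
  and polys_scale = cfun_scale[of _ "range (\<lambda>(\<alpha>, \<beta>). cmono \<alpha> \<beta>)", folded polys_def]
  and polys_sum = cfun_sum[of _ _ "range (\<lambda>(\<alpha>, \<beta>). cmono \<alpha> \<beta>)", folded polys_def]

lemma polys_induct [consumes 1, case_names mono zero add scale]:
  assumes "f \<in> polys" "\<And>\<alpha> \<beta>. P (cmono \<alpha> \<beta>)" "P (\<lambda>_. 0)"
    "\<And>f g. f \<in> polys \<Longrightarrow> g \<in> polys \<Longrightarrow> P f \<Longrightarrow> P g \<Longrightarrow> P (\<lambda>x. f x + g x)"
    "\<And>c f. f \<in> polys \<Longrightarrow> P f \<Longrightarrow> P (\<lambda>x. c * f x)"
  shows "P f"
  using assms(1) unfolding polys_def
  by (induction rule: cfun_span_induct) (auto intro: assms(2-5)[unfolded polys_def])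

lemma cmono_mult: "cmono \<alpha> \<beta> x * cmono \<gamma> \<delta> x = cmono (\<lambda>i. \<alpha> i + \<gamma> i) (\<lambda>i. \<beta> i + \<delta> i) x"
  unfolding cmono_def prod.distrib[symmetric] by (simp add: power_add ac_simps)

lemma polys_mult: "f \<in> polys \<Longrightarrow> g \<in> polys \<Longrightarrow> (\<lambda>x. f x * g x) \<in> polys"
proof (induction rule: polys_induct)
  case (mono \<alpha> \<beta>)
  from mono show ?case
  proof (induction rule: polys_induct)
    case (add f g)
    then show ?case using polys_add by (simp add: distrib_left)
  next
    case (scale c f)
    then show ?case using polys_scale[OF scale(2), of c] by (simp add: mult_ac)
  qed (auto simp: cmono_mult cmono_polys polys_zero)
next
  case (add f g)
  then show ?case using polys_add by (simp add: distrib_right)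
next
  case (scale c f)
  then show ?case using polys_scale[OF scale(2), of c] by (simp add: mult_ac)
qed (auto simp: polys_zero)

lemma polys_const: "(\<lambda>x. c) \<in> polys"
  using polys_scale[OF cmono_polys[of "\<lambda>_. 0" "\<lambda>_. 0"], of c] by (simp add: cmono_def)

lemma polys_nth: "(\<lambda>x. x $ k) \<in> polys" "(\<lambda>x. cnj (x $ k)) \<in> polys"
proof -
  have "cmono (\<lambda>i. if i = k then 1 else 0) (\<lambda>_. 0) x = (\<Prod>i\<in>UNIV. if i = k then x $ k else 1)"
    "cmono (\<lambda>_. 0) (\<lambda>i. if i = k then 1 else 0) x = (\<Prod>i\<in>UNIV. if i = k then cnj (x $ k) else 1)" for x
    unfolding cmono_def by (intro prod.cong refl; simp)+
  then have "cmono (\<lambda>i. if i = k then 1 else 0) (\<lambda>_. 0) = (\<lambda>x. x $ k)"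
    "cmono (\<lambda>_. 0) (\<lambda>i. if i = k then 1 else 0) = (\<lambda>x. cnj (x $ k))"
    by (simp_all add: fun_eq_iff)
  then show "(\<lambda>x. x $ k) \<in> polys" "(\<lambda>x. cnj (x $ k)) \<in> polys"
    using cmono_polys[of "\<lambda>i. if i = k then 1 else 0" "\<lambda>_. 0"]
      cmono_polys[of "\<lambda>_. 0" "\<lambda>i. if i = k then 1 else 0"] by simp_all
qed

lemma bounded_linear_polys:
  fixes f :: "complex^'n \<Rightarrow> real" assumes "bounded_linear f"
  shows "(\<lambda>x. of_real (f x)) \<in> polys"
proof -
  interpret bounded_linear f by fact
  have fe: "f x = (\<Sum>i\<in>UNIV. Re (x $ i) * f (axis i 1) + Im (x $ i) * f (axis i \<i>))" for x
  proof -
    have "x = (\<Sum>i\<in>UNIV. Re (x $ i) *\<^sub>R axis i 1 + Im (x $ i) *\<^sub>R axis i \<i>)"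
      by (simp add: vec_eq_iff axis_def complex_eq_iff if_distrib sum.distrib Re_sum Im_sum cong: if_cong)
    then have "f x = f (\<Sum>i\<in>UNIV. Re (x $ i) *\<^sub>R axis i 1 + Im (x $ i) *\<^sub>R axis i \<i>)"
      by (rule arg_cong)
    then show ?thesis by (simp add: sum add scaleR)
  qed
  \<comment> \<open>Re z = (z + cnj z) / 2 and Im z = - (\<i> / 2) (z - cnj z).\<close>
  have t: "of_real (Re z * a + Im z * b) = of_real (a / 2) * (z + cnj z) + (- (\<i> / 2) * of_real b) * (z + (- 1) * cnj z)" for z a b
    by (simp add: complex_eq_iff)
  have "(\<lambda>x. complex_of_real (f x)) = (\<lambda>x. \<Sum>i\<in>UNIV.
      of_real (f (axis i 1) / 2) * (x $ i + cnj (x $ i)) + (- (\<i> / 2) * of_real (f (axis i \<i>))) * (x $ i + (- 1) * cnj (x $ i)))"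
    unfolding t[symmetric] of_real_sum[symmetric] by (rule ext, rule arg_cong[where f = of_real], rule fe)
  also have "\<dots> \<in> polys"
    by (intro polys_sum polys_add polys_scale polys_nth)
  finally show ?thesis .
qed

lemma real_polynomial_function_polys:
  fixes f :: "complex^'n \<Rightarrow> real" assumes "real_polynomial_function f"
  shows "(\<lambda>x. of_real (f x)) \<in> polys"
  using assms
  by (induction rule: real_polynomial_function.induct)
    (auto intro: bounded_linear_polys polys_const polys_add polys_mult)

lemma polynomial_function_polys:
  fixes Y :: "complex^'n \<Rightarrow> complex" assumes "polynomial_function Y"
  shows "Y \<in> polys"
proof -
  have "real_polynomial_function (Re \<circ> Y)" "real_polynomial_function (Im \<circ> Y)"
    using assms bounded_linear_Re bounded_linear_Im unfolding polynomial_function_def by simp_all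
  then have "real_polynomial_function (\<lambda>x. Re (Y x))" "real_polynomial_function (\<lambda>x. Im (Y x))"
    unfolding o_def .
  then have "(\<lambda>x. of_real (Re (Y x)) + \<i> * of_real (Im (Y x))) \<in> polys"
    by (intro polys_add polys_scale real_polynomial_function_polys)
  then show ?thesis by (simp flip: complex_eq)
qed

section \<open>Wirtinger calculus on monomials\<close>

lemma cmono_has_derivative:
  fixes \<alpha> \<beta> :: "'n::finite \<Rightarrow> nat"
  shows "(cmono \<alpha> \<beta> has_derivative (\<lambda>v. \<Sum>k\<in>UNIV. v $ k * (of_nat (\<alpha> k) * cmono (\<alpha>(k := \<alpha> k - 1)) \<beta> x)
      + cnj (v $ k) * (of_nat (\<beta> k) * cmono \<alpha> (\<beta>(k := \<beta> k - 1)) x))) (at x)"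
proof -
  have d: "((\<lambda>x::complex^'n. x $ i ^ a * cnj (x $ i) ^ b) has_derivative
      (\<lambda>v. v $ i * (of_nat a * (x $ i ^ (a - 1) * cnj (x $ i) ^ b)) + cnj (v $ i) * (of_nat b * (x $ i ^ a * cnj (x $ i) ^ (b - 1))))) (at x)"
    for i a b
    by (auto intro!: derivative_eq_intros bounded_linear.has_derivative[OF bounded_linear_vec_nth]
        bounded_linear.has_derivative[OF bounded_linear_cnj] simp: algebra_simps)
  have 1: "cmono (\<alpha>(k := a)) \<beta> x = (x $ k ^ a * cnj (x $ k) ^ \<beta> k) * (\<Prod>i\<in>UNIV - {k}. x $ i ^ \<alpha> i * cnj (x $ i) ^ \<beta> i)" for k a
    unfolding cmono_def by (subst prod.remove[of _ k]) auto
  have 2: "cmono \<alpha> (\<beta>(k := b)) x = (x $ k ^ \<alpha> k * cnj (x $ k) ^ b) * (\<Prod>i\<in>UNIV - {k}. x $ i ^ \<alpha> i * cnj (x $ i) ^ \<beta> i)" for k b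
    unfolding cmono_def by (subst prod.remove[of _ k]) auto
  have "((\<lambda>x. \<Prod>i\<in>UNIV. x $ i ^ \<alpha> i * cnj (x $ i) ^ \<beta> i) has_derivative
    (\<lambda>v. \<Sum>k\<in>UNIV. v $ k * (of_nat (\<alpha> k) * cmono (\<alpha>(k := \<alpha> k - 1)) \<beta> x)
      + cnj (v $ k) * (of_nat (\<beta> k) * cmono \<alpha> (\<beta>(k := \<beta> k - 1)) x))) (at x)"
    by (rule has_derivative_eq_rhs[OF has_derivative_prod[OF d]]) (simp add: 1 2 algebra_simps)
  then show ?thesis by (simp add: cmono_def[abs_def])
qed

lemma cmono_frechet:
  fixes \<alpha> \<beta> :: "'n::finite \<Rightarrow> nat"
  shows "frechet_derivative (cmono \<alpha> \<beta>) (at x) (axis k c) =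
    c * (of_nat (\<alpha> k) * cmono (\<alpha>(k := \<alpha> k - 1)) \<beta> x) + cnj c * (of_nat (\<beta> k) * cmono \<alpha> (\<beta>(k := \<beta> k - 1)) x)"
proof -
  have "(\<Sum>j\<in>UNIV. axis k c $ j * A j + cnj (axis k c $ j) * B j) = c * A k + cnj c * B k" for A B :: "'n \<Rightarrow> complex"
    by (simp add: axis_def if_distrib if_distribR sum.distrib cong: if_cong)
  then show ?thesis
    by (simp add: frechet_derivative_at[OF cmono_has_derivative, symmetric])
qed

lemma polys_smooth: "f \<in> polys \<Longrightarrow> open S \<Longrightarrow> smooth_on S f"
proof (induction rule: polys_induct)
  case (mono \<alpha> \<beta>)
  have "bounded_linear (\<lambda>x::complex^'n. cnj (x $ i))" for i
    by (rule bounded_linear_compose[OF bounded_linear_cnj bounded_linear_vec_nth])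
  with mono show ?case
    unfolding cmono_def[abs_def]
    by (intro smooth_on_prod smooth_on_mult smooth_on_power smooth_on_linear bounded_linear_vec_nth)
qed (auto intro: smooth_on_const smooth_on_add smooth_on_mult)

lemma polys_differentiable: "f \<in> polys \<Longrightarrow> f differentiable (at x)"
  using smooth_on_differentiable[OF polys_smooth[OF _ open_UNIV]] by simp

lemma polys_has_derivative: "f \<in> polys \<Longrightarrow> (f has_derivative frechet_derivative f (at x)) (at x)"
  by (simp add: polys_differentiable frechet_derivative_works[symmetric])

lemma polys_continuous: "f \<in> polys \<Longrightarrow> continuous_on S f"
  using smooth_on_continuous[OF polys_smooth[OF _ open_UNIV]] continuous_on_subset by blast

lemma frechet_add:
  "f \<in> polys \<Longrightarrow> g \<in> polys \<Longrightarrow> frechet_derivative (\<lambda>x. f x + g x) (at x) v =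
    frechet_derivative f (at x) v + frechet_derivative g (at x) v"
  by (subst frechet_derivative_at[OF has_derivative_add[OF polys_has_derivative polys_has_derivative], symmetric]) auto

lemma frechet_scale:
  "f \<in> polys \<Longrightarrow> frechet_derivative (\<lambda>x. c * f x) (at x) v = c * frechet_derivative f (at x) v"
  by (subst frechet_derivative_at[OF has_derivative_mult_right[OF polys_has_derivative], symmetric]) auto

lemma frechet_const: "frechet_derivative (\<lambda>x. c) (at x) v = 0"
  by (simp add: frechet_derivative_at[OF has_derivative_const, symmetric])

lemma polys_frechet: "f \<in> polys \<Longrightarrow> (\<lambda>x. frechet_derivative f (at x) (axis k c)) \<in> polys"
  by (induction rule: polys_induct)
    (auto simp: cmono_frechet frechet_add frechet_scale frechet_const
      intro!: polys_add polys_scale cmono_polys polys_zero)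

text \<open>The product of the two Wirtinger derivatives in the k-th coordinate, a quarter of the
  Laplacian of that complex line.\<close>

definition wlap :: "'n \<Rightarrow> (complex^'n \<Rightarrow> complex) \<Rightarrow> complex^'n \<Rightarrow> complex" where
  "wlap k f x =
     (frechet_derivative (\<lambda>y. frechet_derivative f (at y) (axis k 1)) (at x) (axis k 1) +
      frechet_derivative (\<lambda>y. frechet_derivative f (at y) (axis k \<i>)) (at x) (axis k \<i>)) / 4"

lemma laplacian_wlap: "laplacian f x = 4 * (\<Sum>k\<in>UNIV. wlap k f x)"
proof -
  have "laplacian f x = (\<Sum>(k, u)\<in>UNIV \<times> Basis.
      frechet_derivative (\<lambda>y. frechet_derivative f (at y) (axis k u)) (at x) (axis k u))"
    unfolding laplacian_def Basis_vec_image
    by (subst sum.reindex) (auto simp: inj_on_def axis_eq_axis split_def)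
  also have "\<dots> = 4 * (\<Sum>k\<in>UNIV. wlap k f x)"
    by (simp add: sum.cartesian_product[symmetric] Basis_complex_def wlap_def flip: sum_divide_distrib)
  finally show ?thesis .
qed

text \<open>Operators with this property are determined by their values on monomials; the predicate
  carries that argument through sums, powers and compositions.\<close>

definition lin_polys :: "((complex^'n \<Rightarrow> complex) \<Rightarrow> complex^'n \<Rightarrow> complex) \<Rightarrow> bool" where
  "lin_polys T \<longleftrightarrow> (\<forall>f\<in>polys. T f \<in> polys) \<and>
     (\<forall>f\<in>polys. \<forall>g\<in>polys. T (\<lambda>x. f x + g x) = (\<lambda>x. T f x + T g x)) \<and>
     (\<forall>f\<in>polys. \<forall>c. T (\<lambda>x. c * f x) = (\<lambda>x. c * T f x))"

lemma lin_polysD: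
  assumes "lin_polys T"
  shows "f \<in> polys \<Longrightarrow> T f \<in> polys"
    "f \<in> polys \<Longrightarrow> g \<in> polys \<Longrightarrow> T (\<lambda>x. f x + g x) = (\<lambda>x. T f x + T g x)"
    "f \<in> polys \<Longrightarrow> T (\<lambda>x. c * f x) = (\<lambda>x. c * T f x)"
  using assms unfolding lin_polys_def by blast+

lemma lin_polys_zero: "lin_polys T \<Longrightarrow> T (\<lambda>_. 0) = (\<lambda>_. 0)"
  using lin_polysD(3)[of T "\<lambda>_. 0" 0] polys_zero by simp

lemma lin_polys_sum:
  assumes "lin_polys T" "\<And>i. i \<in> I \<Longrightarrow> f i \<in> polys"
  shows "T (\<lambda>x. \<Sum>i\<in>I. f i x) = (\<lambda>x. \<Sum>i\<in>I. T (f i) x)"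
  using assms(2)
proof (induction I rule: infinite_finite_induct)
  case (insert i I)
  then show ?case by (simp add: lin_polysD(2)[OF assms(1)] polys_sum)
qed (simp_all add: lin_polys_zero[OF assms(1)])

lemma lin_polys_funpow: "lin_polys T \<Longrightarrow> lin_polys (T ^^ k)"
proof (induction k)
  case (Suc k)
  note IH = lin_polysD[OF Suc.IH[OF Suc.prems]]
  show ?case
    unfolding lin_polys_def by (auto simp: IH lin_polysD[OF Suc.prems])
qed (simp add: lin_polys_def)

lemma lin_polys_eq:
  assumes "lin_polys T" "lin_polys S" "\<And>\<alpha> \<beta>. T (cmono \<alpha> \<beta>) = S (cmono \<alpha> \<beta>)" "f \<in> polys"
  shows "T f = S f"
  using assms(4)
  by (induction rule: polys_induct) (simp_all add: assms(3) lin_polys_zero assms(1,2) lin_polysD(2,3)[OF assms(1)] lin_polysD(2,3)[OF assms(2)])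

lemma lin_polys_comp: "lin_polys T \<Longrightarrow> lin_polys S \<Longrightarrow> lin_polys (\<lambda>f. T (S f))"
  unfolding lin_polys_def by auto

lemma lin_polys_wlap:
  fixes k :: "'n::finite"
  shows "lin_polys (wlap k)"
  unfolding lin_polys_def
proof (intro conjI ballI allI)
  fix f :: "complex^'n \<Rightarrow> complex" assume f: "f \<in> polys"
  have "(\<lambda>x. (1 / 4) * (frechet_derivative (\<lambda>y. frechet_derivative f (at y) (axis k 1)) (at x) (axis k 1) +
      frechet_derivative (\<lambda>y. frechet_derivative f (at y) (axis k \<i>)) (at x) (axis k \<i>))) \<in> polys"
    using f by (intro polys_scale polys_add polys_frechet)
  then show "wlap k f \<in> polys"
    by (simp add: wlap_def[abs_def])
  show "wlap k (\<lambda>x. c * f x) = (\<lambda>x. c * wlap k f x)" for c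
    using f by (simp add: wlap_def[abs_def] frechet_scale polys_frechet algebra_simps)
  show "wlap k (\<lambda>x. f x + g x) = (\<lambda>x. wlap k f x + wlap k g x)" if "g \<in> polys" for g
    using f that by (simp add: wlap_def[abs_def] frechet_add polys_frechet add_divide_distrib fun_eq_iff)
qed

lemma wlap_cmono:
  "wlap k (cmono \<alpha> \<beta>) = (\<lambda>x. of_nat (\<alpha> k * \<beta> k) * cmono (\<alpha>(k := \<alpha> k - 1)) (\<beta>(k := \<beta> k - 1)) x)"
proof
  fix x
  have fr: "frechet_derivative (\<lambda>y. c * (a * cmono \<gamma> \<delta> y) + d * (b * cmono \<gamma>' \<delta>' y)) (at x) v =
      c * (a * frechet_derivative (cmono \<gamma> \<delta>) (at x) v) + d * (b * frechet_derivative (cmono \<gamma>' \<delta>') (at x) v)"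
    for a b c d v and \<gamma> \<delta> \<gamma>' \<delta>' :: "'a \<Rightarrow> nat"
    by (simp only: frechet_add frechet_scale polys_scale cmono_polys)
  \<comment> \<open>The pure second derivatives cancel between the directions 1 and \<i>; only the
    mixed ones remain.\<close>
  have ring: "(1 * (a * (1 * X + cnj 1 * Y)) + cnj 1 * (b * (1 * Y' + cnj 1 * Z))
      + (\<i> * (a * (\<i> * X + cnj \<i> * Y)) + cnj \<i> * (b * (\<i> * Y' + cnj \<i> * Z)))) / 4 = (a * Y + b * Y') / 2"
    for a b X Y Y' Z :: complex
    by (simp add: algebra_simps)
  show "wlap k (cmono \<alpha> \<beta>) x = of_nat (\<alpha> k * \<beta> k) * cmono (\<alpha>(k := \<alpha> k - 1)) (\<beta>(k := \<beta> k - 1)) x"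
    unfolding wlap_def cmono_frechet fr ring by simp
qed

text \<open>A quarter of the Laplacian along the hyperplanes on which the k-th coordinate is
  constant.\<close>

definition tlap :: "'n \<Rightarrow> (complex^'n \<Rightarrow> complex) \<Rightarrow> complex^'n \<Rightarrow> complex" where
  "tlap k f x = (\<Sum>i\<in>UNIV - {k}. wlap i f x)"

lemma lin_polys_tlap: "lin_polys (tlap k)"
  unfolding lin_polys_def tlap_def[abs_def]
  by (auto intro!: polys_sum lin_polysD(1)[OF lin_polys_wlap]
      simp: sum.distrib sum_distrib_left lin_polysD(2,3)[OF lin_polys_wlap])

lemma wlap_commute: "f \<in> polys \<Longrightarrow> wlap i (wlap k f) = wlap k (wlap i f)"
proof (rule lin_polys_eq[OF lin_polys_comp[OF lin_polys_wlap lin_polys_wlap] lin_polys_comp[OF lin_polys_wlap lin_polys_wlap]])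
  show "wlap i (wlap k (cmono \<alpha> \<beta>)) = wlap k (wlap i (cmono \<alpha> \<beta>))" for \<alpha> \<beta>
    by (cases "i = k")
      (simp_all add: wlap_cmono lin_polysD(3)[OF lin_polys_wlap] cmono_polys fun_upd_twist)
qed

lemma tlap_wlap_commute: "f \<in> polys \<Longrightarrow> tlap k (wlap k f) = wlap k (tlap k f)"
  unfolding tlap_def[abs_def]
  by (simp add: lin_polys_sum[OF lin_polys_wlap] lin_polysD(1)[OF lin_polys_wlap] wlap_commute[of f _ k])

text \<open>Harmonicity says that \<open>tlap k Y\<close> is the negative of
  \<open>wlap k Y\<close>; the two operators commute, so the relation passes to powers.\<close>

lemma tlap_pow_harmonic:
  assumes "Y \<in> polys" "\<And>x. laplacian Y x = 0"
  shows "(tlap k ^^ j) Y = (\<lambda>x. (- 1) ^ j * (wlap k ^^ j) Y x)"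
proof (induction j)
  case (Suc j)
  have pw: "(wlap k ^^ j) Y \<in> polys" for j
    using lin_polysD(1)[OF lin_polys_funpow[OF lin_polys_wlap]] assms(1) .
  have t: "tlap k Y = (\<lambda>x. - 1 * wlap k Y x)"
  proof
    fix x
    have "0 = (\<Sum>i\<in>UNIV. wlap i Y x)" using assms(2) by (simp add: laplacian_wlap)
    also have "\<dots> = wlap k Y x + tlap k Y x" by (simp add: tlap_def sum.remove[of UNIV k])
    finally show "tlap k Y x = - 1 * wlap k Y x" by (simp add: eq_neg_iff_add_eq_0 add.commute)
  qed
  have "tlap k ((wlap k ^^ j) Y) = (wlap k ^^ j) (tlap k Y)" for j
    by (induction j) (simp_all add: tlap_wlap_commute pw)
  then have "(tlap k ^^ Suc j) Y = (\<lambda>x. (- 1) ^ j * (wlap k ^^ j) (tlap k Y) x)"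
    using Suc by (simp add: lin_polysD(3)[OF lin_polys_tlap] pw)
  also have "\<dots> = (\<lambda>x. (- 1) ^ Suc j * (wlap k ^^ Suc j) Y x)"
    unfolding t
    by (subst lin_polysD(3)[OF lin_polys_funpow[OF lin_polys_wlap]])
      (simp_all add: lin_polysD(1)[OF lin_polys_wlap] assms(1) funpow_swap1 fun_eq_iff)
  finally show ?case .
qed simp

text \<open>The condition on the exponents and the product of factorials are those of
  \<open>product_moment\<close>. This allows the integral of a monomial over a hyperplane to be
  written through powers of \<open>tlap\<close>.\<close>

lemma tlap_pow_cmono:
  "(tlap k ^^ j) (cmono \<alpha> \<beta>) (axis k a) =
    (if (\<forall>i\<in>UNIV - {k}. \<alpha> i = \<beta> i) \<and> sum \<alpha> (UNIV - {k}) = j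
     then fact j * (\<Prod>i\<in>UNIV - {k}. fact (\<alpha> i)) * (a ^ \<alpha> k * cnj a ^ \<beta> k) else 0)"
proof (induction j arbitrary: \<alpha> \<beta>)
  case 0
  have m: "cmono \<alpha> \<beta> (axis k a) = (a ^ \<alpha> k * cnj a ^ \<beta> k) * (\<Prod>i\<in>UNIV - {k}. 0 ^ \<alpha> i * 0 ^ \<beta> i)"
    unfolding cmono_def by (subst prod.remove[of _ k]) (auto simp: axis_def intro!: prod.cong)
  show ?case
  proof (cases "\<forall>i\<in>UNIV - {k}. \<alpha> i = 0 \<and> \<beta> i = 0")
    case True
    then show ?thesis using m by simp
  next
    case False
    then obtain i where i: "i \<noteq> k" "\<alpha> i \<noteq> 0 \<or> \<beta> i \<noteq> 0" by auto
    then have "(\<Prod>i\<in>UNIV - {k}. (0::complex) ^ \<alpha> i * 0 ^ \<beta> i) = 0"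
      by (intro prod_zero) (auto intro!: bexI[of _ i])
    then show ?thesis using m i by auto
  qed
next
  case (Suc j)
  let ?W = "UNIV - {k}"
  let ?E = "\<lambda>\<alpha> \<beta> j. if (\<forall>i\<in>?W. \<alpha> i = \<beta> i) \<and> sum \<alpha> ?W = j
     then fact j * (\<Prod>i\<in>?W. fact (\<alpha> i)) * (a ^ \<alpha> k * cnj a ^ \<beta> k) else 0"
  let ?a = "\<lambda>i. \<alpha>(i := \<alpha> i - 1)" and ?b = "\<lambda>i. \<beta>(i := \<beta> i - 1)"
  have "(tlap k ^^ Suc j) (cmono \<alpha> \<beta>) = (tlap k ^^ j) (\<lambda>x. \<Sum>i\<in>?W. of_nat (\<alpha> i * \<beta> i) * cmono (?a i) (?b i) x)"
    unfolding funpow_Suc_right o_apply tlap_def[of k "cmono \<alpha> \<beta>", abs_def] wlap_cmono ..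
  also have "\<dots> = (\<lambda>x. \<Sum>i\<in>?W. of_nat (\<alpha> i * \<beta> i) * (tlap k ^^ j) (cmono (?a i) (?b i)) x)"
    by (subst lin_polys_sum[OF lin_polys_funpow[OF lin_polys_tlap]])
      (auto intro: polys_scale cmono_polys simp: lin_polysD(3)[OF lin_polys_funpow[OF lin_polys_tlap]] cmono_polys)
  finally have "(tlap k ^^ Suc j) (cmono \<alpha> \<beta>) (axis k a) = (\<Sum>i\<in>?W. of_nat (\<alpha> i * \<beta> i) * ?E (?a i) (?b i) j)"
    by (simp only: Suc.IH)
  \<comment> \<open>When the transverse exponents agree, one factor of
    \<open>\<alpha> i * \<beta> i\<close> completes the factorial of \<open>\<alpha> i - 1\<close>
    and the other is left over. The left-over factors add up to \<open>Suc j\<close> and complete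
    the outer factorial.\<close>
  also have "\<dots> = (\<Sum>i\<in>?W. of_nat (\<alpha> i) * (if (\<forall>i\<in>?W. \<alpha> i = \<beta> i) \<and> sum \<alpha> ?W = Suc j
     then fact j * (\<Prod>i\<in>?W. fact (\<alpha> i)) * (a ^ \<alpha> k * cnj a ^ \<beta> k) else 0))"
  proof (rule sum.cong[OF refl])
    fix i assume i: "i \<in> ?W"
    show "of_nat (\<alpha> i * \<beta> i) * ?E (?a i) (?b i) j = of_nat (\<alpha> i) * (if (\<forall>i\<in>?W. \<alpha> i = \<beta> i) \<and> sum \<alpha> ?W = Suc j
     then fact j * (\<Prod>i\<in>?W. fact (\<alpha> i)) * (a ^ \<alpha> k * cnj a ^ \<beta> k) else 0)"
    proof (cases "\<alpha> i = 0 \<or> \<beta> i = 0")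
      case True
      then show ?thesis using i by auto
    next
      case False
      have c1: "(\<forall>l\<in>?W. ?a i l = ?b i l) \<longleftrightarrow> (\<forall>l\<in>?W. \<alpha> l = \<beta> l)"
      proof -
        have "\<alpha> i - 1 = \<beta> i - 1 \<longleftrightarrow> \<alpha> i = \<beta> i" using False by auto
        then show ?thesis using i by (intro ball_cong refl) (simp add: fun_upd_def)
      qed
      have s: "sum \<alpha> ?W = \<alpha> i + sum \<alpha> (?W - {i})" "sum (?a i) ?W = (\<alpha> i - 1) + sum \<alpha> (?W - {i})"
      proof -
        have "sum (?a i) (?W - {i}) = sum \<alpha> (?W - {i})" by (rule sum.cong) auto
        then show "sum \<alpha> ?W = \<alpha> i + sum \<alpha> (?W - {i})" "sum (?a i) ?W = (\<alpha> i - 1) + sum \<alpha> (?W - {i})"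
          using sum.remove[OF _ i, of \<alpha>] sum.remove[OF _ i, of "?a i"] by simp_all
      qed
      have p: "(\<Prod>l\<in>?W. fact (\<alpha> l)) = of_nat (\<alpha> i) * (\<Prod>l\<in>?W. fact (?a i l) :: complex)"
      proof -
        have "(\<Prod>l\<in>?W. fact (\<alpha> l) :: complex) = fact (\<alpha> i) * (\<Prod>l\<in>?W - {i}. fact (\<alpha> l))"
          "(\<Prod>l\<in>?W. fact (?a i l) :: complex) = fact (\<alpha> i - 1) * (\<Prod>l\<in>?W - {i}. fact (\<alpha> l))"
        proof -
          have "(\<Prod>l\<in>?W - {i}. fact (?a i l) :: complex) = (\<Prod>l\<in>?W - {i}. fact (\<alpha> l))" by (rule prod.cong) auto
          then show "(\<Prod>l\<in>?W. fact (\<alpha> l) :: complex) = fact (\<alpha> i) * (\<Prod>l\<in>?W - {i}. fact (\<alpha> l))"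
            "(\<Prod>l\<in>?W. fact (?a i l) :: complex) = fact (\<alpha> i - 1) * (\<Prod>l\<in>?W - {i}. fact (\<alpha> l))"
            using prod.remove[OF _ i, of "\<lambda>l. fact (\<alpha> l) :: complex"] prod.remove[OF _ i, of "\<lambda>l. fact (?a i l) :: complex"]
            by simp_all
        qed
        moreover have "(fact (\<alpha> i) :: complex) = of_nat (\<alpha> i) * fact (\<alpha> i - 1)"
          using False by (simp add: fact_reduce)
        ultimately show ?thesis by simp
      qed
      have ik: "?a i k = \<alpha> k" "?b i k = \<beta> k" using i by auto
      have c2: "sum (?a i) ?W = j \<longleftrightarrow> sum \<alpha> ?W = Suc j" using s False by auto
      have k: "of_nat (\<alpha> i * \<beta> i) * (if C \<and> D then F * X * Z else 0) =
          of_nat (\<alpha> i) * (if C \<and> D then F * (of_nat (\<alpha> i) * X) * Z else 0)"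
        if "C \<Longrightarrow> \<alpha> i = \<beta> i" for C D and F X Z :: complex
        using that by auto
      show ?thesis
        unfolding c1 c2 p ik using i by (intro k) auto
    qed
  qed
  also have "\<dots> = (\<Sum>i\<in>?W. of_nat (\<alpha> i)) * (if (\<forall>i\<in>?W. \<alpha> i = \<beta> i) \<and> sum \<alpha> ?W = Suc j
     then fact j * (\<Prod>i\<in>?W. fact (\<alpha> i)) * (a ^ \<alpha> k * cnj a ^ \<beta> k) else 0)"
    by (rule sum_distrib_right[symmetric])
  also have "(\<Sum>i\<in>?W. of_nat (\<alpha> i) :: complex) = of_nat (sum \<alpha> ?W)" by simp
  also have "of_nat (sum \<alpha> ?W) * (if (\<forall>i\<in>?W. \<alpha> i = \<beta> i) \<and> sum \<alpha> ?W = Suc j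
     then fact j * (\<Prod>i\<in>?W. fact (\<alpha> i)) * (a ^ \<alpha> k * cnj a ^ \<beta> k) else 0) = ?E \<alpha> \<beta> (Suc j)"
  proof -
    have "of_nat S * (if C \<and> S = Suc j then fact j * X * Z else 0) =
        (if C \<and> S = Suc j then fact (Suc j) * X * Z else 0)" for C S and X Z :: complex
      by simp
    then show ?thesis .
  qed
  finally show ?case .
qed

text \<open>Derivatives along the axis are read off from the restriction of f to that complex line.
  Two terms are allowed because the first derivative of a single \<open>c^p cnj c^q\<close> already
  has two, and the lemma is applied to it once more.\<close>

lemma line_derivative:
  fixes f :: "complex^'n \<Rightarrow> complex"
  assumes f: "f \<in> polys" and line: "\<And>c. f (axis k c) = A * (c ^ p * cnj c ^ q) + B * (c ^ r * cnj c ^ s)"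
  shows "frechet_derivative f (at (axis k c)) (axis k b) =
     A * (b * (of_nat p * (c ^ (p - 1) * cnj c ^ q)) + cnj b * (of_nat q * (c ^ p * cnj c ^ (q - 1)))) +
     B * (b * (of_nat r * (c ^ (r - 1) * cnj c ^ s)) + cnj b * (of_nat s * (c ^ r * cnj c ^ (s - 1))))"
proof -
  have bl: "bounded_linear (axis k :: complex \<Rightarrow> complex^'n)"
    by (intro linear_conv_bounded_linear[THEN iffD1] linearI) (auto simp: axis_def vec_eq_iff)
  have d: "((\<lambda>c. c ^ p * cnj c ^ q) has_derivative
      (\<lambda>b. b * (of_nat p * (c ^ (p - 1) * cnj c ^ q)) + cnj b * (of_nat q * (c ^ p * cnj c ^ (q - 1))))) (at c)" for p q
    by (auto intro!: derivative_eq_intros bounded_linear.has_derivative[OF bounded_linear_cnj] simp: algebra_simps)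
  have "((\<lambda>c. f (axis k c)) has_derivative (\<lambda>b. frechet_derivative f (at (axis k c)) (axis k b))) (at c)"
    by (rule has_derivative_compose[OF bounded_linear_imp_has_derivative[OF bl] polys_has_derivative[OF f]])
  moreover have "((\<lambda>c. f (axis k c)) has_derivative (\<lambda>b.
     A * (b * (of_nat p * (c ^ (p - 1) * cnj c ^ q)) + cnj b * (of_nat q * (c ^ p * cnj c ^ (q - 1)))) +
     B * (b * (of_nat r * (c ^ (r - 1) * cnj c ^ s)) + cnj b * (of_nat s * (c ^ r * cnj c ^ (s - 1)))))) (at c)"
    unfolding line by (intro has_derivative_add has_derivative_mult_right d)
  ultimately show ?thesis by (rule has_derivative_unique[THEN fun_cong])
qed

lemma wlap_line:
  fixes f :: "complex^'n \<Rightarrow> complex"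
  assumes f: "f \<in> polys" and line: "\<And>c. f (axis k c) = A * (c ^ p * cnj c ^ q)"
  shows "wlap k f (axis k c) = A * of_nat p * of_nat q * (c ^ (p - 1) * cnj c ^ (q - 1))"
proof -
  have 1: "frechet_derivative f (at (axis k c)) (axis k b) =
     (A * b * of_nat p) * (c ^ (p - 1) * cnj c ^ q) + (A * cnj b * of_nat q) * (c ^ p * cnj c ^ (q - 1))" for b c
    using line_derivative[OF f, of k A p q 0 0 0 c b] line by (simp add: algebra_simps)
  show ?thesis
    unfolding wlap_def line_derivative[OF polys_frechet[OF f] 1] by (simp add: algebra_simps)
qed

lemma wlap_pow_line:
  fixes Y :: "complex^'n \<Rightarrow> complex"
  assumes Y: "Y \<in> polys" and line: "\<And>c. Y (axis k c) = A * (c ^ p * cnj c ^ q)"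
  shows "(wlap k ^^ j) Y (axis k c) = A * ffall (of_nat p) j * ffall (of_nat q) j * (c ^ (p - j) * cnj c ^ (q - j))"
proof (induction j arbitrary: c)
  case 0
  then show ?case using line by (simp add: ffall_0)
next
  case (Suc j)
  \<comment> \<open>Truncated subtraction is consistent here: for j \<ge> p both sides
    vanish.\<close>
  have z: "ffall (of_nat p) j * of_nat (p - j) = ffall (of_nat p) (Suc j)" for p
  proof (cases "j \<le> p")
    case False
    then show ?thesis by (simp add: ffall_of_nat binomial_eq_0)
  qed (simp add: ffall_Suc of_nat_diff)
  have "(wlap k ^^ Suc j) Y (axis k c) = A * ffall (of_nat p) j * ffall (of_nat q) j *
     of_nat (p - j) * of_nat (q - j) * (c ^ (p - j - 1) * cnj c ^ (q - j - 1))"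
    using wlap_line[OF lin_polysD(1)[OF lin_polys_funpow[OF lin_polys_wlap] Y] Suc] by simp
  also have "\<dots> = A * (ffall (of_nat p) j * of_nat (p - j)) * (ffall (of_nat q) j * of_nat (q - j)) *
     (c ^ (p - Suc j) * cnj c ^ (q - Suc j))"
    by simp
  finally show ?case unfolding z .
qed

section \<open>The transform of a polynomial times a radial function\<close>

text \<open>The hyperplanes \<open>bilin \<xi> x = 1\<close> keep a positive distance from 0, so
  continuity off 0 and bounded support are enough for the integral and its linearity.\<close>

definition pc :: "(complex^'n \<Rightarrow> complex) \<Rightarrow> bool" where
  "pc f \<longleftrightarrow> f 0 = 0 \<and> continuous_on (- {0}) f \<and> (\<exists>R. \<forall>x. R < norm x \<longrightarrow> f x = 0)"

lemma pc_measurable: assumes "pc f" shows "f \<in> borel_measurable borel"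
proof -
  have "(\<lambda>y. if y \<in> - {0} then f y else 0) \<in> borel_measurable borel"
    using assms by (intro borel_measurable_continuous_on_if continuous_on_const) (auto simp: pc_def)
  also have "(\<lambda>y. if y \<in> - {0} then f y else 0) = f"
    using assms by (auto simp: fun_eq_iff pc_def)
  finally show ?thesis .
qed

lemma pc_bounded:
  fixes f :: "complex^'n \<Rightarrow> complex"
  assumes "pc f" "0 < r" obtains B R where "\<And>x. r \<le> norm x \<Longrightarrow> norm (f x) \<le> B" "\<And>x. R < norm x \<Longrightarrow> f x = 0" "0 < R"
proof -
  obtain R0 where R0: "\<And>x. R0 < norm x \<Longrightarrow> f x = 0" using assms by (auto simp: pc_def)
  define R where "R = max R0 1"
  have R: "\<And>x. R < norm x \<Longrightarrow> f x = 0" using R0 by (auto simp: R_def)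
  have "compact (cball 0 R - ball (0::complex^'n) r)" by (intro compact_diff) auto
  then have "compact (f ` (cball 0 R - ball 0 r))"
    using assms by (intro compact_continuous_image) (auto simp: pc_def intro: continuous_on_subset)
  then have "bounded (f ` (cball 0 R - ball 0 r))" by (rule compact_imp_bounded)
  then obtain B where B: "\<forall>x\<in>f ` (cball 0 R - ball 0 r). norm x \<le> B" unfolding bounded_iff ..
  have "norm (f x) \<le> max B 0" if "r \<le> norm x" for x
    using B R[of x] that by (cases "norm x \<le> R") (auto simp: le_max_iff_disj)
  then show thesis using R by (intro that[of "max B 0" R]) (auto simp: R_def)
qed

lemma pc_add: assumes "pc f" "pc g" shows "pc (\<lambda>x. f x + g x)"
proof -
  obtain R where "\<And>x. R < norm x \<Longrightarrow> f x = 0" using assms(1) by (auto simp: pc_def)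
  moreover obtain Q where "\<And>x. Q < norm x \<Longrightarrow> g x = 0" using assms(2) by (auto simp: pc_def)
  ultimately have "\<forall>x. max R Q < norm x \<longrightarrow> f x + g x = 0" by simp
  then show ?thesis using assms unfolding pc_def by (auto intro!: continuous_on_add exI[of _ "max R Q"])
qed

lemma pc_scale: "pc f \<Longrightarrow> pc (\<lambda>x. c * f x)"
  unfolding pc_def by (auto intro!: continuous_on_mult continuous_on_const)

lemma pc_zero: "pc (\<lambda>x. 0)"
  unfolding pc_def by auto

lemma integral_scale_measure_complex:
  fixes f :: "'a \<Rightarrow> complex"
  assumes "f \<in> borel_measurable M" "0 \<le> c"
  shows "(\<integral>x. f x \<partial>scale_measure (ennreal c) M) = of_real c * (\<integral>x. f x \<partial>M)"
proof -
  have "scale_measure (ennreal c) M = density M (\<lambda>_. ennreal c)"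
    by (rule measure_eqI) (simp_all add: emeasure_density_const)
  then show ?thesis
    using assms by (simp add: integral_density scaleR_conv_of_real)
qed

section \<open>The transform as a Lebesgue integral over a slab\<close>

definition slab :: "complex^'n \<Rightarrow> (complex^'n) set" where
  "slab \<xi> = {x. norm (bilin \<xi> x - 1) < 1}"

definition hproj :: "complex^'n \<Rightarrow> complex^'n \<Rightarrow> complex^'n" where
  "hproj \<xi> x = x + (1 - bilin \<xi> x) *s normal_vec \<xi>"

lemma measurable_hproj [measurable]: "hproj \<xi> \<in> borel_measurable borel"
  unfolding hproj_def[abs_def] by measurable

lemma slab_borel [measurable]: "slab \<xi> \<in> sets borel"
  unfolding slab_def by measurable

lemma transform_eq:
  assumes "\<xi> \<noteq> 0" and f [measurable]: "f \<in> borel_measurable borel"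
  shows "transform f \<xi> = of_real (1 / pi) * (\<integral>x. indicator (slab \<xi>) x *\<^sub>R f (hproj \<xi> x) \<partial>lborel)"
proof -
  have m: "hproj \<xi> \<in> measurable (restrict_space lborel (slab \<xi>)) borel"
    by (rule measurable_restrict_space1) simp
  have "transform f \<xi> = (\<integral>x. f x \<partial>scale_measure (ennreal (1 / pi)) (distr (restrict_space lborel (slab \<xi>)) borel (hproj \<xi>)))"
    using assms(1) by (simp add: transform_def hyperplane_measure_alt slab_def hproj_def[abs_def])
  also have "\<dots> = of_real (1 / pi) * (\<integral>x. f x \<partial>distr (restrict_space lborel (slab \<xi>)) borel (hproj \<xi>))"
    by (rule integral_scale_measure_complex) auto
  also have "(\<integral>x. f x \<partial>distr (restrict_space lborel (slab \<xi>)) borel (hproj \<xi>)) =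
      (\<integral>x. f (hproj \<xi> x) \<partial>restrict_space lborel (slab \<xi>))"
    by (rule integral_distr[OF m f])
  also have "\<dots> = (\<integral>x. indicator (slab \<xi>) x *\<^sub>R f (hproj \<xi> x) \<partial>lborel)"
    by (rule integral_restrict_space) simp
  finally show ?thesis .
qed

lemma norm_cnj_vec [simp]: "norm (cnj_vec x) = norm x"
  by (simp add: norm_vec_def cnj_vec_def)

lemma norm_smult: "norm (c *s x) = norm c * norm (x::complex^'n)"
  by (simp add: norm_vec_def L2_set_def norm_mult power_mult_distrib sum_distrib_left[symmetric] real_sqrt_mult)

lemma bilin_le: "norm (bilin \<xi> x) \<le> norm \<xi> * norm x"
proof -
  have "norm (bilin \<xi> x) \<le> (\<Sum>i\<in>UNIV. norm (\<xi> $ i) * norm (x $ i))"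
    unfolding bilin_def by (rule norm_sum[THEN order_trans]) (simp add: norm_mult)
  also have "\<dots> \<le> norm \<xi> * norm x"
    using L2_set_mult_ineq[where A = UNIV and f = "\<lambda>i. norm (\<xi> $ i)" and g = "\<lambda>i. norm (x $ i)"] by (simp add: norm_vec_def)
  finally show ?thesis .
qed

lemma bilin_hproj: "\<xi> \<noteq> 0 \<Longrightarrow> bilin \<xi> (hproj \<xi> x) = 1"
  unfolding hproj_def bilin_add bilin_scale by (simp add: bilin_normal_vec)

text \<open>By Cauchy-Schwarz the hyperplane has distance at least 1 / ||\<xi>|| from the origin.
  This keeps a singularity of f at 0 away from the integral.\<close>

lemma norm_hproj: assumes "\<xi> \<noteq> 0" shows "1 / norm \<xi> \<le> norm (hproj \<xi> x)"
proof -
  have "1 \<le> norm \<xi> * norm (hproj \<xi> x)"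
    using bilin_le[of \<xi> "hproj \<xi> x"] bilin_hproj[OF assms] by simp
  then show ?thesis using assms by (simp add: field_simps)
qed

lemma transform_integrable:
  fixes f :: "complex^'n \<Rightarrow> complex"
  assumes "pc f" "\<xi> \<noteq> 0"
  shows "integrable lborel (\<lambda>x. indicator (slab \<xi>) x *\<^sub>R f (hproj \<xi> x))"
proof -
  note [measurable] = pc_measurable[OF assms(1)]
  obtain B R where B: "\<And>x. 1 / norm \<xi> \<le> norm x \<Longrightarrow> norm (f x) \<le> B" "\<And>x. R < norm x \<Longrightarrow> f x = 0"
    using pc_bounded[OF assms(1), of "1 / norm \<xi>"] assms(2) by (metis zero_less_divide_1_iff zero_less_norm_iff)
  let ?A = "cball 0 (R + norm (normal_vec \<xi>)) :: (complex^'n) set"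
  have sup: "x \<in> ?A" if "indicator (slab \<xi>) x *\<^sub>R f (hproj \<xi> x) \<noteq> 0" for x
  proof -
    \<comment> \<open>In the slab x differs from its projection by at most the length of
      \<open>normal_vec \<xi>\<close>, so a bound on the support of f bounds x as well.\<close>
    have s: "x \<in> slab \<xi>" "norm (hproj \<xi> x) \<le> R"
      using that B(2)[of "hproj \<xi> x"] by (auto simp: indicator_def not_less[symmetric] split: if_splits)
    have "norm x = norm (hproj \<xi> x - (1 - bilin \<xi> x) *s normal_vec \<xi>)"
      by (simp add: hproj_def)
    also have "\<dots> \<le> norm (hproj \<xi> x) + norm (1 - bilin \<xi> x) * norm (normal_vec \<xi>)"
      using norm_triangle_ineq4 by (metis norm_smult)
    also have "\<dots> \<le> R + 1 * norm (normal_vec \<xi>)"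
      using s by (intro add_mono mult_right_mono) (auto simp: slab_def norm_minus_commute)
    finally show ?thesis by simp
  qed
  show ?thesis
  proof (rule integrableI_bounded_set[where A = ?A and B = B])
    show "emeasure lborel ?A < \<infinity>" using emeasure_bounded_finite[of ?A] by simp
    have "norm (indicator (slab \<xi>) x *\<^sub>R f (hproj \<xi> x)) \<le> B" for x
      using B(1)[OF norm_hproj[OF assms(2)], of x] order_trans[OF norm_ge_zero B(1)[OF norm_hproj[OF assms(2)], of x]]
      by (auto simp: indicator_def)
    then show "AE x in lborel. x \<in> ?A \<longrightarrow> norm (indicator (slab \<xi>) x *\<^sub>R f (hproj \<xi> x)) \<le> B" by simp
    show "AE x in lborel. x \<notin> ?A \<longrightarrow> indicator (slab \<xi>) x *\<^sub>R f (hproj \<xi> x) = 0"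
      using sup by (intro AE_I2) blast
  qed auto
qed

lemma transform_add:
  assumes "pc f" "pc g" shows "transform (\<lambda>x. f x + g x) = (\<lambda>\<xi>. transform f \<xi> + transform g \<xi>)"
proof
  fix \<xi>
  show "transform (\<lambda>x. f x + g x) \<xi> = transform f \<xi> + transform g \<xi>"
  proof (cases "\<xi> = 0")
    case False
    then show ?thesis
      using assms
      by (simp add: transform_eq pc_measurable pc_add scaleR_add_right transform_integrable distrib_left)
  qed (simp add: transform_def)
qed

lemma transform_cmult:
  assumes "pc f" shows "transform (\<lambda>x. c * f x) = (\<lambda>\<xi>. c * transform f \<xi>)"
proof
  fix \<xi>
  show "transform (\<lambda>x. c * f x) \<xi> = c * transform f \<xi>"
  proof (cases "\<xi> = 0")
    case False
    have eq: "(\<lambda>x. indicator (slab \<xi>) x *\<^sub>R (c * f (hproj \<xi> x))) = (\<lambda>x. c * (indicator (slab \<xi>) x *\<^sub>R f (hproj \<xi> x)))"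
      by auto
    show ?thesis
      unfolding transform_eq[OF False pc_measurable[OF assms]] transform_eq[OF False pc_measurable[OF pc_scale[OF assms]]]
        eq integral_mult_right_zero
      by (rule mult.left_commute)
  qed (simp add: transform_def)
qed

lemma transform_zero: "transform (\<lambda>x. 0) = (\<lambda>\<xi>. 0)"
  using transform_cmult[OF pc_zero, of 0] by simp

text \<open>The unitary group as a set of maps instead of matrices, so that it composes directly
  with functions. The two descriptions are compared when \<open>K_finite\<close> is
  rewritten.\<close>

definition UM :: "(complex^'n \<Rightarrow> complex^'n) set" where
  "UM = {A. (\<forall>x y. A (x + y) = A x + A y) \<and> (\<forall>c x. A (c *s x) = c *s A x) \<and> (\<forall>x. norm (A x) = norm x)}"

lemma UM_add: "A \<in> UM \<Longrightarrow> A (x + y) = A x + A y"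
  and UM_smult: "A \<in> UM \<Longrightarrow> A (c *s x) = c *s A x"
  and UM_norm: "A \<in> UM \<Longrightarrow> norm (A x) = norm x"
  by (auto simp: UM_def)

lemma scaleR_smult: "r *\<^sub>R x = of_real r *s (x::complex^'n)"
  by (simp add: vec_eq_iff scaleR_conv_of_real[where 'a = complex])

lemma UM_linear: "A \<in> UM \<Longrightarrow> linear A"
  by (rule linearI) (auto simp: UM_add UM_smult scaleR_smult)

lemma UM_bounded_linear: "A \<in> UM \<Longrightarrow> bounded_linear A"
  by (simp add: UM_linear linear_conv_bounded_linear[symmetric])

lemma UM_zero [simp]: "A \<in> UM \<Longrightarrow> A 0 = 0"
  using UM_norm[of A 0] by simp

lemma UM_eq_0_iff [simp]: "A \<in> UM \<Longrightarrow> A x = 0 \<longleftrightarrow> x = 0"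
  using UM_norm[of A x] by (metis norm_eq_zero)

lemma UM_comp: "A \<in> UM \<Longrightarrow> B \<in> UM \<Longrightarrow> (\<lambda>x. A (B x)) \<in> UM"
  by (simp add: UM_def)

lemma UM_id: "(\<lambda>x. x) \<in> UM"
  by (simp add: UM_def)

lemma UM_inverse:
  assumes "A \<in> UM" obtains A' where "A' \<in> UM" "\<And>x. A (A' x) = x" "\<And>x. A' (A x) = x"
proof -
  have inj: "inj A"
    using UM_linear[OF assms] assms by (simp add: linear_injective_0)
  then have surj: "surj A" using UM_linear[OF assms] linear_injective_imp_surjective by blast
  have l: "inv A (A x) = x" "A (inv A x) = x" for x using inj surj by (simp_all add: surj_f_inv_f)
  have "inv A \<in> UM"
    unfolding UM_def
  proof (intro CollectI conjI allI)
    show "inv A (x + y) = inv A x + inv A y" for x y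
      using l UM_add[OF assms, of "inv A x" "inv A y"] by metis
    show "inv A (c *s x) = c *s inv A x" for c x
      using l UM_smult[OF assms, of c "inv A x"] by metis
    show "norm (inv A x) = norm x" for x
      using l UM_norm[OF assms, of "inv A x"] by metis
  qed
  then show thesis using l that by blast
qed

lemma Re_bilin: "Re (bilin (cnj_vec y) x) = x \<bullet> y"
  by (simp add: bilin_def cnj_vec_def inner_vec_def inner_complex_def Re_sum mult.commute)

text \<open>By polarization A preserves the real inner product, the real part of the Hermitian
  product; complex linearity yields the imaginary part on replacing x by -\<i> x.\<close>

lemma bilin_UM: assumes "A \<in> UM" shows "bilin (cnj_vec (A y)) (A x) = bilin (cnj_vec y) x"
proof -
  have in_eq: "A x \<bullet> A y = x \<bullet> y" for x y
    unfolding dot_norm[of "A x"] dot_norm[of x] UM_add[OF assms, symmetric] UM_norm[OF assms] ..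
  have Im: "Im (bilin (cnj_vec y) x) = ((- \<i>) *s x) \<bullet> y" for x y :: "complex^'a"
    unfolding Re_bilin[symmetric] bilin_scale by simp
  show ?thesis
    using in_eq by (simp add: complex_eq_iff Re_bilin Im UM_smult[OF assms, symmetric])
qed

lemma cnj_vec_cnj_vec [simp]: "cnj_vec (cnj_vec x) = x"
  by (simp add: cnj_vec_def vec_eq_iff)

lemma cnj_vec_smult: "cnj_vec (c *s x) = cnj c *s cnj_vec x"
  by (simp add: cnj_vec_def vec_eq_iff)

lemma cnj_vec_add: "cnj_vec (x + y) = cnj_vec x + cnj_vec y"
  by (simp add: cnj_vec_def vec_eq_iff)

lemma cnj_vec_eq_0 [simp]: "cnj_vec x = 0 \<longleftrightarrow> x = 0"
  by (metis norm_cnj_vec norm_eq_zero)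

lemma UM_conj: "A \<in> UM \<Longrightarrow> (\<lambda>x. cnj_vec (A (cnj_vec x))) \<in> UM"
  by (simp add: UM_def cnj_vec_add cnj_vec_smult)

text \<open>\<open>bilin\<close> is complex bilinear and not Hermitian, so \<xi> moves by the
  complex conjugate of A. Then slab, normal vector and projection are carried along, and A preserves
  Lebesgue measure.\<close>

lemma transform_UM:
  fixes f :: "complex^'n \<Rightarrow> complex"
  assumes f: "pc f" and A: "A \<in> UM"
  shows "transform (\<lambda>x. f (A x)) \<xi> = transform f (cnj_vec (A (cnj_vec \<xi>)))"
proof (cases "\<xi> = 0")
  case False
  let ?\<eta> = "cnj_vec (A (cnj_vec \<xi>))"
  have \<eta>: "?\<eta> \<noteq> 0" using A False by simp
  have "A \<in> borel_measurable borel"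
    using A by (intro borel_measurable_continuous_onI linear_continuous_on UM_bounded_linear)
  note [measurable] = pc_measurable[OF f] this
  have b: "bilin ?\<eta> (A x) = bilin \<xi> x" for x
    using bilin_UM[OF A, of "cnj_vec \<xi>" x] by simp
  have nv: "normal_vec ?\<eta> = A (normal_vec \<xi>)"
    by (simp add: normal_vec_def UM_smult[OF A] UM_norm[OF A])
  have hp: "A (hproj \<xi> x) = hproj ?\<eta> (A x)" for x
    unfolding hproj_def UM_add[OF A] UM_smult[OF A] b nv ..
  have sl: "indicat_real (slab \<xi>) x = indicator (slab ?\<eta>) (A x)" for x
    by (simp add: slab_def indicator_def b)
  have "(\<integral>x. indicator (slab \<xi>) x *\<^sub>R f (A (hproj \<xi> x)) \<partial>lborel) =
      (\<integral>x. (\<lambda>x. indicator (slab ?\<eta>) x *\<^sub>R f (hproj ?\<eta> x)) (A x) \<partial>lborel)"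
    unfolding hp sl ..
  also have "\<dots> = (\<integral>x. indicator (slab ?\<eta>) x *\<^sub>R f (hproj ?\<eta> x) \<partial>lborel)"
    by (rule integral_lborel_isometry[OF UM_linear[OF A] UM_norm[OF A]]) measurable
  finally show ?thesis
    using transform_eq[OF False, of "\<lambda>x. f (A x)"] transform_eq[OF \<eta>, of f] by simp
qed (use A in \<open>simp add: transform_def\<close>)

lemma norm_axis_complex [simp]: "norm (axis k c :: complex^'n) = norm c"
  by (simp add: norm_eq_sqrt_inner inner_axis_axis)

text \<open>A Householder reflection composed with a phase.\<close>

lemma UM_transitive:
  fixes u :: "complex^'n"
  assumes "norm u = 1" obtains A where "A \<in> UM" "A (axis k 1) = u"
proof -
  \<comment> \<open>The phase of the k-th coordinate of u. It makes the Hermitian product of e and u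
    real, as the Householder reflection exchanging two unit vectors requires.\<close>
  define s where "s = (if u $ k = 0 then 1 else sgn (u $ k))"
  define e where "e = s *s (axis k 1 :: complex^'n)"
  define v where "v = e - u"
  define H where "H = (\<lambda>y. y - (if v = 0 then 0 else 2 * bilin (cnj_vec v) y / of_real ((norm v)\<^sup>2)) *s v)"
  have ns: "norm s = 1" by (simp add: s_def norm_sgn)
  have ne: "norm e = 1" by (simp add: e_def norm_smult ns)
  have nv: "bilin (cnj_vec w) w = of_real ((norm w)\<^sup>2)" for w :: "complex^'n"
    using bilin_cnj[of "cnj_vec w"] by simp
  have ue: "bilin (cnj_vec u) e = of_real (norm (u $ k))"
  proof -
    have "bilin (cnj_vec u) e = cnj (u $ k) * s"
      by (simp add: bilin_def e_def cnj_vec_def axis_def if_distrib cong: if_cong)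
    also have "\<dots> = of_real (norm (u $ k))"
    proof (cases "u $ k = 0")
      case False
      have "cnj (u $ k) * sgn (u $ k) = (u $ k * cnj (u $ k)) / of_real (norm (u $ k))" by (simp add: sgn_eq)
      also have "\<dots> = of_real (norm (u $ k))"
        unfolding complex_norm_square[symmetric] using False by (simp add: power2_eq_square)
      finally show ?thesis using False by (simp add: s_def)
    qed (simp add: s_def)
    finally show ?thesis .
  qed
  have Hu: "H e = u"
  proof (cases "v = 0")
    case False
    have cd: "cnj_vec (x - y) = cnj_vec x - cnj_vec y" for x y :: "complex^'n"
      by (simp add: cnj_vec_def vec_eq_iff)
    have bd: "bilin (x - y) z = bilin x z - bilin y z" for x y z :: "complex^'n"
      by (simp add: bilin_def algebra_simps sum_subtractf)
    have bc: "bilin (cnj_vec x) y = cnj (bilin (cnj_vec y) x)" for x y :: "complex^'n"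
      by (simp add: bilin_def cnj_vec_def mult.commute)
    have "bilin (cnj_vec v) v = of_real (2 - 2 * norm (u $ k))"
      using nv[of e] nv[of u] bc[of e u] ue by (simp add: v_def cd bd bilin_diff ne assms)
    then have V: "of_real ((norm v)\<^sup>2) = (of_real (2 - 2 * norm (u $ k)) :: complex)" using nv by metis
    have E: "bilin (cnj_vec v) e = of_real (1 - norm (u $ k))"
      using nv[of e] ue by (simp add: v_def cd bd ne)
    have "2 * bilin (cnj_vec v) e = of_real ((norm v)\<^sup>2)" unfolding V E by simp
    then have "2 * bilin (cnj_vec v) e / of_real ((norm v)\<^sup>2) = 1" using False by simp
    then show ?thesis using False by (simp add: H_def v_def)
  qed (simp add: H_def v_def)
  have Hadd: "H (x + y) = H x + H y" for x y
    by (simp add: H_def bilin_add vec_eq_iff algebra_simps add_divide_distrib)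
  have Hs: "H (c *s x) = c *s H x" for c x
    by (simp add: H_def bilin_scale vec_eq_iff algebra_simps)
  have Hn: "norm (H x) = norm x" for x
  proof (cases "v = 0")
    case False
    define t where "t = bilin (cnj_vec v) x"
    define c where "c = 2 * t / of_real ((norm v)\<^sup>2)"
    have "(c *s v) \<bullet> x = Re (c * cnj t)"
    proof -
      have "(c *s v) \<bullet> x = Re (bilin (cnj_vec x) (c *s v))" by (rule Re_bilin[symmetric])
      also have "bilin (cnj_vec x) (c *s v) = c * cnj t"
        by (simp add: t_def bilin_def cnj_vec_def sum_distrib_left mult_ac)
      finally show ?thesis .
    qed
    also have "c * cnj t = of_real (2 * (norm t)\<^sup>2 / (norm v)\<^sup>2)"
      using complex_norm_square[of t] by (simp add: c_def mult.assoc)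
    finally have 1: "(c *s v) \<bullet> x = 2 * (norm t)\<^sup>2 / (norm v)\<^sup>2" by simp
    have 2: "(c *s v) \<bullet> (c *s v) = 4 * (norm t)\<^sup>2 / (norm v)\<^sup>2"
      using False
      by (simp add: power2_norm_eq_inner[symmetric] norm_smult c_def norm_mult norm_divide power_mult_distrib
          power_divide norm_power field_simps power2_eq_square)
    have "H x = x - c *s v" using False by (simp add: H_def c_def t_def)
    have "(norm (H x))\<^sup>2 = (norm x)\<^sup>2"
    proof -
      have "(x - w) \<bullet> (x - w) = x \<bullet> x - 2 * (w \<bullet> x) + w \<bullet> w" for w
        by (simp add: inner_diff_left inner_diff_right inner_commute)
      from this[of "c *s v"] show ?thesis
        unfolding \<open>H x = x - c *s v\<close> power2_norm_eq_inner 1 2 by simp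
    qed
    then show ?thesis by simp
  qed (simp add: H_def)
  have "(\<lambda>x. H (s *s x)) \<in> UM"
    unfolding UM_def
    by (auto simp: Hadd Hs Hn norm_smult ns vector_add_ldistrib vector_smult_assoc mult.commute)
  moreover have "H (s *s axis k 1) = u" using Hu by (simp add: e_def)
  ultimately show thesis by (rule that)
qed

text \<open>For \<xi> on the axis the slab restricts the k-th coordinate alone, to a disc of area
  \<pi> / \<rho>^2, and the projection sets that coordinate to 1 / \<rho>. Fubini leaves the
  integral over the other coordinates.\<close>

lemma transform_axis:
  fixes f :: "complex^'n \<Rightarrow> complex" and k :: 'n
  assumes f: "pc f" and \<rho>: "0 < \<rho>"
  shows "transform f (axis k (of_real \<rho>)) = of_real (1 / \<rho>\<^sup>2) *
    (\<integral>x. f (\<chi> i. (x(k := of_real (1 / \<rho>))) i) \<partial>Pi\<^sub>M (UNIV - {k}) (\<lambda>_. lborel))"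
proof -
  interpret P: product_sigma_finite "\<lambda>_::'n. lborel::complex measure" ..
  let ?\<xi> = "axis k (of_real \<rho>) :: complex^'n"
  let ?F = "\<lambda>x. indicator (slab ?\<xi>) x *\<^sub>R f (hproj ?\<xi> x)"
  let ?W = "UNIV - {k}"
  have ins: "insert k ?W = UNIV" by auto
  have \<xi>: "?\<xi> \<noteq> 0" using \<rho> by (simp add: axis_eq_0_iff)
  note [measurable] = pc_measurable[OF f]
  have b: "bilin ?\<xi> x = of_real \<rho> * x $ k" for x
    by (simp add: bilin_def axis_def if_distrib if_distribR cong: if_cong)
  have "norm ?\<xi> = \<rho>" using \<rho> by simp
  then have nv: "normal_vec ?\<xi> = axis k (of_real (1 / \<rho>))"
    using \<rho> by (simp add: normal_vec_def cnj_vec_def vec_eq_iff axis_def power2_eq_square)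
  have hp: "hproj ?\<xi> (\<chi> i. (x(k := z)) i) = (\<chi> i. (x(k := of_real (1 / \<rho>))) i)" for x z
    unfolding hproj_def b nv using \<rho> by (auto simp: vec_eq_iff axis_def field_simps)
  have sl: "indicat_real (slab ?\<xi>) (\<chi> i. (x(k := z)) i) = indicator (ball (of_real (1 / \<rho>)) (1 / \<rho>)) z" for x z
  proof -
    have "norm (of_real \<rho> * z - 1) = \<rho> * norm (of_real (1 / \<rho>) - z)"
    proof -
      have "of_real \<rho> * z - 1 = of_real (- \<rho>) * (of_real (1 / \<rho>) - z)" using \<rho> by (simp add: field_simps)
      then show ?thesis using \<rho> by (simp only: norm_mult norm_of_real)
    qed
    then show ?thesis using \<rho> by (simp add: slab_def b indicator_def dist_norm field_simps)
  qed
  have int: "integrable (Pi\<^sub>M (insert k ?W) (\<lambda>_. lborel)) (\<lambda>x. ?F (\<chi> i. x i))"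
    unfolding ins
    by (rule integrable_distr[OF measurable_vec_lambda])
      (use transform_integrable[OF f \<xi>] lborel_vec[where 'n = 'n and 'a = complex] in simp)
  have "(\<integral>x. ?F x \<partial>lborel) = (\<integral>x. ?F (\<chi> i. x i) \<partial>Pi\<^sub>M UNIV (\<lambda>_. lborel))"
    by (subst lborel_vec, rule integral_distr) auto
  also have "\<dots> = (\<integral>x. ?F (\<chi> i. x i) \<partial>Pi\<^sub>M (insert k ?W) (\<lambda>_. lborel))"
    unfolding ins ..
  also have "\<dots> = (\<integral>x. (\<integral>z. ?F (\<chi> i. (x(k := z)) i) \<partial>lborel) \<partial>Pi\<^sub>M ?W (\<lambda>_. lborel))"
    by (rule P.product_integral_insert[OF _ _ int]) auto
  also have "\<dots> = (\<integral>x. of_real (pi / \<rho>\<^sup>2) * f (\<chi> i. (x(k := of_real (1 / \<rho>))) i) \<partial>Pi\<^sub>M ?W (\<lambda>_. lborel))"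
  proof (rule Bochner_Integration.integral_cong[OF refl])
    fix x
    have "(\<integral>z. ?F (\<chi> i. (x(k := z)) i) \<partial>lborel) =
        (\<integral>z. indicator (ball (complex_of_real (1 / \<rho>)) (1 / \<rho>)) z *\<^sub>R f (\<chi> i. (x(k := of_real (1 / \<rho>))) i) \<partial>lborel)"
      unfolding hp sl ..
    also have "\<dots> = measure lborel (ball (complex_of_real (1 / \<rho>)) (1 / \<rho>)) *\<^sub>R f (\<chi> i. (x(k := of_real (1 / \<rho>))) i)"
      using emeasure_bounded_finite[of "ball (complex_of_real (1 / \<rho>)) (1 / \<rho>)"]
      by (subst integral_scaleR_left) (auto simp: integrable_indicator_iff)
    also have "measure lborel (ball (complex_of_real (1 / \<rho>)) (1 / \<rho>)) = pi / \<rho>\<^sup>2"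
      using \<rho> by (simp add: measure_def emeasure_ball unit_ball_vol_2 power_divide)
    finally show "(\<integral>z. ?F (\<chi> i. (x(k := z)) i) \<partial>lborel) = of_real (pi / \<rho>\<^sup>2) * f (\<chi> i. (x(k := of_real (1 / \<rho>))) i)"
      by (simp add: scaleR_conv_of_real)
  qed
  also have "\<dots> = of_real (pi / \<rho>\<^sup>2) * (\<integral>x. f (\<chi> i. (x(k := of_real (1 / \<rho>))) i) \<partial>Pi\<^sub>M ?W (\<lambda>_. lborel))"
    by simp
  finally show ?thesis by (simp add: transform_eq[OF \<xi>] power2_eq_square)
qed

lemma pc_radial:
  fixes P :: "complex^'n \<Rightarrow> complex"
  assumes "h \<in> Cp" "continuous_on UNIV P" shows "pc (\<lambda>x. h ((norm x)\<^sup>2) * P x)"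
proof -
  obtain R where R: "R > 0" "\<And>y. y > R \<Longrightarrow> h y = 0" using Cp_bound[OF assms(1)] by metis
  have "h ((norm x)\<^sup>2) * P x = 0" if "sqrt R < norm x" for x
  proof -
    have "sqrt R ^ 2 < norm x ^ 2" using that R(1) by (intro power_strict_mono) auto
    then show ?thesis using R by simp
  qed
  moreover have "continuous_on (- {0}) (\<lambda>x. h ((norm x)\<^sup>2) * P x)"
    by (intro continuous_on_mult continuous_on_compose2[OF Cp_continuous[OF assms(1)]]
        continuous_on_subset[OF assms(2)] continuous_intros) auto
  ultimately show ?thesis using Cp_nonpos[OF assms(1), of 0] by (auto simp: pc_def)
qed

text \<open>Only the j equal to the degree of the transverse part contributes. Written as a sum over
  all j up to a bound, the right-hand side is linear in the monomial and can be extended to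
  polynomials.\<close>

lemma transform_cmono_axis:
  fixes k :: "'n::finite"
  assumes h: "h \<in> Cp" and \<rho>: "0 < \<rho>" and K: "sum \<alpha> (UNIV - {k}) \<le> K"
  shows "transform (\<lambda>x. h ((norm x)\<^sup>2) * cmono \<alpha> \<beta> x) (axis k (of_real \<rho>)) =
    of_real (1 / \<rho>\<^sup>2) * (\<Sum>j\<le>K. (tlap k ^^ j) (cmono \<alpha> \<beta>) (axis k (of_real (1 / \<rho>))) / fact j *
      (of_real pi ^ (CARD('n) - 1) * (iop ^^ (CARD('n) - 1 + j)) h ((1 / \<rho>)\<^sup>2)))"
proof -
  let ?W = "UNIV - {k}" and ?a = "1 / \<rho>"
  let ?A = "of_real ?a ^ \<alpha> k * cnj (of_real ?a) ^ \<beta> k :: complex"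
  have cW: "card ?W = CARD('n) - 1" by (simp add: card_Diff_singleton)
  have nrm: "(norm (\<chi> i. (x(k := of_real ?a)) i))\<^sup>2 = ?a\<^sup>2 + (\<Sum>j\<in>?W. (norm (x j :: complex))\<^sup>2)" for x
  proof -
    have "(norm (\<chi> i. (x(k := of_real ?a)) i))\<^sup>2 = (\<Sum>j\<in>UNIV. (norm ((x(k := of_real ?a)) j))\<^sup>2)"
      by (simp add: norm_vec_def L2_set_def sum_nonneg)
    also have "\<dots> = ?a\<^sup>2 + (\<Sum>j\<in>?W. (norm ((x(k := of_real ?a)) j))\<^sup>2)"
      by (subst sum.remove[of _ k]) (auto simp: norm_divide power_divide)
    also have "(\<Sum>j\<in>?W. (norm ((x(k := of_real ?a)) j))\<^sup>2) = (\<Sum>j\<in>?W. (norm (x j))\<^sup>2)"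
      by (rule sum.cong) auto
    finally show ?thesis .
  qed
  have mon: "cmono \<alpha> \<beta> (\<chi> i. (x(k := of_real ?a)) i) = ?A * (\<Prod>j\<in>?W. x j ^ \<alpha> j * cnj (x j) ^ \<beta> j)" for x
    unfolding cmono_def by (subst prod.remove[of _ k]) (auto intro!: prod.cong)
  have "transform (\<lambda>x. h ((norm x)\<^sup>2) * cmono \<alpha> \<beta> x) (axis k (of_real \<rho>)) = of_real (1 / \<rho>\<^sup>2) *
    (\<integral>x. ?A * (h (?a\<^sup>2 + (\<Sum>j\<in>?W. (norm (x j))\<^sup>2)) * (\<Prod>j\<in>?W. x j ^ \<alpha> j * cnj (x j) ^ \<beta> j)) \<partial>Pi\<^sub>M ?W (\<lambda>_. lborel))"
    unfolding transform_axis[OF pc_radial[OF h polys_continuous[OF cmono_polys]] \<rho>] nrm mon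
    by (subst mult.left_commute) (rule refl)
  also have "\<dots> = of_real (1 / \<rho>\<^sup>2) * (?A * (if \<forall>j\<in>?W. \<alpha> j = \<beta> j
     then of_real pi ^ card ?W * (\<Prod>j\<in>?W. fact (\<alpha> j)) * (iop ^^ (card ?W + sum \<alpha> ?W)) h (?a\<^sup>2) else 0))"
    using \<rho> by (subst integral_mult_right_zero, subst product_moment[OF _ h]) auto
  also have "\<dots> = of_real (1 / \<rho>\<^sup>2) * (\<Sum>j\<le>K. (if sum \<alpha> ?W = j then (if \<forall>j\<in>?W. \<alpha> j = \<beta> j then
      (\<Prod>i\<in>?W. fact (\<alpha> i)) * ?A * (of_real pi ^ card ?W * (iop ^^ (card ?W + j)) h (?a\<^sup>2)) else 0) else 0))"
    using K by (simp add: sum.delta')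
  also have "(\<Sum>j\<le>K. (if sum \<alpha> ?W = j then (if \<forall>j\<in>?W. \<alpha> j = \<beta> j then
      (\<Prod>i\<in>?W. fact (\<alpha> i)) * ?A * (of_real pi ^ card ?W * (iop ^^ (card ?W + j)) h (?a\<^sup>2)) else 0) else 0)) =
     (\<Sum>j\<le>K. (tlap k ^^ j) (cmono \<alpha> \<beta>) (axis k (of_real ?a)) / fact j * (of_real pi ^ card ?W * (iop ^^ (card ?W + j)) h (?a\<^sup>2)))"
    unfolding tlap_pow_cmono by (intro sum.cong refl) simp
  finally show ?thesis unfolding cW .
qed

text \<open>The truncation bound depends on P. Asserting the formula for all large K lets formulas
  with different bounds be added.\<close>

lemma transform_polys_axis:
  fixes k :: "'n::finite"
  assumes h: "h \<in> Cp" and \<rho>: "0 < \<rho>" and P: "P \<in> polys"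
  shows "\<exists>K0. \<forall>K\<ge>K0. transform (\<lambda>x. h ((norm x)\<^sup>2) * P x) (axis k (of_real \<rho>)) =
    of_real (1 / \<rho>\<^sup>2) * (\<Sum>j\<le>K. (tlap k ^^ j) P (axis k (of_real (1 / \<rho>))) / fact j *
      (of_real pi ^ (CARD('n) - 1) * (iop ^^ (CARD('n) - 1 + j)) h ((1 / \<rho>)\<^sup>2)))"
  using P
proof (induction rule: polys_induct)
  case (mono \<alpha> \<beta>)
  show ?case using transform_cmono_axis[OF h \<rho>] by blast
next
  case zero
  show ?case
    by (simp only: lin_polys_zero[OF lin_polys_funpow[OF lin_polys_tlap]]) (simp add: transform_zero)
next
  case (add f g)
  have t: "transform (\<lambda>x. h ((norm x)\<^sup>2) * (f x + g x)) = (\<lambda>\<xi>. transform (\<lambda>x. h ((norm x)\<^sup>2) * f x) \<xi> + transform (\<lambda>x. h ((norm x)\<^sup>2) * g x) \<xi>)"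
    using transform_add[OF pc_radial[OF h polys_continuous[OF add(1)]] pc_radial[OF h polys_continuous[OF add(2)]]]
    by (simp add: distrib_left)
  have l: "(tlap k ^^ j) (\<lambda>x. f x + g x) = (\<lambda>x. (tlap k ^^ j) f x + (tlap k ^^ j) g x)" for j
    by (rule lin_polysD(2)[OF lin_polys_funpow[OF lin_polys_tlap] add(1,2)])
  obtain K1 K2 where fg: "\<forall>K\<ge>K1. transform (\<lambda>x. h ((norm x)\<^sup>2) * f x) (axis k (of_real \<rho>)) =
    of_real (1 / \<rho>\<^sup>2) * (\<Sum>j\<le>K. (tlap k ^^ j) f (axis k (of_real (1 / \<rho>))) / fact j *
      (of_real pi ^ (CARD('n) - 1) * (iop ^^ (CARD('n) - 1 + j)) h ((1 / \<rho>)\<^sup>2)))"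
   "\<forall>K\<ge>K2. transform (\<lambda>x. h ((norm x)\<^sup>2) * g x) (axis k (of_real \<rho>)) =
    of_real (1 / \<rho>\<^sup>2) * (\<Sum>j\<le>K. (tlap k ^^ j) g (axis k (of_real (1 / \<rho>))) / fact j *
      (of_real pi ^ (CARD('n) - 1) * (iop ^^ (CARD('n) - 1 + j)) h ((1 / \<rho>)\<^sup>2)))"
    using add by blast
  show ?case
    unfolding t l
  proof (intro exI[of _ "max K1 K2"] allI impI)
    fix K assume K: "max K1 K2 \<le> K"
    show "transform (\<lambda>x. h ((norm x)\<^sup>2) * f x) (axis k (of_real \<rho>)) + transform (\<lambda>x. h ((norm x)\<^sup>2) * g x) (axis k (of_real \<rho>)) =
      of_real (1 / \<rho>\<^sup>2) * (\<Sum>j\<le>K. ((tlap k ^^ j) f (axis k (of_real (1 / \<rho>))) + (tlap k ^^ j) g (axis k (of_real (1 / \<rho>)))) / fact j *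
      (of_real pi ^ (CARD('n) - 1) * (iop ^^ (CARD('n) - 1 + j)) h ((1 / \<rho>)\<^sup>2)))"
      using fg(1)[rule_format, of K] fg(2)[rule_format, of K] K
      by (simp only: max.bounded_iff add_divide_distrib distrib_right distrib_left sum.distrib simp_thms)
  qed
next
  case (scale c f)
  have t: "transform (\<lambda>x. h ((norm x)\<^sup>2) * (c * f x)) = (\<lambda>\<xi>. c * transform (\<lambda>x. h ((norm x)\<^sup>2) * f x) \<xi>)"
    using transform_cmult[OF pc_radial[OF h polys_continuous[OF scale(1)]], of c]
    by (simp add: mult.left_commute)
  have l: "(tlap k ^^ j) (\<lambda>x. c * f x) = (\<lambda>x. c * (tlap k ^^ j) f x)" for j
    by (rule lin_polysD(3)[OF lin_polys_funpow[OF lin_polys_tlap] scale(1)])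
  from scale(2) obtain K0 where K0: "\<forall>K\<ge>K0. transform (\<lambda>x. h ((norm x)\<^sup>2) * f x) (axis k (of_real \<rho>)) =
    of_real (1 / \<rho>\<^sup>2) * (\<Sum>j\<le>K. (tlap k ^^ j) f (axis k (of_real (1 / \<rho>))) / fact j *
      (of_real pi ^ (CARD('n) - 1) * (iop ^^ (CARD('n) - 1 + j)) h ((1 / \<rho>)\<^sup>2)))" ..
  have r: "c * (a * (\<Sum>j\<le>K. F j / fact j * G j)) = a * (\<Sum>j\<le>K. c * F j / fact j * G j)"
    for a K and F G :: "nat \<Rightarrow> complex"
    by (simp add: sum_distrib_left mult_ac)
  show ?case
    unfolding t l
  proof (intro exI[of _ K0] allI impI)
    fix K assume K: "K0 \<le> K"
    show "c * transform (\<lambda>x. h ((norm x)\<^sup>2) * f x) (axis k (of_real \<rho>)) =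
      of_real (1 / \<rho>\<^sup>2) * (\<Sum>j\<le>K. c * (tlap k ^^ j) f (axis k (of_real (1 / \<rho>))) / fact j *
      (of_real pi ^ (CARD('n) - 1) * (iop ^^ (CARD('n) - 1 + j)) h ((1 / \<rho>)\<^sup>2)))"
      unfolding K0[rule_format, OF K] r ..
  qed
qed

definition rtr :: "nat \<Rightarrow> nat \<Rightarrow> nat \<Rightarrow> (real \<Rightarrow> complex) \<Rightarrow> real \<Rightarrow> complex" where
  "rtr n p q h = (\<lambda>y. (of_real pi ^ (n - 1) * (- 1) ^ min p q) *
     mulp (int (min p q) + 1) ((dop ^^ min p q) (mulp (int (max p q)) ((iop ^^ (min p q + n - 1)) h))) y)"

text \<open>The factors of \<open>rtr\<close> undone in reverse order, with m = min p q:
  \<open>iop ^^ m\<close> inverts (-1)^m \<open>dop ^^ m\<close>, and (-1)^(m+n-1)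
  \<open>dop ^^ (m + n - 1)\<close> inverts the antiderivatives.\<close>

definition rinv :: "nat \<Rightarrow> nat \<Rightarrow> nat \<Rightarrow> (real \<Rightarrow> complex) \<Rightarrow> real \<Rightarrow> complex" where
  "rinv n p q H = (\<lambda>y. ((- 1) ^ (min p q + n - 1) / of_real pi ^ (n - 1)) *
     (dop ^^ (min p q + n - 1)) (mulp (- int (max p q)) ((iop ^^ min p q) (mulp (- int (min p q) - 1) H))) y)"

lemma rtr_Cp: "h \<in> Cp \<Longrightarrow> rtr n p q h \<in> Cp"
  unfolding rtr_def by (intro Cp_cmult mulp_Cp dop_pow_Cp iop_pow_Cp)

lemma rinv_Cp: "h \<in> Cp \<Longrightarrow> rinv n p q h \<in> Cp"
  unfolding rinv_def by (intro Cp_cmult mulp_Cp dop_pow_Cp iop_pow_Cp)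

lemma rtr_rinv: assumes "H \<in> Cp" shows "rtr n p q (rinv n p q H) = H"
proof -
  let ?m = "min p q" and ?M = "max p q"
  define X where "X = mulp (- int ?M) ((iop ^^ ?m) (mulp (- int ?m - 1) H))"
  have X: "X \<in> Cp" unfolding X_def by (intro mulp_Cp iop_pow_Cp assms)
  have 1: "(iop ^^ (?m + n - 1)) (rinv n p q H) = (\<lambda>y. ((- 1) ^ (?m + n - 1) / of_real pi ^ (n - 1) * (- 1) ^ (?m + n - 1)) * X y)"
    unfolding rinv_def X_def[symmetric] by (simp only: iop_pow_cmult dop_pow_Cp X iop_dop_pow mult.assoc)
  have 2: "((- 1) ^ (?m + n - 1) / of_real pi ^ (n - 1) * (- 1) ^ (?m + n - 1) :: complex) = 1 / of_real pi ^ (n - 1)"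
    by (simp flip: power_add)
  have 3: "mulp (int ?M) X = (iop ^^ ?m) (mulp (- int ?m - 1) H)"
    unfolding X_def by (simp add: mulp_mulp iop_pow_Cp mulp_Cp assms mulp_0)
  have 4: "(dop ^^ ?m) (\<lambda>y. c * (iop ^^ ?m) (mulp (- int ?m - 1) H) y) = (\<lambda>y. c * ((- 1) ^ ?m * mulp (- int ?m - 1) H y))" for c
    by (simp only: dop_pow_cmult iop_pow_Cp mulp_Cp assms dop_iop_pow)
  have 5: "mulp (int ?m + 1) (mulp (- int ?m - 1) H) = H"
    by (simp add: mulp_mulp assms mulp_0)
  show ?thesis
    unfolding rtr_def 1 2 mulp_cmult 3 4 5 by (simp add: fun_eq_iff flip: power_add)
qed

lemma rinv_rtr: assumes "h \<in> Cp" shows "rinv n p q (rtr n p q h) = h"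
proof -
  let ?m = "min p q" and ?M = "max p q"
  define X where "X = mulp (int ?M) ((iop ^^ (?m + n - 1)) h)"
  have X: "X \<in> Cp" unfolding X_def by (intro mulp_Cp iop_pow_Cp assms)
  have 1: "mulp (- int ?m - 1) (rtr n p q h) = (\<lambda>y. (of_real pi ^ (n - 1) * (- 1) ^ ?m) * (dop ^^ ?m) X y)"
    unfolding rtr_def X_def[symmetric] mulp_cmult by (simp add: mulp_mulp dop_pow_Cp X mulp_0)
  have 2: "(iop ^^ ?m) (\<lambda>y. c * (dop ^^ ?m) X y) = (\<lambda>y. c * ((- 1) ^ ?m * X y))" for c
    by (simp only: iop_pow_cmult dop_pow_Cp X iop_dop_pow)
  have 3: "mulp (- int ?M) X = (iop ^^ (?m + n - 1)) h"
    unfolding X_def by (simp add: mulp_mulp iop_pow_Cp assms mulp_0)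
  have 4: "(dop ^^ (?m + n - 1)) (\<lambda>y. c * (iop ^^ (?m + n - 1)) h y) = (\<lambda>y. c * ((- 1) ^ (?m + n - 1) * h y))" for c
    by (simp only: dop_pow_cmult iop_pow_Cp assms dop_iop_pow)
  show ?thesis
    unfolding rinv_def 1 2 mult.assoc[symmetric] mulp_cmult 3 4
    by (simp add: fun_eq_iff minus_one_power_iff flip: power_add)
qed

section \<open>Harmonic polynomials under isometries, and the transform of each type\<close>

lemma harmonic_polysD:
  assumes "Y \<in> harmonic_polys p q"
  shows "Y \<in> polys" "polynomial_function Y" "laplacian Y z = 0" "Y (c *s z) = c ^ p * cnj c ^ q * Y z"
    "Y (r *\<^sub>R z) = of_real r ^ (p + q) * Y z"
  using assms polynomial_function_polys by (auto simp: harmonic_polys_def)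

text \<open>The Laplacian is the trace of the second derivative, regarded as a bilinear form
  \<open>B\<close> of two directions, and a trace does not depend on the orthonormal basis.\<close>

lemma laplacian_isometry:
  fixes f :: "complex^'n \<Rightarrow> complex" and T :: "complex^'n \<Rightarrow> complex^'n"
  assumes f: "f \<in> polys" and T: "linear T" "\<And>x. norm (T x) = norm x"
  shows "laplacian (\<lambda>x. f (T x)) x = laplacian f (T x)"
proof -
  have T_in: "T x \<bullet> T y = x \<bullet> y" for x y
    unfolding dot_norm[of "T x"] dot_norm[of x] linear_add[OF T(1), symmetric] T(2) ..
  have "inj T" unfolding linear_injective_0[OF T(1)] using T(2) by (metis norm_eq_zero)
  then have surj: "surj T" by (rule linear_injective_imp_surjective[OF T(1)]) (rule refl)
  define S where "S = inv T"
  have TS: "T (S x) = x" for x using surj by (simp add: S_def surj_f_inv_f)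
  have adj: "T b \<bullet> c = b \<bullet> S c" for b c using T_in[of b "S c"] TS by simp
  have S_in: "S c \<bullet> S d = c \<bullet> d" for c d using T_in[of "S c" "S d"] TS by simp
  have bl: "bounded_linear T" using T(1) linear_conv_bounded_linear by blast
  define B where "B u w y = frechet_derivative (\<lambda>z. frechet_derivative f (at z) u) (at y) w" for u w y
  have d1: "(f has_derivative frechet_derivative f (at z)) (at z)" for z
    by (rule polys_has_derivative[OF f])
  have d2: "((\<lambda>z. frechet_derivative f (at z) u) has_derivative (\<lambda>w. B u w y)) (at y)" for u y
    using smooth_on_has_derivative[OF smooth_on_frechet_derivative[OF polys_smooth[OF f open_UNIV]]]
    unfolding B_def by auto
  have e1: "frechet_derivative (\<lambda>x. f (T x)) (at y) b = frechet_derivative f (at (T y)) (T b)" for y b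
    by (rule frechet_derivative_at[OF has_derivative_compose[OF bounded_linear_imp_has_derivative[OF bl] d1], symmetric, THEN fun_cong])
  have e2: "frechet_derivative (\<lambda>y. frechet_derivative f (at (T y)) (T b)) (at x) b = B (T b) (T b) (T x)" for b
    by (rule frechet_derivative_at[OF has_derivative_compose[OF bounded_linear_imp_has_derivative[OF bl] d2], symmetric, THEN fun_cong])
  have B1: "B u w y = (\<Sum>c\<in>Basis. (u \<bullet> c) *\<^sub>R B c w y)" for u w y
  proof -
    have "frechet_derivative f (at z) u = (\<Sum>c\<in>Basis. (u \<bullet> c) *\<^sub>R frechet_derivative f (at z) c)" for z
      using linear_sum[OF has_derivative_linear[OF d1[of z]], of "\<lambda>c. (u \<bullet> c) *\<^sub>R c" Basis]
      by (simp add: euclidean_representation linear_scale[OF has_derivative_linear[OF d1[of z]]])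
    then have eq: "(\<lambda>z. frechet_derivative f (at z) u) = (\<lambda>z. \<Sum>c\<in>Basis. (u \<bullet> c) *\<^sub>R frechet_derivative f (at z) c)"
      by (rule ext)
    have "((\<lambda>z. frechet_derivative f (at z) u) has_derivative (\<lambda>w. \<Sum>c\<in>Basis. (u \<bullet> c) *\<^sub>R B c w y)) (at y)"
      unfolding eq by (intro has_derivative_sum has_derivative_scaleR_right d2)
    from has_derivative_unique[OF this d2] show ?thesis by (metis (no_types, lifting))
  qed
  have B2: "B c w y = (\<Sum>d\<in>Basis. (w \<bullet> d) *\<^sub>R B c d y)" for c w y
    using linear_sum[OF has_derivative_linear[OF d2[of c y]], of "\<lambda>c. (w \<bullet> c) *\<^sub>R c" Basis]
    by (simp add: euclidean_representation linear_scale[OF has_derivative_linear[OF d2]])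
  have B3: "B u u y = (\<Sum>c\<in>Basis. \<Sum>d\<in>Basis. ((u \<bullet> c) * (u \<bullet> d)) *\<^sub>R B c d y)" for u y
    by (subst B1, subst B2) (simp add: scaleR_sum_right)
  have "laplacian (\<lambda>x. f (T x)) x = (\<Sum>b\<in>Basis. B (T b) (T b) (T x))"
    unfolding laplacian_def e1 e2 ..
  also have "\<dots> = (\<Sum>b\<in>Basis. \<Sum>c\<in>Basis. \<Sum>d\<in>Basis. ((T b \<bullet> c) * (T b \<bullet> d)) *\<^sub>R B c d (T x))"
    unfolding B3[of "T _"] ..
  also have "\<dots> = (\<Sum>c\<in>Basis. \<Sum>d\<in>Basis. (\<Sum>b\<in>Basis. (T b \<bullet> c) * (T b \<bullet> d)) *\<^sub>R B c d (T x))"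
    unfolding scaleR_sum_left by (rule trans[OF sum.swap sum.cong[OF refl sum.swap]])
  also have "\<dots> = (\<Sum>c\<in>Basis. \<Sum>d\<in>Basis. (c \<bullet> d) *\<^sub>R B c d (T x))"
  proof -
    \<comment> \<open>Parseval's identity for the adjoint S of T, which is its inverse and again an
      isometry.\<close>
    have "(\<Sum>b\<in>Basis. (T b \<bullet> c) * (T b \<bullet> d)) = c \<bullet> d" for c d
    proof -
      have "(\<Sum>b\<in>Basis. (T b \<bullet> c) * (T b \<bullet> d)) = S c \<bullet> S d"
        unfolding adj by (subst euclidean_inner) (simp add: inner_commute)
      then show ?thesis by (simp only: S_in)
    qed
    then show ?thesis by (simp only:)
  qed
  also have "\<dots> = (\<Sum>c\<in>Basis. B c c (T x))"
    by (intro sum.cong refl) (simp add: inner_Basis if_distrib if_distribR sum.delta cong: if_cong)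
  finally show ?thesis by (simp add: laplacian_def B_def)
qed

lemma polynomial_function_linear: "linear T \<Longrightarrow> polynomial_function (T :: 'a::euclidean_space \<Rightarrow> 'b::euclidean_space)"
  by (simp add: polynomial_function_bounded_linear linear_conv_bounded_linear)

lemma harmonic_polys_UM:
  assumes Y: "Y \<in> harmonic_polys p q" and A: "A \<in> UM"
  shows "(\<lambda>x. Y (A x)) \<in> harmonic_polys p q"
proof -
  have "polynomial_function (Y \<circ> A)"
    by (intro polynomial_function_compose polynomial_function_linear UM_linear A harmonic_polysD(2)[OF Y])
  then have "polynomial_function (\<lambda>x. Y (A x))" by (simp add: o_def)
  then show ?thesis
    using Y A unfolding harmonic_polys_def
    by (simp add: laplacian_isometry[OF harmonic_polysD(1)[OF Y] UM_linear[OF A] UM_norm[OF A]]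
        linear_scale[OF UM_linear[OF A]] UM_smult)
qed

lemma linear_cnj_vec: "linear cnj_vec"
  by (rule linearI) (auto simp: cnj_vec_add cnj_vec_smult scaleR_smult)

lemma harmonic_polys_cnj_vec:
  assumes Y: "Y \<in> harmonic_polys p q"
  shows "(\<lambda>x. Y (cnj_vec x)) \<in> harmonic_polys q p"
proof -
  have "polynomial_function (Y \<circ> cnj_vec)"
    by (intro polynomial_function_compose polynomial_function_linear linear_cnj_vec harmonic_polysD(2)[OF Y])
  then have "polynomial_function (\<lambda>x. Y (cnj_vec x))" by (simp add: o_def)
  then show ?thesis
    using Y unfolding harmonic_polys_def
    by (simp add: laplacian_isometry[OF harmonic_polysD(1)[OF Y] linear_cnj_vec norm_cnj_vec]
        linear_scale[OF linear_cnj_vec] cnj_vec_smult add.commute mult_ac)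
qed

text \<open>\<open>tlap_pow_harmonic\<close> and \<open>wlap_pow_line\<close> evaluate the terms of
  \<open>transform_polys_axis\<close>; those with j > min p q are zero, and the rest is the sum of
  \<open>rodrigues\<close> with M = max p q, applied to \<open>(iop ^^ (n - 1)) h\<close>.\<close>

lemma funk_hecke_axis:
  fixes Y :: "complex^'n \<Rightarrow> complex" and k :: 'n
  assumes h: "h \<in> Cp" and Y: "Y \<in> harmonic_polys p q" and \<rho>: "0 < \<rho>"
  shows "transform (\<lambda>x. h ((norm x)\<^sup>2) * Y x) (axis k (of_real \<rho>)) =
    rtr CARD('n) p q h (1 / \<rho>\<^sup>2) * (of_real \<rho> ^ (p + q) * Y (axis k 1))"
proof -
  let ?N = "CARD('n) - 1" and ?m = "min p q" and ?M = "max p q" and ?a = "1 / \<rho>"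
  let ?Y = "Y (axis k 1)"
  have mN: "?m + CARD('n) - 1 = ?m + ?N" by (simp add: Suc_le_eq)
  have Yp: "Y \<in> polys" by (rule harmonic_polysD(1)[OF Y])
  have line: "Y (axis k c) = ?Y * (c ^ p * cnj c ^ q)" for c
  proof -
    have "axis k c = c *s (axis k 1 :: complex^'n)" by (simp add: vec_eq_iff axis_def)
    then show ?thesis using harmonic_polysD(4)[OF Y, of c "axis k 1"] by simp
  qed
  obtain K0 where K0: "\<And>K. K0 \<le> K \<Longrightarrow> transform (\<lambda>x. h ((norm x)\<^sup>2) * Y x) (axis k (of_real \<rho>)) =
    of_real (1 / \<rho>\<^sup>2) * (\<Sum>j\<le>K. (tlap k ^^ j) Y (axis k (of_real ?a)) / fact j *
      (of_real pi ^ ?N * (iop ^^ (?N + j)) h (?a\<^sup>2)))"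
    using transform_polys_axis[OF h \<rho> Yp, of k] by blast
  define K where "K = max K0 ?m"
  have t: "(tlap k ^^ j) Y (axis k (of_real ?a)) = (- 1) ^ j * (?Y * ffall (of_nat p) j * ffall (of_nat q) j *
      (of_real ?a ^ (p - j) * of_real ?a ^ (q - j)))" for j
    unfolding tlap_pow_harmonic[OF Yp harmonic_polysD(3)[OF Y]] wlap_pow_line[OF Yp line] by simp
  \<comment> \<open>The falling factorial of min p q is j! times a binomial coefficient and cancels
    the 1/j! of the series; the other one belongs to max p q.\<close>
  have pq: "ffall (of_nat p) j * ffall (of_nat q) j = (fact j * of_nat (?m choose j)) * ffall (of_int (int ?M)) j" for j
    by (cases "p \<le> q") (simp_all add: min_def max_def ffall_of_nat mult_ac)
  have trm: "of_real (1 / \<rho>\<^sup>2) * ((tlap k ^^ j) Y (axis k (of_real ?a)) / fact j * (of_real pi ^ ?N * (iop ^^ (?N + j)) h (?a\<^sup>2))) =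
      (of_real pi ^ ?N * of_real ((1 / \<rho>\<^sup>2) powi (int ?m + 1)) * (of_real \<rho> ^ (p + q) * ?Y)) *
      ((- 1) ^ j * of_nat (?m choose j) * ffall (of_int (int ?M)) j * mulp (int ?M - int j) ((iop ^^ j) ((iop ^^ ?N) h)) (1 / \<rho>\<^sup>2))"
    if j: "j \<le> ?m" for j
  proof -
    \<comment> \<open>Both sides are powers of 1 / \<rho>. The exponent on the left is 2 + (p - j) +
      (q - j); the exponent 2 (min p q + 1) + 2 (max p q - j) exceeds it by p + q, which
      \<open>\<rho> ^ (p + q)\<close> compensates.\<close>
    have "1 / \<rho>\<^sup>2 * (?a ^ (p - j) * ?a ^ (q - j)) = (1 / \<rho>\<^sup>2) powi (int ?m + 1) * \<rho> ^ (p + q) * (1 / \<rho>\<^sup>2) powi (int ?M - int j)"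
    proof -
      have "(1 / \<rho>\<^sup>2) powi (int ?m + 1) * (1 / \<rho>\<^sup>2) powi (int ?M - int j) = (1 / \<rho>\<^sup>2) powi (int (p + q + 1 - j))"
      proof -
        have "int ?m + 1 + (int ?M - int j) = int (p + q + 1 - j)" using j by auto
        then show ?thesis using \<rho> by (subst power_int_add[symmetric]) auto
      qed
      also have "\<dots> = ?a ^ (2 * (p + q + 1 - j))"
        by (simp only: power_int_of_nat power_mult power_one_over)
      also have "2 * (p + q + 1 - j) = (p + q) + (2 + (p - j) + (q - j))" using j by auto
      also have "?a ^ ((p + q) + (2 + (p - j) + (q - j))) = ?a ^ (p + q) * (?a ^ 2 * (?a ^ (p - j) * ?a ^ (q - j)))"
        by (simp only: power_add mult.assoc)
      finally have *: "(1 / \<rho>\<^sup>2) powi (int ?m + 1) * (1 / \<rho>\<^sup>2) powi (int ?M - int j) =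
          ?a ^ (p + q) * (?a ^ 2 * (?a ^ (p - j) * ?a ^ (q - j)))" .
      have "?a ^ (p + q) * \<rho> ^ (p + q) = 1" using \<rho> by (simp add: power_one_over)
      then have inv: "\<rho> ^ (p + q) * (?a ^ (p + q) * X) = X" for X by (simp add: mult.assoc[symmetric] mult.commute)
      have "?a ^ 2 * (?a ^ (p - j) * ?a ^ (q - j)) =
         \<rho> ^ (p + q) * ((1 / \<rho>\<^sup>2) powi (int ?m + 1) * (1 / \<rho>\<^sup>2) powi (int ?M - int j))" unfolding * inv ..
      then show ?thesis by (simp only: power_one_over mult_ac)
    qed
    then have e: "of_real (1 / \<rho>\<^sup>2) * (of_real ?a ^ (p - j) * of_real ?a ^ (q - j)) =
       (of_real ((1 / \<rho>\<^sup>2) powi (int ?m + 1)) * of_real \<rho> ^ (p + q) * of_real ((1 / \<rho>\<^sup>2) powi (int ?M - int j)) :: complex)"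
      unfolding of_real_power[symmetric] of_real_mult[symmetric] by (rule arg_cong)
    have i: "(iop ^^ (?N + j)) h (?a\<^sup>2) = (iop ^^ j) ((iop ^^ ?N) h) (1 / \<rho>\<^sup>2)"
      unfolding add.commute[of ?N j] funpow_add o_apply by (simp add: power_one_over)
    have "of_real (1 / \<rho>\<^sup>2) * ((tlap k ^^ j) Y (axis k (of_real ?a)) / fact j * (of_real pi ^ ?N * (iop ^^ (?N + j)) h (?a\<^sup>2))) =
      (- 1) ^ j * ?Y * (ffall (of_nat p) j * ffall (of_nat q) j / fact j) *
      (of_real (1 / \<rho>\<^sup>2) * (of_real ?a ^ (p - j) * of_real ?a ^ (q - j))) *
      (of_real pi ^ ?N * (iop ^^ j) ((iop ^^ ?N) h) (1 / \<rho>\<^sup>2))"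
      unfolding t i by (simp only: times_divide_eq_left times_divide_eq_right mult_ac)
    also have "ffall (of_nat p) j * ffall (of_nat q) j / fact j = of_nat (?m choose j) * ffall (of_int (int ?M)) j"
      unfolding pq by simp
    finally show ?thesis unfolding e mulp_def by (simp only: mult_ac)
  qed
  have "transform (\<lambda>x. h ((norm x)\<^sup>2) * Y x) (axis k (of_real \<rho>)) =
     (\<Sum>j\<le>K. of_real (1 / \<rho>\<^sup>2) * ((tlap k ^^ j) Y (axis k (of_real ?a)) / fact j * (of_real pi ^ ?N * (iop ^^ (?N + j)) h (?a\<^sup>2))))"
    unfolding sum_distrib_left[symmetric] by (rule K0) (simp add: K_def)
  also have "\<dots> = (\<Sum>j\<le>?m. of_real (1 / \<rho>\<^sup>2) * ((tlap k ^^ j) Y (axis k (of_real ?a)) / fact j * (of_real pi ^ ?N * (iop ^^ (?N + j)) h (?a\<^sup>2))))"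
  proof (rule sum.mono_neutral_right)
    show "\<forall>j\<in>{..K} - {..?m}. of_real (1 / \<rho>\<^sup>2) * ((tlap k ^^ j) Y (axis k (of_real ?a)) / fact j * (of_real pi ^ ?N * (iop ^^ (?N + j)) h (?a\<^sup>2))) = 0"
    proof
      fix j assume "j \<in> {..K} - {..?m}"
      then have "?m < j" by auto
      then have "?m choose j = 0" by (rule binomial_eq_0)
      then have "ffall (of_nat p) j * ffall (of_nat q) j = 0" unfolding pq by simp
      then show "of_real (1 / \<rho>\<^sup>2) * ((tlap k ^^ j) Y (axis k (of_real ?a)) / fact j * (of_real pi ^ ?N * (iop ^^ (?N + j)) h (?a\<^sup>2))) = 0"
        unfolding t by auto
    qed
  qed (auto simp: K_def)
  also have "\<dots> = (of_real pi ^ ?N * of_real ((1 / \<rho>\<^sup>2) powi (int ?m + 1)) * (of_real \<rho> ^ (p + q) * ?Y)) *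
     (\<Sum>j\<le>?m. (- 1) ^ j * of_nat (?m choose j) * ffall (of_int (int ?M)) j * mulp (int ?M - int j) ((iop ^^ j) ((iop ^^ ?N) h)) (1 / \<rho>\<^sup>2))"
    unfolding sum_distrib_left by (intro sum.cong refl trm) simp
  also have "\<dots> = (of_real pi ^ ?N * of_real ((1 / \<rho>\<^sup>2) powi (int ?m + 1)) * (of_real \<rho> ^ (p + q) * ?Y)) *
     ((- 1) ^ ?m * (dop ^^ ?m) (mulp (int ?M) ((iop ^^ ?m) ((iop ^^ ?N) h))) (1 / \<rho>\<^sup>2))"
    unfolding rodrigues[OF iop_pow_Cp[OF h]] ..
  also have "(iop ^^ ?m) ((iop ^^ ?N) h) = (iop ^^ (?m + CARD('n) - 1)) h"
    unfolding mN funpow_add o_apply ..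
  finally show ?thesis
    unfolding rtr_def mulp_def by (simp only: mult_ac)
qed

text \<open>The value on an axis is known for every Y of type p, q, in particular after composing Y
  with a unitary map; equivariance then reaches every \<xi>, and homogeneity of Y cancels the powers
  of \<rho>.\<close>

theorem funk_hecke:
  fixes Y :: "complex^'n \<Rightarrow> complex"
  assumes h: "h \<in> Cp" and Y: "Y \<in> harmonic_polys p q" and \<xi>: "\<xi> \<noteq> 0"
  shows "transform (\<lambda>x. h ((norm x)\<^sup>2) * Y x) \<xi> = rtr CARD('n) p q h (1 / (norm \<xi>)\<^sup>2) * Y (cnj_vec \<xi>)"
proof -
  obtain k :: 'n where True by simp
  define \<rho> where "\<rho> = norm \<xi>"
  have \<rho>: "0 < \<rho>" using \<xi> by (simp add: \<rho>_def)
  obtain B where B: "B \<in> UM" "B (axis k 1) = (1 / of_real \<rho>) *s \<xi>"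
    using UM_transitive[of "(1 / of_real \<rho>) *s \<xi>" k] \<rho> by (auto simp: norm_smult norm_divide \<rho>_def)
  \<comment> \<open>Equivariance involves the conjugate of A; with A itself a conjugate, the axis
    point is sent to \<xi> by B.\<close>
  define A where "A = (\<lambda>x. cnj_vec (B (cnj_vec x)))"
  have A: "A \<in> UM" unfolding A_def by (rule UM_conj[OF B(1)])
  have ax: "axis k (of_real \<rho>) = of_real \<rho> *s (axis k 1 :: complex^'n)" by (simp add: vec_eq_iff axis_def)
  have cax: "cnj_vec (axis k 1) = (axis k 1 :: complex^'n)" by (simp add: vec_eq_iff axis_def cnj_vec_def)
  have AB: "cnj_vec (A (cnj_vec (axis k (of_real \<rho>)))) = \<xi>"
    using \<rho> unfolding A_def ax by (simp add: UM_smult[OF B(1)] B(2) vector_smult_assoc)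
  have Ae: "A (axis k 1) = (1 / of_real \<rho>) *s cnj_vec \<xi>"
    unfolding A_def cax B(2) cnj_vec_smult by simp
  have "transform (\<lambda>x. h ((norm x)\<^sup>2) * Y x) \<xi> = transform (\<lambda>x. h ((norm (A x))\<^sup>2) * Y (A x)) (axis k (of_real \<rho>))"
    using transform_UM[OF pc_radial[OF h polys_continuous[OF harmonic_polysD(1)[OF Y]]] A, of "axis k (of_real \<rho>)"] AB by simp
  also have "\<dots> = rtr CARD('n) p q h (1 / \<rho>\<^sup>2) * (of_real \<rho> ^ (p + q) * Y (A (axis k 1)))"
    unfolding UM_norm[OF A] by (rule funk_hecke_axis[OF h harmonic_polys_UM[OF Y A] \<rho>])
  also have "Y (A (axis k 1)) = (1 / of_real \<rho>) ^ (p + q) * Y (cnj_vec \<xi>)"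
    unfolding Ae harmonic_polysD(4)[OF Y] by (simp add: power_add)
  also have "of_real \<rho> ^ (p + q) * ((1 / of_real \<rho>) ^ (p + q) * Y (cnj_vec \<xi>)) = Y (cnj_vec \<xi>)"
    using \<rho> by (simp add: power_one_over)
  finally show ?thesis by (simp add: \<rho>_def)
qed

section \<open>Finite-dimensional spaces of functions\<close>

lemma sub_zero: "cfun.subspace V \<Longrightarrow> (\<lambda>x. 0) \<in> V"
  using cfun.subspace_0[of V] by (simp add: zero_fun_def)

lemma sub_add: "cfun.subspace V \<Longrightarrow> f \<in> V \<Longrightarrow> g \<in> V \<Longrightarrow> (\<lambda>x. f x + g x) \<in> V"
  using cfun.subspace_add[of V f g] by (simp add: plus_fun_def)

lemma sub_scale: "cfun.subspace V \<Longrightarrow> f \<in> V \<Longrightarrow> (\<lambda>x. c * f x) \<in> V"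
  by (rule cfun.subspace_scale)

lemma sub_diff: "cfun.subspace V \<Longrightarrow> f \<in> V \<Longrightarrow> g \<in> V \<Longrightarrow> (\<lambda>x. f x - g x) \<in> V"
  using sub_add[OF _ _ sub_scale, of V f g "- 1"] by simp

lemma sub_sum: "cfun.subspace V \<Longrightarrow> (\<And>i. i \<in> I \<Longrightarrow> f i \<in> V) \<Longrightarrow> (\<lambda>x. \<Sum>i\<in>I. f i x) \<in> V"
  by (induction I rule: infinite_finite_induct) (auto intro: sub_zero sub_add)

lemma subspaceI:
  assumes "(\<lambda>x. 0) \<in> V" "\<And>f g. f \<in> V \<Longrightarrow> g \<in> V \<Longrightarrow> (\<lambda>x. f x + g x) \<in> V" "\<And>c f. f \<in> V \<Longrightarrow> (\<lambda>x. c * f x) \<in> V"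
  shows "cfun.subspace V"
  using assms by (auto intro!: cfun.subspaceI simp: zero_fun_def plus_fun_def)

definition fd :: "('a \<Rightarrow> complex) set \<Rightarrow> bool" where
  "fd V \<longleftrightarrow> cfun.subspace V \<and> (\<exists>B. finite B \<and> V \<subseteq> cfun.span B)"

lemma fd_subspace: "fd V \<Longrightarrow> cfun.subspace V"
  by (simp add: fd_def)

lemma fd_subset: "fd V \<Longrightarrow> cfun.subspace W \<Longrightarrow> W \<subseteq> V \<Longrightarrow> fd W"
  unfolding fd_def by blast

lemma fd_basis:
  assumes "fd V" obtains B where "finite B" "V = cfun.span B"
proof -
  obtain B0 where B0: "finite B0" "V \<subseteq> cfun.span B0" and V: "cfun.subspace V" using assms by (auto simp: fd_def)
  obtain B where B: "B \<subseteq> V" "cfun.independent B" "V \<subseteq> cfun.span B"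
    using cfun.maximal_independent_subset[of V] by blast
  have "finite B"
    using cfun.independent_span_bound[OF B0(1) B(2)] B(1) B0(2) by blast
  moreover have "V = cfun.span B" using B(1,3) V cfun.span_minimal by blast
  ultimately show thesis by (rule that)
qed

text \<open>Evaluation at finitely many points is a coordinate system on a finite-dimensional space
  of functions, with \<open>e\<close> as dual basis. Limits, eigenvalue bounds and definiteness are
  all reduced to these evaluations.\<close>

lemma dual_points:
  fixes B :: "('a \<Rightarrow> complex) set"
  assumes "finite B"
  shows "\<exists>X e. finite X \<and> (\<forall>x\<in>X. e x \<in> cfun.span B) \<and> (\<forall>x\<in>X. \<forall>y\<in>X. e x y = (if x = y then 1 else 0)) \<and>
    (\<forall>F\<in>cfun.span B. \<forall>z. F z = (\<Sum>x\<in>X. F x * e x z))"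
  using assms
proof (induction B rule: finite_induct)
  case empty
  then show ?case
    by (intro exI[of _ "{}"]) (simp add: cfun.span_empty zero_fun_def)
next
  case (insert b B)
  obtain X e where IH: "finite X \<and> (\<forall>x\<in>X. e x \<in> cfun.span B) \<and>
      (\<forall>x\<in>X. \<forall>y\<in>X. e x y = (if x = y then 1 else 0)) \<and> (\<forall>F\<in>cfun.span B. \<forall>z. F z = (\<Sum>x\<in>X. F x * e x z))"
    using insert.IH by (elim exE)
  have X: "finite X" "\<And>x. x \<in> X \<Longrightarrow> e x \<in> cfun.span B"
    and d: "\<And>x y. x \<in> X \<Longrightarrow> y \<in> X \<Longrightarrow> e x y = (if x = y then 1 else 0)"
    and r: "\<And>F z. F \<in> cfun.span B \<Longrightarrow> F z = (\<Sum>x\<in>X. F x * e x z)"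
    using IH by simp_all
  have sub: "cfun.span B \<subseteq> cfun.span (insert b B)" by (rule cfun.span_mono) auto
  \<comment> \<open>The interpolation error of the new generator at the points found so far; it
    vanishes at all of them.\<close>
  define b' where "b' z = b z - (\<Sum>x\<in>X. b x * e x z)" for z
  have b'X: "b' y = 0" if "y \<in> X" for y
  proof -
    have "(\<Sum>x\<in>X. b x * e x y) = (\<Sum>x\<in>X. if x = y then b x else 0)"
      using d that by (intro sum.cong) auto
    then show ?thesis using that X(1) by (simp add: b'_def)
  qed
  have dec: "\<exists>c. (\<lambda>z. F z - c * b z) \<in> cfun.span B" if F: "F \<in> cfun.span (insert b B)" for F
    using F cfun.span_breakdown_eq[of F b B] by (auto simp: fun_diff_def)
  show ?case
  proof (cases "\<forall>z. b' z = 0")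
    case True
    have "F z = (\<Sum>x\<in>X. F x * e x z)" if F: "F \<in> cfun.span (insert b B)" for F z
    proof -
      obtain c where c: "(\<lambda>z. F z - c * b z) \<in> cfun.span B" using dec[OF F] by (elim exE)
      define G where "G z = F z - c * b z" for z
      have G: "G \<in> cfun.span B" "\<And>z. F z = c * b z + G z" using c by (simp_all add: G_def[abs_def])
      have bz: "b z = (\<Sum>x\<in>X. b x * e x z)" using spec[OF True, of z] unfolding b'_def by (rule right_minus_eq[THEN iffD1])
      have "F z = c * (\<Sum>x\<in>X. b x * e x z) + (\<Sum>x\<in>X. G x * e x z)"
        unfolding bz[symmetric] r[OF G(1), of z, symmetric] by (rule G(2))
      then show ?thesis unfolding G(2) by (simp add: sum_distrib_left distrib_right sum.distrib mult.assoc)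
    qed
    then show ?thesis using X d sub by (intro exI[of _ X] exI[of _ e]) auto
  next
    case False
    then obtain x0 where x0: "b' x0 \<noteq> 0" by blast
    then have x0X: "x0 \<notin> X" using b'X by blast
    \<comment> \<open>A point where the error is nonzero joins X. The normalised error is its dual
      function, and the old dual functions are corrected so as to vanish there.\<close>
    define e0 where "e0 z = b' z / b' x0" for z
    define e' where "e' x = (if x = x0 then e0 else (\<lambda>z. e x z - e x x0 * e0 z))" for x
    have bsp: "b \<in> cfun.span (insert b B)" by (rule cfun.span_base) simp
    have esp: "e x \<in> cfun.span (insert b B)" if "x \<in> X" for x using X(2)[OF that] sub by blast
    have "b' \<in> cfun.span (insert b B)"
      unfolding b'_def[abs_def] using bsp esp
      by (intro sub_diff[OF cfun.subspace_span] cfun_sum cfun_scale)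
    then have e0: "e0 \<in> cfun.span (insert b B)"
      unfolding e0_def[abs_def] using cfun_scale[of b' _ "1 / b' x0"] by simp
    have e0X: "e0 y = 0" if "y \<in> X" for y using b'X[OF that] by (simp add: e0_def)
    have e00: "e0 x0 = 1" using x0 by (simp add: e0_def)
    have "F z = (\<Sum>x\<in>insert x0 X. F x * e' x z)" if F: "F \<in> cfun.span (insert b B)" for F z
    proof -
      have s: "(\<Sum>x\<in>insert x0 X. F x * e' x z) = F x0 * e0 z + ((\<Sum>x\<in>X. F x * e x z) - (\<Sum>x\<in>X. F x * e x x0) * e0 z)" for F
      proof -
        have "(\<Sum>x\<in>X. F x * e' x z) = (\<Sum>x\<in>X. F x * e x z - (F x * e x x0) * e0 z)"
          using x0X by (intro sum.cong) (auto simp: e'_def algebra_simps)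
        then show ?thesis
          using X(1) x0X by (simp add: e'_def sum_subtractf sum_distrib_right)
      qed
      have 1: "G z = (\<Sum>x\<in>insert x0 X. G x * e' x z)" if "G \<in> cfun.span B" for G
        unfolding s using r[OF that, of z] r[OF that, of x0] by simp
      have 2: "b z = (\<Sum>x\<in>insert x0 X. b x * e' x z)"
      proof -
        have e: "(\<Sum>x\<in>X. b x * e x x0) = b x0 - b' x0" "(\<Sum>x\<in>X. b x * e x z) = b z - b' z" by (simp_all add: b'_def)
        have "b' x0 * e0 z = b' z" using x0 by (simp add: e0_def)
        then show ?thesis unfolding s e by (simp add: left_diff_distrib)
      qed
      obtain c where c: "(\<lambda>z. F z - c * b z) \<in> cfun.span B" using dec[OF F] by (elim exE)
      define G where "G z = F z - c * b z" for z
      have G: "G \<in> cfun.span B" "\<And>z. F z = c * b z + G z" using c by (simp_all add: G_def[abs_def])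
      have "F z = c * (\<Sum>x\<in>insert x0 X. b x * e' x z) + (\<Sum>x\<in>insert x0 X. G x * e' x z)"
        using G(2)[of z] 1[OF G(1)] 2 by simp
      then show ?thesis unfolding G(2) by (simp add: sum_distrib_left distrib_right sum.distrib mult.assoc)
    qed
    moreover have "e' x y = (if x = y then 1 else 0)" if "x \<in> insert x0 X" "y \<in> insert x0 X" for x y
      using that d[of x y] e0X e00 x0X by (auto simp: e'_def)
    moreover have "e' x \<in> cfun.span (insert b B)" if "x \<in> insert x0 X" for x
    proof (cases "x = x0")
      case True
      then show ?thesis using e0 by (simp add: e'_def)
    next
      case False
      then show ?thesis
        using that sub_diff[OF cfun.subspace_span esp cfun_scale[OF e0, of "e x x0"], of x] by (simp add: e'_def)
    qed
    ultimately show ?thesis using X(1) by (intro exI[of _ "insert x0 X"] exI[of _ e']) simp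
  qed
qed

lemma fd_dual:
  assumes "fd V"
  shows "\<exists>X e. finite X \<and> (\<forall>x\<in>X. e x \<in> V) \<and> (\<forall>F\<in>V. \<forall>z. F z = (\<Sum>x\<in>X. F x * e x z))"
proof -
  obtain B where B: "finite B" "V = cfun.span B" using fd_basis[OF assms] by metis
  obtain X e where "finite X \<and> (\<forall>x\<in>X. e x \<in> cfun.span B) \<and>
      (\<forall>x\<in>X. \<forall>y\<in>X. e x y = (if x = y then 1 else 0)) \<and> (\<forall>F\<in>cfun.span B. \<forall>z. F z = (\<Sum>x\<in>X. F x * e x z))"
    using dual_points[OF B(1)] by (elim exE)
  then show ?thesis using B(2) by (intro exI[of _ X] exI[of _ e]) simp
qed

text \<open>Coordinates are values at finitely many points, so they converge along with the
  functions. Applied to difference quotients, this keeps derivatives of the group action inside an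
  invariant space.\<close>

lemma fd_closed:
  assumes "fd V" "\<And>k. F k \<in> V" "\<And>z. (\<lambda>k::nat. F k z) \<longlonglongrightarrow> G z"
  shows "G \<in> V"
proof -
  obtain X e where "finite X \<and> (\<forall>x\<in>X. e x \<in> V) \<and> (\<forall>F\<in>V. \<forall>z. F z = (\<Sum>x\<in>X. F x * e x z))"
    using fd_dual[OF assms(1)] by (elim exE)
  then have X: "finite X" "\<And>x. x \<in> X \<Longrightarrow> e x \<in> V" "\<And>F z. F \<in> V \<Longrightarrow> F z = (\<Sum>x\<in>X. F x * e x z)"
    by simp_all
  have "G z = (\<Sum>x\<in>X. G x * e x z)" for z
  proof (rule LIMSEQ_unique)
    show "(\<lambda>k. F k z) \<longlonglongrightarrow> G z" by (rule assms(3))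
    have "(\<lambda>k. \<Sum>x\<in>X. F k x * e x z) \<longlonglongrightarrow> (\<Sum>x\<in>X. G x * e x z)"
      by (intro tendsto_sum tendsto_mult tendsto_const assms(3))
    then show "(\<lambda>k. F k z) \<longlonglongrightarrow> (\<Sum>x\<in>X. G x * e x z)"
      unfolding X(3)[OF assms(2), of _ z, symmetric] .
  qed
  then have "G = (\<lambda>z. \<Sum>x\<in>X. G x * e x z)" by (rule ext)
  also have "\<dots> \<in> V" using X(2) fd_subspace[OF assms(1)] by (intro sub_sum sub_scale)
  finally show ?thesis .
qed

definition lin_on :: "('a \<Rightarrow> complex) set \<Rightarrow> (('a \<Rightarrow> complex) \<Rightarrow> 'a \<Rightarrow> complex) \<Rightarrow> bool" where
  "lin_on V T \<longleftrightarrow> (\<forall>f\<in>V. T f \<in> V) \<and> (\<forall>f\<in>V. \<forall>g\<in>V. T (\<lambda>x. f x + g x) = (\<lambda>x. T f x + T g x)) \<and>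
     (\<forall>c. \<forall>f\<in>V. T (\<lambda>x. c * f x) = (\<lambda>x. c * T f x))"

lemma lin_onD:
  assumes "lin_on V T"
  shows "f \<in> V \<Longrightarrow> T f \<in> V" "f \<in> V \<Longrightarrow> g \<in> V \<Longrightarrow> T (\<lambda>x. f x + g x) = (\<lambda>x. T f x + T g x)"
    "f \<in> V \<Longrightarrow> T (\<lambda>x. c * f x) = (\<lambda>x. c * T f x)"
  using assms by (auto simp: lin_on_def)

lemma lin_on_sum:
  assumes "cfun.subspace V" "lin_on V T" "\<And>i. i \<in> I \<Longrightarrow> f i \<in> V"
  shows "T (\<lambda>x. \<Sum>i\<in>I. f i x) = (\<lambda>x. \<Sum>i\<in>I. T (f i) x)"
proof -
  have z: "T (\<lambda>x. 0) = (\<lambda>x. 0)" using lin_onD(3)[OF assms(2) sub_zero[OF assms(1)], of 0] by simp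
  show ?thesis
    using assms(3)
  proof (induction I rule: infinite_finite_induct)
    case (insert i I)
    then show ?case by (simp add: lin_onD(2)[OF assms(2)] sub_sum[OF assms(1)])
  qed (simp_all add: z)
qed

text \<open>At a point of X where w is largest in modulus, the eigenvalue equation bounds c by a row
  sum of the matrix of T in the basis \<open>e\<close>. The condition at \<open>x0\<close> expresses
  that w is nonzero.\<close>

lemma eigenvalue_bounded:
  assumes V: "fd V" and T: "lin_on V T"
  obtains C where "\<And>w c. w \<in> V \<Longrightarrow> w x0 \<noteq> 0 \<Longrightarrow> T w = (\<lambda>x. c * w x) \<Longrightarrow> norm c \<le> C"
proof -
  note sub = fd_subspace[OF V]
  obtain X e where "finite X \<and> (\<forall>x\<in>X. e x \<in> V) \<and> (\<forall>F\<in>V. \<forall>z. F z = (\<Sum>x\<in>X. F x * e x z))"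
    using fd_dual[OF V] by (elim exE)
  then have X: "finite X" "\<And>x. x \<in> X \<Longrightarrow> e x \<in> V" "\<And>F z. F \<in> V \<Longrightarrow> F z = (\<Sum>x\<in>X. F x * e x z)"
    by simp_all
  define C where "C = (\<Sum>x\<in>X. \<Sum>y\<in>X. norm (T (e y) x))"
  have "norm c \<le> C" if w: "w \<in> V" "w x0 \<noteq> 0" "T w = (\<lambda>x. c * w x)" for w c
  proof -
    have "w x0 = (\<Sum>x\<in>X. w x * e x x0)" by (rule X(3)[OF w(1)])
    moreover have "(\<Sum>x\<in>X. w x * e x x0) = 0" if "\<forall>x\<in>X. w x = 0"
      using that by (intro sum.neutral) simp
    ultimately have "\<exists>x\<in>X. w x \<noteq> 0" using w(2) by (cases "\<forall>x\<in>X. w x = 0") auto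
    then have ne: "X \<noteq> {}" by auto
    define M where "M = Max ((\<lambda>x. norm (w x)) ` X)"
    have M: "norm (w x) \<le> M" if "x \<in> X" for x using that X(1) by (simp add: M_def)
    have "M \<in> (\<lambda>x. norm (w x)) ` X" unfolding M_def using X(1) ne by (intro Max_in) auto
    then obtain x where x: "x \<in> X" "norm (w x) = M" by auto
    have Mpos: "0 < M"
    proof -
      obtain y where "y \<in> X" "w y \<noteq> 0" using \<open>\<exists>x\<in>X. w x \<noteq> 0\<close> by blast
      then show ?thesis using M[of y] by (meson less_le_trans zero_less_norm_iff)
    qed
    have "w = (\<lambda>z. \<Sum>y\<in>X. w y * e y z)" using X(3)[OF w(1)] by (rule ext)
    then have "T w = T (\<lambda>z. \<Sum>y\<in>X. w y * e y z)" by (rule arg_cong)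
    also have "\<dots> = (\<lambda>z. \<Sum>y\<in>X. w y * T (e y) z)"
      using X(2) by (subst lin_on_sum[OF sub T]) (auto simp: lin_onD(3)[OF T] intro: sub_scale[OF sub])
    finally have "c * w x = (\<Sum>y\<in>X. w y * T (e y) x)" unfolding w(3) by (rule fun_cong)
    then have "norm c * M = norm (\<Sum>y\<in>X. w y * T (e y) x)" using x(2) by (metis norm_mult)
    also have "\<dots> \<le> (\<Sum>y\<in>X. M * norm (T (e y) x))"
      by (rule sum_norm_le) (auto simp: norm_mult intro!: mult_right_mono M)
    also have "\<dots> = M * (\<Sum>y\<in>X. norm (T (e y) x))" by (simp add: sum_distrib_left)
    also have "(\<Sum>y\<in>X. norm (T (e y) x)) \<le> C"
      unfolding C_def
      by (rule member_le_sum[OF x(1), of "\<lambda>x. \<Sum>y\<in>X. norm (T (e y) x)"]) (auto intro: sum_nonneg X(1))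
    finally show ?thesis using Mpos by (simp add: mult.commute)
  qed
  then show thesis by (rule that)
qed

lemma span_image_sum:
  assumes "finite A" "f \<in> cfun.span (g ` A)"
  shows "\<exists>c. \<forall>x. f x = (\<Sum>a\<in>A. c a * g a x)"
  using assms(2)
proof (induction rule: cfun_span_induct)
  case (base b)
  then obtain a where a: "a \<in> A" "b = g a" by (elim imageE)
  then show ?case using assms(1) by (intro exI[of _ "\<lambda>i. if i = a then 1 else 0"]) (simp add: if_distrib if_distribR sum.delta cong: if_cong)
next
  case zero
  show ?case by (intro exI[of _ "\<lambda>_. 0"]) simp
next
  case (add f h)
  then obtain c d where "\<forall>x. f x = (\<Sum>a\<in>A. c a * g a x)" "\<forall>x. h x = (\<Sum>a\<in>A. d a * g a x)" by (elim exE)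
  then show ?case by (intro exI[of _ "\<lambda>a. c a + d a"]) (simp add: distrib_right sum.distrib)
next
  case (scale k f)
  then obtain c where "\<forall>x. f x = (\<Sum>a\<in>A. c a * g a x)" by (elim exE)
  then show ?case by (intro exI[of _ "\<lambda>a. k * c a"]) (simp add: sum_distrib_left mult.assoc)
qed

text \<open>The iterates of v first become dependent at some k, with a monic relation P. For a
  complex root \<mu> of P with cofactor Q, the vector w = Q(T) v is killed by T - \<mu>, and it is
  nonzero because Q has smaller degree than the first relation.\<close>

lemma eigenvector_exists:
  assumes V: "fd V" and T: "lin_on V T" and v: "v \<in> V" "v x0 \<noteq> 0"
  obtains w c where "w \<in> V" "w \<noteq> (\<lambda>x. 0)" "T w = (\<lambda>x. c * w x)"
proof -
  note sub = fd_subspace[OF V]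
  define t where "t j = (T ^^ j) v" for j
  have tV: "t j \<in> V" for j unfolding t_def by (induction j) (auto simp: v lin_onD(1)[OF T])
  have Tt: "T (t j) = t (Suc j)" for j by (simp add: t_def)
  \<comment> \<open>Otherwise the iterates would provide arbitrarily many independent vectors in a
    finite span.\<close>
  have "\<exists>k. t k \<in> cfun.span (t ` {..<k})"
  proof (rule ccontr)
    assume n: "\<not> ?thesis"
    obtain B where B: "finite B" "V \<subseteq> cfun.span B" using V by (auto simp: fd_def)
    have "cfun.independent (t ` {..<k}) \<and> card (t ` {..<k}) = k" for k
    proof (induction k)
      case 0
      show ?case using cfun.independent_empty by simp
    next
      case (Suc k)
      have nk: "t k \<notin> cfun.span (t ` {..<k})" using n by simp
      then have "t k \<notin> t ` {..<k}" using cfun.span_base[of "t k" "t ` {..<k}"] by auto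
      then show ?case using Suc nk by (simp add: lessThan_Suc cfun.independent_insert)
    qed
    note ind = this[of "Suc (card B)"]
    have "t ` {..<Suc (card B)} \<subseteq> cfun.span B" using B(2) tV by auto
    then have "card (t ` {..<Suc (card B)}) \<le> card B"
      using cfun.independent_span_bound[OF B(1) conjunct1[OF ind]] by simp
    then show False using conjunct2[OF ind] by linarith
  qed
  then obtain k where "t k \<in> cfun.span (t ` {..<k}) \<and> (\<forall>j<k. t j \<notin> cfun.span (t ` {..<j}))"
    unfolding exists_least_iff[of "\<lambda>k. t k \<in> cfun.span (t ` {..<k})"] by (elim exE)
  then have k: "t k \<in> cfun.span (t ` {..<k})" "\<And>j. j < k \<Longrightarrow> t j \<notin> cfun.span (t ` {..<j})"
    by simp_all
  have "k \<noteq> 0"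
  proof
    assume "k = 0"
    then have "v = (\<lambda>x. 0)" using k(1) by (simp add: t_def zero_fun_def)
    then show False using v by simp
  qed
  then obtain k' where k': "k = Suc k'" using not0_implies_Suc by blast
  obtain c where c: "\<And>x. t k x = (\<Sum>j<k. c j * t j x)"
    using span_image_sum[OF _ k(1)] by auto
  define P where "P = monom 1 k - (\<Sum>j<k. monom (c j) j)"
  have cP: "coeff P i = (if i = k then 1 else if i < k then - c i else 0)" for i
    by (simp add: P_def coeff_sum)
  have dP: "degree P = k"
    by (rule antisym, rule degree_le) (auto simp: cP intro: le_degree)
  obtain \<mu> where "(\<Sum>i\<le>k. coeff P i * \<mu> ^ i) = 0"
    by (rule fundamental_theorem_of_algebra[of "coeff P" k]) (use k' in \<open>auto simp: cP intro!: bexI[of _ k]\<close>)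
  then have "poly P \<mu> = 0" by (simp add: poly_altdef dP)
  then obtain Q where Q: "P = [:- \<mu>, 1:] * Q" by (auto simp: poly_eq_0_iff_dvd)
  have P0: "P \<noteq> 0" using dP k' by auto
  have dQ: "degree Q = k'"
  proof -
    have "Q \<noteq> 0" using P0 Q by auto
    then have "degree P = Suc (degree Q)" unfolding Q by (subst degree_mult_eq) auto
    then show ?thesis using dP k' by simp
  qed
  have cQ: "coeff P (Suc i) = coeff Q i - \<mu> * coeff Q (Suc i)" "coeff P 0 = - \<mu> * coeff Q 0" for i
    unfolding Q by (simp_all add: coeff_mult_0)
  have Qk: "coeff Q k' = 1" using cQ(1)[of k'] dQ by (simp add: cP k' coeff_eq_0)
  define w where "w x = (\<Sum>j\<le>k'. coeff Q j * t j x)" for x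
  have wV: "w \<in> V" unfolding w_def[abs_def] by (intro sub_sum sub_scale sub tV)
  have "w \<noteq> (\<lambda>x. 0)"
  proof
    assume w0: "w = (\<lambda>x. 0)"
    have "t k' = (\<lambda>x. \<Sum>j<k'. - coeff Q j * t j x)"
    proof
      fix x
      have "0 = w x" using w0 by simp
      also have "\<dots> = (\<Sum>j<k'. coeff Q j * t j x) + t k' x"
        by (simp add: w_def lessThan_Suc_atMost[symmetric] Qk)
      finally show "t k' x = (\<Sum>j<k'. - coeff Q j * t j x)" by (simp add: sum_negf eq_neg_iff_add_eq_0 add.commute)
    qed
    moreover have "(\<lambda>x. \<Sum>j<k'. - coeff Q j * t j x) \<in> cfun.span (t ` {..<k'})"
      by (intro cfun_sum cfun_scale cfun.span_base) auto
    ultimately show False using k(2)[of k'] k' by simp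
  qed
  moreover have "T w = (\<lambda>x. \<mu> * w x)"
  proof
    fix x
    have "T w x = (\<Sum>j\<le>k'. coeff Q j * t (Suc j) x)"
      unfolding w_def[abs_def]
      by (subst lin_on_sum[OF sub T]) (auto simp: lin_onD(3)[OF T tV] Tt intro: sub_scale[OF sub tV])
    also have "\<dots> = (\<Sum>j\<le>k'. coeff P (Suc j) * t (Suc j) x) + \<mu> * (\<Sum>j\<le>k'. coeff Q (Suc j) * t (Suc j) x)"
      unfolding cQ by (simp add: algebra_simps sum.distrib sum_subtractf sum_distrib_left)
    also have "(\<Sum>j\<le>k'. coeff Q (Suc j) * t (Suc j) x) = w x - coeff Q 0 * t 0 x"
    proof -
      have "w x = (\<Sum>j\<le>Suc k'. coeff Q j * t j x)" using dQ by (simp add: w_def coeff_eq_0)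
      then have "w x = coeff Q 0 * t 0 x + (\<Sum>j\<le>k'. coeff Q (Suc j) * t (Suc j) x)"
        unfolding sum.atMost_Suc_shift .
      then show ?thesis by simp
    qed
    also have "(\<Sum>j\<le>k'. coeff P (Suc j) * t (Suc j) x) = - coeff P 0 * t 0 x"
    proof -
      have "(\<Sum>j\<le>k. coeff P j * t j x) = 0"
        using c[of x] by (simp add: lessThan_Suc_atMost[symmetric] cP sum_negf)
      then have "coeff P 0 * t 0 x + (\<Sum>j\<le>k'. coeff P (Suc j) * t (Suc j) x) = 0"
        unfolding k' sum.atMost_Suc_shift .
      then show ?thesis by (simp add: eq_neg_iff_add_eq_0 add.commute)
    qed
    finally show "T w x = \<mu> * w x" unfolding cQ(2) by (simp add: algebra_simps)
  qed
  ultimately show thesis using wV by (intro that[of w \<mu>])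
qed

text \<open>The derivative as the limit of a sequence, the form in which \<open>fd_closed\<close>
  can use it.\<close>

lemma vector_derivative_sequence:
  fixes f :: "real \<Rightarrow> complex"
  assumes "(f has_vector_derivative D) (at 0)"
  shows "(\<lambda>n. of_real (real (Suc n)) * (f (inverse (real (Suc n))) - f 0)) \<longlonglongrightarrow> D"
proof -
  have "(\<lambda>h. norm (f (0 + h) - f 0 - h *\<^sub>R D) / norm h) \<midarrow>0\<rightarrow> 0"
    using assms by (simp add: has_vector_derivative_def has_derivative_at)
  moreover have "filterlim (\<lambda>n. inverse (real (Suc n))) (at 0) sequentially"
    unfolding filterlim_at using LIMSEQ_inverse_real_of_nat by auto
  ultimately have "(\<lambda>n. norm (f (0 + inverse (real (Suc n))) - f 0 - inverse (real (Suc n)) *\<^sub>R D) / norm (inverse (real (Suc n)))) \<longlonglongrightarrow> 0"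
    by (rule filterlim_compose)
  moreover have "norm (f (0 + inverse (real (Suc n))) - f 0 - inverse (real (Suc n)) *\<^sub>R D) / norm (inverse (real (Suc n))) =
      norm (of_real (real (Suc n)) * (f (inverse (real (Suc n))) - f 0) - D)" for n
  proof -
    have "of_real (real (Suc n)) * (f (inverse (real (Suc n))) - f 0) - D =
        of_real (real (Suc n)) * (f (0 + inverse (real (Suc n))) - f 0 - inverse (real (Suc n)) *\<^sub>R D)"
      by (simp add: scaleR_conv_of_real algebra_simps del: of_nat_Suc)
    then show ?thesis by (simp only: norm_mult norm_of_real) (simp add: divide_inverse mult.commute)
  qed
  ultimately show ?thesis
    by (simp only: tendsto_norm_zero_iff LIM_zero_iff)
qed

section \<open>Highest weight vectors\<close>

lemma norm_square_vec: "(norm (x::complex^'n))\<^sup>2 = (\<Sum>l\<in>UNIV. (norm (x $ l))\<^sup>2)"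
  by (simp add: norm_vec_def L2_set_def sum_nonneg)

section \<open>One-parameter families of unitary maps\<close>

definition circ :: "'n \<Rightarrow> real \<Rightarrow> complex^'n \<Rightarrow> complex^'n" where
  "circ i \<theta> x = (\<chi> l. if l = i then cis \<theta> * x $ l else x $ l)"

definition rot :: "'n \<Rightarrow> 'n \<Rightarrow> complex \<Rightarrow> real \<Rightarrow> complex^'n \<Rightarrow> complex^'n" where
  "rot i j c \<theta> x = (\<chi> l. if l = i then of_real (cos \<theta>) * x $ i + c * of_real (sin \<theta>) * x $ j
     else if l = j then of_real (cos \<theta>) * x $ j - cnj c * of_real (sin \<theta>) * x $ i else x $ l)"

lemma circ_UM: "circ i \<theta> \<in> UM"
proof -
  have "norm (circ i \<theta> x $ l) = norm (x $ l)" for x l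
    by (simp add: circ_def norm_mult)
  then have "norm (circ i \<theta> x) = norm x" for x
    by (simp add: norm_vec_def)
  then show ?thesis
    by (auto simp: UM_def circ_def vec_eq_iff algebra_simps)
qed

lemma rot_UM:
  assumes "norm c = 1" "i \<noteq> j" shows "rot i j c \<theta> \<in> UM"
proof -
  have two: "(norm (of_real (cos \<theta>) * a + c * of_real (sin \<theta>) * b))\<^sup>2 + (norm (of_real (cos \<theta>) * b - cnj c * of_real (sin \<theta>) * a))\<^sup>2 =
      (norm a)\<^sup>2 + (norm b)\<^sup>2" for a b
  proof -
    have cc: "c * cnj c = 1" using assms(1) complex_norm_square[of c] by simp
    have sc: "of_real (cos \<theta>) * of_real (cos \<theta>) + of_real (sin \<theta>) * of_real (sin \<theta>) = (1::complex)"
      unfolding of_real_mult[symmetric] of_real_add[symmetric] using sin_cos_squared_add3[of \<theta>] by simp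
    let ?C = "of_real (cos \<theta>) :: complex" and ?S = "of_real (sin \<theta>) :: complex"
    have "of_real ((norm (?C * a + c * ?S * b))\<^sup>2 + (norm (?C * b - cnj c * ?S * a))\<^sup>2) =
      (?C * a + c * ?S * b) * (?C * cnj a + cnj c * ?S * cnj b) + (?C * b - cnj c * ?S * a) * (?C * cnj b - c * ?S * cnj a)"
      by (simp only: of_real_add complex_norm_square complex_cnj_add complex_cnj_diff complex_cnj_mult complex_cnj_complex_of_real complex_cnj_cnj)
    also have "\<dots> = (?C * ?C + (c * cnj c) * (?S * ?S)) * (a * cnj a) + (?C * ?C + (c * cnj c) * (?S * ?S)) * (b * cnj b)"
      by algebra
    also have "\<dots> = of_real ((norm a)\<^sup>2 + (norm b)\<^sup>2)"
      unfolding cc by (simp only: sc mult_1 of_real_add complex_norm_square)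
    finally show ?thesis by (simp only: of_real_eq_iff)
  qed
  have "(norm (rot i j c \<theta> x))\<^sup>2 = (norm x)\<^sup>2" for x
  proof -
    have split: "(\<Sum>l\<in>UNIV. f l) = f i + f j + (\<Sum>l\<in>UNIV - {i, j}. f l)" for f :: "'a \<Rightarrow> real"
    proof -
      have "UNIV - {i} - {j} = UNIV - {i, j}" by auto
      then show ?thesis using assms(2) by (simp add: sum.remove[of UNIV i] sum.remove[of "UNIV - {i}" j])
    qed
    have "(\<Sum>l\<in>UNIV - {i, j}. (norm (rot i j c \<theta> x $ l))\<^sup>2) = (\<Sum>l\<in>UNIV - {i, j}. (norm (x $ l))\<^sup>2)"
      by (rule sum.cong) (auto simp: rot_def)
    then show ?thesis
      unfolding norm_square_vec split using two[of "x $ i" "x $ j"] assms(2) by (simp add: rot_def)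
  qed
  then have "norm (rot i j c \<theta> x) = norm x" for x by (metis norm_ge_zero power2_eq_imp_eq)
  then show ?thesis
    unfolding UM_def by (auto simp: rot_def vec_eq_iff algebra_simps)
qed

lemma circ_zero [simp]: "circ i \<theta> 0 = 0"
  by (simp add: circ_def vec_eq_iff)

lemma circ_eq_0_iff [simp]: "circ i \<theta> x = 0 \<longleftrightarrow> x = 0"
  by (rule UM_eq_0_iff[OF circ_UM])

lemma vec_has_vector_derivative:
  fixes g :: "real \<Rightarrow> complex^'n"
  assumes "\<And>l. ((\<lambda>\<theta>. g \<theta> $ l) has_vector_derivative v $ l) (at t)"
  shows "(g has_vector_derivative v) (at t)"
proof -
  have "((\<lambda>\<theta>. \<Sum>l\<in>UNIV. axis l (g \<theta> $ l)) has_vector_derivative (\<Sum>l\<in>UNIV. axis l (v $ l))) (at t)"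
  proof (rule has_vector_derivative_sum)
    fix l
    have "bounded_linear (axis l :: complex \<Rightarrow> complex^'n)"
      by (intro linear_conv_bounded_linear[THEN iffD1] linearI) (auto simp: axis_def vec_eq_iff)
    from bounded_linear.has_vector_derivative[OF this assms[of l]]
    show "((\<lambda>\<theta>. axis l (g \<theta> $ l)) has_vector_derivative axis l (v $ l)) (at t)" .
  qed
  moreover have "(\<Sum>l\<in>UNIV. axis l (x $ l)) = x" for x :: "complex^'n"
    by (simp add: vec_eq_iff axis_def if_distrib cong: if_cong)
  ultimately show ?thesis by simp
qed

lemma circ_derivative:
  "((\<lambda>\<theta>. circ i \<theta> x) has_vector_derivative axis i (\<i> * (cis t * x $ i))) (at t)"
proof (rule vec_has_vector_derivative)
  fix l
  have "((\<lambda>\<theta>. exp (\<i> * of_real \<theta>)) has_vector_derivative \<i> * exp (\<i> * of_real t)) (at t)"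
    by (rule has_vector_derivative_real_field) (auto intro!: derivative_eq_intros)
  then have "((\<lambda>\<theta>. cis \<theta> * x $ i) has_vector_derivative \<i> * cis t * x $ i) (at t)"
    unfolding cis_conv_exp by (rule has_vector_derivative_mult_left)
  then show "((\<lambda>\<theta>. circ i \<theta> x $ l) has_vector_derivative axis i (\<i> * (cis t * x $ i)) $ l) (at t)"
    by (cases "l = i") (simp_all add: circ_def axis_def mult.assoc)
qed

text \<open>The setting of the representation theory. It is instantiated by the span of the
  translates of a K-finite function and by invariant subspaces of such a span, in particular
  orthogonal complements.\<close>

locale inv_space =
  fixes V :: "(complex^'n::finite \<Rightarrow> complex) set"
  assumes fdV: "fd V" and inv: "\<And>A F. A \<in> UM \<Longrightarrow> F \<in> V \<Longrightarrow> (\<lambda>x. F (A x)) \<in> V"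
    and zeroV: "\<And>F. F \<in> V \<Longrightarrow> F 0 = 0" and smoothV: "\<And>F. F \<in> V \<Longrightarrow> smooth_on (- {0}) F"
begin

section \<open>The infinitesimal action on an invariant space\<close>

lemma subV: "cfun.subspace V" using fdV by (rule fd_subspace)

lemma deriv: "F \<in> V \<Longrightarrow> x \<noteq> 0 \<Longrightarrow> (F has_derivative frechet_derivative F (at x)) (at x)"
  by (rule smooth_on_has_derivative[OF smoothV]) auto

lemma lin: "F \<in> V \<Longrightarrow> x \<noteq> 0 \<Longrightarrow> linear (frechet_derivative F (at x))"
  using deriv by (rule has_derivative_linear)

text \<open>Set to 0 at the origin, where members of V need not be differentiable, so that the
  operators built from it return functions vanishing at 0.\<close>

definition dF :: "(complex^'n \<Rightarrow> complex) \<Rightarrow> complex^'n \<Rightarrow> complex^'n \<Rightarrow> complex" where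
  "dF F x v = (if x = 0 then 0 else frechet_derivative F (at x) v)"

lemma dF_add: "F \<in> V \<Longrightarrow> dF F x (u + v) = dF F x u + dF F x v"
  by (simp add: dF_def linear_add[OF lin])

lemma dF_scale: "F \<in> V \<Longrightarrow> dF F x (r *\<^sub>R v) = of_real r * dF F x v"
  by (simp add: dF_def linear_scale[OF lin] scaleR_conv_of_real[where 'a = complex])

lemma dF_sum: "F \<in> V \<Longrightarrow> dF F x (sum g S) = (\<Sum>i\<in>S. dF F x (g i))"
  by (cases "x = 0") (simp_all add: dF_def linear_sum[OF lin])

lemma dF_plus: "F \<in> V \<Longrightarrow> G \<in> V \<Longrightarrow> dF (\<lambda>x. F x + G x) x v = dF F x v + dF G x v"
  by (simp add: dF_def frechet_derivative_at[OF has_derivative_add[OF deriv deriv], symmetric])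

lemma dF_cmult: "F \<in> V \<Longrightarrow> dF (\<lambda>x. c * F x) x v = c * dF F x v"
  by (simp add: dF_def frechet_derivative_at[OF has_derivative_mult_right[OF deriv], symmetric])

text \<open>The difference quotients along the curve of unitary maps lie in V and converge
  pointwise, trivially so at 0; \<open>fd_closed\<close> puts the limit in V.\<close>

lemma deriv_in:
  assumes F: "F \<in> V" and G: "\<And>\<theta>. G \<theta> \<in> UM" "\<And>x. G 0 x = x" "\<And>x. ((\<lambda>\<theta>. G \<theta> x) has_vector_derivative v x) (at 0)"
  shows "(\<lambda>x. dF F x (v x)) \<in> V"
proof (rule fd_closed[OF fdV])
  show "(\<lambda>x. of_real (real (Suc k)) * (F (G (inverse (real (Suc k))) x) - F x)) \<in> V" for k
    by (rule sub_scale[OF subV sub_diff[OF subV inv[OF G(1) F] F]])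
  fix x
  show "(\<lambda>k. of_real (real (Suc k)) * (F (G (inverse (real (Suc k))) x) - F x)) \<longlonglongrightarrow> dF F x (v x)"
  proof (cases "x = 0")
    case True
    then show ?thesis using zeroV[OF F] UM_zero[OF G(1)] by (simp add: dF_def)
  next
    case False
    have "((\<lambda>\<theta>. F (G \<theta> x)) has_vector_derivative frechet_derivative F (at x) (v x)) (at 0)"
    proof -
      have "((\<lambda>\<theta>. F (G \<theta> x)) has_derivative (\<lambda>h. frechet_derivative F (at x) (h *\<^sub>R v x))) (at 0)"
        using G(3)[of x] deriv[OF F False] G(2)[of x]
        by (intro has_derivative_compose[where f = "\<lambda>\<theta>. G \<theta> x" and g = F]) (auto simp: has_vector_derivative_def)
      then show ?thesis by (simp add: has_vector_derivative_def linear_scale[OF lin[OF F False]])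
    qed
    from vector_derivative_sequence[OF this] show ?thesis
      using False by (simp add: dF_def G(2))
  qed
qed

text \<open>The generator of the i-th coordinate circle; on a vector of weight k it is
  multiplication by \<i> times \<open>k i\<close>.\<close>

definition Hop :: "'n \<Rightarrow> (complex^'n \<Rightarrow> complex) \<Rightarrow> complex^'n \<Rightarrow> complex" where
  "Hop i F x = dF F x (axis i (\<i> * x $ i))"

lemma Hop_in: "F \<in> V \<Longrightarrow> Hop i F \<in> V"
  unfolding Hop_def[abs_def]
  by (rule deriv_in[where G = "circ i"])
    (use circ_derivative[of i _ 0] circ_UM in \<open>auto simp: circ_def vec_eq_iff\<close>)

lemma lin_on_Hop: "lin_on V (Hop i)"
  unfolding lin_on_def by (auto simp: Hop_in) (auto simp: Hop_def[abs_def] dF_plus dF_cmult)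

definition rvec :: "'n \<Rightarrow> 'n \<Rightarrow> complex \<Rightarrow> complex^'n \<Rightarrow> complex^'n" where
  "rvec i j c x = axis i (c * x $ j) - axis j (cnj c * x $ i)"

lemma rvec_in:
  assumes "F \<in> V" "norm c = 1" "i \<noteq> j"
  shows "(\<lambda>x. dF F x (rvec i j c x)) \<in> V"
proof (rule deriv_in[where G = "rot i j c"])
  show "((\<lambda>\<theta>. rot i j c \<theta> x) has_vector_derivative rvec i j c x) (at 0)" for x
  proof (rule vec_has_vector_derivative)
    fix l
    have co: "((\<lambda>\<theta>. complex_of_real (cos \<theta>)) has_vector_derivative 0) (at 0)"
      "((\<lambda>\<theta>. complex_of_real (sin \<theta>)) has_vector_derivative 1) (at 0)"
      using has_vector_derivative_of_real[of cos 0 "at 0"] has_vector_derivative_of_real[of sin 1 "at 0"]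
      by (auto simp flip: has_real_derivative_iff_has_vector_derivative intro!: derivative_eq_intros)
    have *: "((\<lambda>\<theta>. of_real (cos \<theta>) * a + b * of_real (sin \<theta>) * d) has_vector_derivative b * d) (at 0)" for a b d :: complex
      using has_vector_derivative_add[OF has_vector_derivative_mult_left[OF co(1), of a]
          has_vector_derivative_mult_left[OF has_vector_derivative_mult_right[OF co(2), of b], of d]] by simp
    from *[of "x $ i" c "x $ j"] *[of "x $ j" "- cnj c" "x $ i"]
    show "((\<lambda>\<theta>. rot i j c \<theta> x $ l) has_vector_derivative rvec i j c x $ l) (at 0)"
      using assms(3) by (cases "l = i"; cases "l = j") (simp_all add: rot_def rvec_def axis_def)
  qed
qed (use assms rot_UM in \<open>auto simp: rot_def vec_eq_iff\<close>)

definition dz :: "'n \<Rightarrow> (complex^'n \<Rightarrow> complex) \<Rightarrow> complex^'n \<Rightarrow> complex" where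
  "dz i F x = (dF F x (axis i 1) - \<i> * dF F x (axis i \<i>)) / 2"

definition dzb :: "'n \<Rightarrow> (complex^'n \<Rightarrow> complex) \<Rightarrow> complex^'n \<Rightarrow> complex" where
  "dzb i F x = (dF F x (axis i 1) + \<i> * dF F x (axis i \<i>)) / 2"

lemma dF_axis:
  assumes "F \<in> V" shows "dF F x (axis i z) = z * dz i F x + cnj z * dzb i F x"
proof -
  have "axis i z = Re z *\<^sub>R axis i 1 + Im z *\<^sub>R (axis i \<i> :: complex^'n)"
    by (simp add: vec_eq_iff axis_def complex_eq_iff)
  then have "dF F x (axis i z) = of_real (Re z) * dF F x (axis i 1) + of_real (Im z) * dF F x (axis i \<i>)"
    by (simp add: dF_add[OF assms] dF_scale[OF assms])
  also have "\<dots> = z * dz i F x + cnj z * dzb i F x"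
    by (simp add: dz_def dzb_def complex_eq_iff field_simps)
  finally show ?thesis .
qed

lemma dF_expand:
  assumes "F \<in> V" shows "dF F x v = (\<Sum>i\<in>UNIV. v $ i * dz i F x + cnj (v $ i) * dzb i F x)"
proof -
  have "v = (\<Sum>i\<in>UNIV. axis i (v $ i))"
    by (simp add: vec_eq_iff axis_def if_distrib cong: if_cong)
  then have "dF F x v = dF F x (\<Sum>i\<in>UNIV. axis i (v $ i))" by (rule arg_cong)
  then show ?thesis by (simp add: dF_sum[OF assms] dF_axis[OF assms])
qed

text \<open>A root vector of the complexified Lie algebra of the unitary group, in terms of the
  Wirtinger derivatives \<open>dz\<close> and \<open>dzb\<close>. On weights it adds one at j and
  subtracts one at i.\<close>

definition Rop :: "'n \<Rightarrow> 'n \<Rightarrow> (complex^'n \<Rightarrow> complex) \<Rightarrow> complex^'n \<Rightarrow> complex" where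
  "Rop i j F x = x $ j * dz i F x - cnj (x $ i) * dzb j F x"

lemma Rop_in: assumes F: "F \<in> V" and "i \<noteq> j" shows "Rop i j F \<in> V"
proof -
  have mi: "dF F x (u - v) = dF F x u - dF F x v" for x u v
    using dF_add[OF F, of x "u - v" v] by simp
  \<comment> \<open>The real directions with c = 1 and c = \<i> are combined over the complex
    numbers; the terms with \<open>dzb i\<close> and \<open>dz j\<close> cancel.\<close>
  have "Rop i j F = (\<lambda>x. 1 / 2 * (dF F x (rvec i j 1 x) + (- \<i>) * dF F x (rvec i j \<i> x)))"
    by (rule ext) (simp add: Rop_def rvec_def mi dF_axis[OF F] algebra_simps)
  also have "\<dots> \<in> V"
    using assms by (intro sub_scale sub_add subV rvec_in) auto
  finally show ?thesis .
qed

text \<open>A weight with respect to the coordinate circles in S only; in the existence proof S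
  grows one coordinate at a time.\<close>

definition wt :: "'n set \<Rightarrow> ('n \<Rightarrow> int) \<Rightarrow> (complex^'n \<Rightarrow> complex) \<Rightarrow> bool" where
  "wt S k w \<longleftrightarrow> (\<forall>i\<in>S. \<forall>\<theta> x. w (circ i \<theta> x) = cis (of_int (k i) * \<theta>) * w x)"

lemma wt_dF:
  assumes w: "w \<in> V" "wt S k w" and l: "l \<in> S"
  shows "dF w (circ l \<theta> x) (circ l \<theta> v) = cis (of_int (k l) * \<theta>) * dF w x v"
proof (cases "x = 0")
  case True
  then show ?thesis by (simp add: dF_def)
next
  case False
  have c0: "circ l \<theta> x \<noteq> 0" using False by simp
  have "((\<lambda>x. w (circ l \<theta> x)) has_derivative (\<lambda>v. frechet_derivative w (at (circ l \<theta> x)) (circ l \<theta> v))) (at x)"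
    by (rule has_derivative_compose[OF bounded_linear_imp_has_derivative[OF UM_bounded_linear[OF circ_UM]] deriv[OF w(1) c0]])
  moreover have "((\<lambda>x. w (circ l \<theta> x)) has_derivative (\<lambda>v. cis (of_int (k l) * \<theta>) * frechet_derivative w (at x) v)) (at x)"
  proof -
    have "(\<lambda>x. w (circ l \<theta> x)) = (\<lambda>x. cis (of_int (k l) * \<theta>) * w x)" using w(2) l by (simp add: wt_def)
    then show ?thesis using has_derivative_mult_right[OF deriv[OF w(1) False]] by simp
  qed
  ultimately have "(\<lambda>v. frechet_derivative w (at (circ l \<theta> x)) (circ l \<theta> v)) =
      (\<lambda>v. cis (of_int (k l) * \<theta>) * frechet_derivative w (at x) v)"
    by (rule has_derivative_unique)
  from fun_cong[OF this, of v] show ?thesis using False c0 by (simp add: dF_def)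
qed

lemma wt_subspace: "fd {w \<in> V. wt S k w}"
proof (rule fd_subset[OF fdV])
  show "cfun.subspace {w \<in> V. wt S k w}"
    by (rule subspaceI) (auto simp: wt_def algebra_simps intro: sub_zero sub_add sub_scale subV)
qed auto

lemma wt_Hop: assumes "w \<in> V" "wt S k w" shows "wt S k (Hop j w)"
  unfolding wt_def
proof (intro ballI allI)
  fix i \<theta> x assume i: "i \<in> S"
  have "axis j (\<i> * circ i \<theta> x $ j) = circ i \<theta> (axis j (\<i> * x $ j))"
    by (auto simp: circ_def axis_def vec_eq_iff)
  then show "Hop j w (circ i \<theta> x) = cis (of_int (k i) * \<theta>) * Hop j w x"
    unfolding Hop_def by (simp add: wt_dF[OF assms i])
qed

text \<open>Simultaneous diagonalisation of the torus: the weight space for S is finite-dimensional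
  and preserved by \<open>Hop j\<close>, so it contains an eigenvector, and an eigenvector of the
  generator is one of the whole circle.\<close>

lemma wt_exists:
  assumes "v \<in> V" "v \<noteq> (\<lambda>x. 0)"
  shows "\<exists>w k. w \<in> V \<and> w \<noteq> (\<lambda>x. 0) \<and> wt S k w"
proof -
  have "finite S" by simp
  then show ?thesis
  proof (induction S rule: finite_induct)
    case empty
    then show ?case using assms by (auto simp: wt_def)
  next
    case (insert j S)
    then obtain v k where v: "v \<in> V" "v \<noteq> (\<lambda>x. 0)" "wt S k v" by blast
    then obtain x0 where x0: "v x0 \<noteq> 0" by auto
    let ?W = "{w \<in> V. wt S k w}"
    have "lin_on ?W (Hop j)"
      using lin_onD[OF lin_on_Hop[of j]] wt_Hop unfolding lin_on_def by auto
    then obtain w c where w: "w \<in> ?W" "w \<noteq> (\<lambda>x. 0)" "Hop j w = (\<lambda>x. c * w x)"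
      using eigenvector_exists[OF wt_subspace, of S k "Hop j" v x0] v x0 by auto
    have wV: "w \<in> V" using w by simp
    obtain x1 where x1: "w x1 \<noteq> 0" using w(2) by auto
    \<comment> \<open>The eigenvalue equation holds all along the circle through x, so w restricted
      to this circle solves a linear differential equation with constant coefficient c.\<close>
    have e: "w (circ j \<theta> x) = exp (c * of_real \<theta>) * w x" for \<theta> x
    proof (cases "x = 0")
      case True
      then show ?thesis using zeroV[OF wV] by simp
    next
      case False
      have nz: "circ j t x \<noteq> 0" for t using False by simp
      have d: "((\<lambda>t. w (circ j t x)) has_vector_derivative c * w (circ j t x)) (at t)" for t
      proof -
        have "((\<lambda>t. w (circ j t x)) has_derivative (\<lambda>h. frechet_derivative w (at (circ j t x)) (h *\<^sub>R axis j (\<i> * (cis t * x $ j))))) (at t)"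
          using circ_derivative[of j x t] deriv[OF wV nz]
          by (intro has_derivative_compose[where f = "\<lambda>\<theta>. circ j \<theta> x" and g = w]) (auto simp: has_vector_derivative_def)
        moreover have "frechet_derivative w (at (circ j t x)) (axis j (\<i> * (cis t * x $ j))) = c * w (circ j t x)"
          using fun_cong[OF w(3), of "circ j t x"] nz by (simp add: Hop_def dF_def circ_def)
        ultimately show ?thesis by (simp add: has_vector_derivative_def linear_scale[OF lin[OF wV nz]])
      qed
      have "((\<lambda>t. exp (- c * of_real t) * w (circ j t x)) has_vector_derivative 0) (at t within UNIV)" for t
      proof -
        have "((\<lambda>t. exp (- c * of_real t)) has_vector_derivative - c * exp (- c * of_real t)) (at t)"
          by (rule has_vector_derivative_real_field) (auto intro!: derivative_eq_intros)
        from has_vector_derivative_mult[OF this d] show ?thesis by (simp add: algebra_simps)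
      qed
      then obtain C where C: "\<And>t. exp (- c * of_real t) * w (circ j t x) = C"
        using has_vector_derivative_zero_constant[of UNIV "\<lambda>t. exp (- c * of_real t) * w (circ j t x)"] by auto
      have "circ j 0 x = x" by (simp add: circ_def vec_eq_iff)
      then have "exp (- c * of_real \<theta>) * w (circ j \<theta> x) = w x" using C[of 0] C[of \<theta>] by simp
      then have "exp (c * of_real \<theta>) * w x = (exp (c * of_real \<theta>) * exp (- c * of_real \<theta>)) * w (circ j \<theta> x)" by simp
      then show ?thesis by (simp flip: exp_add)
    qed
    \<comment> \<open>A full turn is the identity; this forces c = \<i> m for an integer m.\<close>
    have "circ j (2 * pi) x1 = x1" by (simp add: circ_def vec_eq_iff)
    then have "exp (c * of_real (2 * pi)) = 1" using e[of "2 * pi" x1] x1 by simp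
    then obtain m :: int where m: "c * of_real (2 * pi) = of_int (2 * m) * pi * \<i>"
      unfolding exp_eq_1 by (auto simp: complex_eq_iff)
    have c: "c = \<i> * of_int m"
    proof -
      have "of_real (2 * pi) * c = of_real (2 * pi) * (\<i> * of_int m)" using m by (simp add: mult_ac)
      then show ?thesis by simp
    qed
    have "wt (insert j S) (k(j := m)) w"
      unfolding wt_def
    proof (intro ballI allI)
      fix i \<theta> x assume "i \<in> insert j S"
      then show "w (circ i \<theta> x) = cis (of_int ((k(j := m)) i) * \<theta>) * w x"
        using w(1) insert(2) e[of \<theta> x] by (cases "i = j") (auto simp: wt_def c cis_conv_exp mult_ac)
    qed
    then show ?case using w wV by blast
  qed
qed

text \<open>Under a coordinate circle \<open>x $ j\<close> and \<open>dzb j\<close> acquire the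
  phase of coordinate j, while \<open>dz i\<close> and the conjugate of \<open>x $ i\<close> acquire
  the conjugate phase of coordinate i. Both terms of \<open>Rop\<close> are thus multiplied by the
  same phase.\<close>

lemma wt_Rop:
  assumes w: "w \<in> V" "wt UNIV k w" and ij: "i \<noteq> j"
  shows "wt UNIV (\<lambda>l. k l + (if l = j then 1 else 0) - (if l = i then 1 else 0)) (Rop i j w)"
  unfolding wt_def
proof (intro ballI allI)
  fix l :: 'n and \<theta> :: real and x :: "complex^'n"
  define s where "s m = (if m = l then cis \<theta> else 1)" for m
  have cs: "circ l \<theta> x $ m = s m * x $ m" for m x by (simp add: circ_def s_def)
  have ss: "cnj (s m) * s m = 1" for m by (simp add: s_def cis_cnj cis_mult)
  have ax: "axis m z = circ l \<theta> (axis m (cnj (s m) * z))" for m z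
  proof -
    have e: "circ l \<theta> (axis m y) = axis m (s m * y)" for y
      by (auto simp: vec_eq_iff axis_def circ_def s_def)
    have f: "s m * (cnj (s m) * z) = z" using ss[of m] by (simp add: mult.assoc[symmetric] mult.commute[of "s m"])
    show ?thesis unfolding e f ..
  qed
  have d: "dF w (circ l \<theta> x) (axis m z) = cis (of_int (k l) * \<theta>) * (cnj (s m) * z * dz m w x + s m * cnj z * dzb m w x)" for m z
    by (subst ax) (simp add: wt_dF[OF w] dF_axis[OF w(1)])
  have d1: "dz m w (circ l \<theta> x) = cis (of_int (k l) * \<theta>) * cnj (s m) * dz m w x"
    "dzb m w (circ l \<theta> x) = cis (of_int (k l) * \<theta>) * s m * dzb m w x" for m
    unfolding dz_def[of m w "circ l \<theta> x"] dzb_def[of m w "circ l \<theta> x"] d by (simp_all add: algebra_simps)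
  have "Rop i j w (circ l \<theta> x) = cis (of_int (k l) * \<theta>) * (s j * cnj (s i)) * Rop i j w x"
    unfolding Rop_def d1 cs by (simp add: algebra_simps)
  also have "cis (of_int (k l) * \<theta>) * (s j * cnj (s i)) =
      cis (of_int (k l + (if l = j then 1 else 0) - (if l = i then 1 else 0)) * \<theta>)"
    using ij by (auto simp: s_def cis_mult cis_cnj algebra_simps)
  finally show "Rop i j w (circ l \<theta> x) =
      cis (of_int (k l + (if l = j then 1 else 0) - (if l = i then 1 else 0)) * \<theta>) * Rop i j w x" .
qed

lemma wt_Hop_eq:
  assumes w: "w \<in> V" "wt UNIV k w" shows "Hop i w = (\<lambda>x. \<i> * of_int (k i) * w x)"
proof
  fix x
  show "Hop i w x = \<i> * of_int (k i) * w x"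
  proof (cases "x = 0")
    case True
    then show ?thesis using zeroV[OF w(1)] by (simp add: Hop_def dF_def)
  next
    case False
    have c0: "circ i 0 x = x" by (simp add: circ_def vec_eq_iff)
    have "((\<lambda>t. w (circ i t x)) has_derivative (\<lambda>h. frechet_derivative w (at x) (h *\<^sub>R axis i (\<i> * x $ i)))) (at 0)"
      using circ_derivative[of i x 0] deriv[OF w(1) False]
      by (intro has_derivative_compose[where f = "\<lambda>\<theta>. circ i \<theta> x" and g = w]) (auto simp: has_vector_derivative_def c0)
    then have "((\<lambda>t. w (circ i t x)) has_vector_derivative Hop i w x) (at 0)"
      using False by (simp add: has_vector_derivative_def linear_scale[OF lin[OF w(1)]] Hop_def dF_def)
    moreover have "((\<lambda>t. w (circ i t x)) has_vector_derivative \<i> * of_int (k i) * w x) (at 0)"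
    proof -
      have "((\<lambda>t. exp (\<i> * of_int (k i) * of_real t)) has_vector_derivative \<i> * of_int (k i)) (at 0)"
        by (rule has_vector_derivative_real_field) (auto intro!: derivative_eq_intros)
      from has_vector_derivative_mult_left[OF this, of "w x"]
      show ?thesis using w(2) by (simp add: wt_def cis_conv_exp mult_ac)
    qed
    ultimately show ?thesis by (rule vector_derivative_unique_at)
  qed
qed

text \<open>\<open>h\<close> is a height on weights that \<open>Rop i j\<close> strictly increases
  when d i < d j. The heights that occur are, up to the factor \<i>, eigenvalues of the single
  operator \<open>T\<close>, hence bounded; a weight vector of maximal height is
  annihilated.\<close>

lemma highest_weight_exists:
  fixes d :: "'n \<Rightarrow> nat"
  assumes "v \<in> V" "v \<noteq> (\<lambda>x. 0)"
  shows "\<exists>w k. w \<in> V \<and> w \<noteq> (\<lambda>x. 0) \<and> wt UNIV k w \<and> (\<forall>i j. d i < d j \<longrightarrow> Rop i j w = (\<lambda>x. 0))"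
proof -
  define h where "h k = (\<Sum>i\<in>UNIV. int (d i) * k i)" for k :: "'n \<Rightarrow> int"
  define T where "T F x = (\<Sum>i\<in>UNIV. of_nat (d i) * Hop i F x)" for F x
  have T: "lin_on V T"
    unfolding lin_on_def T_def[abs_def]
    using lin_onD[OF lin_on_Hop]
    by (auto intro!: sub_sum sub_scale subV simp: distrib_left sum.distrib sum_distrib_left mult.left_commute)
  have Tw: "T w = (\<lambda>x. (\<i> * of_int (h k)) * w x)" if "w \<in> V" "wt UNIV k w" for w k
    unfolding T_def[abs_def] wt_Hop_eq[OF that] h_def by (simp add: sum_distrib_left sum_distrib_right mult_ac)
  define Z where "Z = {h k |k. \<exists>w\<in>V. w \<noteq> (\<lambda>x. 0) \<and> wt UNIV k w}"
  obtain X e where "finite X \<and> (\<forall>x\<in>X. e x \<in> V) \<and> (\<forall>F\<in>V. \<forall>z. F z = (\<Sum>x\<in>X. F x * e x z))"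
    using fd_dual[OF fdV] by (elim exE)
  then have X: "finite X" "\<And>F z. F \<in> V \<Longrightarrow> F z = (\<Sum>x\<in>X. F x * e x z)" by simp_all
  have "\<forall>x0. \<exists>C. \<forall>w c. w \<in> V \<longrightarrow> w x0 \<noteq> 0 \<longrightarrow> T w = (\<lambda>x. c * w x) \<longrightarrow> norm c \<le> C"
    using eigenvalue_bounded[OF fdV T] by metis
  then obtain C where C: "\<And>x0 w c. w \<in> V \<Longrightarrow> w x0 \<noteq> 0 \<Longrightarrow> T w = (\<lambda>x. c * w x) \<Longrightarrow> norm c \<le> C x0" by metis
  have "Z \<subseteq> {- \<lceil>\<Sum>x\<in>X. \<bar>C x\<bar>\<rceil> .. \<lceil>\<Sum>x\<in>X. \<bar>C x\<bar>\<rceil>}"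
  proof
    fix z assume "z \<in> Z"
    then obtain k w where kw: "z = h k" "w \<in> V" "w \<noteq> (\<lambda>x. 0)" "wt UNIV k w" by (auto simp: Z_def)
    \<comment> \<open>A member of V is determined by its values on X, so one of finitely many
      eigenvalue bounds applies.\<close>
    have "\<exists>x\<in>X. w x \<noteq> 0"
    proof (rule ccontr)
      assume "\<not> ?thesis"
      then have "(\<Sum>x\<in>X. w x * e x z) = 0" for z by (intro sum.neutral) auto
      then have "w z = 0" for z using X(2)[OF kw(2), of z] by simp
      then show False using kw(3) by auto
    qed
    then obtain x where x: "x \<in> X" "w x \<noteq> 0" by blast
    have "\<bar>real_of_int z\<bar> = norm (\<i> * of_int (h k))" using kw(1) by (simp add: norm_mult)
    also have "\<dots> \<le> C x" by (rule C[OF kw(2) x(2) Tw[OF kw(2,4)]])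
    also have "\<dots> \<le> \<bar>C x\<bar>" by simp
    also have "\<dots> \<le> (\<Sum>x\<in>X. \<bar>C x\<bar>)" using x(1) X(1) by (intro member_le_sum) auto
    finally show "z \<in> {- \<lceil>\<Sum>x\<in>X. \<bar>C x\<bar>\<rceil> .. \<lceil>\<Sum>x\<in>X. \<bar>C x\<bar>\<rceil>}" by (auto simp: abs_le_iff) linarith+
  qed
  then have fin: "finite Z" by (rule finite_subset) simp
  have ne: "Z \<noteq> {}" using wt_exists[OF assms, of UNIV] by (auto simp: Z_def)
  have "Max Z \<in> Z" using fin ne by simp
  then obtain k w where kw: "Max Z = h k" "w \<in> V" "w \<noteq> (\<lambda>x. 0)" "wt UNIV k w" by (auto simp: Z_def)
  have "Rop i j w = (\<lambda>x. 0)" if ij: "d i < d j" for i j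
  proof (rule ccontr)
    assume n: "Rop i j w \<noteq> (\<lambda>x. 0)"
    have "i \<noteq> j" using ij by auto
    let ?k = "\<lambda>l. k l + (if l = j then 1 else 0) - (if l = i then 1 else 0)"
    have "h ?k \<in> Z"
      unfolding Z_def using n Rop_in[OF kw(2) \<open>i \<noteq> j\<close>] wt_Rop[OF kw(2,4) \<open>i \<noteq> j\<close>] by blast
    then have "h ?k \<le> h k" unfolding kw(1)[symmetric] by (rule Max_ge[OF fin])
    moreover have "h ?k = h k + int (d j) - int (d i)"
    proof -
      have "int (d l) * ?k l = int (d l) * k l + (if l = j then int (d l) else 0) - (if l = i then int (d l) else 0)" for l
        by (simp add: algebra_simps)
      then show ?thesis by (simp add: h_def sum.distrib sum_subtractf)
    qed
    ultimately show False using ij by simp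
  qed
  then show ?thesis using kw by (intro exI[of _ w] exI[of _ k]) simp
qed

end

section \<open>The shape of a highest weight vector\<close>

context inv_space
begin

text \<open>The vanishing of \<open>Rop i s w\<close> and \<open>Rop e j w\<close> makes all
  Wirtinger derivatives explicit multiples of one unknown A, except \<open>dz s w\<close> and
  \<open>dzb e w\<close>, which the weight equations supply. So the derivative is a radial term plus
  w times the logarithmic derivative of x_s^(k s) cnj(x_e)^(-k e).\<close>

lemma highest_weight_derivative:
  assumes w: "w \<in> V" "wt UNIV k w" and R: "\<And>i. i \<noteq> s \<Longrightarrow> Rop i s w = (\<lambda>x. 0)" "\<And>j. j \<noteq> e \<Longrightarrow> Rop e j w = (\<lambda>x. 0)"
    and se: "s \<noteq> e" and x: "x $ s \<noteq> 0" "x $ e \<noteq> 0"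
  shows "\<exists>A. \<forall>v. dF w x v = of_real (2 * (x \<bullet> v)) * A
    + w x * (of_int (k s) * (v $ s / x $ s) - of_int (k e) * (cnj (v $ e) / cnj (x $ e)))"
proof -
  define A where "A = dzb s w x / x $ s"
  have H: "x $ i * dz i w x - cnj (x $ i) * dzb i w x = of_int (k i) * w x" for i
  proof -
    have "\<i> * (x $ i * dz i w x - cnj (x $ i) * dzb i w x) = Hop i w x"
      by (simp add: Hop_def dF_axis[OF w(1)] algebra_simps)
    also have "\<dots> = \<i> * (of_int (k i) * w x)" by (simp add: wt_Hop_eq[OF w])
    finally show ?thesis by simp
  qed
  have bs: "dzb s w x = x $ s * A" using x by (simp add: A_def)
  have z: "dz i w x = cnj (x $ i) * A" if "i \<noteq> s" for i
    using fun_cong[OF R(1)[OF that], of x] x by (simp add: Rop_def bs)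
  have zb: "dzb j w x = x $ j * A" if "j \<noteq> e" for j
    using fun_cong[OF R(2)[OF that], of x] x z[of e] se by (simp add: Rop_def mult.left_commute[of "x $ j"])
  have zs: "dz s w x = cnj (x $ s) * A + of_int (k s) * w x / x $ s"
    using H[of s] x by (simp add: bs field_simps)
  have zbe: "dzb e w x = x $ e * A - of_int (k e) * w x / cnj (x $ e)"
    using H[of e] x z[of e] se by (simp add: field_simps)
  have "dF w x v = of_real (2 * (x \<bullet> v)) * A
    + w x * (of_int (k s) * (v $ s / x $ s) - of_int (k e) * (cnj (v $ e) / cnj (x $ e)))" for v
  proof -
    have "v $ i * dz i w x + cnj (v $ i) * dzb i w x = of_real (2 * (x $ i \<bullet> v $ i)) * A
       + (if i = s then v $ s * (of_int (k s) * w x / x $ s) else 0)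
       - (if i = e then cnj (v $ e) * (of_int (k e) * w x / cnj (x $ e)) else 0)" for i
    proof -
      have r: "of_real (2 * (a \<bullet> b)) = b * cnj a + cnj b * a" for a b :: complex
        by (simp add: complex_eq_iff inner_complex_def)
      have D1: "dz i w x = cnj (x $ i) * A + (if i = s then of_int (k s) * w x / x $ s else 0)"
        using z[of i] zs by auto
      have D2: "dzb i w x = x $ i * A - (if i = e then of_int (k e) * w x / cnj (x $ e) else 0)"
        using zb[of i] zbe by auto
      show ?thesis unfolding r D1 D2 using se by (auto simp: algebra_simps)
    qed
    then have "dF w x v = (\<Sum>i\<in>UNIV. of_real (2 * (x $ i \<bullet> v $ i)) * A) +
        v $ s * (of_int (k s) * w x / x $ s) - cnj (v $ e) * (of_int (k e) * w x / cnj (x $ e))"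
      unfolding dF_expand[OF w(1)] by (simp add: sum.distrib sum_subtractf)
    also have "(\<Sum>i\<in>UNIV. of_real (2 * (x $ i \<bullet> v $ i)) * A) = of_real (2 * (x \<bullet> v)) * A"
      by (simp add: inner_vec_def sum_distrib_left sum_distrib_right)
    finally show ?thesis by (simp add: algebra_simps)
  qed
  then show ?thesis by blast
qed

text \<open>The quotient of w by the expected monomial x_s^(k s) cnj(x_e)^(-k e), whose exponents
  may still be negative at this stage.\<close>

definition red :: "'n \<Rightarrow> 'n \<Rightarrow> ('n \<Rightarrow> int) \<Rightarrow> (complex^'n \<Rightarrow> complex) \<Rightarrow> complex^'n \<Rightarrow> complex" where
  "red s e k w x = w x * (x $ s powi (- k s) * cnj (x $ e) powi (k e))"

text \<open>Along a curve tangent to the sphere the radial term of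
  \<open>highest_weight_derivative\<close> drops out, and the logarithmic term is cancelled by the
  derivative of the monomial.\<close>

lemma red_curve:
  assumes w: "w \<in> V" "wt UNIV k w" and R: "\<And>i. i \<noteq> s \<Longrightarrow> Rop i s w = (\<lambda>x. 0)" "\<And>j. j \<noteq> e \<Longrightarrow> Rop e j w = (\<lambda>x. 0)"
    and se: "s \<noteq> e" and g: "(g has_vector_derivative v) (at t)" "g t $ s \<noteq> 0" "g t $ e \<noteq> 0" "g t \<bullet> v = 0"
  shows "((\<lambda>t. red s e k w (g t)) has_vector_derivative 0) (at t)"
proof -
  let ?x = "g t"
  have x0: "?x \<noteq> 0" using g(2) by auto
  obtain A where A: "dF w ?x v = of_real (2 * (?x \<bullet> v)) * A
    + w ?x * (of_int (k s) * (v $ s / ?x $ s) - of_int (k e) * (cnj (v $ e) / cnj (?x $ e)))"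
    using highest_weight_derivative[OF w R se g(2,3)] by blast
  have dw: "((\<lambda>t. w (g t)) has_vector_derivative dF w ?x v) (at t)"
  proof -
    have "((\<lambda>t. w (g t)) has_derivative (\<lambda>h. frechet_derivative w (at ?x) (h *\<^sub>R v))) (at t)"
      using g(1) deriv[OF w(1) x0]
      by (intro has_derivative_compose[where f = g and g = w]) (auto simp: has_vector_derivative_def)
    then show ?thesis
      using x0 by (simp add: has_vector_derivative_def linear_scale[OF lin[OF w(1) x0]] dF_def)
  qed
  have gs: "((\<lambda>t. g t $ i) has_vector_derivative v $ i) (at t)" for i
    by (rule bounded_linear.has_vector_derivative[OF bounded_linear_vec_nth g(1)])
  have gc: "((\<lambda>t. cnj (g t $ i)) has_vector_derivative cnj (v $ i)) (at t)" for i
    by (rule bounded_linear.has_vector_derivative[OF bounded_linear_cnj gs])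
  have pw: "((\<lambda>t. u t powi m) has_vector_derivative of_int m * u t powi (m - 1) * u') (at t)"
    if "(u has_vector_derivative u') (at t)" "u t \<noteq> 0" for u :: "real \<Rightarrow> complex" and u' m
  proof -
    have "((\<lambda>z. z powi m) has_field_derivative of_int m * u t powi (m - 1)) (at (u t))"
      using that(2) by (auto intro!: derivative_eq_intros)
    from field_vector_diff_chain_at[OF that(1) this] show ?thesis by (simp add: o_def mult_ac)
  qed
  have "((\<lambda>t. red s e k w (g t)) has_vector_derivative
      w ?x * (?x $ s powi (- k s) * (of_int (k e) * cnj (?x $ e) powi (k e - 1) * cnj (v $ e)) +
        (of_int (- k s) * ?x $ s powi (- k s - 1) * v $ s) * cnj (?x $ e) powi k e) +
      dF w ?x v * (?x $ s powi (- k s) * cnj (?x $ e) powi k e)) (at t)"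
    unfolding red_def
    by (intro has_vector_derivative_mult dw pw[of "\<lambda>t. g t $ s", OF gs g(2)] pw[of "\<lambda>t. cnj (g t $ e)", OF gc])
      (use g(3) in simp)
  also have "w ?x * (?x $ s powi (- k s) * (of_int (k e) * cnj (?x $ e) powi (k e - 1) * cnj (v $ e)) +
        (of_int (- k s) * ?x $ s powi (- k s - 1) * v $ s) * cnj (?x $ e) powi k e) +
      dF w ?x v * (?x $ s powi (- k s) * cnj (?x $ e) powi k e) = 0"
    unfolding A g(4) using g(2,3)
    by (simp add: power_int_diff field_simps)
  finally show ?thesis .
qed

lemma red_circ:
  assumes w: "w \<in> V" "wt UNIV k w" and se: "s \<noteq> e" and i: "i = s \<or> i = e"
  shows "red s e k w (circ i \<theta> x) = red s e k w x"
proof -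
  have w': "w (circ i \<theta> x) = cis (of_int (k i) * \<theta>) * w x" using w(2) by (simp add: wt_def)
  have c: "cis \<theta> powi m = cis (of_int m * \<theta>)" for m by (rule cis_power_int)
  show ?thesis
  proof (cases "i = s")
    case True
    have cv: "circ s \<theta> x $ s = cis \<theta> * x $ s" "circ s \<theta> x $ e = x $ e" using se by (simp_all add: circ_def)
    have "red s e k w (circ i \<theta> x) = (cis (of_int (k s) * \<theta>) * cis (of_int (- k s) * \<theta>)) * red s e k w x"
      unfolding red_def w' unfolding True cv power_int_mult_distrib c by (simp only: mult_ac)
    then show ?thesis by (simp add: cis_mult)
  next
    case False
    then have ie: "i = e" using i by simp
    have cv: "circ e \<theta> x $ e = cis \<theta> * x $ e" "circ e \<theta> x $ s = x $ s" using se by (simp_all add: circ_def)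
    have "red s e k w (circ i \<theta> x) = (cis (of_int (k e) * \<theta>) * cis (of_int (k e) * - \<theta>)) * red s e k w x"
      unfolding red_def w' unfolding ie cv complex_cnj_mult cis_cnj power_int_mult_distrib cis_power_int by (simp only: mult_ac)
    then show ?thesis by (simp add: cis_mult)
  qed
qed

text \<open>Two points have to be joined on their sphere without meeting the zeros of the
  coordinates s and e. Phase rotations, which leave \<open>red\<close> unchanged, first give both
  coordinates positive real part. This condition is convex, so the segment, rescaled to the sphere,
  is such a path.\<close>

lemma red_const:
  assumes w: "w \<in> V" "wt UNIV k w" and R: "\<And>i. i \<noteq> s \<Longrightarrow> Rop i s w = (\<lambda>x. 0)" "\<And>j. j \<noteq> e \<Longrightarrow> Rop e j w = (\<lambda>x. 0)"
    and se: "s \<noteq> e" and x: "x $ s \<noteq> 0" "x $ e \<noteq> 0" and y: "y $ s \<noteq> 0" "y $ e \<noteq> 0" and n: "norm x = norm y"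
  shows "red s e k w x = red s e k w y"
proof -
  have phase: "\<exists>x'. red s e k w x' = red s e k w x \<and> norm x' = norm x \<and> 0 < Re (x' $ s) \<and> 0 < Re (x' $ e)"
    if "x $ s \<noteq> 0" "x $ e \<noteq> 0" for x
  proof -
    let ?x' = "circ e (- Arg (x $ e)) (circ s (- Arg (x $ s)) x)"
    have ph: "cis (- Arg z) * z = of_real (norm z)" for z
    proof -
      have "cis (- Arg z) * z = cis (- Arg z) * (of_real (norm z) * cis (Arg z))"
        using cis_cnj rcis_cmod_Arg[of z] by (simp add: rcis_def)
      also have "\<dots> = (cis (- Arg z) * cis (Arg z)) * of_real (norm z)" by (simp only: mult_ac)
      finally show ?thesis by (simp add: cis_mult)
    qed
    have "red s e k w ?x' = red s e k w x" using se by (simp add: red_circ[OF w])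
    moreover have "norm ?x' = norm x" by (simp add: UM_norm[OF circ_UM])
    moreover have "?x' $ s = of_real (norm (x $ s))" "?x' $ e = of_real (norm (x $ e))"
      using se ph[of "x $ s"] ph[of "x $ e"] by (auto simp: circ_def)
    ultimately show ?thesis using that by (intro exI[of _ ?x']) simp
  qed
  obtain x' where x': "red s e k w x' = red s e k w x" "norm x' = norm x" "0 < Re (x' $ s)" "0 < Re (x' $ e)"
    using phase[OF x] by blast
  obtain y' where y': "red s e k w y' = red s e k w y" "norm y' = norm y" "0 < Re (y' $ s)" "0 < Re (y' $ e)"
    using phase[OF y] by blast
  define r where "r = norm x"
  have r: "0 < r" using x by (auto simp: r_def)
  define c where "c t = x' + t *\<^sub>R (y' - x')" for t
  define g where "g t = (r / norm (c t)) *\<^sub>R c t" for t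
  have cpos: "0 < Re (c t $ s)" "0 < Re (c t $ e)" if "t \<in> {0..1}" for t
  proof -
    have "0 < (1 - t) * a + t * b" if "0 < a" "0 < b" for a b
    proof (cases "t = 0")
      case False
      then have "0 < t * b" using \<open>t \<in> {0..1}\<close> that by simp
      moreover have "0 \<le> (1 - t) * a" using \<open>t \<in> {0..1}\<close> that by simp
      ultimately show ?thesis by linarith
    qed (use that in simp)
    from this[OF x'(3) y'(3)] this[OF x'(4) y'(4)]
    show "0 < Re (c t $ s)" "0 < Re (c t $ e)" by (simp_all add: c_def algebra_simps)
  qed
  have c0: "c t \<noteq> 0" if "t \<in> {0..1}" for t using cpos(1)[OF that] by auto
  have "((\<lambda>t. red s e k w (g t)) has_vector_derivative 0) (at t within {0..1})" if t: "t \<in> {0..1}" for t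
  proof -
    have dc: "(c has_vector_derivative (y' - x')) (at t)"
      unfolding c_def by (auto intro!: derivative_eq_intros)
    have "(\<lambda>t. norm (c t)) differentiable (at t)"
      using dc c0[OF t] by (intro differentiable_compose[of norm c] differentiable_norm_at)
        (auto simp: has_vector_derivative_def differentiable_def)
    then have "g differentiable (at t)"
      unfolding g_def using c0[OF t] dc
      by (intro differentiable_scaleR differentiable_divide differentiable_const)
        (auto simp: has_vector_derivative_def differentiable_def)
    then obtain v where v: "(g has_vector_derivative v) (at t)" using vector_derivative_works by blast
    \<comment> \<open>The norm is constant along g, so velocity and position are orthogonal.\<close>
    have "((\<lambda>t. g t \<bullet> g t) has_vector_derivative (g t \<bullet> v + v \<bullet> g t)) (at t)"
      using v unfolding has_vector_derivative_def
      by (auto intro!: derivative_eq_intros simp: algebra_simps)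
    moreover have "((\<lambda>t. g t \<bullet> g t) has_vector_derivative 0) (at t)"
    proof (rule has_vector_derivative_transform_within_open[of "\<lambda>t. r\<^sup>2" _ _ "{t. c t \<noteq> 0}"])
      have "continuous_on UNIV c" unfolding c_def by (intro continuous_intros)
      then show "open {t. c t \<noteq> 0}" by (intro open_Collect_neq continuous_on_const)
      show "r\<^sup>2 = g t \<bullet> g t" if "t \<in> {t. c t \<noteq> 0}" for t
        using that by (simp add: g_def power2_norm_eq_inner[symmetric] power_mult_distrib power_divide flip: power2_norm_eq_inner)
    qed (use c0[OF t] in auto)
    ultimately have "g t \<bullet> v + v \<bullet> g t = 0" by (rule vector_derivative_unique_at)
    then have gv: "g t \<bullet> v = 0" by (simp add: inner_commute)
    have "g t $ s \<noteq> 0" "g t $ e \<noteq> 0"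
      using cpos[OF t] r c0[OF t] by (auto simp: g_def)
    from red_curve[OF w R se v this gv]
    show ?thesis by (rule has_vector_derivative_at_within)
  qed
  then obtain C where "\<And>t. t \<in> {0..1} \<Longrightarrow> red s e k w (g t) = C"
    using has_vector_derivative_zero_constant[of "{0..1}" "\<lambda>t. red s e k w (g t)"] by auto
  then have "red s e k w (g 0) = red s e k w (g 1)" by simp
  moreover have "g 0 = x'" "g 1 = y'" using r x'(2) y'(2) n by (simp_all add: g_def c_def r_def)
  ultimately show ?thesis using x'(1) y'(1) by simp
qed

end

lemma polynomial_function_complex_mult:
  fixes f g :: "'a::euclidean_space \<Rightarrow> complex"
  assumes "polynomial_function f" "polynomial_function g"
  shows "polynomial_function (\<lambda>x. f x * g x)"
proof -
  have *: "polynomial_function h \<longleftrightarrow> real_polynomial_function (\<lambda>x. Re (h x)) \<and> real_polynomial_function (\<lambda>x. Im (h x))"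
    for h :: "'a \<Rightarrow> complex"
    unfolding polynomial_function_iff_Basis_inner by (auto simp: Basis_complex_def)
  show ?thesis
    using assms unfolding *
    by (auto intro!: real_polynomial_function.intros(3,4) real_polynomial_function_diff)
qed

lemma polynomial_function_complex_power:
  fixes f :: "'a::euclidean_space \<Rightarrow> complex"
  shows "polynomial_function f \<Longrightarrow> polynomial_function (\<lambda>x. f x ^ k)"
  by (induction k) (auto intro: polynomial_function_complex_mult)

text \<open>For s \<noteq> e no coordinate occurs together with its conjugate, so every
  \<open>wlap k\<close> annihilates the monomial.\<close>

lemma harmonic_monomial:
  fixes s e :: "'n::finite"
  assumes "s \<noteq> e"
  shows "(\<lambda>x::complex^'n. x $ s ^ p * cnj (x $ e) ^ q) \<in> harmonic_polys p q"
proof -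
  have bl: "bounded_linear (\<lambda>x::complex^'n. x $ s)" "bounded_linear (\<lambda>x::complex^'n. cnj (x $ e))"
    by (auto intro: bounded_linear_vec_nth bounded_linear_compose[OF bounded_linear_cnj])
  have m: "(\<lambda>x::complex^'n. x $ s ^ p * cnj (x $ e) ^ q) = cmono (\<lambda>i. if i = s then p else 0) (\<lambda>i. if i = e then q else 0)"
  proof
    fix x :: "complex^'n"
    have "cmono (\<lambda>i. if i = s then p else 0) (\<lambda>i. if i = e then q else 0) x =
        (\<Prod>i\<in>UNIV. (if i = s then x $ s ^ p else 1) * (if i = e then cnj (x $ e) ^ q else 1))"
      unfolding cmono_def by (intro prod.cong) auto
    then show "x $ s ^ p * cnj (x $ e) ^ q = cmono (\<lambda>i. if i = s then p else 0) (\<lambda>i. if i = e then q else 0) x"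
      by (simp add: prod.distrib)
  qed
  have "laplacian (\<lambda>x::complex^'n. x $ s ^ p * cnj (x $ e) ^ q) z = 0" for z
    unfolding m laplacian_wlap wlap_cmono using assms by (auto intro!: sum.neutral)
  moreover have "polynomial_function (\<lambda>x::complex^'n. x $ s ^ p * cnj (x $ e) ^ q)"
    by (intro polynomial_function_complex_mult polynomial_function_complex_power polynomial_function_bounded_linear bl)
  ultimately show ?thesis
    unfolding harmonic_polys_def
    by (simp add: power_mult_distrib power_add scaleR_conv_of_real[where 'a = complex])
qed

context inv_space
begin

lemma limit_point:
  assumes w: "w \<in> V" and x: "x \<noteq> 0" and X: "X \<longlonglongrightarrow> x"
  shows "(\<lambda>n. w (X n)) \<longlonglongrightarrow> w x"
proof -
  have "isCont w x"
    using smooth_on_continuous[OF smoothV[OF w]] x continuous_on_eq_continuous_at[of "- {0}" w]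
    by (auto simp: open_Compl)
  then show ?thesis using X by (rule isCont_tendsto_compose)
qed

text \<open>By \<open>red_const\<close> w is radial times a monomial with integer exponents where
  the coordinates s and e are nonzero. Continuity of w elsewhere forces nonnegative exponents, and
  density extends the formula. The last clause serves to transfer support conditions from w to
  h.\<close>

lemma highest_weight_form:
  assumes w: "w \<in> V" "w \<noteq> (\<lambda>x. 0)" "wt UNIV k w"
    and R: "\<And>i. i \<noteq> s \<Longrightarrow> Rop i s w = (\<lambda>x. 0)" "\<And>j. j \<noteq> e \<Longrightarrow> Rop e j w = (\<lambda>x. 0)" and se: "s \<noteq> e"
  shows "\<exists>h p q. smooth_on {0<..} h \<and> (\<forall>y\<le>0. h y = 0) \<and>
    (\<forall>x. w x = h ((norm x)\<^sup>2) * (x $ s ^ p * cnj (x $ e) ^ q)) \<and>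
    (\<forall>y>0. (\<forall>x. norm x = sqrt y \<longrightarrow> w x = 0) \<longrightarrow> h y = 0)"
proof -
  \<comment> \<open>A unit vector with both relevant coordinates real and nonzero; the radial factor
    is read off along its ray.\<close>
  define z0 where "z0 = (of_real (1 / sqrt 2)) *s (axis s 1 + axis e 1 :: complex^'n)"
  have z0s: "z0 $ s = of_real (1 / sqrt 2)" "z0 $ e = of_real (1 / sqrt 2)"
    using se by (simp_all add: z0_def axis_def)
  have nz0: "norm z0 = 1"
  proof -
    have "(norm (axis s 1 + axis e 1 :: complex^'n))\<^sup>2 = 2"
      using se by (simp add: power2_norm_eq_inner inner_add_left inner_add_right inner_axis_axis)
    then have "norm (axis s 1 + axis e 1 :: complex^'n) = sqrt 2" by (simp add: real_sqrt_unique)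
    then show ?thesis unfolding z0_def norm_smult by (simp add: norm_divide)
  qed
  define \<Phi> where "\<Phi> r = red s e k w (r *\<^sub>R z0)" for r
  have U: "w x = \<Phi> (norm x) * (x $ s powi k s * cnj (x $ e) powi (- k e))" if x: "x $ s \<noteq> 0" "x $ e \<noteq> 0" for x
  proof -
    have n0: "norm x \<noteq> 0" using x by auto
    have "red s e k w x = \<Phi> (norm x)"
      unfolding \<Phi>_def using x n0 by (intro red_const[OF w(1,3) R se]) (auto simp: z0s nz0)
    moreover have "x $ s powi (- k s) * x $ s powi k s = 1" "cnj (x $ e) powi (k e) * cnj (x $ e) powi (- k e) = 1"
      using x by (simp_all add: power_int_minus)
    then have "red s e k w x * (x $ s powi k s * cnj (x $ e) powi (- k e)) = w x"
      unfolding red_def by algebra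
    ultimately show ?thesis by simp
  qed
  define eps where "eps n = inverse (real (Suc n))" for n
  have eps0: "eps \<longlonglongrightarrow> 0" unfolding eps_def by (rule LIMSEQ_inverse_real_of_nat)
  have epsp: "0 < eps n" for n by (simp add: eps_def)
  have dense: "\<exists>X. X \<longlonglongrightarrow> x \<and> (\<forall>\<^sub>F n in sequentially. X n $ s \<noteq> 0 \<and> X n $ e \<noteq> 0)" for x :: "complex^'n"
  proof -
    \<comment> \<open>A coordinate equal to 0 becomes nonzero at once, and a nonzero one eventually
      stays so.\<close>
    define X where "X n = x + eps n *\<^sub>R (axis s 1 + axis e 1)" for n
    have lim: "X \<longlonglongrightarrow> x"
      unfolding X_def using tendsto_add[OF tendsto_const[of x] tendsto_scaleR[OF eps0 tendsto_const[of "axis s 1 + axis e 1 :: complex^'n"]]] by simp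
    have ev: "\<forall>\<^sub>F n in sequentially. X n $ i \<noteq> 0" if i: "i = s \<or> i = e" for i
    proof (cases "x $ i = 0")
      case True
      then have "X n $ i \<noteq> 0" for n
        using epsp[of n] i se by (auto simp: X_def axis_def scaleR_conv_of_real[where 'a = complex])
      then show ?thesis by simp
    next
      case False
      have "(\<lambda>n. X n $ i) \<longlonglongrightarrow> x $ i" by (intro tendsto_vec_nth lim)
      then show ?thesis using False by (rule tendsto_imp_eventually_ne)
    qed
    show ?thesis using lim ev[of s] ev[of e] by (intro exI[of _ X]) (auto intro: eventually_conj)
  qed
  obtain x1 where x1: "x1 $ s \<noteq> 0" "x1 $ e \<noteq> 0" "w x1 \<noteq> 0"
  proof -
    obtain x where x: "w x \<noteq> 0" using w(2) by auto
    then have x0: "x \<noteq> 0" using zeroV[OF w(1)] by auto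
    obtain X where X: "X \<longlonglongrightarrow> x" "\<forall>\<^sub>F n in sequentially. X n $ s \<noteq> 0 \<and> X n $ e \<noteq> 0" using dense by blast
    have "\<forall>\<^sub>F n in sequentially. w (X n) \<noteq> 0"
      using limit_point[OF w(1) x0 X(1)] x by (rule tendsto_imp_eventually_ne)
    from eventually_conj[OF this X(2)] have "\<forall>\<^sub>F n in sequentially. w (X n) \<noteq> 0 \<and> X n $ s \<noteq> 0 \<and> X n $ e \<noteq> 0" .
    then obtain n where "w (X n) \<noteq> 0 \<and> X n $ s \<noteq> 0 \<and> X n $ e \<noteq> 0" unfolding eventually_sequentially by auto
    then show thesis using that by blast
  qed
  define r where "r = norm x1"
  have r: "0 < r" using x1 by (auto simp: r_def)
  have \<Phi>r: "\<Phi> r \<noteq> 0" using U[OF x1(1,2)] x1(3) by (auto simp: r_def)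
  \<comment> \<open>Points with coordinates a n and b n lie on the sphere of radius r, where \<Phi>
    is nonzero, and tend to a point of a coordinate axis.\<close>
  define a where "a n = r / 2 * eps n" for n
  define b where "b n = sqrt (r\<^sup>2 - (a n)\<^sup>2)" for n
  have a: "0 < a n" "a n < r" for n
  proof -
    show "0 < a n" using epsp[of n] r by (simp add: a_def)
    have "eps n \<le> 1" by (simp add: eps_def field_simps)
    then have "r / 2 * eps n \<le> r / 2 * 1" using r by (intro mult_left_mono) auto
    then show "a n < r" using r by (simp add: a_def)
  qed
  have b: "0 < b n" for n using a[of n] by (simp add: b_def power_strict_mono)
  have ab: "(a n)\<^sup>2 + (b n)\<^sup>2 = r\<^sup>2" for n using a[of n] by (simp add: b_def power_mono)
  have a0: "a \<longlonglongrightarrow> 0" unfolding a_def using tendsto_mult_right_zero[OF eps0] by simp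
  have b0: "b \<longlonglongrightarrow> r"
  proof -
    have "b \<longlonglongrightarrow> sqrt (r\<^sup>2 - 0\<^sup>2)" unfolding b_def by (intro tendsto_intros a0)
    then show ?thesis using r by simp
  qed
  have nonneg: "0 \<le> m"
    if "i \<noteq> j" and form: "\<And>n. w (axis i (of_real (a n)) + axis j (of_real (b n))) = \<Phi> r * of_real (a n powi m * b n powi l)"
    for i j m l
  proof (rule ccontr)
    assume "\<not> 0 \<le> m"
    then obtain m' where m': "m = - int (Suc m')" by (metis nonneg_int_cases not_le negD)
    define X where "X n = axis i (of_real (a n)) + axis j (of_real (b n) :: complex)" for n
    have bl: "bounded_linear (\<lambda>c. axis i (of_real c :: complex) :: complex^'n)" for i
      by (intro linear_conv_bounded_linear[THEN iffD1] linearI) (auto simp: axis_def vec_eq_iff scaleR_conv_of_real[where 'a = complex])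
    have "X \<longlonglongrightarrow> axis i (of_real 0) + axis j (of_real r)"
      unfolding X_def by (intro tendsto_add bounded_linear.tendsto[OF bl] a0 b0)
    then have X: "X \<longlonglongrightarrow> axis j (of_real r)" by (simp add: axis_def zero_vec_def[symmetric] cong: if_cong)
    have ax: "axis j (of_real r) \<noteq> (0 :: complex^'n)" using r by (simp add: axis_eq_0_iff)
    \<comment> \<open>Multiplied by a positive power of a n, w tends to 0, being continuous at the
      nonzero axis point, whereas the form with a negative exponent tends to a nonzero
      value.\<close>
    have L1: "(\<lambda>n. w (X n) * of_real (a n) ^ Suc m') \<longlonglongrightarrow> w (axis j (of_real r)) * of_real 0 ^ Suc m'"
      by (intro tendsto_intros limit_point[OF w(1) ax X] a0)
    have eq: "w (X n) * of_real (a n) ^ Suc m' = \<Phi> r * of_real (b n powi l)" for n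
    proof -
      have "a n powi m * a n ^ Suc m' = 1"
        using a(1)[of n] by (simp add: m' power_int_minus del: of_nat_Suc power_Suc)
      then have "of_real (a n powi m) * of_real (a n) ^ Suc m' = (1 :: complex)"
        by (metis of_real_1 of_real_mult of_real_power)
      moreover have "u * (v * y) * z = u * y * (v * z)" for u v y z :: complex by (simp only: mult_ac)
      ultimately show ?thesis unfolding X_def form of_real_mult by simp
    qed
    have L2: "(\<lambda>n. \<Phi> r * of_real (b n powi l)) \<longlonglongrightarrow> \<Phi> r * of_real (r powi l)"
      using r by (intro tendsto_intros b0) auto
    have "\<Phi> r * of_real (r powi l) = 0" using LIMSEQ_unique[OF L2 L1[unfolded eq]] by simp
    then show False using \<Phi>r r by simp
  qed
  have nX: "norm (axis i (of_real (a n)) + axis j (of_real (b n)) :: complex^'n) = r" if "i \<noteq> j" for i j n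
  proof -
    have "(norm (axis i (of_real (a n)) + axis j (of_real (b n)) :: complex^'n))\<^sup>2 = r\<^sup>2"
      unfolding power2_norm_eq_inner inner_add_left inner_add_right inner_axis_axis
      using that ab[of n] by (simp add: inner_complex_def power2_eq_square)
    then show ?thesis using r by (simp add: power2_eq_iff_nonneg)
  qed
  have comp: "(axis i u + axis j v) $ i = u" "(axis i u + axis j v) $ j = v" if "i \<noteq> j" for i j :: 'n and u v :: complex
    using that by (simp_all add: axis_def)
  have ps: "0 \<le> k s"
  proof (rule nonneg[OF se])
    fix n
    show "w (axis s (of_real (a n)) + axis e (of_real (b n))) = \<Phi> r * of_real (a n powi (k s) * b n powi (- k e))"
      using a(1)[of n] b[of n] se by (subst U) (simp_all add: nX comp del: vector_add_component)
  qed
  have qe: "0 \<le> - k e"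
  proof (rule nonneg[OF se[symmetric]])
    fix n
    show "w (axis e (of_real (a n)) + axis s (of_real (b n))) = \<Phi> r * of_real (a n powi (- k e) * b n powi (k s))"
      using a(1)[of n] b[of n] se[symmetric] by (subst U) (simp_all add: nX comp mult.commute del: vector_add_component)
  qed
  define p where "p = nat (k s)"
  define q where "q = nat (- k e)"
  have kp: "k s = int p" "- k e = int q" using ps qe by (simp_all add: p_def q_def)
  have smw: "smooth_on {0<..} (\<lambda>t. w (t *\<^sub>R z0))"
    using nz0
    by (intro smooth_on_compose_linear[where T = "- {0}" and A = "\<lambda>t. t *\<^sub>R z0"] smoothV w(1) bounded_linear_scaleR_left) auto
  have \<Phi>_eq: "\<Phi> t = w (t *\<^sub>R z0) * of_real ((t * (1 / sqrt 2)) powi (k e - k s))" if "0 < t" for t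
  proof -
    have "(of_real (t * (1 / sqrt 2)) :: complex) powi (- k s) * of_real (t * (1 / sqrt 2)) powi (k e) = of_real ((t * (1 / sqrt 2)) powi (k e - k s))"
      using that by (simp add: power_int_diff power_int_minus divide_inverse mult.commute)
    then show ?thesis by (simp add: \<Phi>_def red_def z0s scaleR_conv_of_real[where 'a = complex] mult.assoc)
  qed
  have sm\<Phi>: "smooth_on {0<..} \<Phi>"
  proof -
    have "smooth_on {0<..} (\<lambda>t. (t * (1 / sqrt 2)) powi (k e - k s))"
      by (rule smooth_on_compose_real[where T = "{0<..}" and u = "\<lambda>t. t powi (k e - k s)" and g = "\<lambda>t. t * (1 / sqrt 2)"])
        (simp_all only: open_greaterThan smooth_on_powi smooth_on_mult smooth_on_id smooth_on_const, simp)
    then have "smooth_on {0<..} (\<lambda>t. w (t *\<^sub>R z0) * of_real ((t * (1 / sqrt 2)) powi (k e - k s)))"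
      by (intro smooth_on_mult smw smooth_on_of_real) auto
    then show ?thesis using \<Phi>_eq by (subst smooth_on_cong[OF open_greaterThan, of 0 \<Phi>]) auto
  qed
  define h where "h y = (if 0 < y then \<Phi> (sqrt y) else 0)" for y
  have "smooth_on {0<..} (\<lambda>y. \<Phi> (sqrt y))"
    by (rule smooth_on_compose_real[where T = "{0<..}"]) (auto intro: smooth_on_sqrt sm\<Phi>)
  then have smh: "smooth_on {0<..} h"
    by (subst smooth_on_cong[OF open_greaterThan, where g = "\<lambda>y. \<Phi> (sqrt y)"]) (auto simp: h_def)
  have all: "w x = h ((norm x)\<^sup>2) * (x $ s ^ p * cnj (x $ e) ^ q)" for x
  proof (cases "x = 0")
    case True
    then show ?thesis using zeroV[OF w(1)] by (simp add: h_def)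
  next
    case False
    obtain X where X: "X \<longlonglongrightarrow> x" "\<forall>\<^sub>F n in sequentially. X n $ s \<noteq> 0 \<and> X n $ e \<noteq> 0" using dense by blast
    have "(\<lambda>n. w (X n)) \<longlonglongrightarrow> w x" by (rule limit_point[OF w(1) False X(1)])
    moreover have "(\<lambda>n. w (X n)) \<longlonglongrightarrow> \<Phi> (norm x) * (x $ s ^ p * cnj (x $ e) ^ q)"
    proof (rule Lim_transform_eventually)
      have "isCont \<Phi> (norm x)"
        using smooth_on_continuous[OF sm\<Phi>] False by (simp add: continuous_on_eq_continuous_at)
      then have "(\<lambda>n. \<Phi> (norm (X n))) \<longlonglongrightarrow> \<Phi> (norm x)"
        using tendsto_norm[OF X(1)] by (rule isCont_tendsto_compose)
      then show "(\<lambda>n. \<Phi> (norm (X n)) * (X n $ s ^ p * cnj (X n $ e) ^ q)) \<longlonglongrightarrow> \<Phi> (norm x) * (x $ s ^ p * cnj (x $ e) ^ q)"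
        by (intro tendsto_intros X(1))
      show "\<forall>\<^sub>F n in sequentially. \<Phi> (norm (X n)) * (X n $ s ^ p * cnj (X n $ e) ^ q) = w (X n)"
        using X(2) by eventually_elim (simp add: U kp)
    qed
    ultimately have "w x = \<Phi> (norm x) * (x $ s ^ p * cnj (x $ e) ^ q)" by (rule LIMSEQ_unique)
    then show ?thesis using False by (simp add: h_def)
  qed
  have "h y = 0" if y: "0 < y" "\<forall>x. norm x = sqrt y \<longrightarrow> w x = 0" for y
  proof -
    have "w (sqrt y *\<^sub>R z0) = 0" using y nz0 by simp
    then show "h y = 0" using y(1) by (simp add: h_def \<Phi>_eq)
  qed
  moreover have "\<forall>y\<le>0. h y = 0" by (simp add: h_def)
  ultimately show ?thesis using smh all by (intro exI[of _ h] exI[of _ p] exI[of _ q]) simp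
qed

text \<open>An injective numbering of the coordinates orders the root vectors. Its extremal
  coordinates s and e are distinct because there are at least two coordinates, so the monomial found
  is harmonic.\<close>

theorem highest_weight_vector:
  assumes card: "2 \<le> CARD('n)" and v: "v \<in> V" "v \<noteq> (\<lambda>x. 0)"
  shows "\<exists>w h p q Y. w \<in> V \<and> w \<noteq> (\<lambda>x. 0) \<and> Y \<in> harmonic_polys p q \<and>
    smooth_on {0<..} h \<and> (\<forall>y\<le>0. h y = 0) \<and> w = (\<lambda>x. h ((norm x)\<^sup>2) * Y x) \<and>
    (\<forall>y>0. (\<forall>x. norm x = sqrt y \<longrightarrow> w x = 0) \<longrightarrow> h y = 0)"
proof -
  obtain d :: "'n \<Rightarrow> nat" where d: "inj d" using finite_imp_inj_to_nat_seg[of "UNIV :: 'n set"] by auto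
  have "Max (range d) \<in> range d" "Min (range d) \<in> range d" by (intro Max_in Min_in; simp)+
  then obtain s e where s: "Max (range d) = d s" and e: "Min (range d) = d e" by blast
  have ds: "d i < d s" if "i \<noteq> s" for i
    using Max_ge[of "range d" "d i"] that injD[OF d, of i s] s by (auto simp: order.strict_iff_order)
  have de: "d e < d j" if "j \<noteq> e" for j
    using Min_le[of "range d" "d j"] that injD[OF d, of e j] e by (auto simp: order.strict_iff_order)
  have se: "s \<noteq> e"
  proof
    assume "s = e"
    then have "i = s" for i using ds[of i] de[of i] by (cases "i = s") auto
    then have "(UNIV :: 'n set) = {s}" by auto
    then have "CARD('n) = card {s}" by (rule arg_cong)
    then show False using card by simp
  qed
  obtain w k where "w \<in> V \<and> w \<noteq> (\<lambda>x. 0) \<and> wt UNIV k w \<and> (\<forall>i j. d i < d j \<longrightarrow> Rop i j w = (\<lambda>x. 0))"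
    using highest_weight_exists[OF v, of d] by (elim exE)
  then have w: "w \<in> V" "w \<noteq> (\<lambda>x. 0)" "wt UNIV k w" "\<And>i j. d i < d j \<Longrightarrow> Rop i j w = (\<lambda>x. 0)"
    by simp_all
  have R: "\<And>i. i \<noteq> s \<Longrightarrow> Rop i s w = (\<lambda>x. 0)" "\<And>j. j \<noteq> e \<Longrightarrow> Rop e j w = (\<lambda>x. 0)"
    using w(4) ds de by auto
  obtain h p q where h: "smooth_on {0<..} h \<and> (\<forall>y\<le>0. h y = 0) \<and>
    (\<forall>x. w x = h ((norm x)\<^sup>2) * (x $ s ^ p * cnj (x $ e) ^ q)) \<and>
    (\<forall>y>0. (\<forall>x. norm x = sqrt y \<longrightarrow> w x = 0) \<longrightarrow> h y = 0)"
  proof -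
    have "\<exists>h p q. smooth_on {0<..} h \<and> (\<forall>y\<le>0. h y = 0) \<and>
      (\<forall>x. w x = h ((norm x)\<^sup>2) * (x $ s ^ p * cnj (x $ e) ^ q)) \<and>
      (\<forall>y>0. (\<forall>x. norm x = sqrt y \<longrightarrow> w x = 0) \<longrightarrow> h y = 0)"
      by (rule highest_weight_form[OF w(1-3) _ _ se]) (use R in auto)
    then show thesis using that by (elim exE)
  qed
  then have "w = (\<lambda>x. h ((norm x)\<^sup>2) * (x $ s ^ p * cnj (x $ e) ^ q))" by (intro ext) simp
  with h w(1,2) harmonic_monomial[OF se, of p q] show ?thesis by (intro exI conjI) auto
qed

section \<open>Complete reducibility\<close>

definition shell :: "real \<Rightarrow> real \<Rightarrow> (complex^'n) set" where
  "shell a b = {x. a < norm x \<and> norm x < b}"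

text \<open>Over a spherical shell with positive inner radius the integral is finite, although
  members of V may be singular at 0 and unbounded at infinity, and it is unitarily
  invariant.\<close>

definition ip :: "real \<Rightarrow> real \<Rightarrow> (complex^'n \<Rightarrow> complex) \<Rightarrow> (complex^'n \<Rightarrow> complex) \<Rightarrow> complex" where
  "ip a b F G = (\<integral>x. indicator (shell a b) x *\<^sub>R (F x * cnj (G x)) \<partial>lborel)"

lemma shell_open: "open (shell a b)"
  unfolding shell_def by (intro open_Collect_conj open_Collect_less continuous_intros)

lemma V_measurable: assumes "F \<in> V" shows "F \<in> borel_measurable borel"
proof -
  have "(\<lambda>y. if y \<in> - {0} then F y else 0) \<in> borel_measurable borel"
    by (intro borel_measurable_continuous_on_if continuous_on_const smooth_on_continuous smoothV assms) auto
  also have "(\<lambda>y. if y \<in> - {0} then F y else 0) = F"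
    using zeroV[OF assms] by (auto simp: fun_eq_iff)
  finally show ?thesis .
qed

lemma ip_integrable:
  assumes "F \<in> V" "G \<in> V" "0 < a"
  shows "integrable lborel (\<lambda>x. indicator (shell a b) x *\<^sub>R (F x * cnj (G x)))"
proof -
  note [measurable] = V_measurable[OF assms(1)] V_measurable[OF assms(2)]
  have [measurable]: "shell a b \<in> sets borel" using shell_open by simp
  have c: "continuous_on (- {0}) (\<lambda>x. F x * cnj (G x))"
    by (intro continuous_intros smooth_on_continuous smoothV assms)
  have "compact (cball 0 b - ball (0::complex^'n) a)" by (intro compact_diff) auto
  then have "compact ((\<lambda>x. F x * cnj (G x)) ` (cball 0 b - ball 0 a))"
    using assms(3) by (intro compact_continuous_image continuous_on_subset[OF c]) auto
  then have "bounded ((\<lambda>x. F x * cnj (G x)) ` (cball 0 b - ball 0 a))" by (rule compact_imp_bounded)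
  then obtain B where B: "\<forall>z\<in>(\<lambda>x. F x * cnj (G x)) ` (cball 0 b - ball 0 a). norm z \<le> B" unfolding bounded_iff ..
  show ?thesis
  proof (rule integrableI_bounded_set[where A = "shell a b" and B = B])
    have "emeasure lborel (shell a b) \<le> emeasure lborel (cball (0::complex^'n) b)"
      by (rule emeasure_mono) (auto simp: shell_def)
    also have "\<dots> < \<infinity>" using emeasure_bounded_finite[of "cball (0::complex^'n) b"] by simp
    finally show "emeasure lborel (shell a b) < \<infinity>" .
    show "AE x in lborel. x \<in> shell a b \<longrightarrow> norm (indicator (shell a b) x *\<^sub>R (F x * cnj (G x))) \<le> B"
      using B by (intro AE_I2) (auto simp: shell_def)
  qed auto
qed

lemma ip_add: "F \<in> V \<Longrightarrow> F' \<in> V \<Longrightarrow> G \<in> V \<Longrightarrow> 0 < a \<Longrightarrow> ip a b (\<lambda>x. F x + F' x) G = ip a b F G + ip a b F' G"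
  unfolding ip_def by (subst Bochner_Integration.integral_add[symmetric]) (auto intro: ip_integrable simp: algebra_simps)

lemma ip_scale: "ip a b (\<lambda>x. c * F x) G = c * ip a b F G"
  unfolding ip_def by (subst integral_mult_right_zero[symmetric]) (simp add: mult.assoc)

lemma ip_add2: "F \<in> V \<Longrightarrow> G \<in> V \<Longrightarrow> G' \<in> V \<Longrightarrow> 0 < a \<Longrightarrow> ip a b F (\<lambda>x. G x + G' x) = ip a b F G + ip a b F G'"
  unfolding ip_def by (subst Bochner_Integration.integral_add[symmetric]) (auto intro: ip_integrable simp: algebra_simps)

lemma ip_scale2: "ip a b F (\<lambda>x. c * G x) = cnj c * ip a b F G"
  unfolding ip_def by (subst integral_mult_right_zero[symmetric]) (simp add: mult.left_commute)

lemma ip_zero2: "ip a b F (\<lambda>x. 0) = 0"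
  by (simp add: ip_def)

lemma ip_UM:
  assumes "F \<in> V" "G \<in> V" "A \<in> UM"
  shows "ip a b (\<lambda>x. F (A x)) (\<lambda>x. G (A x)) = ip a b F G"
proof -
  note [measurable] = V_measurable[OF assms(1)] V_measurable[OF assms(2)]
  have [measurable]: "shell a b \<in> sets borel" using shell_open by simp
  have "indicat_real (shell a b) x = indicator (shell a b) (A x)" for x
    by (simp add: shell_def indicator_def UM_norm[OF assms(3)])
  then have "ip a b (\<lambda>x. F (A x)) (\<lambda>x. G (A x)) =
      (\<integral>x. (\<lambda>x. indicator (shell a b) x *\<^sub>R (F x * cnj (G x))) (A x) \<partial>lborel)"
    unfolding ip_def by simp
  also have "\<dots> = ip a b F G"
    unfolding ip_def by (rule integral_lborel_isometry[OF UM_linear[OF assms(3)] UM_norm[OF assms(3)]]) measurable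
  finally show ?thesis .
qed

text \<open>A nonempty open set on which F is nonzero would have positive measure. The conclusion is
  confined to the shell, so the radii must be adapted to V later.\<close>

lemma ip_definite:
  assumes F: "F \<in> V" and a: "0 < a" and z: "ip a b F F = 0" and x: "x \<in> shell a b"
  shows "F x = 0"
proof (rule ccontr)
  assume n: "F x \<noteq> 0"
  let ?f = "\<lambda>x. indicat_real (shell a b) x * (norm (F x))\<^sup>2"
  note [measurable] = V_measurable[OF F]
  have [measurable]: "shell a b \<in> sets borel" using shell_open by simp
  have e: "indicator (shell a b) x *\<^sub>R (F x * cnj (F x)) = of_real (?f x)" for x
    by (simp only: complex_norm_square[symmetric] scaleR_conv_of_real of_real_mult)
  have "integrable lborel (\<lambda>x. complex_of_real (?f x))" using ip_integrable[OF F F a, of b] unfolding e .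
  then have i: "integrable lborel ?f" by (simp only: complex_of_real_integrable_eq)
  have "complex_of_real (\<integral>x. ?f x \<partial>lborel) = 0" using z unfolding ip_def e integral_complex_of_real .
  then have "(\<integral>x. ?f x \<partial>lborel) = 0" by (simp only: of_real_eq_0_iff)
  then have "AE x in lborel. ?f x = 0" using i by (subst (asm) integral_nonneg_eq_0_iff_AE) auto
  then have ae: "AE x in lborel. x \<notin> {x \<in> shell a b. F x \<noteq> 0}" by eventually_elim auto
  have "open {x \<in> shell a b. F x \<noteq> 0}"
  proof -
    have "{x \<in> shell a b. F x \<noteq> 0} = shell a b \<inter> F -` (- {0})" by auto
    moreover have "continuous_on (shell a b) F"
      using a by (intro continuous_on_subset[OF smooth_on_continuous[OF smoothV[OF F]]]) (auto simp: shell_def)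
    then have "open (shell a b \<inter> F -` (- {0}))"
      by (rule continuous_open_preimage[OF _ shell_open]) (simp add: open_Compl)
    ultimately show ?thesis by simp
  qed
  then have "emeasure lborel {x \<in> shell a b. F x \<noteq> 0} \<noteq> 0" "{x \<in> shell a b. F x \<noteq> 0} \<in> sets lborel"
    using n x open_not_negligible[of "{x \<in> shell a b. F x \<noteq> 0}"]
    by (auto simp: negligible_iff_null_sets null_sets_def null_sets_completionI)
  then show False using ae by (simp add: AE_iff_measurable[OF _ refl] AE_iff_null_sets null_sets_def)
qed

text \<open>Gram-Schmidt, one generator at a time: c1 and F1 are the errors of c and F after
  projection to the old span, and F1 is then projected onto c1.\<close>

lemma projection:
  assumes B: "finite B" "B \<subseteq> V" and a: "0 < a"
    and def: "\<And>F. F \<in> V \<Longrightarrow> ip a b F F = 0 \<Longrightarrow> F = (\<lambda>x. 0)" and F: "F \<in> V"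
  shows "\<exists>P\<in>cfun.span B. \<forall>g\<in>cfun.span B. ip a b (\<lambda>x. F x - P x) g = 0"
  using B F
proof (induction B arbitrary: F rule: finite_induct)
  case empty
  then show ?case
    by (intro bexI[of _ "\<lambda>x. 0"]) (auto simp: zero_fun_def ip_zero2)
next
  case (insert c B)
  have sp: "cfun.span B \<subseteq> V" "cfun.span (insert c B) \<subseteq> V"
    by (rule cfun.span_minimal[OF _ subV]; use insert.prems(1) in auto)+
  have sub: "cfun.span B \<subseteq> cfun.span (insert c B)" by (rule cfun.span_mono) auto
  have cV: "c \<in> V" using insert.prems by auto
  obtain Q where Q: "Q \<in> cfun.span B" "\<forall>g\<in>cfun.span B. ip a b (\<lambda>x. c x - Q x) g = 0"
    using insert.IH[OF _ cV] insert.prems by blast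
  obtain P where P: "P \<in> cfun.span B" "\<forall>g\<in>cfun.span B. ip a b (\<lambda>x. F x - P x) g = 0"
    using insert.IH[OF _ insert.prems(2)] insert.prems by blast
  define c1 where "c1 x = c x - Q x" for x
  define F1 where "F1 x = F x - P x" for x
  have c1V: "c1 \<in> V" unfolding c1_def[abs_def] using Q(1) sp cV by (intro sub_diff subV) auto
  have F1V: "F1 \<in> V" unfolding F1_def[abs_def] using P(1) sp insert.prems by (intro sub_diff subV) auto
  \<comment> \<open>The value 0 covers the case c1 = 0, in which the new generator already lies in
    the old span.\<close>
  define k where "k = (if ip a b c1 c1 = 0 then 0 else ip a b F1 c1 / ip a b c1 c1)"
  have c1s: "c1 \<in> cfun.span (insert c B)"
    unfolding c1_def[abs_def] using Q(1) sub by (intro sub_diff[OF cfun.subspace_span]) (auto intro: cfun.span_base)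
  have Ps: "(\<lambda>x. P x + k * c1 x) \<in> cfun.span (insert c B)"
    using P(1) sub c1s by (intro cfun_add cfun_scale) auto
  have ipk: "ip a b (\<lambda>x. F1 x + (- k) * c1 x) g = ip a b F1 g + (- k) * ip a b c1 g" if "g \<in> V" for g
    by (simp only: ip_add[OF F1V sub_scale[OF subV c1V] that a] ip_scale)
  have "ip a b (\<lambda>x. F x - (P x + k * c1 x)) g = 0" if g: "g \<in> cfun.span (insert c B)" for g
  proof -
    obtain l where "(\<lambda>z. g z - l * c z) \<in> cfun.span B"
      using g cfun.span_breakdown_eq[of g c B] by (auto simp: fun_diff_def)
    moreover define g0 where "g0 z = (g z - l * c z) + l * Q z" for z
    ultimately have g0: "g0 \<in> cfun.span B"
      unfolding g0_def[abs_def] using Q(1) by (intro cfun_add cfun_scale)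
    have ge: "g = (\<lambda>z. g0 z + l * c1 z)" by (simp add: g0_def c1_def fun_eq_iff algebra_simps)
    have g0V: "g0 \<in> V" using g0 sp by blast
    have "ip a b (\<lambda>x. F x - (P x + k * c1 x)) g = ip a b (\<lambda>x. F1 x + (- k) * c1 x) g"
      by (simp add: F1_def algebra_simps)
    also have "\<dots> = ip a b F1 g + (- k) * ip a b c1 g"
      using g sp by (intro ipk) auto
    also have "ip a b F1 g = cnj l * ip a b F1 c1"
    proof -
      have "ip a b F1 g0 = 0" using P(2) g0 unfolding F1_def[abs_def] by blast
      then show ?thesis unfolding ge ip_add2[OF F1V g0V sub_scale[OF subV c1V] a] ip_scale2 by simp
    qed
    also have "ip a b c1 g = cnj l * ip a b c1 c1"
    proof -
      have "ip a b c1 g0 = 0" using Q(2) g0 unfolding c1_def[abs_def] by blast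
      then show ?thesis unfolding ge ip_add2[OF c1V g0V sub_scale[OF subV c1V] a] ip_scale2 by simp
    qed
    also have "cnj l * ip a b F1 c1 + - k * (cnj l * ip a b c1 c1) = 0"
    proof (cases "ip a b c1 c1 = 0")
      case True
      then have "c1 = (\<lambda>x. 0)" using def[OF c1V] by simp
      then show ?thesis by (simp add: ip_zero2)
    qed (simp add: k_def)
    finally show ?thesis .
  qed
  then show ?case using Ps by (intro bexI[of _ "\<lambda>x. P x + k * c1 x"]) auto
qed

lemma sub_inv_space:
  assumes "cfun.subspace W" "W \<subseteq> V" "\<And>A F. A \<in> UM \<Longrightarrow> F \<in> W \<Longrightarrow> (\<lambda>x. F (A x)) \<in> W"
  shows "inv_space W"
  using assms fd_subset[OF fdV assms(1,2)] by unfold_locales (auto intro: zeroV smoothV)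

text \<open>If the good functions did not span V, the orthogonal complement of their span would be a
  nonzero invariant space and so contain a good function, which would be orthogonal to itself.
  \<open>good\<close> stays abstract, for use with both \<open>Rplus\<close> and
  \<open>Rminus\<close>.\<close>

theorem complete_reducibility:
  assumes T: "\<And>F A. F \<in> V \<Longrightarrow> A \<in> UM \<Longrightarrow> good F \<Longrightarrow> good (\<lambda>x. F (A x))"
    and ex: "\<And>W F. inv_space W \<Longrightarrow> W \<subseteq> V \<Longrightarrow> F \<in> W \<Longrightarrow> F \<noteq> (\<lambda>x. 0) \<Longrightarrow> \<exists>w\<in>W. w \<noteq> (\<lambda>x. 0) \<and> good w"
  shows "V \<subseteq> cfun.span {F \<in> V. good F}"
proof (rule ccontr)
  let ?G = "{F \<in> V. good F}"
  let ?S = "cfun.span ?G"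
  assume "\<not> V \<subseteq> ?S"
  then obtain F where F: "F \<in> V" "F \<notin> ?S" by blast
  have SV: "?S \<subseteq> V" by (intro cfun.span_minimal subV) auto
  obtain X e where "finite X \<and> (\<forall>x\<in>X. e x \<in> V) \<and> (\<forall>F\<in>V. \<forall>z. F z = (\<Sum>x\<in>X. F x * e x z))"
    using fd_dual[OF fdV] by (elim exE)
  then have X: "finite X" "\<And>F z. F \<in> V \<Longrightarrow> F z = (\<Sum>x\<in>X. F x * e x z)" by simp_all
  \<comment> \<open>The shell contains all nonzero points of X. The form is then definite on V,
    because a member vanishing on X is zero and every member vanishes at the origin.\<close>
  obtain a b where ab: "0 < a" "\<And>x. x \<in> X \<Longrightarrow> x \<noteq> 0 \<Longrightarrow> x \<in> shell a b"
  proof -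
    let ?N = "insert 1 (norm ` (X - {0}))"
    have fin: "finite ?N" using X(1) by simp
    have p: "0 < Min ?N" using fin by (subst Min_gr_iff) auto
    have "x \<in> shell (Min ?N / 2) (Max ?N + 1)" if "x \<in> X" "x \<noteq> 0" for x
    proof -
      have "norm x \<in> ?N" using that by auto
      then have "Min ?N \<le> norm x" "norm x \<le> Max ?N" using fin by auto
      then show ?thesis using p by (simp add: shell_def)
    qed
    then show thesis using p by (intro that[of "Min ?N / 2" "Max ?N + 1"]) auto
  qed
  have def: "F = (\<lambda>x. 0)" if "F \<in> V" "ip a b F F = 0" for F
  proof
    fix z
    have "F x = 0" if "x \<in> X" for x
      using ip_definite[OF \<open>F \<in> V\<close> ab(1) \<open>ip a b F F = 0\<close>] ab(2)[OF that] zeroV[OF \<open>F \<in> V\<close>] by (cases "x = 0") auto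
    then have "(\<Sum>x\<in>X. F x * e x z) = 0" by (intro sum.neutral) simp
    then show "F z = 0" using X(2)[OF \<open>F \<in> V\<close>, of z] by simp
  qed
  have "fd ?S" by (rule fd_subset[OF fdV _ SV]) (rule cfun.subspace_span)
  then obtain B where B: "finite B" "?S = cfun.span B" by (rule fd_basis)
  have BV: "B \<subseteq> V" using SV B(2) cfun.span_superset[of B] by auto
  obtain P where P: "P \<in> ?S" "\<forall>g\<in>?S. ip a b (\<lambda>x. F x - P x) g = 0"
    using projection[OF B(1) BV ab(1) def F(1)] unfolding B(2)[symmetric] by auto
  define W where "W = {F \<in> V. \<forall>g\<in>?S. ip a b F g = 0}"
  have Sinv: "(\<lambda>x. g (A x)) \<in> ?S" if "g \<in> ?S" "A \<in> UM" for g A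
    using that(1)
  proof (induction rule: cfun_span_induct)
    case (base g)
    then show ?case using T[of g A] inv[OF that(2)] that(2) by (intro cfun.span_base) auto
  qed (auto intro: cfun_zero cfun_add cfun_scale)
  have W: "inv_space W"
  proof (rule sub_inv_space)
    show "cfun.subspace W"
      unfolding W_def
    proof (rule subspaceI)
      show "(\<lambda>x. 0) \<in> {F \<in> V. \<forall>g\<in>?S. ip a b F g = 0}" using sub_zero[OF subV] by (simp add: ip_def)
      show "(\<lambda>x. f x + g x) \<in> {F \<in> V. \<forall>g\<in>?S. ip a b F g = 0}"
        if "f \<in> {F \<in> V. \<forall>g\<in>?S. ip a b F g = 0}" "g \<in> {F \<in> V. \<forall>g\<in>?S. ip a b F g = 0}" for f g
        using that SV by (auto intro: sub_add[OF subV] simp: ip_add[OF _ _ _ ab(1)] subset_iff)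
      show "(\<lambda>x. c * f x) \<in> {F \<in> V. \<forall>g\<in>?S. ip a b F g = 0}"
        if "f \<in> {F \<in> V. \<forall>g\<in>?S. ip a b F g = 0}" for c f
        using that by (auto intro: sub_scale[OF subV] simp: ip_scale)
    qed
    show "W \<subseteq> V" by (auto simp: W_def)
    show "(\<lambda>x. F (A x)) \<in> W" if A: "A \<in> UM" and "F \<in> W" for A F
    proof -
      have F: "F \<in> V" "\<And>g. g \<in> ?S \<Longrightarrow> ip a b F g = 0" using \<open>F \<in> W\<close> by (auto simp: W_def)
      \<comment> \<open>The complement is invariant under A because the span of the good functions
        is invariant under the inverse of A.\<close>
      obtain A' where A': "A' \<in> UM" "\<And>x. A (A' x) = x" "\<And>x. A' (A x) = x" using UM_inverse[OF A] by metis
      have "ip a b (\<lambda>x. F (A x)) g = 0" if g: "g \<in> ?S" for g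
      proof -
        have g': "(\<lambda>x. g (A' x)) \<in> ?S" by (rule Sinv[OF g A'(1)])
        have "ip a b (\<lambda>x. F (A x)) g = ip a b (\<lambda>x. F (A x)) (\<lambda>x. (\<lambda>x. g (A' x)) (A x))" by (simp add: A'(3))
        also have "\<dots> = ip a b F (\<lambda>x. g (A' x))" using g' SV by (intro ip_UM[OF F(1) _ A]) auto
        also have "\<dots> = 0" by (rule F(2)[OF g'])
        finally show ?thesis .
      qed
      then show ?thesis using inv[OF A F(1)] by (simp add: W_def)
    qed
  qed
  have "(\<lambda>x. F x - P x) \<in> W"
    unfolding W_def using P F(1) SV by (auto intro: sub_diff[OF subV])
  moreover have "(\<lambda>x. F x - P x) \<noteq> (\<lambda>x. 0)"
  proof
    assume "(\<lambda>x. F x - P x) = (\<lambda>x. 0)"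
    then have "F = P" by (simp add: fun_eq_iff)
    then show False using P(1) F(2) by simp
  qed
  ultimately obtain w where w: "w \<in> W" "w \<noteq> (\<lambda>x. 0)" "good w"
    using ex[OF W, of "\<lambda>x. F x - P x"] by (auto simp: W_def)
  then have "w \<in> ?S" by (intro cfun.span_base) (auto simp: W_def)
  then have "ip a b w w = 0" using w(1) by (auto simp: W_def)
  then show False using def[of w] w by (auto simp: W_def)
qed

end

section \<open>The function spaces\<close>

lemma UM_expand: "A \<in> UM \<Longrightarrow> A x = (\<Sum>j\<in>UNIV. x $ j *s A (axis j 1))"
proof -
  assume A: "A \<in> UM"
  have "x = (\<Sum>j\<in>UNIV. x $ j *s axis j 1)"
    by (simp add: vec_eq_iff axis_def if_distrib cong: if_cong)
  then have "A x = A (\<Sum>j\<in>UNIV. x $ j *s axis j 1)" by (rule arg_cong)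
  then show ?thesis by (simp add: linear_sum[OF UM_linear[OF A]] UM_smult[OF A])
qed

lemma matrix_inv_eqI:
  fixes A B :: "complex^'n^'n"
  assumes "A ** B = mat 1" "B ** A = mat 1" shows "matrix_inv A = B"
  unfolding matrix_inv_def
proof (rule some_equality)
  show "A ** B = mat 1 \<and> B ** A = mat 1" using assms by simp
  fix C assume C: "A ** C = mat 1 \<and> C ** A = mat 1"
  have "C = C ** (A ** B)" using assms by simp
  also have "\<dots> = B" using C by (simp add: matrix_mul_assoc)
  finally show "C = B" .
qed

lemma unitary_group_UM:
  assumes "g \<in> unitary_group" shows "(\<lambda>x. matrix_inv g *v x) \<in> UM"
proof -
  let ?h = "\<chi> i j. cnj (g $ j $ i)"
  have hg: "?h ** g = mat 1" using assms by (simp add: unitary_group_def)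
  then have gh: "g ** ?h = mat 1" by (simp add: matrix_left_right_inverse)
  have "matrix_inv g = ?h" by (rule matrix_inv_eqI[OF gh hg])
  moreover have "norm (?h *v x) = norm x" for x
  proof -
    have "bilin (cnj_vec (?h *v x)) (?h *v x) = bilin (cnj_vec x) (g *v (?h *v x))"
    proof -
      have "bilin (cnj_vec (?h *v x)) y = bilin (cnj_vec x) (g *v y)" for y
        unfolding bilin_def cnj_vec_def matrix_vector_mult_def
        by (simp add: sum_distrib_left sum_distrib_right mult_ac) (rule sum.swap)
      then show ?thesis .
    qed
    also have "\<dots> = bilin (cnj_vec x) x" using gh by (simp add: matrix_vector_mul_assoc)
    finally have "(norm (?h *v x))\<^sup>2 = (norm x)\<^sup>2"
      using Re_bilin[of "?h *v x" "?h *v x"] Re_bilin[of x x] by (simp add: power2_norm_eq_inner)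
    then show ?thesis by simp
  qed
  ultimately show ?thesis
    unfolding UM_def by (auto simp: matrix_vector_right_distrib vector_scalar_commute)
qed

lemma UM_unitary_group:
  fixes A :: "complex^'n \<Rightarrow> complex^'n"
  assumes A: "A \<in> UM" obtains g where "g \<in> unitary_group" "\<And>x. matrix_inv g *v x = A x"
proof -
  obtain A' where A': "A' \<in> UM" "\<And>x. A (A' x) = x" "\<And>x. A' (A x) = x" using UM_inverse[OF A] by metis
  define g where "g = (\<chi> i j. A' (axis j 1) $ i)"
  have gv: "g *v x = A' x" for x
    by (subst UM_expand[OF A'(1)]) (simp add: g_def matrix_vector_mult_def vec_eq_iff mult.commute)
  let ?h = "\<chi> i j. cnj (g $ j $ i)"
  have hg: "?h ** g = mat 1"
  proof -
    have "(\<Sum>k\<in>UNIV. cnj (A' (axis i 1) $ k) * A' (axis j 1) $ k) = (if i = j then 1 else 0)" for i j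
    proof -
      have "(\<Sum>k\<in>UNIV. cnj (A' (axis i 1) $ k) * A' (axis j 1) $ k) = bilin (cnj_vec (A' (axis i 1))) (A' (axis j 1))"
        by (simp add: bilin_def cnj_vec_def)
      also have "\<dots> = bilin (cnj_vec (axis i 1)) (axis j 1)" by (rule bilin_UM[OF A'(1)])
      also have "\<dots> = (if i = j then 1 else 0)"
      proof -
        have "cnj (axis i (1::complex) $ k) * axis j 1 $ k = (if k = i then (if i = j then 1 else 0) else 0)" for k
          by (simp add: axis_def)
        then show ?thesis by (simp add: bilin_def cnj_vec_def)
      qed
      finally show ?thesis .
    qed
    then show ?thesis by (simp add: g_def matrix_matrix_mult_def mat_def vec_eq_iff)
  qed
  then have gu: "g \<in> unitary_group" by (simp add: unitary_group_def)
  have gh: "g ** ?h = mat 1" using hg by (simp add: matrix_left_right_inverse)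
  have inv: "matrix_inv g = ?h" by (rule matrix_inv_eqI[OF gh hg])
  have "matrix_inv g *v x = A x" for x
  proof -
    have "matrix_inv g *v x = matrix_inv g *v (g *v A x)" by (simp add: gv A'(3))
    also have "\<dots> = A x" unfolding inv by (simp add: matrix_vector_mul_assoc hg)
    finally show ?thesis .
  qed
  with gu show thesis by (rule that)
qed

text \<open>Unitary matrices and \<open>UM\<close> produce the same set of translates, since the
  inverses of unitary matrices act as exactly the members of \<open>UM\<close>.\<close>

lemma K_finite_iff: "K_finite f \<longleftrightarrow> (\<exists>B. finite B \<and> (\<forall>A\<in>UM. (\<lambda>x. f (A x)) \<in> cfun.span B))"
proof -
  have "{\<lambda>x. f (matrix_inv g *v x) |g. g \<in> unitary_group} = {\<lambda>x. f (A x) |A. A \<in> UM}"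
  proof (intro equalityI subsetI)
    fix F assume "F \<in> {\<lambda>x. f (matrix_inv g *v x) |g. g \<in> unitary_group}"
    then show "F \<in> {\<lambda>x. f (A x) |A. A \<in> UM}" using unitary_group_UM by auto
  next
    fix F assume "F \<in> {\<lambda>x. f (A x) |A. A \<in> UM}"
    then obtain A where A: "A \<in> UM" "F = (\<lambda>x. f (A x))" by blast
    obtain g where "g \<in> unitary_group" "\<And>x. matrix_inv g *v x = A x" using UM_unitary_group[OF A(1)] by metis
    then show "F \<in> {\<lambda>x. f (matrix_inv g *v x) |g. g \<in> unitary_group}"
      unfolding A(2) by (intro CollectI exI[of _ g]) simp
  qed
  then show ?thesis unfolding K_finite_def by auto
qed

section \<open>K-finiteness of radial functions times polynomials\<close>

lemma K_finite_add:
  fixes f g :: "complex^'n \<Rightarrow> complex"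
  assumes "K_finite f" "K_finite g" shows "K_finite (\<lambda>x. f x + g x)"
proof -
  obtain B C where B: "finite B" "\<forall>A\<in>UM. (\<lambda>x. f (A x)) \<in> cfun.span B" and C: "finite C" "\<forall>A\<in>UM. (\<lambda>x. g (A x)) \<in> cfun.span C"
    using assms unfolding K_finite_iff by blast
  have s: "cfun.span B \<subseteq> cfun.span (B \<union> C)" "cfun.span C \<subseteq> cfun.span (B \<union> C)"
    by (rule cfun.span_mono, simp)+
  show ?thesis
    unfolding K_finite_iff using B C s by (intro exI[of _ "B \<union> C"] conjI ballI cfun_add) auto
qed

lemma K_finite_scale: assumes "K_finite f" shows "K_finite (\<lambda>x. c * f x)"
proof -
  obtain B where B: "finite B" "\<forall>A\<in>UM. (\<lambda>x. f (A x)) \<in> cfun.span B" using assms unfolding K_finite_iff by blast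
  have "\<forall>A\<in>UM. (\<lambda>x. c * f (A x)) \<in> cfun.span B"
  proof
    fix A :: "complex^'a \<Rightarrow> complex^'a" assume "A \<in> UM"
    then show "(\<lambda>x. c * f (A x)) \<in> cfun.span B" using B(2) by (intro cfun_scale) simp
  qed
  then show ?thesis unfolding K_finite_iff using B(1) by (intro exI[of _ B]) simp
qed

text \<open>Bounding the total degree in x and its conjugate gives a space with finitely many
  generators that contains all unitary translates of a polynomial at once.\<close>

definition pdeg :: "nat \<Rightarrow> (complex^'n::finite \<Rightarrow> complex) set" where
  "pdeg k = cfun.span ((\<lambda>(\<alpha>, \<beta>). cmono \<alpha> \<beta>) ` {(\<alpha>, \<beta>). sum \<alpha> UNIV + sum \<beta> UNIV \<le> k})"

lemma finite_degrees: "finite {(\<alpha>::'n::finite \<Rightarrow> nat, \<beta>::'n \<Rightarrow> nat). sum \<alpha> UNIV + sum \<beta> UNIV \<le> k}"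
proof -
  have le: "\<alpha> i \<le> sum \<alpha> UNIV" for \<alpha> :: "'n \<Rightarrow> nat" and i by (rule member_le_sum) auto
  have "{(\<alpha>::'n \<Rightarrow> nat, \<beta>::'n \<Rightarrow> nat). sum \<alpha> UNIV + sum \<beta> UNIV \<le> k} \<subseteq> (Pi\<^sub>E UNIV (\<lambda>_. {..k})) \<times> (Pi\<^sub>E UNIV (\<lambda>_. {..k}))"
    using le by (fastforce intro: order_trans)
  then show ?thesis by (rule finite_subset) (intro finite_cartesian_product finite_PiE; simp)
qed

lemma pdeg_cmono: "sum \<alpha> UNIV + sum \<beta> UNIV \<le> k \<Longrightarrow> cmono \<alpha> \<beta> \<in> pdeg k"
  unfolding pdeg_def by (intro cfun.span_base) auto

lemma pdeg_mono: "j \<le> k \<Longrightarrow> pdeg j \<subseteq> pdeg k"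
  unfolding pdeg_def by (intro cfun.span_mono image_mono) auto

lemma pdeg_mult: "f \<in> pdeg j \<Longrightarrow> g \<in> pdeg k \<Longrightarrow> (\<lambda>x. f x * g x) \<in> pdeg (j + k)"
  unfolding pdeg_def[of j]
proof (induction rule: cfun_span_induct)
  case (base f)
  then obtain \<alpha> \<beta> where f: "f = cmono \<alpha> \<beta>" "sum \<alpha> UNIV + sum \<beta> UNIV \<le> j" by auto
  from base(2) show ?case
    unfolding pdeg_def[of k]
  proof (induction rule: cfun_span_induct)
    case (base g)
    then show ?case using f by (auto simp: cmono_mult sum.distrib intro!: pdeg_cmono)
  next
    case zero
    show ?case by (simp add: pdeg_def cfun_zero)
  next
    case (add g h)
    then show ?case unfolding pdeg_def by (simp add: distrib_left cfun_add)
  next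
    case (scale c g)
    then show ?case unfolding pdeg_def using cfun_scale[of "\<lambda>x. f x * g x" _ c] by (simp add: mult.left_commute)
  qed
next
  case zero
  show ?case by (simp add: pdeg_def cfun_zero)
next
  case (add f h)
  then show ?case unfolding pdeg_def by (simp add: distrib_right cfun_add)
next
  case (scale c f)
  then show ?case unfolding pdeg_def using cfun_scale[of "\<lambda>x. f x * g x" _ c] by (simp add: mult.assoc)
qed

lemma pdeg_const: "(\<lambda>x. c) \<in> pdeg 0"
  using cfun_scale[of "cmono (\<lambda>_. 0) (\<lambda>_. 0)" _ c] pdeg_cmono[of "\<lambda>_. 0" "\<lambda>_. 0" 0]
  unfolding pdeg_def by (simp add: cmono_def)

lemma pdeg_nth: "(\<lambda>x. x $ k) \<in> pdeg 1" "(\<lambda>x. cnj (x $ k)) \<in> pdeg 1"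
proof -
  have "cmono (\<lambda>i. if i = k then 1 else 0) (\<lambda>_. 0) x = (\<Prod>i\<in>UNIV. if i = k then x $ k else 1)"
    "cmono (\<lambda>_. 0) (\<lambda>i. if i = k then 1 else 0) x = (\<Prod>i\<in>UNIV. if i = k then cnj (x $ k) else 1)" for x
    unfolding cmono_def by (intro prod.cong refl; simp)+
  then have "cmono (\<lambda>i. if i = k then 1 else 0) (\<lambda>_. 0) = (\<lambda>x. x $ k)"
    "cmono (\<lambda>_. 0) (\<lambda>i. if i = k then 1 else 0) = (\<lambda>x. cnj (x $ k))"
    by (simp_all add: fun_eq_iff)
  then show "(\<lambda>x. x $ k) \<in> pdeg 1" "(\<lambda>x. cnj (x $ k)) \<in> pdeg 1"
    using pdeg_cmono[of "\<lambda>i. if i = k then 1 else 0" "\<lambda>_. 0" 1]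
      pdeg_cmono[of "\<lambda>_. 0" "\<lambda>i. if i = k then 1 else 0" 1] by simp_all
qed

lemma pdeg_power: "f \<in> pdeg j \<Longrightarrow> (\<lambda>x. f x ^ k) \<in> pdeg (k * j)"
  by (induction k) (use pdeg_const[of 1] pdeg_mult in auto)

lemma pdeg_prod:
  assumes "finite I" shows "(\<And>i. i \<in> I \<Longrightarrow> f i \<in> pdeg (d i)) \<Longrightarrow> (\<lambda>x. \<Prod>i\<in>I. f i x) \<in> pdeg (sum d I)"
  using assms
proof (induction I rule: finite_induct)
  case (insert k I)
  then have "(\<lambda>x. f k x * (\<Prod>i\<in>I. f i x)) \<in> pdeg (d k + sum d I)" by (intro pdeg_mult) auto
  then show ?case using insert.hyps by simp
qed (simp add: pdeg_const)

lemma pdeg_UM_nth: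
  assumes "A \<in> UM" shows "(\<lambda>x. A x $ i) \<in> pdeg 1" "(\<lambda>x. cnj (A x $ i)) \<in> pdeg 1"
proof -
  have "(\<lambda>x. A x $ i) = (\<lambda>x. \<Sum>j\<in>UNIV. A (axis j 1) $ i * x $ j)"
    by (rule ext, subst UM_expand[OF assms]) (simp add: mult.commute)
  moreover have "(\<lambda>x. cnj (A x $ i)) = (\<lambda>x. \<Sum>j\<in>UNIV. cnj (A (axis j 1) $ i) * cnj (x $ j))"
    by (rule ext, subst UM_expand[OF assms]) (simp add: mult.commute)
  moreover have "(\<lambda>x. \<Sum>j\<in>UNIV. c j * x $ j) \<in> pdeg 1" "(\<lambda>x. \<Sum>j\<in>UNIV. c j * cnj (x $ j)) \<in> pdeg 1" for c
    unfolding pdeg_def by (intro cfun_sum cfun_scale pdeg_nth[unfolded pdeg_def])+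
  ultimately show "(\<lambda>x. A x $ i) \<in> pdeg 1" "(\<lambda>x. cnj (A x $ i)) \<in> pdeg 1" by simp_all
qed

lemma polys_UM_pdeg: "P \<in> polys \<Longrightarrow> \<exists>k. \<forall>A\<in>UM. (\<lambda>x. P (A x)) \<in> pdeg k"
proof (induction rule: polys_induct)
  case (mono \<alpha> \<beta>)
  have "(\<lambda>x. cmono \<alpha> \<beta> (A x)) \<in> pdeg (\<Sum>i\<in>UNIV. \<alpha> i * 1 + \<beta> i * 1)" if "A \<in> UM" for A
    unfolding cmono_def by (intro pdeg_prod pdeg_mult pdeg_power pdeg_UM_nth that) simp
  then show ?case by blast
next
  case zero
  show ?case using pdeg_const[of 0] by blast
next
  case (add f g)
  then obtain j k where "\<forall>A\<in>UM. (\<lambda>x. f (A x)) \<in> pdeg j" "\<forall>A\<in>UM. (\<lambda>x. g (A x)) \<in> pdeg k" by blast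
  then have "\<forall>A\<in>UM. (\<lambda>x. f (A x)) \<in> pdeg (max j k) \<and> (\<lambda>x. g (A x)) \<in> pdeg (max j k)"
    using pdeg_mono[of j "max j k"] pdeg_mono[of k "max j k"] by auto
  then show ?case
    unfolding pdeg_def by (intro exI[of _ "max j k"]) (simp add: cfun_add)
next
  case (scale c f)
  then obtain k where k: "\<forall>A\<in>UM. (\<lambda>x. f (A x)) \<in> pdeg k" by blast
  show ?case
  proof (intro exI ballI)
    fix A :: "complex^'a \<Rightarrow> complex^'a" assume "A \<in> UM"
    then show "(\<lambda>x. c * f (A x)) \<in> pdeg k" using k unfolding pdeg_def by (intro cfun_scale) simp
  qed
qed

text \<open>Unitary maps fix the radial factor and keep the degree of P bounded; the finitely many
  monomials up to that degree, times the radial factor, span all translates.\<close>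

lemma K_finite_radial:
  assumes "P \<in> polys" shows "K_finite (\<lambda>x. a (norm x) * P x)"
proof -
  obtain k where k: "\<forall>A\<in>UM. (\<lambda>x. P (A x)) \<in> pdeg k" using polys_UM_pdeg[OF assms] by blast
  let ?M = "(\<lambda>(\<alpha>, \<beta>). cmono \<alpha> \<beta>) ` {(\<alpha>, \<beta>). sum \<alpha> UNIV + sum \<beta> UNIV \<le> k}"
  let ?B = "(\<lambda>m x. a (norm x) * m x) ` ?M"
  have "(\<lambda>x. a (norm x) * f x) \<in> cfun.span ?B" if "f \<in> pdeg k" for f
    using that unfolding pdeg_def
  proof (induction rule: cfun_span_induct)
    case (base f)
    then show ?case by (intro cfun.span_base) blast
  next
    case (add f g)
    then show ?case by (simp add: distrib_left cfun_add)
  next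
    case (scale c f)
    then show ?case using cfun_scale[of "\<lambda>x. a (norm x) * f x" ?B c] by (simp add: mult.left_commute)
  qed (simp add: cfun_zero)
  then have "(\<lambda>x. a (norm (A x)) * P (A x)) \<in> cfun.span ?B" if "A \<in> UM" for A
    using k that unfolding UM_norm[OF that] by blast
  then show ?thesis
    unfolding K_finite_iff using finite_degrees by (intro exI[of _ ?B] conjI ballI finite_imageI)
qed

section \<open>Radial functions times harmonic polynomials span the function spaces\<close>

lemma C_all_add: "f \<in> C_all \<Longrightarrow> g \<in> C_all \<Longrightarrow> (\<lambda>x. f x + g x) \<in> C_all"
  unfolding C_all_def by (simp add: smooth_on_add K_finite_add open_Compl)

lemma C_all_scale: "f \<in> C_all \<Longrightarrow> (\<lambda>x. c * f x) \<in> C_all"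
  unfolding C_all_def by (simp add: smooth_on_mult smooth_on_const K_finite_scale open_Compl)

lemma C_plus_subspace: "cfun.subspace (C_plus :: (complex^'n \<Rightarrow> complex) set)"
proof (rule subspaceI)
  have "K_finite (\<lambda>x. 0)" using K_finite_radial[OF polys_zero] by simp
  then show "(\<lambda>x. 0) \<in> C_plus" unfolding C_plus_def C_all_def by (simp add: smooth_on_const open_Compl)
  fix f g :: "complex^'n \<Rightarrow> complex" assume "f \<in> C_plus" "g \<in> C_plus"
  then obtain R Q where "\<forall>x. R < norm x \<longrightarrow> f x = 0" "\<forall>x. Q < norm x \<longrightarrow> g x = 0" "f \<in> C_all" "g \<in> C_all"
    unfolding C_plus_def by blast
  then show "(\<lambda>x. f x + g x) \<in> C_plus"
    unfolding C_plus_def by (auto intro: C_all_add exI[of _ "max R Q"])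
next
  fix c and f :: "complex^'n \<Rightarrow> complex" assume "f \<in> C_plus"
  then show "(\<lambda>x. c * f x) \<in> C_plus" unfolding C_plus_def using C_all_scale[of f c] by auto
qed

lemma C_minus_subspace: "cfun.subspace (C_minus :: (complex^'n \<Rightarrow> complex) set)"
proof (rule subspaceI)
  have "K_finite (\<lambda>x. 0)" using K_finite_radial[OF polys_zero] by simp
  then show "(\<lambda>x. 0) \<in> C_minus"
    unfolding C_minus_def C_all_def by (auto simp: smooth_on_const open_Compl intro: exI[of _ 1])
  fix f g :: "complex^'n \<Rightarrow> complex" assume "f \<in> C_minus" "g \<in> C_minus"
  then obtain R Q where RQ: "0 < R" "0 < Q" "\<forall>x. norm x < R \<longrightarrow> f x = 0" "\<forall>x. norm x < Q \<longrightarrow> g x = 0"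
    and fg: "f \<in> C_all" "g \<in> C_all"
    unfolding C_minus_def by blast
  then have "0 < min R Q" "\<forall>x. norm x < min R Q \<longrightarrow> f x + g x = 0" by simp_all
  then show "(\<lambda>x. f x + g x) \<in> C_minus"
    unfolding C_minus_def using C_all_add[OF fg] by blast
next
  fix c and f :: "complex^'n \<Rightarrow> complex" assume "f \<in> C_minus"
  then show "(\<lambda>x. c * f x) \<in> C_minus" unfolding C_minus_def using C_all_scale[of f c] by auto
qed

text \<open>Y is evaluated at x and not on the unit sphere; the resulting power of the norm is
  smooth off 0 and absorbed by the profile.\<close>

definition Rplus :: "(complex^'n \<Rightarrow> complex) set" where
  "Rplus = {\<lambda>x. h ((norm x)\<^sup>2) * Y x |h p q Y. h \<in> Cp \<and> Y \<in> harmonic_polys p q}"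

text \<open>In the variable 1 / ||x||^2 vanishing near 0 becomes vanishing for large argument, so
  the same class \<open>Cp\<close> serves both spaces.\<close>

definition Rminus :: "(complex^'n \<Rightarrow> complex) set" where
  "Rminus = {\<lambda>x. h (1 / (norm x)\<^sup>2) * Y x |h p q Y. h \<in> Cp \<and> Y \<in> harmonic_polys p q}"

lemma RplusI: "h \<in> Cp \<Longrightarrow> Y \<in> harmonic_polys p q \<Longrightarrow> (\<lambda>x. h ((norm x)\<^sup>2) * Y x) \<in> Rplus"
  unfolding Rplus_def by blast

lemma RminusI: "h \<in> Cp \<Longrightarrow> Y \<in> harmonic_polys p q \<Longrightarrow> (\<lambda>x. h (1 / (norm x)\<^sup>2) * Y x) \<in> Rminus"
  unfolding Rminus_def by blast

lemma smooth_norm_square: "smooth_on (- {0}) (\<lambda>x::complex^'n. (norm x)\<^sup>2)"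
  by (intro smooth_on_power smooth_on_norm) (simp add: open_Compl)

lemma smooth_radial_mult:
  fixes P :: "complex^'n \<Rightarrow> complex"
  assumes "smooth_on {0<..} h" "P \<in> polys" shows "smooth_on (- {0}) (\<lambda>x. h ((norm x)\<^sup>2) * P x)"
proof (rule smooth_on_mult)
  show "open (- {0 :: complex^'n})" by (simp add: open_Compl)
  then show "smooth_on (- {0}) (\<lambda>x::complex^'n. h ((norm x)\<^sup>2))"
    by (rule smooth_on_compose_real[where u = h and T = "{0<..}", OF _ open_greaterThan _ assms(1) smooth_norm_square]) simp
  show "smooth_on (- {0}) P" by (intro polys_smooth assms) (simp add: open_Compl)
qed

lemma Rplus_C_plus: "Rplus \<subseteq> C_plus"
proof
  fix f :: "complex^'n \<Rightarrow> complex" assume "f \<in> Rplus"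
  then obtain h p q Y where f: "f = (\<lambda>x. h ((norm x)\<^sup>2) * Y x)" and h: "h \<in> Cp" and Y: "Y \<in> harmonic_polys p q"
    unfolding Rplus_def by blast
  have "K_finite f"
    unfolding f using K_finite_radial[OF harmonic_polysD(1)[OF Y], of "\<lambda>t. h (t\<^sup>2)"] by simp
  moreover have "smooth_on (- {0}) f"
    unfolding f
    by (rule smooth_radial_mult[OF Cp_smooth[OF h] harmonic_polysD(1)[OF Y]])
  ultimately show "f \<in> C_plus"
    using pc_radial[OF h polys_continuous[OF harmonic_polysD(1)[OF Y]]]
    unfolding C_plus_def C_all_def pc_def f by simp
qed

lemma Rminus_C_minus: "Rminus \<subseteq> C_minus"
proof
  fix f :: "complex^'n \<Rightarrow> complex" assume "f \<in> Rminus"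
  then obtain h p q Y where f: "f = (\<lambda>x. h (1 / (norm x)\<^sup>2) * Y x)" and h: "h \<in> Cp" and Y: "Y \<in> harmonic_polys p q"
    unfolding Rminus_def by blast
  have "K_finite f"
    unfolding f using K_finite_radial[OF harmonic_polysD(1)[OF Y], of "\<lambda>t. h (1 / t\<^sup>2)"] by simp
  moreover have "smooth_on (- {0}) f"
  proof -
    have "smooth_on {0<..} (\<lambda>y. h (inverse y))"
      by (rule smooth_on_compose_real[where u = h and T = "{0<..}", OF open_greaterThan open_greaterThan _ Cp_smooth[OF h] smooth_on_inverse]) simp
    from smooth_radial_mult[OF this harmonic_polysD(1)[OF Y]]
    show ?thesis unfolding f by (simp only: inverse_eq_divide)
  qed
  moreover have "f 0 = 0" using Cp_nonpos[OF h, of 0] by (simp add: f)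
  moreover have "\<exists>\<epsilon>>0. \<forall>x. norm x < \<epsilon> \<longrightarrow> f x = 0"
  proof -
    obtain R where R: "R > 0" "\<And>y. y > R \<Longrightarrow> h y = 0" using Cp_bound[OF h] by metis
    have "f x = 0" if "norm x < sqrt (1 / R)" for x
    proof (cases "x = 0")
      case False
      have "(norm x)\<^sup>2 < (sqrt (1 / R))\<^sup>2" using that by (intro power_strict_mono) auto
      then have "(norm x)\<^sup>2 < 1 / R" using R(1) by simp
      then have "R < 1 / (norm x)\<^sup>2" using R(1) False by (simp add: field_simps)
      then show ?thesis using R(2) by (simp add: f)
    qed (use \<open>f 0 = 0\<close> in simp)
    then show ?thesis using R(1) by (intro exI[of _ "sqrt (1 / R)"]) auto
  qed
  ultimately show "f \<in> C_minus"
    unfolding C_minus_def C_all_def by simp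
qed

definition translates :: "(complex^'n \<Rightarrow> complex) \<Rightarrow> (complex^'n \<Rightarrow> complex) set" where
  "translates f = cfun.span {\<lambda>x. f (A x) |A. A \<in> UM}"

lemma translates_self: "f \<in> translates f"
  unfolding translates_def using UM_id by (intro cfun.span_base) auto

lemma inv_space_translates:
  fixes f :: "complex^'n \<Rightarrow> complex"
  assumes "f \<in> C_all" shows "inv_space (translates f)"
proof
  have f: "f 0 = 0" "smooth_on (- {0}) f" "K_finite f" using assms by (auto simp: C_all_def)
  obtain B where B: "finite B" "\<forall>A\<in>UM. (\<lambda>x. f (A x)) \<in> cfun.span B" using f(3) unfolding K_finite_iff by blast
  have sub: "translates f \<subseteq> cfun.span B"
    unfolding translates_def using B(2) by (intro cfun.span_minimal cfun.subspace_span) blast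
  then show "fd (translates f)"
    unfolding fd_def using B(1) by (intro exI[of _ B] conjI) (simp_all add: translates_def cfun.subspace_span)
  show "(\<lambda>x. F (A x)) \<in> translates f" if A: "A \<in> UM" and "F \<in> translates f" for A F
    using that(2) unfolding translates_def
  proof (induction rule: cfun_span_induct)
    case (base F)
    then obtain A' where "A' \<in> UM" "F = (\<lambda>x. f (A' x))" by blast
    then show ?case using UM_comp[OF _ A] by (intro cfun.span_base) auto
  qed (auto intro: cfun_zero cfun_add cfun_scale)
  show "F 0 = 0" if "F \<in> translates f" for F
    using that unfolding translates_def by (induction rule: cfun_span_induct) (auto simp: f)
  show "smooth_on (- {0}) F" if "F \<in> translates f" for F
    using that unfolding translates_def
  proof (induction rule: cfun_span_induct)
    case (base F)
    then obtain A where "A \<in> UM" "F = (\<lambda>x. f (A x))" by blast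
    then show ?case
      using smooth_on_compose_linear[OF _ _ UM_bounded_linear _ f(2), of "- {0}" A] by (simp add: open_Compl)
  qed (simp_all add: smooth_on_const smooth_on_add smooth_on_mult open_Compl)
qed

text \<open>Unitary maps preserve spheres, so the vanishing of f on a sphere is inherited by its
  translates. This transfers the support of f to highest weight vectors.\<close>

lemma translates_vanish:
  assumes "F \<in> translates f" "\<And>x. norm x = r \<Longrightarrow> f x = 0" "norm x = r"
  shows "F x = 0"
  using assms(1) unfolding translates_def
  by (induction rule: cfun_span_induct) (use assms(2,3) UM_norm in auto)

text \<open>Complete reducibility is applied to the span of the translates of f, with membership in
  \<open>Rplus\<close> as the good property. A highest weight vector of an invariant subspace has
  this property once its profile is known to vanish for large argument.\<close>

lemma C_plus_span:
  assumes card: "2 \<le> CARD('n::finite)"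
  shows "(C_plus :: (complex^'n \<Rightarrow> complex) set) = cfun.span Rplus"
proof
  show "cfun.span Rplus \<subseteq> (C_plus :: (complex^'n \<Rightarrow> complex) set)"
    by (rule cfun.span_minimal[OF Rplus_C_plus C_plus_subspace])
  show "C_plus \<subseteq> cfun.span (Rplus :: (complex^'n \<Rightarrow> complex) set)"
  proof
    fix f :: "complex^'n \<Rightarrow> complex" assume f: "f \<in> C_plus"
    then obtain R where R: "\<forall>x. R < norm x \<longrightarrow> f x = 0" and fC: "f \<in> C_all" by (auto simp: C_plus_def)
    let ?V = "translates f"
    interpret V: inv_space ?V by (rule inv_space_translates[OF fC])
    have "?V \<subseteq> cfun.span {F \<in> ?V. F \<in> Rplus}"
    proof (rule V.complete_reducibility)
      show "(\<lambda>x. F (A x)) \<in> Rplus" if "A \<in> UM" "F \<in> Rplus" for F A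
      proof -
        obtain h p q Y where F: "F = (\<lambda>x. h ((norm x)\<^sup>2) * Y x)" and h: "h \<in> Cp" and Y: "Y \<in> harmonic_polys p q"
          using \<open>F \<in> Rplus\<close> unfolding Rplus_def by blast
        show ?thesis
          using RplusI[OF h harmonic_polys_UM[OF Y \<open>A \<in> UM\<close>]] unfolding F UM_norm[OF \<open>A \<in> UM\<close>] .
      qed
      fix W F assume W: "inv_space W" "W \<subseteq> ?V" "F \<in> W" "F \<noteq> (\<lambda>x. 0)"
      interpret W: inv_space W by fact
      obtain w h p q Y where w: "w \<in> W \<and> w \<noteq> (\<lambda>x. 0) \<and> Y \<in> harmonic_polys p q \<and>
          smooth_on {0<..} h \<and> (\<forall>y\<le>0. h y = 0) \<and> w = (\<lambda>x. h ((norm x)\<^sup>2) * Y x) \<and>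
          (\<forall>y>0. (\<forall>x. norm x = sqrt y \<longrightarrow> w x = 0) \<longrightarrow> h y = 0)"
        using W.highest_weight_vector[OF card W(3,4)] by (elim exE)
      \<comment> \<open>R may be negative, hence the maximum. Beyond this bound f vanishes on the
        sphere of radius sqrt y.\<close>
      have "h y = 0" if "y > (max R 0)\<^sup>2" for y
      proof -
        have y: "0 < y" using that by (meson le_less_trans zero_le_power2)
        have "R < sqrt y" using that by (smt (verit) real_less_rsqrt)
        then have "f x = 0" if "norm x = sqrt y" for x using R that by simp
        moreover have "w \<in> ?V" using w W(2) by blast
        ultimately have "\<forall>x. norm x = sqrt y \<longrightarrow> w x = 0"
          using translates_vanish[of w f "sqrt y"] by blast
        then show ?thesis using w y by blast
      qed
      then have "h \<in> Cp" using w by (intro CpI) auto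
      then show "\<exists>w\<in>W. w \<noteq> (\<lambda>x. 0) \<and> w \<in> Rplus" using w unfolding Rplus_def by (intro bexI[of _ w]) auto
    qed
    also have "\<dots> \<subseteq> cfun.span Rplus" by (rule cfun.span_mono) auto
    finally show "f \<in> cfun.span Rplus" using translates_self by blast
  qed
qed

lemma C_minus_span:
  assumes card: "2 \<le> CARD('n::finite)"
  shows "(C_minus :: (complex^'n \<Rightarrow> complex) set) = cfun.span Rminus"
proof
  show "cfun.span Rminus \<subseteq> (C_minus :: (complex^'n \<Rightarrow> complex) set)"
    by (rule cfun.span_minimal[OF Rminus_C_minus C_minus_subspace])
  show "C_minus \<subseteq> cfun.span (Rminus :: (complex^'n \<Rightarrow> complex) set)"
  proof
    fix f :: "complex^'n \<Rightarrow> complex" assume f: "f \<in> C_minus"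
    then obtain \<epsilon> where \<epsilon>: "0 < \<epsilon>" "\<forall>x. norm x < \<epsilon> \<longrightarrow> f x = 0" and fC: "f \<in> C_all" by (auto simp: C_minus_def)
    let ?V = "translates f"
    interpret V: inv_space ?V by (rule inv_space_translates[OF fC])
    have "?V \<subseteq> cfun.span {F \<in> ?V. F \<in> Rminus}"
    proof (rule V.complete_reducibility)
      show "(\<lambda>x. F (A x)) \<in> Rminus" if "A \<in> UM" "F \<in> Rminus" for F A
      proof -
        obtain h p q Y where F: "F = (\<lambda>x. h (1 / (norm x)\<^sup>2) * Y x)" and h: "h \<in> Cp" and Y: "Y \<in> harmonic_polys p q"
          using \<open>F \<in> Rminus\<close> unfolding Rminus_def by blast
        show ?thesis
          using RminusI[OF h harmonic_polys_UM[OF Y \<open>A \<in> UM\<close>]] unfolding F UM_norm[OF \<open>A \<in> UM\<close>] .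
      qed
      fix W F assume W: "inv_space W" "W \<subseteq> ?V" "F \<in> W" "F \<noteq> (\<lambda>x. 0)"
      interpret W: inv_space W by fact
      obtain w h p q Y where w: "w \<in> W \<and> w \<noteq> (\<lambda>x. 0) \<and> Y \<in> harmonic_polys p q \<and>
          smooth_on {0<..} h \<and> (\<forall>y\<le>0. h y = 0) \<and> w = (\<lambda>x. h ((norm x)\<^sup>2) * Y x) \<and>
          (\<forall>y>0. (\<forall>x. norm x = sqrt y \<longrightarrow> w x = 0) \<longrightarrow> h y = 0)"
        using W.highest_weight_vector[OF card W(3,4)] by (elim exE)
      \<comment> \<open>The reciprocal variable turns the vanishing of h near 0 into bounded
        support.\<close>
      define H where "H y = (if 0 < y then h (inverse y) else 0)" for y
      have "h y = 0" if "0 < y" "y < \<epsilon>\<^sup>2" for y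
      proof -
        have "sqrt y < \<epsilon>" using that \<epsilon>(1) by (simp add: real_less_lsqrt)
        then have "f x = 0" if "norm x = sqrt y" for x using \<epsilon>(2) that by simp
        moreover have "w \<in> ?V" using w W(2) by blast
        ultimately have "\<forall>x. norm x = sqrt y \<longrightarrow> w x = 0"
          using translates_vanish[of w f "sqrt y"] by blast
        then show ?thesis using w that by blast
      qed
      then have "H y = 0" if "y > 1 / \<epsilon>\<^sup>2" for y
        using that \<epsilon>(1) by (auto simp: H_def field_simps)
      moreover have "smooth_on {0<..} H"
      proof -
        have "smooth_on {0<..} (\<lambda>y. h (inverse y))"
          by (rule smooth_on_compose_real[where u = h and T = "{0<..}", OF open_greaterThan open_greaterThan _ _ smooth_on_inverse])
            (use w in simp_all)
        then show ?thesis
          by (subst smooth_on_cong[OF open_greaterThan, where g = "\<lambda>y. h (inverse y)"]) (auto simp: H_def)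
      qed
      ultimately have "H \<in> Cp" by (intro CpI[of _ "1 / \<epsilon>\<^sup>2"]) (auto simp: H_def)
      moreover have "Y \<in> harmonic_polys p q" using w by blast
      ultimately have "(\<lambda>x. H (1 / (norm x)\<^sup>2) * Y x) \<in> Rminus" by (rule RminusI)
      moreover have "H (1 / (norm x)\<^sup>2) = h ((norm x)\<^sup>2)" for x :: "complex^'n"
        using w by (simp add: H_def)
      moreover have "w = (\<lambda>x. h ((norm x)\<^sup>2) * Y x)" using w by blast
      ultimately have "w \<in> Rminus" by simp
      moreover have "w \<in> W" "w \<noteq> (\<lambda>x. 0)" using w by blast+
      ultimately show "\<exists>w\<in>W. w \<noteq> (\<lambda>x. 0) \<and> w \<in> Rminus" by blast
    qed
    also have "\<dots> \<subseteq> cfun.span Rminus" by (rule cfun.span_mono) auto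
    finally show "f \<in> cfun.span Rminus" using translates_self by blast
  qed
qed

section \<open>The transform is bijective\<close>

lemma C_plus_pc: "f \<in> C_plus \<Longrightarrow> pc f"
  by (auto simp: C_plus_def C_all_def pc_def intro: smooth_on_continuous)

lemma rtr_zero: "rtr n p q (\<lambda>y. 0) = (\<lambda>y. 0)"
proof -
  have "(iop ^^ k) (\<lambda>y. 0) = (\<lambda>y. 0)" "(dop ^^ k) (\<lambda>y. 0) = (\<lambda>y. 0)" for k
    using iop_pow_cmult[OF Cp_zero, of k 0] dop_pow_cmult[OF Cp_zero, of k 0] by simp_all
  moreover have "mulp k (\<lambda>y. 0) = (\<lambda>y. 0)" for k by (simp add: mulp_def fun_eq_iff)
  ultimately show ?thesis by (simp add: rtr_def)
qed

lemma transform_radial: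
  fixes Y :: "complex^'n \<Rightarrow> complex"
  assumes "h \<in> Cp" "Y \<in> harmonic_polys p q"
  shows "transform (\<lambda>x. h ((norm x)\<^sup>2) * Y x) = (\<lambda>\<xi>. rtr CARD('n) p q h (1 / (norm \<xi>)\<^sup>2) * Y (cnj_vec \<xi>))"
proof
  fix \<xi>
  \<comment> \<open>At \<xi> = 0 both sides are 0: division by zero makes the argument 0, where
    every profile vanishes.\<close>
  show "transform (\<lambda>x. h ((norm x)\<^sup>2) * Y x) \<xi> = rtr CARD('n) p q h (1 / (norm \<xi>)\<^sup>2) * Y (cnj_vec \<xi>)"
    using funk_hecke[OF assms, of \<xi>] Cp_nonpos[OF rtr_Cp[OF assms(1)], of 0]
    by (cases "\<xi> = 0") (simp_all add: transform_def)
qed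

lemma complex_linear_on_transform: "complex_linear_on C_plus (transform :: (complex^'n \<Rightarrow> complex) \<Rightarrow> complex^'n \<Rightarrow> complex)"
  unfolding complex_linear_on_def by (auto simp: transform_add transform_cmult C_plus_pc)

text \<open>Y composed with \<open>cnj_vec\<close> has type (q, p), hence the exchanged indices; the
  conjugation built into the transform then restores Y.\<close>

lemma transform_radial_inverse:
  fixes Y :: "complex^'n \<Rightarrow> complex"
  assumes "H \<in> Cp" "Y \<in> harmonic_polys p q"
  shows "transform (\<lambda>x. rinv CARD('n) q p H ((norm x)\<^sup>2) * Y (cnj_vec x)) = (\<lambda>\<xi>. H (1 / (norm \<xi>)\<^sup>2) * Y \<xi>)"
  using transform_radial[OF rinv_Cp[OF assms(1)] harmonic_polys_cnj_vec[OF assms(2)], of "CARD('n)" q p]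
  by (simp add: rtr_rinv[OF assms(1)])

lemma transform_C_minus:
  assumes card: "2 \<le> CARD('n::finite)" and f: "f \<in> (C_plus :: (complex^'n \<Rightarrow> complex) set)"
  shows "transform f \<in> C_minus"
  using f unfolding C_plus_span[OF card]
proof (induction rule: cfun_span_induct)
  case (base f)
  then obtain h p q Y where f: "f = (\<lambda>x. h ((norm x)\<^sup>2) * Y x)" and h: "h \<in> Cp" "Y \<in> harmonic_polys p q"
    unfolding Rplus_def by blast
  have "transform f \<in> Rminus"
    unfolding f transform_radial[OF h] by (rule RminusI[OF rtr_Cp[OF h(1)] harmonic_polys_cnj_vec[OF h(2)]])
  then show ?case using Rminus_C_minus by blast
next
  case zero
  show ?case using sub_zero[OF C_minus_subspace] by (simp add: transform_zero)
next
  case (add f g)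
  then show ?case
    using sub_add[OF C_minus_subspace] transform_add[OF C_plus_pc C_plus_pc, of f g] C_plus_span[OF card] by simp
next
  case (scale c f)
  then show ?case
    using sub_scale[OF C_minus_subspace] transform_cmult[OF C_plus_pc, of f c] C_plus_span[OF card] by simp
qed

lemma transform_surj:
  assumes card: "2 \<le> CARD('n::finite)" and f: "\<phi> \<in> (C_minus :: (complex^'n \<Rightarrow> complex) set)"
  shows "\<phi> \<in> transform ` C_plus"
  using f unfolding C_minus_span[OF card]
proof (induction rule: cfun_span_induct)
  case (base f)
  then obtain h p q Y where f: "f = (\<lambda>x. h (1 / (norm x)\<^sup>2) * Y x)" and h: "h \<in> Cp" "Y \<in> harmonic_polys p q"
    unfolding Rminus_def by blast
  have "(\<lambda>x. rinv CARD('n) q p h ((norm x)\<^sup>2) * Y (cnj_vec x)) \<in> Rplus"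
    by (rule RplusI[OF rinv_Cp[OF h(1)] harmonic_polys_cnj_vec[OF h(2)]])
  then show ?case
    unfolding f transform_radial_inverse[OF h, symmetric] using Rplus_C_plus by blast
next
  case zero
  show ?case by (rule image_eqI[of _ _ "\<lambda>x. 0"]) (simp_all add: sub_zero[OF C_plus_subspace] transform_zero)
next
  case (add f g)
  then obtain F G where "F \<in> C_plus" "G \<in> C_plus" "f = transform F" "g = transform G" by blast
  then show ?case
    using sub_add[OF C_plus_subspace, of F G] transform_add[OF C_plus_pc C_plus_pc, of F G]
    by (intro image_eqI[of _ _ "\<lambda>x. F x + G x"]) auto
next
  case (scale c f)
  then obtain F where "F \<in> C_plus" "f = transform F" by blast
  then show ?case
    using sub_scale[OF C_plus_subspace, of F c] transform_cmult[OF C_plus_pc, of F c]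
    by (intro image_eqI[of _ _ "\<lambda>x. c * F x"]) auto
qed

text \<open>Expanding f in \<open>Rplus\<close> would leave possible cancellation between the terms.
  Instead, equivariance keeps all translates of f in the kernel; their span contains a highest
  weight vector, and on this single product the injectivity of \<open>rtr\<close> applies.\<close>

lemma transform_kernel:
  fixes f :: "complex^'n \<Rightarrow> complex"
  assumes card: "2 \<le> CARD('n)" and f: "f \<in> C_plus" "transform f = (\<lambda>x. 0)"
  shows "f = (\<lambda>x. 0)"
proof (rule ccontr)
  assume f0: "f \<noteq> (\<lambda>x. 0)"
  obtain R where R: "\<forall>x. R < norm x \<longrightarrow> f x = 0" and fC: "f \<in> C_all" using f(1) by (auto simp: C_plus_def)
  let ?V = "translates f"
  interpret V: inv_space ?V by (rule inv_space_translates[OF fC])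
  have ker: "pc F \<and> transform F = (\<lambda>x. 0)" if "F \<in> ?V" for F
    using that unfolding translates_def
  proof (induction rule: cfun_span_induct)
    case (base F)
    then obtain A where A: "A \<in> UM" "F = (\<lambda>x. f (A x))" by blast
    have "F \<in> ?V" unfolding translates_def using A by (intro cfun.span_base) auto
    then have "pc F"
      using V.zeroV[of F] smooth_on_continuous[OF V.smoothV[of F]] A R UM_norm[OF A(1)] unfolding pc_def
      by (intro conjI exI[of _ R]) simp_all
    moreover have "transform F = (\<lambda>x. 0)"
      unfolding A(2) by (rule ext) (simp add: transform_UM[OF C_plus_pc[OF f(1)] A(1)] f(2))
    ultimately show ?case ..
  next
    case (add F G)
    then show ?case using transform_add[of F G] pc_add[of F G] by simp
  next
    case (scale c F)
    then show ?case using transform_cmult[of F c] pc_scale[of F c] by simp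
  qed (simp add: pc_zero transform_zero)
  obtain w h p q Y where w: "w \<in> ?V \<and> w \<noteq> (\<lambda>x. 0) \<and> Y \<in> harmonic_polys p q \<and>
      smooth_on {0<..} h \<and> (\<forall>y\<le>0. h y = 0) \<and> w = (\<lambda>x. h ((norm x)\<^sup>2) * Y x) \<and>
      (\<forall>y>0. (\<forall>x. norm x = sqrt y \<longrightarrow> w x = 0) \<longrightarrow> h y = 0)"
    using V.highest_weight_vector[OF card translates_self f0] by (elim exE)
  have "h y = 0" if "y > (max R 0)\<^sup>2" for y
  proof -
    have y: "0 < y" using that by (meson le_less_trans zero_le_power2)
    have "R < sqrt y" using that by (smt (verit) real_less_rsqrt)
    then have "f x = 0" if "norm x = sqrt y" for x using R that by simp
    then have "\<forall>x. norm x = sqrt y \<longrightarrow> w x = 0"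
      using translates_vanish[of w f "sqrt y"] w by blast
    then show ?thesis using w y by blast
  qed
  then have h: "h \<in> Cp" using w by (intro CpI) auto
  have Y: "Y \<in> harmonic_polys p q" using w by blast
  obtain x0 where x0: "h ((norm x0)\<^sup>2) * Y x0 \<noteq> 0" using w by (auto simp: fun_eq_iff)
  have nx0: "0 < norm x0"
  proof (rule ccontr)
    assume "\<not> 0 < norm x0"
    then show False using x0 Cp_nonpos[OF h, of 0] by simp
  qed
  have "rtr CARD('n) p q h y = 0" if y: "0 < y" for y
  proof -
    \<comment> \<open>Scales x0 so that 1 / ||\<xi>||^2 = y; by homogeneity Y remains nonzero at the
      scaled point.\<close>
    define c where "c = 1 / (sqrt y * norm x0)"
    have c: "0 < c" using y nx0 by (simp add: c_def)
    let ?\<xi> = "cnj_vec (c *\<^sub>R x0)"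
    have "norm ?\<xi> = 1 / sqrt y" using c nx0 by (simp add: c_def)
    then have "1 / (norm ?\<xi>)\<^sup>2 = y" using y by (simp add: power_divide)
    then have "rtr CARD('n) p q h y * Y (c *\<^sub>R x0) = transform w ?\<xi>"
      using transform_radial[OF h Y] w by simp
    also have "\<dots> = 0"
    proof -
      have "w \<in> ?V" using w by blast
      from ker[OF this] show ?thesis by simp
    qed
    finally show ?thesis
      using x0 c by (simp add: harmonic_polysD(5)[OF Y])
  qed
  then have "rtr CARD('n) p q h = (\<lambda>y. 0)"
    by (intro Cp_eqI rtr_Cp h Cp_zero)
  then have "h = rinv CARD('n) p q (rtr CARD('n) p q (\<lambda>y. 0))"
    using rinv_rtr[OF h, of "CARD('n)" p q] by (simp add: rtr_zero)
  then have "h = (\<lambda>y. 0)" by (simp add: rinv_rtr[OF Cp_zero])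
  then show False using x0 by simp
qed

theorem bij_betw_transform:
  assumes card: "2 \<le> CARD('n::finite)"
  shows "bij_betw transform (C_plus :: (complex^'n \<Rightarrow> complex) set) C_minus"
  unfolding bij_betw_def
proof
  show "inj_on transform (C_plus :: (complex^'n \<Rightarrow> complex) set)"
  proof (rule inj_onI)
    fix f g :: "complex^'n \<Rightarrow> complex" assume fg: "f \<in> C_plus" "g \<in> C_plus" "transform f = transform g"
    have "transform (\<lambda>x. f x + (- 1) * g x) = (\<lambda>\<xi>. transform f \<xi> + (- 1) * transform g \<xi>)"
      using transform_add[OF C_plus_pc[OF fg(1)] pc_scale[OF C_plus_pc[OF fg(2)], of "- 1"]]
      unfolding transform_cmult[OF C_plus_pc[OF fg(2)]] .
    then have "transform (\<lambda>x. f x + (- 1) * g x) = (\<lambda>x. 0)" by (simp add: fg(3))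
    moreover have "(\<lambda>x. f x + (- 1) * g x) \<in> C_plus"
      by (rule sub_add[OF C_plus_subspace fg(1) sub_scale[OF C_plus_subspace fg(2)]])
    ultimately have "(\<lambda>x. f x + (- 1) * g x) = (\<lambda>x. 0)" using transform_kernel[OF card] by blast
    then show "f = g" by (simp add: fun_eq_iff)
  qed
  show "transform ` (C_plus :: (complex^'n \<Rightarrow> complex) set) = C_minus"
    using transform_C_minus[OF card] transform_surj[OF card] by blast
qed

section \<open>Smooth cutoff functions\<close>

text \<open>The functions P(1/t) exp(-1/t) form a family closed under differentiation, so smoothness
  becomes an induction over all P.\<close>

definition bump :: "real poly \<Rightarrow> real \<Rightarrow> real" where
  "bump P t = (if 0 < t then poly P (inverse t) * exp (- inverse t) else 0)"

lemma poly_exp_tendsto_0: "((\<lambda>x. poly P x * exp (- x)) \<longlongrightarrow> (0::real)) at_top"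
proof -
  have "((\<lambda>x. \<Sum>i\<le>degree P. coeff P i * (x ^ i / exp x)) \<longlongrightarrow> (\<Sum>i\<le>degree P. coeff P i * 0)) at_top"
    by (intro tendsto_sum tendsto_mult tendsto_const tendsto_power_div_exp_0)
  moreover have "(\<lambda>x. \<Sum>i\<le>degree P. coeff P i * (x ^ i / exp x)) = (\<lambda>x. poly P x * exp (- x))"
    by (simp add: fun_eq_iff poly_altdef sum_distrib_right exp_minus divide_inverse mult.assoc)
  ultimately show ?thesis by simp
qed

lemma bump_deriv: "(bump P has_real_derivative bump ([:0, 0, 1:] * (P - pderiv P)) t) (at t)"
proof -
  consider "0 < t" | "t < 0" | "t = 0" by linarith
  then show ?thesis
  proof cases
    case 1
    have "((\<lambda>t. poly P (inverse t) * exp (- inverse t)) has_real_derivative bump ([:0, 0, 1:] * (P - pderiv P)) t) (at t)"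
      using 1 by (auto intro!: derivative_eq_intros poly_DERIV[THEN DERIV_chain2] simp: bump_def field_simps power2_eq_square)
    then show ?thesis
      by (rule has_field_derivative_transform_within_open[where S = "{0<..}"]) (use 1 in \<open>auto simp: bump_def\<close>)
  next
    case 2
    have "((\<lambda>t. 0) has_real_derivative bump ([:0, 0, 1:] * (P - pderiv P)) t) (at t)"
      using 2 by (simp add: bump_def)
    then show ?thesis
      by (rule has_field_derivative_transform_within_open[where S = "{..<0}"]) (use 2 in \<open>auto simp: bump_def\<close>)
  next
    case 3
    \<comment> \<open>The difference quotient at 0 from the right has the same shape, with the
      polynomial X P in place of P.\<close>
    have "((\<lambda>h. poly ([:0, 1:] * P) (inverse h) * exp (- inverse h)) \<longlongrightarrow> (0::real)) (at_right 0)"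
      by (rule filterlim_compose[OF poly_exp_tendsto_0 filterlim_inverse_at_top_right])
    then have R: "((\<lambda>h. (bump P (0 + h) - bump P 0) / h) \<longlongrightarrow> 0) (at_right 0)"
      by (rule Lim_transform_eventually)
        (auto simp: bump_def eventually_at_right_less divide_inverse mult_ac intro!: eventually_mono[OF eventually_at_right_less[of 0]])
    have L: "((\<lambda>h. (bump P (0 + h) - bump P 0) / h) \<longlongrightarrow> 0) (at_left 0)"
      by (rule Lim_transform_eventually[OF tendsto_const])
        (auto simp: bump_def eventually_at_left_field intro!: exI[of _ "- 1"])
    show ?thesis
      unfolding 3 DERIV_def using filterlim_split_at[OF L R] by (simp add: bump_def)
  qed
qed

lemma bump_smooth: "smooth_on UNIV (bump P)"
proof -
  have "Ck_on k UNIV (bump P)" for k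
  proof (induction k arbitrary: P)
    case 0
    show ?case
      using bump_deriv by (auto intro!: continuous_at_imp_continuous_on DERIV_isCont)
  next
    case (Suc k)
    show ?case
      by (rule Ck_on_SucI[OF open_UNIV bump_deriv[unfolded has_field_derivative_def]])
        (rule Ck_on_bilinear[OF open_UNIV bounded_bilinear_mult Suc.IH Ck_on_const[OF open_UNIV]])
  qed
  then show ?thesis by (simp add: smooth_on_def)
qed

text \<open>The quotient e(2 - t) / (e(2 - t) + e(t - 3/2)) for the flat function e; at every t one
  of the two arguments is positive. The transition lies to the right of 1, away from the support of
  the kernel.\<close>

lemma smooth_cutoff:
  obtains \<eta> :: "real \<Rightarrow> complex" where "smooth_on UNIV \<eta>" "\<And>t. t \<le> 3 / 2 \<Longrightarrow> \<eta> t = 1" "\<And>t. 2 \<le> t \<Longrightarrow> \<eta> t = 0"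
proof -
  define e where "e = bump 1"
  define D where "D t = e (2 - t) + e (t - 3 / 2)" for t
  have e: "0 < t \<Longrightarrow> 0 < e t" "t \<le> 0 \<Longrightarrow> e t = 0" "0 \<le> e t" for t by (simp_all add: e_def bump_def)
  have lin: "smooth_on UNIV (\<lambda>t::real. 2 - t)" "smooth_on UNIV (\<lambda>t::real. t - 3 / 2)"
    using smooth_on_add[OF open_UNIV smooth_on_const[OF open_UNIV] smooth_on_mult[OF open_UNIV smooth_on_const[OF open_UNIV] smooth_on_id[OF open_UNIV]], of 2 "- 1 :: real"]
      smooth_on_add[OF open_UNIV smooth_on_id[OF open_UNIV] smooth_on_const[OF open_UNIV], of "- (3 / 2) :: real"]
    by simp_all
  have se: "smooth_on UNIV (\<lambda>t. e (2 - t))" "smooth_on UNIV (\<lambda>t. e (t - 3 / 2))"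
    unfolding e_def
    by (rule smooth_on_compose_real[OF open_UNIV open_UNIV UNIV_I bump_smooth lin(1)],
        rule smooth_on_compose_real[OF open_UNIV open_UNIV UNIV_I bump_smooth lin(2)])
  have D0: "0 < D t" for t
    using e(1)[of "2 - t"] e(1)[of "t - 3 / 2"] e(3)[of "2 - t"] e(3)[of "t - 3 / 2"] unfolding D_def by argo
  have "smooth_on UNIV D" unfolding D_def by (rule smooth_on_add[OF open_UNIV se])
  then have "smooth_on UNIV (\<lambda>t. inverse (D t))"
    by (intro smooth_on_compose_real[where u = inverse and T = "{0<..}", OF open_UNIV open_greaterThan _ smooth_on_inverse])
      (simp_all add: D0)
  then have "smooth_on UNIV (\<lambda>t. complex_of_real (e (2 - t) * inverse (D t)))"
    by (intro smooth_on_of_real smooth_on_mult se open_UNIV)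
  then show thesis
  proof (rule that)
    show "complex_of_real (e (2 - t) * inverse (D t)) = 1" if "t \<le> 3 / 2" for t
      using that D0[of t] e(2)[of "t - 3 / 2"] by (simp add: D_def)
    show "complex_of_real (e (2 - t) * inverse (D t)) = 0" if "2 \<le> t" for t
      using that e(2)[of "2 - t"] by simp
  qed
qed

section \<open>Test functions\<close>

lemma testI:
  assumes "smooth_on {0<..} \<phi>" "0 < a" "\<And>t. t < a \<Longrightarrow> \<phi> t = 0" "\<And>t. b < t \<Longrightarrow> \<phi> t = 0"
  shows "\<phi> \<in> test_functions"
proof -
  have "\<forall>t. \<phi> t \<noteq> 0 \<longrightarrow> a \<le> t \<and> t \<le> b" using assms(3,4) by (metis not_le)
  then show ?thesis using assms(1,2) unfolding test_functions_def by blast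
qed

lemma testE:
  assumes "\<phi> \<in> test_functions"
  shows "\<exists>a b. smooth_on {0<..} \<phi> \<and> 0 < a \<and> (\<forall>t<a. \<phi> t = 0) \<and> (\<forall>t>b. \<phi> t = 0)"
proof -
  obtain a b where ab: "smooth_on {0<..} \<phi>" "0 < a" "\<forall>t. \<phi> t \<noteq> 0 \<longrightarrow> a \<le> t \<and> t \<le> b"
    using assms unfolding test_functions_def by blast
  then have "(\<forall>t<a. \<phi> t = 0) \<and> (\<forall>t>b. \<phi> t = 0)" by (metis not_le)
  then show ?thesis using ab(1,2) by blast
qed

lemma test_deriv:
  assumes "\<phi> \<in> test_functions" shows "(\<phi> has_vector_derivative vector_derivative \<phi> (at t)) (at t)"
proof -
  obtain a b where p: "smooth_on {0<..} \<phi>" "0 < a" "\<And>t. t < a \<Longrightarrow> \<phi> t = 0" using testE[OF assms] by metis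
  show ?thesis
  proof (cases "0 < t")
    case True
    then show ?thesis using smooth_on_has_vector_derivative[OF p(1)] by simp
  next
    case False
    have "((\<lambda>t. 0) has_vector_derivative (0::complex)) (at t)" by simp
    then have "(\<phi> has_vector_derivative 0) (at t)"
      by (rule has_vector_derivative_transform_within_open[where S = "{..<a}"]) (use False p in auto)
    then show ?thesis by (simp add: vector_derivative_at)
  qed
qed

lemma test_vanish_deriv:
  assumes "\<phi> \<in> test_functions" "open S" "\<And>t. t \<in> S \<Longrightarrow> \<phi> t = g t" "t \<in> S"
  shows "(g has_vector_derivative vector_derivative \<phi> (at t)) (at t)"
  by (rule has_vector_derivative_transform_within_open[OF test_deriv[OF assms(1)] assms(2,4,3)])

lemma test_continuous: "\<phi> \<in> test_functions \<Longrightarrow> continuous_on S \<phi>"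
  by (meson test_deriv continuous_at_imp_continuous_on has_vector_derivative_continuous)

lemma test_add: assumes "\<phi> \<in> test_functions" "\<psi> \<in> test_functions" shows "(\<lambda>t. \<phi> t + \<psi> t) \<in> test_functions"
proof -
  obtain a b where p: "smooth_on {0<..} \<phi>" "0 < a" "\<And>t. t < a \<Longrightarrow> \<phi> t = 0" "\<And>t. b < t \<Longrightarrow> \<phi> t = 0" using testE[OF assms(1)] by metis
  obtain c d where q: "smooth_on {0<..} \<psi>" "0 < c" "\<And>t. t < c \<Longrightarrow> \<psi> t = 0" "\<And>t. d < t \<Longrightarrow> \<psi> t = 0" using testE[OF assms(2)] by metis
  show ?thesis
    by (rule testI[of _ "min a c" "max b d"]) (use p q smooth_on_add[OF open_greaterThan p(1) q(1)] in auto)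
qed

lemma test_mult: assumes "smooth_on {0<..} f" "\<phi> \<in> test_functions" shows "(\<lambda>t. f t * \<phi> t) \<in> test_functions"
proof -
  obtain a b where p: "smooth_on {0<..} \<phi>" "0 < a" "\<And>t. t < a \<Longrightarrow> \<phi> t = 0" "\<And>t. b < t \<Longrightarrow> \<phi> t = 0" using testE[OF assms(2)] by metis
  show ?thesis
    by (rule testI[of _ a b]) (use p smooth_on_mult[OF open_greaterThan assms(1) p(1)] in auto)
qed

lemma test_cmult: "\<phi> \<in> test_functions \<Longrightarrow> (\<lambda>t. c * \<phi> t) \<in> test_functions"
  by (rule test_mult[OF smooth_on_const[OF open_greaterThan]])

lemma test_powi: "\<phi> \<in> test_functions \<Longrightarrow> (\<lambda>t. of_real (t powi k) * \<phi> t) \<in> test_functions"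
  by (rule test_mult[OF smooth_on_of_real[OF open_greaterThan smooth_on_powi]])

lemma test_vector_derivative:
  assumes "\<phi> \<in> test_functions" shows "(\<lambda>t. vector_derivative \<phi> (at t)) \<in> test_functions"
proof -
  obtain a b where p: "smooth_on {0<..} \<phi>" "0 < a" "\<And>t. t < a \<Longrightarrow> \<phi> t = 0" "\<And>t. b < t \<Longrightarrow> \<phi> t = 0" using testE[OF assms] by metis
  show ?thesis
  proof (rule testI[of _ a b])
    show "smooth_on {0<..} (\<lambda>t. vector_derivative \<phi> (at t))"
      by (rule smooth_on_vector_derivative[OF open_greaterThan p(1)])
    show "vector_derivative \<phi> (at t) = 0" if "t < a" for t
      using test_vanish_deriv[OF assms, of "{..<a}" "\<lambda>_. 0" t] p(3) that
      by (auto dest: vector_derivative_at simp: vector_derivative_unique_at)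
    show "vector_derivative \<phi> (at t) = 0" if "b < t" for t
      using test_vanish_deriv[OF assms, of "{b<..}" "\<lambda>_. 0" t] p(4) that
      by (auto dest: vector_derivative_at simp: vector_derivative_unique_at)
  qed fact
qed

text \<open>Supplies the test function that \<open>gf_apply\<close> asks for: g already vanishes
  near 0, and the cutoff changes it only beyond 3/2.\<close>

lemma test_extension:
  assumes g: "smooth_on {0<..} g" and \<epsilon>: "0 < \<epsilon>" "\<And>t. 0 < t \<Longrightarrow> t < \<epsilon> \<Longrightarrow> g t = 0"
  obtains \<phi> where "\<phi> \<in> test_functions" "\<And>t. t \<in> {0<..<1 + 1 / 2} \<Longrightarrow> \<phi> t = g t"
proof -
  obtain \<eta> :: "real \<Rightarrow> complex" where \<eta>: "smooth_on UNIV \<eta>" "\<And>t. t \<le> 3 / 2 \<Longrightarrow> \<eta> t = 1" "\<And>t. 2 \<le> t \<Longrightarrow> \<eta> t = 0"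
    using smooth_cutoff by metis
  define \<phi> where "\<phi> t = (if 0 < t then \<eta> t * g t else 0)" for t
  have "smooth_on {0<..} (\<lambda>t. \<eta> t * g t)"
    by (intro smooth_on_mult g smooth_on_subset[OF _ open_UNIV _ \<eta>(1)]) auto
  then have "smooth_on {0<..} \<phi>"
    by (subst smooth_on_cong[OF open_greaterThan, where g = "\<lambda>t. \<eta> t * g t"]) (auto simp: \<phi>_def)
  then have "\<phi> \<in> test_functions"
    using \<epsilon> \<eta>(3) by (intro testI[of _ \<epsilon> 2]) (auto simp: \<phi>_def)
  then show thesis
    by (rule that) (auto simp: \<phi>_def \<eta>(2))
qed

section \<open>The regularized kernel\<close>

text \<open>The power (1 - t^2)^(w-1) written with the real logarithm, so that it is visibly entire
  in w for t between 0 and 1.\<close>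

definition kw :: "complex \<Rightarrow> real \<Rightarrow> complex" where
  "kw w t = exp ((w - 1) * of_real (ln (1 - t\<^sup>2)))"

definition TI :: "complex \<Rightarrow> (real \<Rightarrow> complex) \<Rightarrow> complex" where
  "TI w \<psi> = (LINT t:{0<..<1}|lborel. kw w t * \<psi> t)"

lemma square_less_1: "0 < t \<Longrightarrow> t < 1 \<Longrightarrow> 0 < 1 - (t::real)\<^sup>2"
  by (simp add: power_less_one_iff)

lemma TI_eq: "TI w \<psi> = (LINT t:{0<..<1}|lborel. of_real (1 - t\<^sup>2) powr (w - 1) * \<psi> t)"
  unfolding TI_def
proof (rule set_lebesgue_integral_cong)
  have "kw w t * \<psi> t = of_real (1 - t\<^sup>2) powr (w - 1) * \<psi> t" if "t \<in> {0<..<1}" for t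
  proof -
    have p: "0 < 1 - t\<^sup>2" using square_less_1[of t] that by simp
    then have "complex_of_real (1 - t\<^sup>2) \<noteq> 0" by (metis less_irrefl of_real_eq_0_iff)
    then have "of_real (1 - t\<^sup>2) powr (w - 1) = kw w t"
      unfolding powr_def kw_def Ln_of_real[OF p] by (simp del: of_real_diff)
    then show ?thesis by simp
  qed
  then show "\<forall>t. t \<in> {0<..<1} \<longrightarrow> kw w t * \<psi> t = of_real (1 - t\<^sup>2) powr (w - 1) * \<psi> t" by blast
qed simp

lemma norm_kw: "0 < t \<Longrightarrow> t < 1 \<Longrightarrow> norm (kw w t) = (1 - t\<^sup>2) powr (Re w - 1)"
  using square_less_1[of t] by (simp add: kw_def powr_def)

lemma kw_continuous: "continuous_on {-1<..<1} (kw w)"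
proof -
  have "1 - t\<^sup>2 \<noteq> 0" if "t \<in> {-1<..<1}" for t :: real
    using that abs_square_less_1[of t] by auto
  then show ?thesis
    unfolding kw_def by (intro continuous_intros) auto
qed

lemma powr_tendsto_0: "0 < \<sigma> \<Longrightarrow> ((\<lambda>t::real. (1 - t\<^sup>2) powr \<sigma>) \<longlongrightarrow> 0) (at_left 1)"
proof -
  assume s: "0 < \<sigma>"
  have "((\<lambda>t::real. (1 - t\<^sup>2) powr \<sigma>) \<longlongrightarrow> (1 - 1\<^sup>2) powr \<sigma>) (at_left 1)"
  proof (rule tendsto_powr')
    have "\<forall>\<^sub>F t::real in at_left 1. 0 < t \<and> t < 1"
      unfolding eventually_at_left_field by (intro exI[of _ 0]) simp
    then have "\<forall>\<^sub>F t::real in at_left 1. 0 \<le> 1 - t\<^sup>2"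
      by eventually_elim (use square_less_1 in force)
    then show "(1::real) - 1\<^sup>2 \<noteq> 0 \<or> 0 < \<sigma> \<and> (\<forall>\<^sub>F t::real in at_left 1. 0 \<le> 1 - t\<^sup>2)" using s by simp
  qed (intro tendsto_intros)+
  then show ?thesis by simp
qed

text \<open>The factor t provides the antiderivative -(1 - t^2)^\<sigma>. Test functions vanish near
  0, so a multiple of this weight dominates the kernel on their support.\<close>

lemma powr_integrable:
  assumes "0 < \<sigma>" shows "set_integrable lborel {0<..<1} (\<lambda>t::real. 2 * \<sigma> * t * (1 - t\<^sup>2) powr (\<sigma> - 1))"
proof -
  have "set_integrable lborel (einterval 0 1) (\<lambda>t::real. 2 * \<sigma> * t * (1 - t\<^sup>2) powr (\<sigma> - 1))"
  proof (rule interval_integral_FTC_nonneg(1))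
    show "((\<lambda>t. - ((1 - t\<^sup>2) powr \<sigma>)) has_real_derivative 2 * \<sigma> * t * (1 - t\<^sup>2) powr (\<sigma> - 1)) (at t)"
      if "0 < ereal t" "ereal t < 1" for t
    proof -
      have p: "0 < 1 - t\<^sup>2" using square_less_1[of t] that by simp
      have "((\<lambda>t. 1 - t\<^sup>2) has_real_derivative - (2 * t)) (at t)" by (auto intro!: derivative_eq_intros)
      from DERIV_minus[OF DERIV_chain2[OF has_real_derivative_powr[OF p] this]]
      show ?thesis by (simp add: mult_ac)
    qed
    show "isCont (\<lambda>t. 2 * \<sigma> * t * (1 - t\<^sup>2) powr (\<sigma> - 1)) t" if "0 < ereal t" "ereal t < 1" for t
    proof -
      have "1 - t\<^sup>2 \<noteq> 0" using square_less_1[of t] that by simp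
      then show ?thesis by (intro continuous_intros)
    qed
    have "isCont (\<lambda>t::real. - ((1 - t\<^sup>2) powr \<sigma>)) 0" by (intro continuous_intros) simp
    then have "((\<lambda>t::real. - ((1 - t\<^sup>2) powr \<sigma>)) \<longlongrightarrow> - 1) (at_right 0)"
      by (auto simp: continuous_within filterlim_at_split)
    then show "(((\<lambda>t. - ((1 - t\<^sup>2) powr \<sigma>)) \<circ> real_of_ereal) \<longlongrightarrow> - 1) (at_right 0)"
      unfolding zero_ereal_def ereal_tendsto_simps1 .
    show "(((\<lambda>t. - ((1 - t\<^sup>2) powr \<sigma>)) \<circ> real_of_ereal) \<longlongrightarrow> - 0) (at_left 1)"
      unfolding one_ereal_def ereal_tendsto_simps1 by (intro tendsto_minus powr_tendsto_0 assms)
    show "AE t in lborel. 0 < ereal t \<longrightarrow> ereal t < 1 \<longrightarrow> 0 \<le> 2 * \<sigma> * t * (1 - t\<^sup>2) powr (\<sigma> - 1)"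
      using assms by simp
  qed simp
  then show ?thesis by (simp add: zero_ereal_def one_ereal_def)
qed

lemma test_bounded:
  assumes "\<psi> \<in> test_functions" obtains C where "0 \<le> C" "\<And>t. 0 \<le> t \<Longrightarrow> t \<le> 1 \<Longrightarrow> norm (\<psi> t) \<le> C"
proof -
  have "compact (\<psi> ` {0..1})" by (intro compact_continuous_image test_continuous assms) simp
  then obtain C where C: "\<forall>x\<in>\<psi> ` {0..1}. norm x \<le> C" using compact_imp_bounded bounded_iff by metis
  show thesis
  proof (rule that)
    show "norm (\<psi> t) \<le> max C 0" if "0 \<le> t" "t \<le> 1" for t using C that by (simp add: max.coboundedI1)
  qed simp
qed

lemma kw_mult_continuous: "\<psi> \<in> test_functions \<Longrightarrow> continuous_on {0<..<1} (\<lambda>t. kw w t * \<psi> t)"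
  by (intro continuous_on_mult test_continuous continuous_on_subset[OF kw_continuous]) auto

lemma kw_integrable:
  assumes \<psi>: "\<psi> \<in> test_functions" and w: "0 < Re w"
  shows "set_integrable lborel {0<..<1} (\<lambda>t. kw w t * \<psi> t)"
proof -
  obtain a where a: "0 < a" "\<And>t. t < a \<Longrightarrow> \<psi> t = 0" using testE[OF \<psi>] by metis
  obtain C where C: "0 \<le> C" "\<And>t. 0 \<le> t \<Longrightarrow> t \<le> 1 \<Longrightarrow> norm (\<psi> t) \<le> C" using test_bounded[OF \<psi>] by metis
  let ?\<sigma> = "Re w"
  show ?thesis
  proof (rule set_integrable_bound)
    show "set_integrable lborel {0<..<1} (\<lambda>t::real. C / (2 * ?\<sigma> * a) * (2 * ?\<sigma> * t * (1 - t\<^sup>2) powr (?\<sigma> - 1)))"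
      using powr_integrable[OF w] by (rule set_integrable_mult_right)
    show "set_borel_measurable lborel {0<..<1} (\<lambda>t. kw w t * \<psi> t)"
      unfolding set_borel_measurable_def
      using borel_measurable_continuous_on_indicator[OF _ kw_mult_continuous[OF \<psi>]] by simp
    have "norm (kw w t * \<psi> t) \<le> norm (C / (2 * ?\<sigma> * a) * (2 * ?\<sigma> * t * (1 - t\<^sup>2) powr (?\<sigma> - 1)))" if t: "0 < t" "t < 1" for t
    proof (cases "t < a")
      case True
      then show ?thesis by (simp only: a(2) mult_zero_right norm_zero norm_ge_zero)
    next
      case False
      have "norm (kw w t * \<psi> t) \<le> (1 - t\<^sup>2) powr (?\<sigma> - 1) * C"
        using C(2)[of t] t by (simp add: norm_mult norm_kw mult_left_mono)
      also have "\<dots> \<le> (t / a) * ((1 - t\<^sup>2) powr (?\<sigma> - 1) * C)"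
        using mult_right_mono[of 1 "t / a" "(1 - t\<^sup>2) powr (?\<sigma> - 1) * C"] False a(1) C(1) by simp
      also have "\<dots> = norm (C / (2 * ?\<sigma> * a) * (2 * ?\<sigma> * t * (1 - t\<^sup>2) powr (?\<sigma> - 1)))"
        using w a(1) C(1) t by (simp add: abs_mult field_simps)
      finally show ?thesis .
    qed
    then show "AE t in lborel. t \<in> {0<..<1} \<longrightarrow> norm (kw w t * \<psi> t) \<le> norm (C / (2 * ?\<sigma> * a) * (2 * ?\<sigma> * t * (1 - t\<^sup>2) powr (?\<sigma> - 1)))"
      by simp
  qed
qed

text \<open>Dividing by t before differentiating matches the derivative -2 w t (1 - t^2)^(w-1) of (1
  - t^2)^w, so that integration by parts shifts the exponent by one.\<close>

definition dq :: "(real \<Rightarrow> complex) \<Rightarrow> real \<Rightarrow> complex" where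
  "dq \<psi> t = vector_derivative (\<lambda>t. of_real (t powi (- 1)) * \<psi> t) (at t)"

lemma test_dq: "\<psi> \<in> test_functions \<Longrightarrow> dq \<psi> \<in> test_functions"
  using test_vector_derivative[OF test_powi[of \<psi> "- 1"]] by (simp add: dq_def[abs_def])

lemma kw_deriv:
  assumes "0 < t" "t < 1"
  shows "(kw (w + 1) has_vector_derivative - 2 * w * of_real t * kw w t) (at t)"
proof -
  have p: "0 < 1 - t\<^sup>2" using square_less_1 assms by blast
  have "((\<lambda>t. ln (1 - t\<^sup>2)) has_real_derivative - (2 * t) / (1 - t\<^sup>2)) (at t)"
    using p by (auto intro!: derivative_eq_intros)
  then have "((\<lambda>t. complex_of_real (ln (1 - t\<^sup>2))) has_vector_derivative of_real (- (2 * t) / (1 - t\<^sup>2))) (at t)"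
    by (intro has_vector_derivative_of_real) (simp add: has_real_derivative_iff_has_vector_derivative)
  then have "((\<lambda>t. w * complex_of_real (ln (1 - t\<^sup>2))) has_vector_derivative w * of_real (- (2 * t) / (1 - t\<^sup>2))) (at t)"
    by (rule has_vector_derivative_mult_right)
  from field_vector_diff_chain_at[OF this DERIV_exp]
  have D: "((\<lambda>t. exp (w * of_real (ln (1 - t\<^sup>2)))) has_vector_derivative
      w * of_real (- (2 * t) / (1 - t\<^sup>2)) * exp (w * of_real (ln (1 - t\<^sup>2)))) (at t)"
    by (simp only: o_def)
  have "exp (w * of_real (ln (1 - t\<^sup>2))) = exp (of_real (ln (1 - t\<^sup>2))) * kw w t"
    unfolding kw_def exp_add[symmetric] by (simp add: algebra_simps)
  also have "exp (complex_of_real (ln (1 - t\<^sup>2))) = of_real (1 - t\<^sup>2)"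
    unfolding exp_of_real exp_ln[OF p] ..
  finally have E: "exp (w * of_real (ln (1 - t\<^sup>2))) = of_real (1 - t\<^sup>2) * kw w t" .
  have R: "of_real (- (2 * t) / (1 - t\<^sup>2)) * complex_of_real (1 - t\<^sup>2) = - 2 * of_real t"
  proof -
    have "- (2 * t) / (1 - t\<^sup>2) * (1 - t\<^sup>2) = - 2 * t" using p by simp
    then show ?thesis unfolding of_real_mult[symmetric] by simp
  qed
  have "w * of_real (- (2 * t) / (1 - t\<^sup>2)) * (of_real (1 - t\<^sup>2) * kw w t) = w * (of_real (- (2 * t) / (1 - t\<^sup>2)) * of_real (1 - t\<^sup>2)) * kw w t"
    by (simp only: mult.assoc)
  also have "\<dots> = - 2 * w * of_real t * kw w t" unfolding R by (simp add: mult_ac)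
  finally have "w * of_real (- (2 * t) / (1 - t\<^sup>2)) * exp (w * of_real (ln (1 - t\<^sup>2))) = - 2 * w * of_real t * kw w t"
    unfolding E .
  with D show ?thesis unfolding kw_def[of "w + 1"] by (simp only: add_diff_cancel_right')
qed

text \<open>The boundary terms vanish: near 0 through the support of \<psi>, and at 1 because (1 -
  t^2)^w tends to 0 for Re w > 0.\<close>

lemma TI_by_parts:
  assumes \<psi>: "\<psi> \<in> test_functions" and w: "0 < Re w"
  shows "TI (w + 1) (dq \<psi>) = 2 * w * TI w \<psi>"
proof -
  define \<kappa> where "\<kappa> t = of_real (t powi (- 1)) * \<psi> t" for t
  have \<kappa>: "\<kappa> \<in> test_functions" using test_powi[OF \<psi>, of "- 1"] by (simp add: \<kappa>_def[abs_def])
  have d\<kappa>: "(\<kappa> has_vector_derivative dq \<psi> t) (at t)" for t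
    using test_deriv[OF \<kappa>] by (simp add: dq_def \<kappa>_def[abs_def])
  have \<psi>\<kappa>: "\<psi> t = of_real t * \<kappa> t" if "0 < t" for t using that by (simp add: \<kappa>_def power_int_minus)
  let ?f = "\<lambda>t. kw (w + 1) t * dq \<psi> t + (- 2 * w) * (kw w t * \<psi> t)"
  have w1: "0 < Re (w + 1)" using w by simp
  have int: "set_integrable lborel {0<..<1} (\<lambda>t. kw (w + 1) t * dq \<psi> t)"
    "set_integrable lborel {0<..<1} (\<lambda>t. (- 2 * w) * (kw w t * \<psi> t))"
    by (rule kw_integrable[OF test_dq[OF \<psi>] w1], rule set_integrable_mult_right, rule kw_integrable[OF \<psi> w])
  have "(LBINT t=0..1. ?f t) = 0 - 0"
  proof (rule interval_integral_FTC_integrable)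
    show "((\<lambda>t. kw (w + 1) t * \<kappa> t) has_vector_derivative ?f t) (at t)" if "0 < ereal t" "ereal t < 1" for t
      using has_vector_derivative_mult[OF kw_deriv d\<kappa>, of t w] that \<psi>\<kappa>[of t] by (simp add: algebra_simps)
    have "continuous_on {0<..<1} ?f"
      by (intro continuous_intros kw_mult_continuous test_dq \<psi>)
    then show "isCont ?f t" if "0 < ereal t" "ereal t < 1" for t
      using that by (simp add: continuous_on_eq_continuous_at)
    show "set_integrable lborel (einterval 0 1) ?f"
      using set_integral_add(1)[OF int] by (simp add: zero_ereal_def one_ereal_def)
    obtain a where a: "0 < a" "\<And>t. t < a \<Longrightarrow> \<kappa> t = 0" using testE[OF \<kappa>] by metis
    have "((\<lambda>t. kw (w + 1) t * \<kappa> t) \<longlongrightarrow> 0) (at_right 0)"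
      by (rule Lim_transform_eventually[OF tendsto_const])
        (use a in \<open>auto simp: eventually_at_right_field intro!: exI[of _ a]\<close>)
    then show "(((\<lambda>t. kw (w + 1) t * \<kappa> t) \<circ> real_of_ereal) \<longlongrightarrow> 0) (at_right 0)"
      unfolding zero_ereal_def ereal_tendsto_simps1 .
    obtain C where C: "\<And>t. 0 \<le> t \<Longrightarrow> t \<le> 1 \<Longrightarrow> norm (\<kappa> t) \<le> C" using test_bounded[OF \<kappa>] by metis
    have ev: "\<forall>\<^sub>F t::real in at_left 1. 0 < t \<and> t < 1"
      unfolding eventually_at_left_field by (intro exI[of _ 0]) simp
    have "((\<lambda>t. kw (w + 1) t * \<kappa> t) \<longlongrightarrow> 0) (at_left 1)"
    proof (rule Lim_null_comparison)
      show "\<forall>\<^sub>F t in at_left 1. norm (kw (w + 1) t * \<kappa> t) \<le> (1 - t\<^sup>2) powr Re w * C"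
        using ev by eventually_elim (simp add: norm_mult norm_kw mult_left_mono C)
      show "((\<lambda>t. (1 - t\<^sup>2) powr Re w * C) \<longlongrightarrow> 0) (at_left 1)"
        by (rule tendsto_mult_left_zero[OF powr_tendsto_0[OF w]])
    qed
    then show "(((\<lambda>t. kw (w + 1) t * \<kappa> t) \<circ> real_of_ereal) \<longlongrightarrow> 0) (at_left 1)"
      unfolding one_ereal_def ereal_tendsto_simps1 .
  qed simp
  moreover have "(LBINT t=0..1. ?f t) = (LINT t:{0<..<1}|lborel. ?f t)"
    by (simp add: interval_lebesgue_integral_def zero_ereal_def one_ereal_def)
  moreover have "(LINT t:{0<..<1}|lborel. ?f t) = TI (w + 1) (dq \<psi>) + (- 2 * w) * TI w \<psi>"
    unfolding set_integral_add(2)[OF int] TI_def by (simp only: set_integral_mult_right)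
  ultimately show ?thesis by simp
qed

lemma TI_integral:
  assumes "\<psi> \<in> test_functions" "0 < Re w"
  shows "(\<lambda>t. kw w t * \<psi> t) integrable_on {0..1}" "TI w \<psi> = integral {0..1} (\<lambda>t. kw w t * \<psi> t)"
proof -
  show "(\<lambda>t. kw w t * \<psi> t) integrable_on {0..1}"
    using set_borel_integral_eq_integral(1)[OF kw_integrable[OF assms]] integrable_on_open_interval_real by blast
  show "TI w \<psi> = integral {0..1} (\<lambda>t. kw w t * \<psi> t)"
    unfolding TI_def set_borel_integral_eq_integral(2)[OF kw_integrable[OF assms]]
    by (rule integral_open_interval_real[symmetric])
qed

text \<open>Truncated at 1 - 1/(n+1), the integral is holomorphic by differentiation under the
  integral sign. For Re w > 1 the kernel has modulus at most 1, so the truncation error is at most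
  C/(n+1), uniformly in w.\<close>

lemma TI_holomorphic:
  assumes \<psi>: "\<psi> \<in> test_functions" shows "(\<lambda>w. TI w \<psi>) holomorphic_on {w. 1 < Re w}"
proof -
  obtain C where C: "0 \<le> C" "\<And>t. 0 \<le> t \<Longrightarrow> t \<le> 1 \<Longrightarrow> norm (\<psi> t) \<le> C" using test_bounded[OF \<psi>] by metis
  define c where "c n = 1 - inverse (real (Suc n))" for n
  have c: "0 \<le> c n" "c n < 1" for n by (simp_all add: c_def inverse_le_1_iff)
  let ?U = "{w. 1 < Re w}"
  have U: "open ?U" "convex ?U" by (simp_all add: open_halfspace_Re_gt convex_halfspace_Re_gt)
  show ?thesis
  proof (rule holomorphic_uniform_sequence[OF U(1)])
    fix n
    have pos: "1 - t\<^sup>2 \<noteq> 0" if "t \<in> cbox 0 (c n)" for t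
      using that c[of n] by (auto simp: power2_eq_1_iff)
    show "(\<lambda>w. integral (cbox 0 (c n)) (\<lambda>t. kw w t * \<psi> t)) holomorphic_on ?U"
    proof (rule leibniz_rule_holomorphic[OF _ _ _ U(2)])
      show "((\<lambda>w. kw w t * \<psi> t) has_field_derivative of_real (ln (1 - t\<^sup>2)) * kw w t * \<psi> t) (at w within ?U)" for w t
        unfolding kw_def by (auto intro!: derivative_eq_intros)
      show "(\<lambda>t. kw w t * \<psi> t) integrable_on cbox 0 (c n)" for w
        by (intro integrable_continuous continuous_on_mult test_continuous \<psi> continuous_on_subset[OF kw_continuous])
          (use c[of n] in auto)
      have "continuous_on (?U \<times> cbox 0 (c n)) (\<lambda>x. of_real (ln (1 - (snd x)\<^sup>2)) * kw (fst x) (snd x) * \<psi> (snd x))"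
        unfolding kw_def using pos
        by (intro continuous_intros continuous_on_compose2[OF test_continuous[OF \<psi>, of UNIV]]) auto
      then show "continuous_on (?U \<times> cbox 0 (c n)) (\<lambda>(w, t). of_real (ln (1 - t\<^sup>2)) * kw w t * \<psi> t)"
        by (simp add: case_prod_unfold)
    qed
  next
    fix x assume "x \<in> ?U"
    then obtain d where d: "0 < d" "cball x d \<subseteq> ?U" using U(1) open_contains_cball by blast
    have b: "dist (integral (cbox 0 (c n)) (\<lambda>t. kw w t * \<psi> t)) (TI w \<psi>) \<le> C * inverse (real (Suc n))"
      if w: "w \<in> ?U" for n w
    proof -
      have I: "(\<lambda>t. kw w t * \<psi> t) integrable_on {0..1}" using TI_integral(1)[OF \<psi>, of w] w by simp
      have "integral {0..c n} (\<lambda>t. kw w t * \<psi> t) + integral {c n..1} (\<lambda>t. kw w t * \<psi> t) = TI w \<psi>"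
        using Henstock_Kurzweil_Integration.integral_combine[OF c(1) less_imp_le[OF c(2)] I] TI_integral(2)[OF \<psi>, of w] w by simp
      then have "dist (integral {0..c n} (\<lambda>t. kw w t * \<psi> t)) (TI w \<psi>) = norm (integral {c n..1} (\<lambda>t. kw w t * \<psi> t))"
        by (metis add_diff_cancel_left' dist_commute dist_norm)
      also have "\<dots> \<le> C * (1 - c n)"
      proof -
        have "norm (kw w t * \<psi> t) \<le> C" if t: "t \<in> cbox (c n) 1" for t
        proof -
          have t01: "0 \<le> t" "t \<le> 1" using t c[of n] by auto
          have "ln (1 - t\<^sup>2) \<le> 0"
          proof (cases "t = 1")
            case False
            then have "0 < 1 - t\<^sup>2" using t01 by (simp add: power_less_one_iff)
            then show ?thesis using ln_le_minus_one[of "1 - t\<^sup>2"] by (smt (verit) zero_le_power2)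
          qed simp
          then have "(Re w - 1) * ln (1 - t\<^sup>2) \<le> 0" using w by (intro mult_nonneg_nonpos) auto
          then have "norm (kw w t) \<le> 1" by (simp add: kw_def)
          then have "norm (kw w t) * norm (\<psi> t) \<le> 1 * C" using C t01 by (intro mult_mono) auto
          then show ?thesis by (simp add: norm_mult)
        qed
        moreover have "(\<lambda>t. kw w t * \<psi> t) integrable_on cbox (c n) 1"
          using integrable_subinterval_real[OF I, of "c n" 1] c(1)[of n] by simp
        ultimately have "norm (integral (cbox (c n) 1) (\<lambda>t. kw w t * \<psi> t)) \<le> C * measure lborel (cbox (c n) 1)"
          by (intro integrable_bound C(1))
        then show ?thesis using c(2)[of n] by simp
      qed
      finally show ?thesis by (simp add: c_def)
    qed
    have lim: "(\<lambda>n. C * inverse (real (Suc n))) \<longlonglongrightarrow> 0"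
      using tendsto_mult_right_zero[OF LIMSEQ_inverse_real_of_nat] .
    have "uniform_limit (cball x d) (\<lambda>n w. integral (cbox 0 (c n)) (\<lambda>t. kw w t * \<psi> t)) (\<lambda>w. TI w \<psi>) sequentially"
    proof (rule uniform_limitI)
      fix e :: real assume "0 < e"
      with lim have "\<forall>\<^sub>F n in sequentially. C * inverse (real (Suc n)) < e" by (rule order_tendstoD)
      then show "\<forall>\<^sub>F n in sequentially. \<forall>w\<in>cball x d. dist (integral (cbox 0 (c n)) (\<lambda>t. kw w t * \<psi> t)) (TI w \<psi>) < e"
        by eventually_elim (use b d(2) in \<open>blast intro: le_less_trans\<close>)
    qed
    then show "\<exists>d>0. cball x d \<subseteq> ?U \<and> uniform_limit (cball x d) (\<lambda>n w. integral (cbox 0 (c n)) (\<lambda>t. kw w t * \<psi> t)) (\<lambda>w. TI w \<psi>) sequentially"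
      using d by blast
  qed
qed

text \<open>The description in \<open>gf_kernel\<close> is well defined by the identity theorem: two
  continuations agree for Re w > 0, hence on the connected larger half-plane.\<close>

lemma gf_kernel_eqI:
  assumes F: "F holomorphic_on {w. - 1 < Re w}" "\<And>w. 0 < Re w \<Longrightarrow> F w = 1 / Gamma w * TI w \<phi>" and s: "- 1 < Re s"
  shows "gf_kernel s \<phi> = F s"
  unfolding gf_kernel_def TI_eq[symmetric]
proof (rule the_equality)
  show "\<exists>F'. F' holomorphic_on {w. - 1 < Re w} \<and> (\<forall>w. 0 < Re w \<longrightarrow> F' w = 1 / Gamma w * TI w \<phi>) \<and> F s = F' s"
    using F by (intro exI[of _ F]) simp
  fix z assume "\<exists>F'. F' holomorphic_on {w. - 1 < Re w} \<and> (\<forall>w. 0 < Re w \<longrightarrow> F' w = 1 / Gamma w * TI w \<phi>) \<and> z = F' s"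
  then obtain F' where F': "F' holomorphic_on {w. - 1 < Re w}" "\<forall>w. 0 < Re w \<longrightarrow> F' w = 1 / Gamma w * TI w \<phi>" "z = F' s" by blast
  have "F' s = F s"
  proof (rule analytic_continuation_open[of "{w. 0 < Re w}" "{w. - 1 < Re w}" F' F s])
    show "connected {w. - 1 < Re w}" by (intro convex_connected convex_halfspace_Re_gt)
    have "1 \<in> {w. 0 < Re w}" by simp
    then show "{w. 0 < Re w} \<noteq> {}" by blast
  qed (use F F' s in \<open>auto simp: open_halfspace_Re_gt\<close>)
  then show "z = F s" using F'(3) by simp
qed

text \<open>Two integrations by parts continue the kernel analytically to \<open>Re s > -1\<close>.\<close>

lemma gf_kernel_eq:
  assumes \<phi>: "\<phi> \<in> test_functions" and s: "- 1 < Re s"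
  shows "gf_kernel s \<phi> = rGamma (s + 2) / 4 * TI (s + 2) (dq (dq \<phi>))"
    and "0 < Re s \<Longrightarrow> gf_kernel s \<phi> = 1 / Gamma s * TI s \<phi>"
proof -
  \<comment> \<open>The two integrations by parts yield the factors 2 w and 2 (w + 1). With Gamma (w
    + 2) = w (w + 1) Gamma w this leaves \<open>rGamma (w + 2) / 4\<close>, which is entire.\<close>
  let ?F = "\<lambda>w. rGamma (w + 2) / 4 * TI (w + 2) (dq (dq \<phi>))"
  have "(\<lambda>w. TI (w + 2) (dq (dq \<phi>))) holomorphic_on {w. - 1 < Re w}"
    using holomorphic_on_compose_gen[OF _ TI_holomorphic[OF test_dq[OF test_dq[OF \<phi>]]], of "\<lambda>w. w + 2" "{w. - 1 < Re w}"]
    by (force simp: o_def intro: holomorphic_intros)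
  then have h: "?F holomorphic_on {w. - 1 < Re w}"
    by (intro holomorphic_intros) auto
  have e: "?F w = 1 / Gamma w * TI w \<phi>" if w: "0 < Re w" for w
  proof -
    have nz: "w \<noteq> 0" "w + 1 \<noteq> 0" using w by (auto simp: complex_eq_iff)
    have "TI (w + 2) (dq (dq \<phi>)) = 2 * (w + 1) * (2 * w * TI w \<phi>)"
      using TI_by_parts[OF \<phi> w] TI_by_parts[OF test_dq[OF \<phi>], of "w + 1"] w by (simp add: add.assoc)
    moreover have "rGamma w = w * ((w + 1) * rGamma (w + 2))"
      using rGamma_plus1[of w] rGamma_plus1[of "w + 1"] by (simp add: add.assoc)
    ultimately show ?thesis
      using nz by (simp add: rGamma_inverse_Gamma[symmetric] inverse_eq_divide[symmetric])
  qed
  show "gf_kernel s \<phi> = ?F s" by (rule gf_kernel_eqI[OF h e s])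
  show "gf_kernel s \<phi> = 1 / Gamma s * TI s \<phi>" if "0 < Re s"
    by (rule trans[OF gf_kernel_eqI[OF h e s] e[OF that]])
qed

lemma gf_kernel_Suc:
  assumes \<phi>: "\<phi> \<in> test_functions"
  shows "gf_kernel (of_nat (Suc a)) \<phi> = 1 / fact a * integral {0..1} (\<lambda>t. of_real ((1 - t\<^sup>2) ^ a) * \<phi> t)"
proof -
  have "gf_kernel (of_nat (Suc a)) \<phi> = 1 / Gamma (of_nat (Suc a)) * TI (of_nat (Suc a)) \<phi>"
    by (rule gf_kernel_eq(2)[OF \<phi>]) simp_all
  also have "Gamma (of_nat (Suc a) :: complex) = fact a" using Gamma_fact[of a] by (simp add: add.commute)
  also have "TI (of_nat (Suc a)) \<phi> = integral {0<..<1} (\<lambda>t. kw (of_nat (Suc a)) t * \<phi> t)"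
    unfolding TI_def by (rule set_borel_integral_eq_integral(2)[OF kw_integrable[OF \<phi>]]) simp
  also have "\<dots> = integral {0<..<1} (\<lambda>t. of_real ((1 - t\<^sup>2) ^ a) * \<phi> t)"
  proof (rule integral_cong)
    fix t :: real assume "t \<in> {0<..<1}"
    then have p: "0 < 1 - t\<^sup>2" using square_less_1[of t] by simp
    have "kw (of_nat (Suc a)) t = exp (of_real (ln (1 - t\<^sup>2))) ^ a"
      unfolding kw_def exp_of_nat_mult[symmetric] by simp
    also have "exp (complex_of_real (ln (1 - t\<^sup>2))) = of_real (1 - t\<^sup>2)"
      unfolding exp_of_real exp_ln[OF p] ..
    finally show "kw (of_nat (Suc a)) t * \<phi> t = of_real ((1 - t\<^sup>2) ^ a) * \<phi> t" by (simp only: of_real_power)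
  qed
  also have "\<dots> = integral {0..1} (\<lambda>t. of_real ((1 - t\<^sup>2) ^ a) * \<phi> t)"
    by (rule integral_open_interval_real[symmetric])
  finally show ?thesis .
qed

text \<open>One integration by parts is undone, and what remains is the integral of a derivative
  from 0 to 1, with value \<phi> 1. The 1/2 is the factor 2 of that step over the 4 of
  \<open>gf_kernel_eq\<close>.\<close>

lemma gf_kernel_0:
  assumes \<phi>: "\<phi> \<in> test_functions" shows "gf_kernel 0 \<phi> = \<phi> 1 / 2"
proof -
  have "gf_kernel 0 \<phi> = rGamma (0 + 2) / 4 * TI (0 + 2) (dq (dq \<phi>))"
    by (rule gf_kernel_eq(1)[OF \<phi>]) simp
  moreover have "TI (1 + 1) (dq (dq \<phi>)) = 2 * 1 * TI 1 (dq \<phi>)"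
    by (rule TI_by_parts[OF test_dq[OF \<phi>]]) simp
  moreover have "rGamma (2::complex) = 1"
    using Gamma_fact[of 1, where 'a = complex] by (simp add: rGamma_inverse_Gamma)
  moreover have "TI 1 (dq \<phi>) = \<phi> 1"
  proof -
    have "TI 1 (dq \<phi>) = integral {0..1} (\<lambda>t. kw 1 t * dq \<phi> t)"
      by (rule TI_integral(2)[OF test_dq[OF \<phi>]]) simp
    also have "(\<lambda>t. kw 1 t * dq \<phi> t) = dq \<phi>" by (simp add: kw_def fun_eq_iff)
    also have "integral {0..1} (dq \<phi>) = of_real (1 powi (- 1)) * \<phi> 1 - of_real (0 powi (- 1)) * \<phi> 0"
      unfolding dq_def
      by (intro integral_unique fundamental_theorem_of_calculus has_vector_derivative_at_within[OF test_deriv[OF test_powi[OF \<phi>]]]) simp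
    finally show ?thesis by simp
  qed
  ultimately have "2 * gf_kernel 0 \<phi> = \<phi> 1" by simp
  then show ?thesis by (simp add: mult.commute[of _ 2])
qed

text \<open>Linearity is not visible in the description operator of \<open>gf_kernel\<close>; it is
  read off from the explicit values at the integers m \<ge> 0.\<close>

lemma gf_kernel_linear:
  assumes "\<phi> \<in> test_functions" "\<psi> \<in> test_functions"
  shows "gf_kernel (of_nat m) (\<lambda>t. \<phi> t + c * \<psi> t) = gf_kernel (of_nat m) \<phi> + c * gf_kernel (of_nat m) \<psi>"
proof (cases m)
  case 0
  then show ?thesis
    using assms by (simp add: gf_kernel_0 test_add test_cmult add_divide_distrib)
next
  case (Suc a)
  have I: "(\<lambda>t. of_real ((1 - t\<^sup>2) ^ a) * \<phi> t) integrable_on {0..1}" if "\<phi> \<in> test_functions" for \<phi> :: "real \<Rightarrow> complex"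
    by (intro integrable_continuous_real continuous_intros test_continuous that)
  have "integral {0..1} (\<lambda>t. of_real ((1 - t\<^sup>2) ^ a) * (\<phi> t + c * \<psi> t)) =
      integral {0..1} (\<lambda>t. of_real ((1 - t\<^sup>2) ^ a) * \<phi> t + c * (of_real ((1 - t\<^sup>2) ^ a) * \<psi> t))"
    by (simp add: algebra_simps)
  also have "\<dots> = integral {0..1} (\<lambda>t. of_real ((1 - t\<^sup>2) ^ a) * \<phi> t) + c * integral {0..1} (\<lambda>t. of_real ((1 - t\<^sup>2) ^ a) * \<psi> t)"
    using integral_add[OF I[OF assms(1)] integrable_on_mult_right[OF I[OF assms(2)]]] by simp
  finally show ?thesis
    unfolding Suc gf_kernel_Suc[OF test_add[OF assms(1) test_cmult[OF assms(2)]]] gf_kernel_Suc[OF assms(1)] gf_kernel_Suc[OF assms(2)]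
    by (simp add: algebra_simps)
qed

section \<open>Evaluation of the inversion distribution\<close>

text \<open>The transpose of \<open>gf_euler c\<close>, acting on test functions; the minus signs of
  \<open>gf_euler\<close> and \<open>gf_deriv\<close> cancel.\<close>

definition Lop :: "complex \<Rightarrow> (real \<Rightarrow> complex) \<Rightarrow> real \<Rightarrow> complex" where
  "Lop c \<phi> t = of_real t * vector_derivative \<phi> (at t) + c * \<phi> t"

fun lprod :: "(nat \<Rightarrow> complex) \<Rightarrow> nat \<Rightarrow> (real \<Rightarrow> complex) \<Rightarrow> real \<Rightarrow> complex" where
  "lprod c 0 \<phi> = \<phi>"
| "lprod c (Suc N) \<phi> = lprod c N (Lop (c (Suc N)) \<phi>)"

lemma test_td: "\<phi> \<in> test_functions \<Longrightarrow> (\<lambda>t. of_real t * vector_derivative \<phi> (at t)) \<in> test_functions"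
  using test_powi[OF test_vector_derivative, of \<phi> 1] by simp

lemma test_Lop: "\<phi> \<in> test_functions \<Longrightarrow> Lop c \<phi> \<in> test_functions"
  using test_add[OF test_td test_cmult, of \<phi> \<phi> c] by (simp add: Lop_def[abs_def])

lemma Lop_lin:
  assumes "\<phi> \<in> test_functions" "\<psi> \<in> test_functions"
  shows "Lop c (\<lambda>t. \<phi> t + a * \<psi> t) = (\<lambda>t. Lop c \<phi> t + a * Lop c \<psi> t)"
proof
  fix t
  have "((\<lambda>t. \<phi> t + a * \<psi> t) has_vector_derivative vector_derivative \<phi> (at t) + a * vector_derivative \<psi> (at t)) (at t)"
    by (intro has_vector_derivative_add has_vector_derivative_mult_right test_deriv assms)
  then show "Lop c (\<lambda>t. \<phi> t + a * \<psi> t) t = Lop c \<phi> t + a * Lop c \<psi> t"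
    unfolding Lop_def by (simp add: vector_derivative_at algebra_simps)
qed

lemma lprod_lin:
  "\<phi> \<in> test_functions \<Longrightarrow> \<psi> \<in> test_functions \<Longrightarrow> lprod c N (\<lambda>t. \<phi> t + a * \<psi> t) = (\<lambda>t. lprod c N \<phi> t + a * lprod c N \<psi> t)"
  by (induction N arbitrary: \<phi> \<psi>) (simp_all add: Lop_lin test_Lop)

lemma test_lprod: "\<phi> \<in> test_functions \<Longrightarrow> lprod c N \<phi> \<in> test_functions"
  by (induction N arbitrary: \<phi>) (simp_all add: test_Lop)

text \<open>Transposition reverses the order: the Euler factor applied last to T acts first on the
  test function. Linearity of T recombines the two terms that each factor produces.\<close>

lemma fold_gf_euler:
  assumes T: "\<And>\<phi> \<psi> a. \<phi> \<in> test_functions \<Longrightarrow> \<psi> \<in> test_functions \<Longrightarrow> T (\<lambda>t. \<phi> t + a * \<psi> t) = T \<phi> + a * T \<psi>"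
  shows "\<phi> \<in> test_functions \<Longrightarrow> fold (\<lambda>j. gf_euler (c j)) [1..<Suc N] T \<phi> = T (lprod c N \<phi>)"
proof (induction N arbitrary: \<phi>)
  case (Suc N)
  let ?d = "\<lambda>t. complex_of_real t * vector_derivative \<phi> (at t)"
  have "fold (\<lambda>j. gf_euler (c j)) [1..<Suc (Suc N)] T \<phi> = gf_euler (c (Suc N)) (fold (\<lambda>j. gf_euler (c j)) [1..<Suc N] T) \<phi>"
    by simp
  also have "\<dots> = T (lprod c N ?d) + c (Suc N) * T (lprod c N \<phi>)"
    unfolding gf_euler_def gf_deriv_def gf_mult_def minus_minus Suc.IH[OF Suc.prems] Suc.IH[OF test_td[OF Suc.prems]] ..
  also have "\<dots> = T (lprod c N (Lop (c (Suc N)) \<phi>))"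
    unfolding Lop_def[abs_def] lprod_lin[OF test_td[OF Suc.prems] Suc.prems]
    by (rule T[symmetric]) (intro test_lprod test_td Suc.prems)+
  finally show ?case by simp
qed simp

lemma profile_deriv:
  assumes g: "g \<in> Cp" and y: "0 \<le> y" and t: "0 < t"
  shows "((\<lambda>t. g (y / t\<^sup>2)) has_vector_derivative of_real (- 2 / t) * yd g (y / t\<^sup>2)) (at t)"
proof (cases "y = 0")
  case True
  then show ?thesis using Cp_nonpos[OF g, of 0] by (simp add: yd_def)
next
  case False
  have "((\<lambda>t. y / t\<^sup>2) has_real_derivative - 2 * (y / t\<^sup>2) / t) (at t)"
    using t by (auto intro!: derivative_eq_intros simp: field_simps power2_eq_square)
  then have "((\<lambda>t. y / t\<^sup>2) has_vector_derivative - 2 * (y / t\<^sup>2) / t) (at t)"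
    by (simp add: has_real_derivative_iff_has_vector_derivative)
  from vector_diff_chain_at[OF this Cp_deriv[OF g]] y t False
  have "((\<lambda>t. g (y / t\<^sup>2)) has_vector_derivative (- 2 * (y / t\<^sup>2) / t) *\<^sub>R dop g (y / t\<^sup>2)) (at t)"
    by (simp add: o_def)
  moreover have "(- 2 * (y / t\<^sup>2) / t) *\<^sub>R dop g (y / t\<^sup>2) = of_real (- 2 / t) * yd g (y / t\<^sup>2)"
    unfolding yd_def scaleR_conv_of_real by simp
  ultimately show ?thesis by simp
qed

text \<open>On t^(-P) g(y/t^2) the operator t d/dt acts as -P - 2 y D, so the constant P of the
  Euler factor cancels. Derivatives are local, so this form of \<phi> may be confined to the
  interval (0, r).\<close>

lemma Lop_profile:
  assumes g: "g \<in> Cp" and y: "0 \<le> y" and \<phi>: "\<phi> \<in> test_functions" and t: "t \<in> {0<..<r}"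
    and eq: "\<And>t. t \<in> {0<..<r} \<Longrightarrow> \<phi> t = of_real (t powi (- int P)) * g (y / t\<^sup>2)"
  shows "Lop (of_nat P - 2 * of_nat j) \<phi> t = of_real (t powi (- int P)) * (- 2 * (yd g (y / t\<^sup>2) + of_nat j * g (y / t\<^sup>2)))"
proof -
  have t0: "0 < t" using t by simp
  have "((\<lambda>t. t powi (- int P)) has_real_derivative of_int (- int P) * t powi (- int P - 1)) (at t)"
    using t0 by (auto intro!: derivative_eq_intros)
  then have "((\<lambda>t. complex_of_real (t powi (- int P))) has_vector_derivative of_real (of_int (- int P) * t powi (- int P - 1))) (at t)"
    by (intro has_vector_derivative_of_real) (simp add: has_real_derivative_iff_has_vector_derivative)
  from has_vector_derivative_mult[OF this profile_deriv[OF g y t0]]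
  have "((\<lambda>t. of_real (t powi (- int P)) * g (y / t\<^sup>2)) has_vector_derivative
      of_real (t powi (- int P)) * (of_real (- 2 / t) * yd g (y / t\<^sup>2)) +
      of_real (of_int (- int P) * t powi (- int P - 1)) * g (y / t\<^sup>2)) (at t)" .
  moreover have "((\<lambda>t. of_real (t powi (- int P)) * g (y / t\<^sup>2)) has_vector_derivative vector_derivative \<phi> (at t)) (at t)"
    by (rule test_vanish_deriv[OF \<phi> open_greaterThanLessThan eq t])
  ultimately have d: "vector_derivative \<phi> (at t) = of_real (t powi (- int P)) * (of_real (- 2 / t) * yd g (y / t\<^sup>2)) +
      of_real (of_int (- int P) * t powi (- int P - 1)) * g (y / t\<^sup>2)"
    using vector_derivative_unique_at by blast
  define E where "E = complex_of_real (t powi (- int P))"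
  have e1: "complex_of_real (of_int (- int P) * t powi (- int P - 1)) = - of_nat P * E / of_real t"
    using t0 by (simp add: E_def power_int_diff)
  show ?thesis
    unfolding Lop_def d eq[OF t] e1 E_def[symmetric] using t0 by (simp add: field_simps)
qed

lemma eprod_cmult: "g \<in> Cp \<Longrightarrow> eprod N (\<lambda>y. c * g y) = (\<lambda>y. c * eprod N g y)"
  by (simp add: eprod_eq Cp_cmult mulp_cmult dop_pow_cmult mulp_Cp)

lemma lprod_profile:
  assumes y: "0 \<le> y"
  shows "g \<in> Cp \<Longrightarrow> \<phi> \<in> test_functions \<Longrightarrow>
    (\<And>t. t \<in> {0<..<r} \<Longrightarrow> \<phi> t = of_real (t powi (- int P)) * g (y / t\<^sup>2)) \<Longrightarrow> t \<in> {0<..<r} \<Longrightarrow>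
    lprod (\<lambda>j. of_nat P - 2 * of_nat j) N \<phi> t = of_real (t powi (- int P)) * ((- 2) ^ N * eprod N g (y / t\<^sup>2))"
proof (induction N arbitrary: g \<phi>)
  case (Suc N)
  define g' where "g' z = - 2 * (yd g z + of_nat (Suc N) * g z)" for z
  have C: "(\<lambda>z. yd g z + of_nat (Suc N) * g z) \<in> Cp" by (intro Cp_add Cp_cmult yd_Cp Suc.prems)
  have g': "g' \<in> Cp" unfolding g'_def[abs_def] by (rule Cp_cmult[OF C])
  have "Lop (of_nat P - 2 * of_nat (Suc N)) \<phi> t = of_real (t powi (- int P)) * g' (y / t\<^sup>2)" if "t \<in> {0<..<r}" for t
    unfolding g'_def by (rule Lop_profile[OF Suc.prems(1) y Suc.prems(2) that Suc.prems(3)])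
  from Suc.IH[OF g' test_Lop[OF Suc.prems(2)] this Suc.prems(4)]
  have "lprod (\<lambda>j. of_nat P - 2 * of_nat j) (Suc N) \<phi> t = of_real (t powi (- int P)) * ((- 2) ^ N * eprod N g' (y / t\<^sup>2))"
    by simp
  also have "eprod N g' = (\<lambda>z. - 2 * eprod (Suc N) g z)"
    unfolding g'_def[abs_def] eprod_cmult[OF C] by simp
  finally show ?case by (simp add: mult_ac)
qed simp

text \<open>The factors produced by s = y/t^2 - y: the Jacobian, the power of s, and the power
  carried by the profile. The kernel appears because s = y (1 - t^2) / t^2.\<close>

lemma substitution_factor:
  fixes y t :: real
  assumes "0 < y" "0 < t"
  shows "(2 * y / t ^ 3) * (y / t\<^sup>2 - y) ^ a * (y / t\<^sup>2) powi c = 2 * y powi (1 + int a + c) * ((1 - t\<^sup>2) ^ a * t powi (- 3 - 2 * int a - 2 * c))"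
proof -
  have t: "t \<noteq> 0" using assms by simp
  have p: "t powi (- 3) = 1 / t ^ 3" "t powi (- 2) = 1 / t\<^sup>2"
    using assms by (simp_all add: power_int_minus divide_inverse)
  have "(y / t\<^sup>2 - y) ^ a = (y * ((1 - t\<^sup>2) * t powi (- 2))) ^ a"
    using assms by (simp add: p field_simps)
  also have "\<dots> = y ^ a * ((1 - t\<^sup>2) ^ a * t powi (- 2 * int a))"
    unfolding power_mult_distrib power_int_mult power_int_of_nat ..
  finally have 1: "(y / t\<^sup>2 - y) ^ a = y ^ a * ((1 - t\<^sup>2) ^ a * t powi (- 2 * int a))" .
  have "(y / t\<^sup>2) powi c = (y * t powi (- 2)) powi c" by (simp add: p)
  also have "\<dots> = y powi c * t powi (- 2 * c)"
    unfolding power_int_mult_distrib power_int_mult ..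
  finally have 2: "(y / t\<^sup>2) powi c = y powi c * t powi (- 2 * c)" .
  have 3: "y powi (1 + int a + c) = y * y ^ a * y powi c" using assms by (simp add: power_int_add)
  have "t powi (- 3 - 2 * int a - 2 * c) = t powi (- 3 + - 2 * int a + - 2 * c)" by (simp add: algebra_simps)
  also have "\<dots> = t powi (- 3) * t powi (- 2 * int a) * t powi (- 2 * c)"
    unfolding power_int_add[OF disjI1[OF t]] ..
  finally have 4: "t powi (- 3 - 2 * int a - 2 * c) = t powi (- 3) * t powi (- 2 * int a) * t powi (- 2 * c)" .
  have "2 * y / t ^ 3 = 2 * y * t powi (- 3)" by (simp add: p)
  then show ?thesis unfolding 1 2 3 4 by (simp only: mult_ac)
qed

text \<open>For m = a + 1 the substitution s = y/t^2 - y makes the pairing a moment of order a,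
  whose factorial is cancelled by 1/Gamma(m). For m = 0 the kernel is half the point mass at 1, so
  the leading 1/2 is common to all m.\<close>

lemma kernel_profile:
  assumes k: "k \<in> Cp" and y: "0 \<le> y" and \<phi>: "\<phi> \<in> test_functions" and r: "1 < r"
    and eq: "\<And>t. t \<in> {0<..<r} \<Longrightarrow> \<phi> t = of_real (t powi (- int P)) * k (y / t\<^sup>2)"
  shows "gf_kernel (of_nat m) (\<lambda>t. of_real (t powi (1 - int P - 2 * int n)) * \<phi> t) =
    1 / 2 * mulp (1 - int P - int n) ((iop ^^ m) (mulp (int P + int n - 1 - int m) k)) y"
proof (cases m)
  case 0
  then show ?thesis
    using gf_kernel_0[OF test_powi[OF \<phi>]] eq[of 1] r k by (simp add: mulp_mulp mulp_0)
next
  case (Suc a)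
  define kk where "kk = mulp (int P + int n - 1 - int m) k"
  have kk: "kk \<in> Cp" unfolding kk_def by (rule mulp_Cp[OF k])
  define F where "F t = of_real ((1 - t\<^sup>2) ^ a) * (of_real (t powi (1 - int P - 2 * int n)) * \<phi> t)" for t
  have ker: "gf_kernel (of_nat m) (\<lambda>t. of_real (t powi (1 - int P - 2 * int n)) * \<phi> t) = 1 / fact a * integral {0..1} F"
    unfolding Suc F_def[abs_def] by (rule gf_kernel_Suc[OF test_powi[OF \<phi>]])
  obtain b where b: "0 < b" "\<And>t. t < b \<Longrightarrow> \<phi> t = 0" using testE[OF \<phi>] by metis
  have F0: "F 0 = 0" using b by (simp add: F_def)
  show ?thesis
  proof (cases "y = 0")
    case True
    have Fz: "F t = 0" if "t \<in> {0..1}" for t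
      using F0 eq[of t] that r True Cp_nonpos[OF k, of 0] by (cases "t = 0") (auto simp: F_def)
    have "integral {0..1} F = integral {0..1} (\<lambda>t::real. 0)" by (rule integral_cong) (rule Fz)
    moreover have "mulp (1 - int P - int n) ((iop ^^ m) kk) 0 = 0"
      using Cp_nonpos[OF mulp_Cp[OF iop_pow_Cp[OF kk]], of 0] by simp
    ultimately show ?thesis using ker True by (simp add: kk_def)
  next
    case False
    then have y0: "0 < y" using y by simp
    obtain R where R: "R > 0" "\<And>z. z > R \<Longrightarrow> k z = 0" using Cp_bound[OF k] by metis
    have kkR: "z > R \<Longrightarrow> kk z = 0" for z using R by (simp add: kk_def mulp_def)
    \<comment> \<open>To the left of this point y/t^2 exceeds R and the integrand vanishes; cutting
      here keeps t = 0 out of the substitution.\<close>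
    define \<delta> where "\<delta> = sqrt (y / (y + R + 1))"
    have \<delta>: "0 < \<delta>" "\<delta> < 1" "y / \<delta>\<^sup>2 = y + R + 1"
      using y0 R(1) by (simp_all add: \<delta>_def)
    have Fint: "F integrable_on {0..1}"
      unfolding F_def by (intro integrable_continuous_real continuous_intros test_continuous test_powi \<phi>)
    have Fz: "F t = 0" if t: "t \<in> {0..\<delta>}" for t
    proof (cases "t = 0")
      case False
      then have t0: "0 < t" using t by simp
      have "t\<^sup>2 \<le> \<delta>\<^sup>2" using t by (simp add: power_mono)
      then have "y / \<delta>\<^sup>2 \<le> y / t\<^sup>2" using t0 y0 \<delta>(1) by (intro divide_left_mono) auto
      then have "k (y / t\<^sup>2) = 0" using R \<delta>(3) y0 by simp
      then show ?thesis using eq[of t] t t0 \<delta>(2) r by (simp add: F_def)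
    qed (simp add: F0)
    have z: "integral {0..\<delta>} F = integral {0..\<delta>} (\<lambda>t::real. 0)" by (rule integral_cong) (rule Fz)
    have I1: "integral {0..1} F = integral {\<delta>..1} F"
      using Henstock_Kurzweil_Integration.integral_combine[OF less_imp_le[OF \<delta>(1)] less_imp_le[OF \<delta>(2)] Fint] z by simp
    define f where "f s = of_real s ^ a * kk (y + s)" for s
    have fc: "continuous_on {0..R + 1} f"
      unfolding f_def
      by (intro continuous_intros continuous_on_compose2[OF Cp_continuous[OF kk]]) (use y0 in auto)
    \<comment> \<open>The substitution decreases in t: the integral over the reversed interval is 0,
      and the other one enters with a minus sign.\<close>
    have sub: "((\<lambda>t. (- (2 * y / t ^ 3)) *\<^sub>R f (y / t\<^sup>2 - y)) has_integral
        (integral {y / \<delta>\<^sup>2 - y..y / 1\<^sup>2 - y} f - integral {y / 1\<^sup>2 - y..y / \<delta>\<^sup>2 - y} f)) {\<delta>..1}"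
    proof (rule has_integral_substitution_general[of "{}" \<delta> 1 "\<lambda>t. y / t\<^sup>2 - y" 0 "R + 1"])
      show "(\<lambda>t. y / t\<^sup>2 - y) ` {\<delta>..1} \<subseteq> {0..R + 1}"
      proof (rule image_subsetI)
        fix t assume t: "t \<in> {\<delta>..1}"
        then have t0: "0 < t" using \<delta>(1) by simp
        have "\<delta>\<^sup>2 \<le> t\<^sup>2" "t\<^sup>2 \<le> 1" using t \<delta>(1) t0 by (auto simp: power_mono power_le_one)
        then have "y / t\<^sup>2 \<le> y / \<delta>\<^sup>2" "y / 1 \<le> y / t\<^sup>2"
          using t0 y0 \<delta>(1) by (auto intro!: divide_left_mono simp del: div_by_1)
        then show "y / t\<^sup>2 - y \<in> {0..R + 1}" using \<delta>(3) by simp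
      qed
      show "continuous_on {\<delta>..1} (\<lambda>t. y / t\<^sup>2 - y)"
        using \<delta>(1) by (intro continuous_intros) auto
      show "((\<lambda>t. y / t\<^sup>2 - y) has_real_derivative - (2 * y / t ^ 3)) (at t within {\<delta>..1})" if "t \<in> {\<delta>..1} - {}" for t
        using that \<delta>(1) by (auto intro!: derivative_eq_intros simp: field_simps power2_eq_square power3_eq_cube)
    qed (use fc \<delta> in auto)
    \<comment> \<open>Solves \<open>substitution_factor\<close> for the integrand F, removing the 2
      and the power of y.\<close>
    define K where "K = (1 / 2) * y powi (1 - int P - int n)"
    have Kf: "(- of_real K) * ((- (2 * y / t ^ 3)) *\<^sub>R f (y / t\<^sup>2 - y)) = F t" if t: "t \<in> {\<delta>..1}" for t
    proof -
      have t0: "0 < t" using t \<delta>(1) by simp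
      define c where "c = int P + int n - 1 - int m"
      have ex: "1 + int a + c = - (1 - int P - int n)" "- 3 - 2 * int a - 2 * c = (1 - int P - 2 * int n) + - int P"
        by (simp_all add: c_def Suc)
      have "(- of_real K) * ((- (2 * y / t ^ 3)) *\<^sub>R f (y / t\<^sup>2 - y)) =
          of_real (K * ((2 * y / t ^ 3) * (y / t\<^sup>2 - y) ^ a * (y / t\<^sup>2) powi c)) * k (y / t\<^sup>2)"
        by (simp add: f_def kk_def mulp_def c_def scaleR_conv_of_real[where 'a = complex])
      also have "K * ((2 * y / t ^ 3) * (y / t\<^sup>2 - y) ^ a * (y / t\<^sup>2) powi c) = (1 - t\<^sup>2) ^ a * (t powi (1 - int P - 2 * int n) * t powi (- int P))"
        unfolding substitution_factor[OF y0 t0] ex K_def power_int_minus[of y] using y0 t0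
        by (subst power_int_add) (simp_all add: field_simps)
      also have "of_real \<dots> * k (y / t\<^sup>2) = F t"
        using eq[of t] t t0 r by (simp add: F_def)
      finally show ?thesis .
    qed
    have e: "y / \<delta>\<^sup>2 - y = R + 1" "y / 1\<^sup>2 - y = 0" using \<delta>(3) by simp_all
    have "((\<lambda>t. (- of_real K) * ((- (2 * y / t ^ 3)) *\<^sub>R f (y / t\<^sup>2 - y))) has_integral (- of_real K) * (integral {R + 1..0} f - integral {0..R + 1} f)) {\<delta>..1}"
      using has_integral_mult_right[OF sub] unfolding e .
    then have "(F has_integral (- of_real K) * (integral {R + 1..0} f - integral {0..R + 1} f)) {\<delta>..1}"
      by (rule has_integral_eq[rotated]) (rule Kf)
    then have I2: "integral {\<delta>..1} F = of_real K * integral {0..R + 1} f"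
      using R(1) by (simp add: integral_unique)
    have "(LINT s:{0..}|lborel. f s) = (LINT s:{0..R + 1}|lborel. f s)"
      unfolding set_lebesgue_integral_def
      by (intro Bochner_Integration.integral_cong) (use kkR y0 in \<open>auto simp: indicator_def f_def not_le\<close>)
    also have "\<dots> = integral {0..R + 1} f"
      by (rule set_borel_integral_eq_integral(2)[OF borel_integrable_atLeastAtMost'[OF fc]])
    finally have "integral {0..R + 1} f = fact a * (iop ^^ m) kk y"
      using moment_eq(2)[OF kk y0, of a] by (simp only: f_def Suc)
    then have "1 / fact a * integral {0..1} F = of_real K * (iop ^^ m) kk y" using I1 I2 by simp
    then show ?thesis
      unfolding ker by (simp add: K_def mulp_def kk_def)
  qed
qed

text \<open>The value is well defined only if all admissible test functions agree on it, hence the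
  last assumption; the first three exhibit one of them.\<close>

lemma gf_apply_eqI:
  assumes "\<phi> \<in> test_functions" "0 < \<epsilon>" "\<And>t. t \<in> {0<..<1 + \<epsilon>} \<Longrightarrow> \<phi> t = g t"
    and "\<And>\<phi> \<epsilon>. \<phi> \<in> test_functions \<Longrightarrow> 0 < \<epsilon> \<Longrightarrow> (\<And>t. t \<in> {0<..<1 + \<epsilon>} \<Longrightarrow> \<phi> t = g t) \<Longrightarrow> T \<phi> = z"
  shows "gf_apply T g = z"
  unfolding gf_apply_def
proof (rule the_equality)
  show "\<exists>\<phi>\<in>test_functions. (\<exists>\<epsilon>>0. \<forall>t\<in>{0<..<1 + \<epsilon>}. \<phi> t = g t) \<and> z = T \<phi>"
    using assms(4)[OF assms(1-3)] assms(1-3) by metis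
  fix w assume "\<exists>\<phi>\<in>test_functions. (\<exists>\<epsilon>>0. \<forall>t\<in>{0<..<1 + \<epsilon>}. \<phi> t = g t) \<and> w = T \<phi>"
  then obtain \<phi> \<epsilon> where "\<phi> \<in> test_functions" "0 < \<epsilon>" "\<forall>t\<in>{0<..<1 + \<epsilon>}. \<phi> t = g t" "w = T \<phi>" by blast
  then show "w = z" using assms(4)[of \<phi> \<epsilon>] by blast
qed

lemma profile_smooth:
  assumes g: "g \<in> Cp" and y: "0 \<le> y"
  shows "smooth_on {0<..} (\<lambda>t. of_real (t powi k) * g (y / t\<^sup>2))"
    and "\<exists>\<epsilon>>0. \<forall>t. 0 < t \<and> t < \<epsilon> \<longrightarrow> g (y / t\<^sup>2) = 0"
proof -
  have g0: "g 0 = 0" using Cp_nonpos[OF g] by simp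
  have "smooth_on {0<..} (\<lambda>t. g (y / t\<^sup>2))"
  proof (cases "y = 0")
    case True
    then show ?thesis by (simp add: g0 smooth_on_const)
  next
    case False
    have "smooth_on {0<..} (\<lambda>t. y * t powi (- 2))"
      by (intro smooth_on_mult smooth_on_const smooth_on_powi) simp_all
    from smooth_on_compose_real[OF open_greaterThan open_greaterThan _ Cp_smooth[OF g] this]
    have "smooth_on {0<..} (\<lambda>t. g (y * t powi (- 2)))" using y False by simp
    then show ?thesis by (simp add: power_int_minus divide_inverse)
  qed
  then show "smooth_on {0<..} (\<lambda>t. of_real (t powi k) * g (y / t\<^sup>2))"
    by (intro smooth_on_mult smooth_on_of_real smooth_on_powi open_greaterThan)
  obtain R where R: "R > 0" "\<And>z. z > R \<Longrightarrow> g z = 0" using Cp_bound[OF g] by metis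
  show "\<exists>\<epsilon>>0. \<forall>t. 0 < t \<and> t < \<epsilon> \<longrightarrow> g (y / t\<^sup>2) = 0"
  proof (cases "y = 0")
    case True
    then show ?thesis using g0 by (intro exI[of _ 1]) simp
  next
    case False
    have "g (y / t\<^sup>2) = 0" if "0 < t" "t < sqrt (y / R)" for t
    proof -
      have "t\<^sup>2 < (sqrt (y / R))\<^sup>2" using that by (intro power_strict_mono) auto
      then have "t\<^sup>2 < y / R" using y R(1) by simp
      then have "R < y / t\<^sup>2" using that(1) R(1) by (simp add: field_simps)
      then show ?thesis by (rule R(2))
    qed
    then show ?thesis using y False R(1) by (intro exI[of _ "sqrt (y / R)"]) auto
  qed
qed

text \<open>On any admissible test function the Euler factors become \<open>eprod\<close> and the
  kernel becomes an iterated antiderivative between powers of y; \<open>eprod\<close> is then moved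
  outside and rewritten with derivatives.\<close>

lemma gf_apply_beta:
  assumes n: "2 \<le> n" and H: "H \<in> Cp" and y: "0 \<le> y"
    and G: "\<And>t. 0 < t \<Longrightarrow> G t = of_real (t powi (- int (p + q))) * mulp (- int n - int (p + q)) H (y / t\<^sup>2)"
  shows "gf_apply (beta n p q) G = rinv n p q H y"
proof -
  define P where "P = p + q"
  define m where "m = min p q"
  define N where "N = n + m - 1"
  define g where "g = mulp (- int n - int P) H"
  have g: "g \<in> Cp" unfolding g_def by (rule mulp_Cp[OF H])
  have SN: "n + m = Suc N" using n by (simp add: N_def)
  define cc where "cc = complex_of_real (1 / (2 ^ (n + m - 2) * pi ^ (n - 1)))"
  have beta_eq: "beta n p q \<phi> = rinv n p q H y"
    if \<phi>: "\<phi> \<in> test_functions" and \<epsilon>: "0 < \<epsilon>" and eq: "\<And>t. t \<in> {0<..<1 + \<epsilon>} \<Longrightarrow> \<phi> t = G t" for \<phi> \<epsilon>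
  proof -
    let ?T = "gf_mult (\<lambda>t. of_real (t powi (1 - int P - 2 * int n))) (gf_kernel (of_nat m))"
    let ?c = "\<lambda>j. of_nat P - 2 * of_nat j :: complex"
    have T: "?T (\<lambda>t. \<phi> t + a * \<psi> t) = ?T \<phi> + a * ?T \<psi>" if "\<phi> \<in> test_functions" "\<psi> \<in> test_functions" for \<phi> \<psi> a
      using gf_kernel_linear[OF test_powi[OF that(1)] test_powi[OF that(2)], of m _ a]
      unfolding gf_mult_def by (simp add: algebra_simps)
    have "beta n p q \<phi> = fold (\<lambda>j. gf_euler (?c j)) [1..<Suc N] ?T (\<lambda>t. cc * \<phi> t)"
      unfolding beta_def Let_def gf_mult_def[of "\<lambda>t. of_real (1 / _)"] m_def[symmetric] SN cc_def
      by (simp add: P_def algebra_simps SN)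
    also have "\<dots> = ?T (lprod ?c N (\<lambda>t. cc * \<phi> t))"
      by (rule fold_gf_euler[OF T test_cmult[OF \<phi>]])
    also have "\<dots> = gf_kernel (of_nat m) (\<lambda>t. of_real (t powi (1 - int P - 2 * int n)) * lprod ?c N (\<lambda>t. cc * \<phi> t) t)"
      by (simp add: gf_mult_def)
    also have "\<dots> = 1 / 2 * mulp (1 - int P - int n) ((iop ^^ m) (mulp (int P + int n - 1 - int m)
        (\<lambda>z. (- 2) ^ N * eprod N (\<lambda>z. cc * g z) z))) y"
    proof (rule kernel_profile[OF Cp_cmult[OF eprod_Cp[OF Cp_cmult[OF g]]] y test_lprod[OF test_cmult[OF \<phi>]]])
      show "1 < 1 + \<epsilon>" using \<epsilon> by simp
      show "lprod ?c N (\<lambda>t. cc * \<phi> t) t = of_real (t powi (- int P)) * ((- 2) ^ N * eprod N (\<lambda>z. cc * g z) (y / t\<^sup>2))"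
        if "t \<in> {0<..<1 + \<epsilon>}" for t
      proof (rule lprod_profile[OF y Cp_cmult[OF g] test_cmult[OF \<phi>] _ that])
        fix t assume t: "t \<in> {0<..<1 + \<epsilon>}"
        then show "cc * \<phi> t = of_real (t powi (- int P)) * (cc * g (y / t\<^sup>2))"
          using eq[OF t] G[of t] by (simp add: g_def P_def)
      qed
    qed
    also have "(\<lambda>z. (- 2) ^ N * eprod N (\<lambda>z. cc * g z) z) = (\<lambda>z. ((- 2) ^ N * cc) * eprod N g z)"
      unfolding eprod_cmult[OF g] mult.assoc ..
    also have "mulp (1 - int P - int n) ((iop ^^ m) (mulp (int P + int n - 1 - int m) (\<lambda>z. ((- 2) ^ N * cc) * eprod N g z))) y
        = ((- 2) ^ N * cc) * mulp (1 - int P - int n) ((iop ^^ m) (mulp (int P + int n - 1 - int m) (eprod N g))) y"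
      unfolding mulp_cmult iop_pow_cmult[OF mulp_Cp[OF eprod_Cp[OF g]]] ..
    \<comment> \<open>This is \<open>eprod_conv\<close> with b = P + n - 1. Outside the integral,
      D^N y^N meets y^(1-P-n) and leaves y^(- max p q) under the derivatives.\<close>
    also have "mulp (1 - int P - int n) ((iop ^^ m) (mulp (int P + int n - 1 - int m) (eprod N g)))
        = eprod N (mulp (1 - int P - int n) ((iop ^^ m) (mulp (int P + int n - 1 - int m) g)))"
      using eprod_conv[OF g, of N "int P + int n - 1" m] by (simp add: algebra_simps)
    also have "\<dots> = (dop ^^ N) (mulp (int N + (1 - int P - int n)) ((iop ^^ m) (mulp (int P + int n - 1 - int m + (- int n - int P)) H)))"
      unfolding g_def mulp_mulp[OF H]
      by (subst eprod_eq) (intro mulp_Cp iop_pow_Cp H, subst mulp_mulp, intro iop_pow_Cp mulp_Cp H, rule refl)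
    also have "int N + (1 - int P - int n) = - int (max p q)"
      using SN by (auto simp: P_def m_def N_def)
    also have "int P + int n - 1 - int m + (- int n - int P) = - int m - 1" by simp
    \<comment> \<open>The 1/2 of the kernel, the (-2)^N of the Euler factors and the 2^(n+m-2) of
      the normalisation leave (-1)^N, because N = n + m - 1.\<close>
    also have "1 / 2 * ((- 2) ^ N * cc * (dop ^^ N) (mulp (- int (max p q)) ((iop ^^ m) (mulp (- int m - 1) H))) y) = rinv n p q H y"
    proof -
      obtain l where l: "n = Suc (Suc l)" using n by (metis add_2_eq_Suc le_Suc_ex)
      have "1 / 2 * ((- 2) ^ N * cc) = (- 1) ^ N / of_real pi ^ (n - 1)"
      proof -
        have "N = Suc (n + m - 2)" by (simp add: N_def l)
        then have "(- 2 :: complex) ^ N = (- 1) ^ N * (2 * 2 ^ (n + m - 2))"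
          by (metis mult_minus1 power_Suc power_mult_distrib)
        moreover have "2 ^ (n + m - 2) * cc = 1 / of_real pi ^ (n - 1)" by (simp add: cc_def)
        moreover have "1 / 2 * (a * (2 * b) * cc) = a * (b * cc)" for a b :: complex by simp
        ultimately show ?thesis by (simp only: times_divide_eq_right mult_1_right)
      qed
      then show ?thesis
        unfolding rinv_def m_def[symmetric] N_def[symmetric] add.commute[of m n] by (simp only: mult.assoc[symmetric])
    qed
    finally show ?thesis .
  qed
  have sm: "smooth_on {0<..} G"
    using profile_smooth(1)[OF g y, of "- int P"] G
    by (subst smooth_on_cong[OF open_greaterThan, where g = "\<lambda>t. of_real (t powi (- int P)) * g (y / t\<^sup>2)"])
      (auto simp: g_def P_def)
  obtain \<epsilon> where \<epsilon>: "0 < \<epsilon>" "\<forall>t. 0 < t \<and> t < \<epsilon> \<longrightarrow> g (y / t\<^sup>2) = 0" using profile_smooth(2)[OF g y] by blast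
  have "G t = 0" if "0 < t" "t < \<epsilon>" for t using \<epsilon>(2) G[of t] that by (simp add: g_def P_def)
  then obtain \<phi> where "\<phi> \<in> test_functions" "\<And>t. t \<in> {0<..<1 + 1 / 2} \<Longrightarrow> \<phi> t = G t"
    using test_extension[OF sm \<epsilon>(1)] by metis
  then show ?thesis
    by (intro gf_apply_eqI[of \<phi> "1 / 2" G]) (use beta_eq in auto)
qed

section \<open>The inversion formula\<close>

text \<open>Homogeneity of Y moves a power of the norm into the profile, which in the variable y = 1
  / ||x||^2 reads y^((p+q)/2) u(y^(-1/2)).\<close>

lemma tensor_radial:
  assumes u: "u \<in> C_minus_pos" and Y: "Y \<in> harmonic_polys p q"
  obtains H where "H \<in> Cp" "tensor u Y = (\<lambda>\<xi>. H (1 / (norm \<xi>)\<^sup>2) * Y \<xi>)"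
proof -
  obtain \<epsilon> where u0: "\<forall>r\<le>0. u r = 0" and su: "smooth_on {0<..} u" and \<epsilon>: "0 < \<epsilon>" "\<forall>r<\<epsilon>. u r = 0"
    using u unfolding C_minus_pos_def by blast
  define H where "H y = (if 0 < y then of_real (sqrt y ^ (p + q)) * u (inverse (sqrt y)) else 0)" for y
  have "smooth_on {0<..} (\<lambda>y. u (inverse (sqrt y)))"
  proof -
    have "smooth_on {0<..} (\<lambda>r. u (inverse r))"
      by (rule smooth_on_compose_real[OF open_greaterThan open_greaterThan _ su smooth_on_inverse]) simp
    from smooth_on_compose_real[OF open_greaterThan open_greaterThan _ this smooth_on_sqrt]
    show ?thesis by simp
  qed
  moreover have "smooth_on {0<..} (\<lambda>y. sqrt y ^ (p + q))"
    by (rule smooth_on_power[OF open_greaterThan smooth_on_sqrt])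
  ultimately have "smooth_on {0<..} (\<lambda>y. of_real (sqrt y ^ (p + q)) * u (inverse (sqrt y)))"
    by (intro smooth_on_mult smooth_on_of_real open_greaterThan)
  then have "smooth_on {0<..} H"
    by (subst smooth_on_cong[OF open_greaterThan, where g = "\<lambda>y. of_real (sqrt y ^ (p + q)) * u (inverse (sqrt y))"])
      (auto simp: H_def)
  moreover have "H y = 0" if "y > (1 / \<epsilon>)\<^sup>2" for y
  proof -
    have "1 / \<epsilon> < sqrt y" using that by (intro real_less_rsqrt)
    then have "inverse (sqrt y) < \<epsilon>" using \<epsilon>(1) by (metis inverse_eq_divide inverse_inverse_eq inverse_less_imp_less less_trans positive_imp_inverse_positive less_imp_inverse_less)
    then show ?thesis using \<epsilon>(2) by (simp add: H_def)
  qed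
  ultimately have "H \<in> Cp" by (intro CpI[of _ "(1 / \<epsilon>)\<^sup>2"]) (auto simp: H_def)
  moreover have "tensor u Y \<xi> = H (1 / (norm \<xi>)\<^sup>2) * Y \<xi>" for \<xi>
  proof (cases "\<xi> = 0")
    case True
    then show ?thesis using u0 by (simp add: tensor_def H_def)
  next
    case False
    then have "sqrt (1 / (norm \<xi>)\<^sup>2) = inverse (norm \<xi>)" by (simp add: real_sqrt_divide inverse_eq_divide)
    then show ?thesis
      using False by (simp add: tensor_def H_def harmonic_polysD(5)[OF Y] of_real_inverse del: real_sqrt_divide)
  qed
  ultimately show thesis by (intro that) auto
qed

text \<open>Linear combinations of tensors have no common profile, so H is allowed to depend on x
  and absorbs the values of the spherical factors. The clause on \<open>Inv_op\<close> is the input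
  of \<open>gf_apply_beta\<close>.\<close>

definition inverted :: "nat \<Rightarrow> nat \<Rightarrow> (complex^'n \<Rightarrow> complex) \<Rightarrow> (complex^'n \<Rightarrow> complex) \<Rightarrow> bool" where
  "inverted p q \<phi> f \<longleftrightarrow> f \<in> C_plus \<and> transform f = \<phi> \<and>
    (\<forall>x. \<exists>H\<in>Cp. f x = rinv CARD('n) p q H ((norm x)\<^sup>2) \<and>
      (\<forall>t>0. Inv_op \<phi> (x /\<^sub>R t) = of_real (t powi (- int (p + q))) * mulp (- int CARD('n) - int (p + q)) H ((norm x)\<^sup>2 / t\<^sup>2)))"

lemma rinv_commute: "rinv n p q = rinv n q p"
  by (rule ext)+ (simp add: rinv_def min.commute max.commute)

lemma rinv_add: "f \<in> Cp \<Longrightarrow> g \<in> Cp \<Longrightarrow> rinv n p q (\<lambda>y. f y + g y) = (\<lambda>y. rinv n p q f y + rinv n p q g y)"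
  unfolding rinv_def
  by (simp add: mulp_add iop_pow_add dop_pow_add mulp_Cp iop_pow_Cp distrib_left)

lemma rinv_cmult: "f \<in> Cp \<Longrightarrow> rinv n p q (\<lambda>y. c * f y) = (\<lambda>y. c * rinv n p q f y)"
  unfolding rinv_def
  by (simp add: mulp_cmult iop_pow_cmult dop_pow_cmult mulp_Cp iop_pow_Cp mult.left_commute)

text \<open>With y = ||x||^2 / t^2, inversion makes y the argument of H. The prefactor of
  \<open>Inv_op\<close> contributes y^(-n), and homogeneity of Y contributes y^(-p-q) and
  t^(-p-q).\<close>

lemma Inv_op_radial:
  fixes Y :: "complex^'n \<Rightarrow> complex"
  assumes H: "H \<in> Cp" and Y: "Y \<in> harmonic_polys p q" and t: "0 < t"
  shows "Inv_op (\<lambda>\<xi>. H (1 / (norm \<xi>)\<^sup>2) * Y \<xi>) (x /\<^sub>R t) =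
    of_real (t powi (- int (p + q))) * mulp (- int CARD('n) - int (p + q)) (\<lambda>y. Y (cnj_vec x) * H y) ((norm x)\<^sup>2 / t\<^sup>2)"
proof (cases "x = 0")
  case True
  then show ?thesis using Cp_nonpos[OF H, of 0] by (simp add: Inv_op_def mulp_def)
next
  case False
  define z where "z = x /\<^sub>R t"
  define y where "y = (norm x)\<^sup>2 / t\<^sup>2"
  have y: "0 < y" "(norm z)\<^sup>2 = y"
    using False t by (simp_all add: y_def z_def power_mult_distrib divide_inverse mult.commute power_inverse)
  have "norm (cnj_vec z /\<^sub>R (norm z)\<^sup>2) = inverse ((norm z)\<^sup>2) * norm z" by simp
  also have "\<dots> = inverse (norm z)" by (cases "z = 0") (simp_all add: power2_eq_square)
  finally have "norm (cnj_vec z /\<^sub>R (norm z)\<^sup>2) = inverse (norm z)" .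
  then have n1: "1 / (norm (cnj_vec z /\<^sub>R (norm z)\<^sup>2))\<^sup>2 = y"
    using y by (simp add: power_divide inverse_eq_divide)
  have cz: "cnj_vec z = cnj_vec x /\<^sub>R t" by (simp add: z_def cnj_vec_def vec_eq_iff)
  have Y1: "Y (cnj_vec z /\<^sub>R (norm z)\<^sup>2) = of_real (inverse y ^ (p + q) * inverse t ^ (p + q)) * Y (cnj_vec x)"
    unfolding y(2) cz harmonic_polysD(5)[OF Y] by simp
  have "norm z ^ (2 * CARD('n)) = y ^ CARD('n)" by (simp add: power_mult y(2))
  then have "Inv_op (\<lambda>\<xi>. H (1 / (norm \<xi>)\<^sup>2) * Y \<xi>) z =
      of_real (inverse t ^ (p + q) * (inverse y ^ (p + q) * inverse y ^ CARD('n))) * (Y (cnj_vec x) * H y)"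
    unfolding Inv_op_def n1 Y1 by (simp add: divide_inverse power_inverse mult_ac)
  also have "inverse t ^ (p + q) = t powi (- int (p + q))"
    unfolding power_int_minus power_int_of_nat power_inverse ..
  also have "inverse y ^ (p + q) * inverse y ^ CARD('n) = y powi (- int CARD('n) - int (p + q))"
    using y(1) by (simp add: power_int_diff power_int_minus power_int_add power_inverse divide_inverse power_add mult_ac)
  finally show ?thesis by (simp add: z_def y_def mulp_def mult.assoc)
qed

text \<open>On a tensor the preimage is known from \<open>transform_radial_inverse\<close>. All
  clauses of \<open>inverted\<close> are linear, with the profiles at each x added and scaled along,
  so the claim extends to the span.\<close>

lemma inverted_exists:
  fixes \<phi> :: "complex^'n \<Rightarrow> complex"
  assumes "\<phi> \<in> C_minus_tensor p q"
  shows "\<exists>f. inverted p q \<phi> f"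
  using assms unfolding C_minus_tensor_def
proof (induction rule: cfun_span_induct)
  case (base \<phi>)
  then obtain u and Y :: "complex^'n \<Rightarrow> complex" where \<phi>: "\<phi> = tensor u Y" and u: "u \<in> C_minus_pos" and Y: "Y \<in> harmonic_polys p q" by blast
  obtain H where H: "H \<in> Cp" "tensor u Y = (\<lambda>\<xi>. H (1 / (norm \<xi>)\<^sup>2) * Y \<xi>)" using tensor_radial[OF u Y] by metis
  let ?f = "\<lambda>x. rinv CARD('n) q p H ((norm x)\<^sup>2) * Y (cnj_vec x)"
  have "?f \<in> C_plus" using RplusI[OF rinv_Cp[OF H(1)] harmonic_polys_cnj_vec[OF Y]] Rplus_C_plus by blast
  moreover have "transform ?f = \<phi>" unfolding \<phi> H(2) by (rule transform_radial_inverse[OF H(1) Y])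
  moreover have "\<exists>K\<in>Cp. ?f x = rinv CARD('n) p q K ((norm x)\<^sup>2) \<and>
      (\<forall>t>0. Inv_op \<phi> (x /\<^sub>R t) = of_real (t powi (- int (p + q))) * mulp (- int CARD('n) - int (p + q)) K ((norm x)\<^sup>2 / t\<^sup>2))" for x
  proof (intro bexI conjI)
    \<comment> \<open>For fixed x the number \<open>Y (cnj_vec x)\<close> is a constant and goes
      into the profile; \<open>rinv\<close> is symmetric in p and q.\<close>
    show "?f x = rinv CARD('n) p q (\<lambda>y. Y (cnj_vec x) * H y) ((norm x)\<^sup>2)"
      unfolding rinv_cmult[OF H(1)] by (simp add: rinv_commute[of _ q p] mult.commute)
    show "\<forall>t>0. Inv_op \<phi> (x /\<^sub>R t) = of_real (t powi (- int (p + q))) * mulp (- int CARD('n) - int (p + q)) (\<lambda>y. Y (cnj_vec x) * H y) ((norm x)\<^sup>2 / t\<^sup>2)"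
      unfolding \<phi> H(2) using Inv_op_radial[OF H(1) Y] by blast
    show "(\<lambda>y. Y (cnj_vec x) * H y) \<in> Cp" by (rule Cp_cmult[OF H(1)])
  qed
  ultimately have "inverted p q \<phi> ?f" unfolding inverted_def by blast
  then show ?case by blast
next
  case zero
  have "rinv CARD('n) p q (\<lambda>y. 0) = (\<lambda>y. 0)" using rinv_cmult[OF Cp_zero, of "CARD('n)" p q 0] by simp
  then have "inverted p q (\<lambda>x::complex^'n. 0) (\<lambda>x. 0)"
    unfolding inverted_def
    by (auto simp: sub_zero[OF C_plus_subspace] transform_zero Inv_op_def mulp_def intro!: bexI[OF _ Cp_zero])
  then show ?case by blast
next
  case (add \<phi> \<psi>)
  then obtain f g where f: "inverted p q \<phi> f" and g: "inverted p q \<psi> g" by blast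
  have fg: "f \<in> C_plus" "g \<in> C_plus" "transform f = \<phi>" "transform g = \<psi>" using f g unfolding inverted_def by blast+
  have "\<exists>K\<in>Cp. f x + g x = rinv CARD('n) p q K ((norm x)\<^sup>2) \<and>
      (\<forall>t>0. Inv_op (\<lambda>x. \<phi> x + \<psi> x) (x /\<^sub>R t) = of_real (t powi (- int (p + q))) * mulp (- int CARD('n) - int (p + q)) K ((norm x)\<^sup>2 / t\<^sup>2))" for x
  proof -
    obtain H where H: "H \<in> Cp" "f x = rinv CARD('n) p q H ((norm x)\<^sup>2)"
      "\<forall>t>0. Inv_op \<phi> (x /\<^sub>R t) = of_real (t powi (- int (p + q))) * mulp (- int CARD('n) - int (p + q)) H ((norm x)\<^sup>2 / t\<^sup>2)"
      using f unfolding inverted_def by blast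
    obtain K where K: "K \<in> Cp" "g x = rinv CARD('n) p q K ((norm x)\<^sup>2)"
      "\<forall>t>0. Inv_op \<psi> (x /\<^sub>R t) = of_real (t powi (- int (p + q))) * mulp (- int CARD('n) - int (p + q)) K ((norm x)\<^sup>2 / t\<^sup>2)"
      using g unfolding inverted_def by blast
    have I: "Inv_op (\<lambda>x. \<phi> x + \<psi> x) z = Inv_op \<phi> z + Inv_op \<psi> z" for z by (simp add: Inv_op_def add_divide_distrib)
    show ?thesis
    proof (intro bexI conjI allI impI)
      show "f x + g x = rinv CARD('n) p q (\<lambda>y. H y + K y) ((norm x)\<^sup>2)"
        unfolding rinv_add[OF H(1) K(1)] H(2) K(2) ..
      show "Inv_op (\<lambda>x. \<phi> x + \<psi> x) (x /\<^sub>R t) = of_real (t powi (- int (p + q))) * mulp (- int CARD('n) - int (p + q)) (\<lambda>y. H y + K y) ((norm x)\<^sup>2 / t\<^sup>2)"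
        if "0 < t" for t
        unfolding I mulp_add distrib_left using H(3) K(3) that by metis
      show "(\<lambda>y. H y + K y) \<in> Cp" by (rule Cp_add[OF H(1) K(1)])
    qed
  qed
  then have "inverted p q (\<lambda>x. \<phi> x + \<psi> x) (\<lambda>x. f x + g x)"
    unfolding inverted_def transform_add[OF C_plus_pc[OF fg(1)] C_plus_pc[OF fg(2)]] fg(3,4)
    using sub_add[OF C_plus_subspace fg(1,2)] by blast
  then show ?case by blast
next
  case (scale c \<phi>)
  then obtain f where f: "inverted p q \<phi> f" by blast
  have fC: "f \<in> C_plus" "transform f = \<phi>" using f unfolding inverted_def by blast+
  have "\<exists>K\<in>Cp. c * f x = rinv CARD('n) p q K ((norm x)\<^sup>2) \<and>
      (\<forall>t>0. Inv_op (\<lambda>x. c * \<phi> x) (x /\<^sub>R t) = of_real (t powi (- int (p + q))) * mulp (- int CARD('n) - int (p + q)) K ((norm x)\<^sup>2 / t\<^sup>2))" for x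
  proof -
    obtain H where H: "H \<in> Cp" "f x = rinv CARD('n) p q H ((norm x)\<^sup>2)"
      "\<forall>t>0. Inv_op \<phi> (x /\<^sub>R t) = of_real (t powi (- int (p + q))) * mulp (- int CARD('n) - int (p + q)) H ((norm x)\<^sup>2 / t\<^sup>2)"
      using f unfolding inverted_def by blast
    have I: "Inv_op (\<lambda>x. c * \<phi> x) z = c * Inv_op \<phi> z" for z by (simp add: Inv_op_def)
    show ?thesis
    proof (intro bexI conjI allI impI)
      show "c * f x = rinv CARD('n) p q (\<lambda>y. c * H y) ((norm x)\<^sup>2)"
        unfolding rinv_cmult[OF H(1)] H(2) ..
      show "Inv_op (\<lambda>x. c * \<phi> x) (x /\<^sub>R t) = of_real (t powi (- int (p + q))) * mulp (- int CARD('n) - int (p + q)) (\<lambda>y. c * H y) ((norm x)\<^sup>2 / t\<^sup>2)"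
        if "0 < t" for t
        unfolding I mulp_cmult mult.left_commute[of _ c] using H(3) that by metis
      show "(\<lambda>y. c * H y) \<in> Cp" by (rule Cp_cmult[OF H(1)])
    qed
  qed
  then have "inverted p q (\<lambda>x. c * \<phi> x) (\<lambda>x. c * f x)"
    unfolding inverted_def transform_cmult[OF C_plus_pc[OF fC(1)]] fC(2)
    using sub_scale[OF C_plus_subspace fC(1)] by blast
  then show ?case by blast
qed

theorem theorem5p3p3:
  assumes "2 \<le> CARD('n::finite)"
  shows "complex_linear_on C_plus (transform :: (complex^'n \<Rightarrow> complex) \<Rightarrow> complex^'n \<Rightarrow> complex)
       \<and> bij_betw transform (C_plus :: (complex^'n \<Rightarrow> complex) set) C_minus
       \<and> (\<forall>p q. \<forall>\<phi> \<in> (C_minus_tensor p q :: (complex^'n \<Rightarrow> complex) set).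
            inv_into C_plus transform \<phi> = mult_conv (beta CARD('n) p q) (Inv_op \<phi>))"
proof (intro conjI allI ballI)
  show "complex_linear_on C_plus (transform :: (complex^'n \<Rightarrow> complex) \<Rightarrow> complex^'n \<Rightarrow> complex)"
    by (rule complex_linear_on_transform)
  show bij: "bij_betw transform (C_plus :: (complex^'n \<Rightarrow> complex) set) C_minus"
    by (rule bij_betw_transform[OF assms])
  fix p q and \<phi> :: "complex^'n \<Rightarrow> complex" assume "\<phi> \<in> C_minus_tensor p q"
  then obtain f where f: "inverted p q \<phi> f" using inverted_exists by blast
  have "mult_conv (beta CARD('n) p q) (Inv_op \<phi>) x = f x" for x
  proof -
    obtain H where H: "H \<in> Cp" "f x = rinv CARD('n) p q H ((norm x)\<^sup>2)"
      "\<forall>t>0. Inv_op \<phi> (x /\<^sub>R t) = of_real (t powi (- int (p + q))) * mulp (- int CARD('n) - int (p + q)) H ((norm x)\<^sup>2 / t\<^sup>2)"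
      using f unfolding inverted_def by blast
    show ?thesis
      unfolding mult_conv_def H(2) by (rule gf_apply_beta[OF assms H(1) zero_le_power2]) (use H(3) in blast)
  qed
  then have "mult_conv (beta CARD('n) p q) (Inv_op \<phi>) = f" by (rule ext)
  moreover have "inv_into C_plus transform \<phi> = f"
    using f bij unfolding inverted_def bij_betw_def by (metis inv_into_f_eq)
  ultimately show "inv_into C_plus transform \<phi> = mult_conv (beta CARD('n) p q) (Inv_op \<phi>)" by simp
qed

end
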